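(* Assume: (a) $f(\cdot,0,0,0):=(f(\cdot,0,0,0,1),\dots,f(\cdot,0,0,0,d))^T\in M^2$, i.e. $\mathbb{E}\int_0^\tau|f(t,0,0,0)|^2dt<\infty$; (b) for all $t\ge0$, $x,x',y,y'\in\mathbb{R}$, $z,z'\in\mathbb{R}^p$, $i\in\Lambda$: $|b(t,x,i)-b(t,x',i)|+|\sigma(t,x,i)-\sigma(t,x',i)|\le u(t)|x-x'|$ and $|f(t,x,y,z,i)-f(t,x',y',z',i)|\le u(t)\big(|x-x'|+|y-y'|+|z-z'|\big)$, where $u$ is a positive deterministic bounded function with $\int_0^\infty u(t)dt<\infty$ and $\int_0^\infty u^2(t)dt<\infty$; (c) $C_{i,j}\ge0$ for all $(i,j)\in\Lambda\times\Lambda$, and $C_{i,j}+C_{j,l}>C_{i,l}$ for all $(i,j,l)\in\Lambda\times\Lambda\times\Lambda$ with $i\ne j$ and $j\ne l$; (d) $g(X(\tau)):=(g(X_1(\tau)),\dots,g(X_d(\tau)))^T\in L^2(\Omega,\mathcal{F}_\tau,P;\mathbb{R}^d)$ takes values in $\bar Q$. Let $(\tilde Y,\tilde Z,\tilde K)\in S^2\times M^2\times A^2$ be a solution of the reflected BSDE (RBSDE) defined in the context. Let $t\ge0$ and $i\in\Lambda$. Then: (i) For any $\alpha\in\mathcal{A}_i(t)$, $\tilde Y_i(t)\ge U^{\alpha}(t)$, $P$-a.s. (ii) Set $\tau_0^*=t$, $\zeta_0^*=i$ and define the sequence $\{\tau_j^*,\zeta_j^*\}_{j\ge1}$ inductively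 by $$\tau_j^*:=\inf\Big\{s\ge\tau_{j-1}^*:\ \tilde Y_{\zeta_{j-1}^*}(s)=\max_{l\ne\zeta_{j-1}^*}\{\tilde Y_l(s)-C_{\zeta_{j-1}^*,l}\}\Big\}\wedge\tau,$$ and $\zeta_j^*$ an $\mathcal{F}_{\tau_j^*}$-measurable random variable such that $$\tilde Y_{\zeta_{j-1}^*}(\tau_j^* )=\tilde Y_{\zeta_j^*}(\tau_j^* )-C_{\zeta_{j-1}^*,\zeta_j^*},\qquad j=1,2,\dots$$ Then the switching strategy $$\alpha_s^*=i\,\mathbf{1}_{\{t\}}(s)+\sum_{j\ge1}\zeta_{j-1}^*\mathbf{1}_{(\tau_{j-1}^*,\tau_j^*]}(s)$$ is admissible, i.e. $\alpha^*\in\mathcal{A}_i(t)$, and $\tilde Y_i(t)=U^{\alpha^*}(t)$. Moreover, $\tilde Y_i(t)=\operatorname{ess\,sup}_{\alpha\in\mathcal{A}_i(t)}U^{\alpha}(t)$ for all $i\in\Lambda$, $t\ge0$. Therefore (RBSDE) has a unique solution.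
   Context: Let $d,p\ge1$ be integers and $\Lambda=\{1,\dots,d\}$. $(\Omega,\mathcal{F},P)$ is a probability space with a $p$-dimensional Brownian motion $W$; $(\mathcal{F}_t)_{t\ge0}$ is its natural filtration augmented by the $P$-null sets. $\tau$ is a stopping time with values in $[0,+\infty]$, not necessarily bounded. The coefficients are $b:\mathbb{R}^+\times\Omega\times\mathbb{R}\times\Lambda\to\mathbb{R}$, $\sigma:\mathbb{R}^+\times\Omega\times\mathbb{R}\times\Lambda\to\mathbb{R}^{1\times p}$, $g:\mathbb{R}\to\mathbb{R}$ and $f:\mathbb{R}^+\times\Omega\times\mathbb{R}\times\mathbb{R}\times\mathbb{R}^p\times\Lambda\to\mathbb{R}$, progressively measurable in $(t,\omega)$ for fixed other arguments; $C:\Lambda\times\Lambda\to\mathbb{R}$ is the switching cost function. Forward SDE: for $i\in\Lambda$, $X_i$ is the solution of $X_i(t)=x_0+\int_0^{t\wedge\tau}b(s,X_i(s),i)ds+\int_0^{t\wedge\tau}\sigma(s,X_i(s),i)dW_s$, $t\ge0$; when $\tau=\infty$, $X_i(\tau)$ is the $L^2$ limit at infinity. Spaces: $S^2$ is the set of $\mathbb{R}^d$-valued adapted càdlàg processes $Y$ with $\mathbb{E}[\sup_{0\le t\le\tau}|Y(t)|^2]<\infty$; $M^2$ is the set of predictable $\mathbb{R}^{d\times p}$-valued processes $Z$ with $\mathbb{E}\int_0^\tau|Z(s)|^2ds<\infty$; $A^2$ is the closed subset of $S^2$ of (componentwise) nondecreasing processes $K$ with $K_0=0$. The same notation is used for processes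 with values in other Euclidean spaces. $Q=\{y\in\mathbb{R}^d:\ y_i>y_j-C_{i,j}\ \text{for all } i\ne j\}$ and $\bar Q$ is its closure. (RBSDE): for all $i\in\Lambda$, $t\ge0$, $$Y_i(t)=g(X_i(\tau))+\int_{t\wedge\tau}^\tau f(s,X_i(s),Y_i(s),Z_i(s),i)ds+\int_{t\wedge\tau}^\tau dK_i(s)-\int_{t\wedge\tau}^\tau Z_i(s)dW(s),$$ $$Y_i(t)\ge\max_{j\in\Lambda}\{Y_j(t)-C_{i,j}\},\qquad\int_0^\tau\Big(Y_i(s)-\max_{j\ne i}\{Y_j(s)-C_{i,j}\}\Big)dK_i(s)=0.$$ Switching strategies: a strategy starting at time $t$ from mode $i$ consists of an increasing sequence $(\tau_k)_{k\ge0}$ of stopping times not exceeding $\tau$ (that is, $\tau_k\le\tau_{k+1}$ and $\lim_k\tau_k=\tau$) with $\tau_0=t$, and $\mathcal{F}_{\tau_k}$-measurable $\Lambda$-valued random variables $\zeta_k$ with $\zeta_0=i$. It is identified with the mode process $\alpha_s=i\,\mathbf{1}_{\{t\}}(s)+\sum_{k\ge0}\zeta_k\mathbf{1}_{(\tau_k,\tau_{k+1}]}(s)$; such a strategy is called admissible. $\mathcal{A}_i(t)$ is the set of admissible strategies starting at time $t$ with $\alpha_t=i$. For such $\alpha$ define $$A^{\alpha}(s)=\sum_{k\ge0}C_{\zeta_k,\zeta_{k+1}}\mathbf{1}_{[\tau_k,\tau]}(s),\qquad X^{\alpha}(s)=X_{\alpha(s)}(s),$$ and let $(U^\alpha,V^\alpha)\in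 S^2\times M^2$ be the solution of the BSDE, for $s\ge t$, $$U(s)=g(X^{\alpha}(\tau))+A^\alpha(\tau)-A^\alpha(s)+\int_{s\wedge\tau}^\tau f(r,X^\alpha(r),U(r),V(r),\alpha(r))dr-\int_{s\wedge\tau}^\tau V(r)dW(r).$$
   Formalization: Costs A are subtracted, charged at τ_{k+1}, never at τ; U(t) in the claims means U(t)−A(t); the Skorokhod condition uses Y(s−); ζ*_j≠ζ*_{j−1}, its equation only on {τ*_j<τ}; α ranges over strategies whose BSDE has a solution. As printed the claim is false (f=g=0, C_12=C_21=1). *)

theory Defs
  imports "HOL-Probability.Probability" "HOL-Probability.Stopping_Time"
begin

text \<open>
  Processes are indexed by real times and only their values at times \<open>s \<ge> 0\<close> matter.
  Filtrations and stopping times are indexed by \<open>[0, \<infinity>] = ennreal\<close>, so that the notions of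
  \<open>HOL-Probability.Stopping_Time\<close> apply to unbounded stopping times; \<open>F \<infinity>\<close> is generated by all
  times.  The set \<open>{1,\<dots>,d}\<close> of modes is the finite type \<open>'d\<close>, and \<open>R^p\<close> is \<open>real^'p\<close>.
\<close>

section \<open>Brownian motion and its augmented filtration\<close>

definition natural_events :: "'w measure \<Rightarrow> (real \<Rightarrow> 'w \<Rightarrow> real^'p) \<Rightarrow> ennreal \<Rightarrow> 'w set set" where
  "natural_events P W t =
     {W s -` B \<inter> space P | s B. 0 \<le> s \<and> ennreal s \<le> t \<and> B \<in> sets borel}"

definition brownian_motion :: "'w measure \<Rightarrow> (real \<Rightarrow> 'w \<Rightarrow> real^'p::finite) \<Rightarrow> bool" where
  "brownian_motion P W \<longleftrightarrow>
     (\<forall>t\<ge>0. W t \<in> borel_measurable P) \<and>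
     (AE \<omega> in P. W 0 \<omega> = 0 \<and> continuous_on {0..} (\<lambda>t. W t \<omega>)) \<and>
     (\<forall>s t. 0 \<le> s \<and> s < t \<longrightarrow>
        (\<forall>j. distributed P lborel (\<lambda>\<omega>. (W t \<omega> - W s \<omega>) $ j) (normal_density 0 (sqrt (t - s)))) \<and>
        prob_space.indep_vars P (\<lambda>_. borel) (\<lambda>j \<omega>. (W t \<omega> - W s \<omega>) $ j) UNIV \<and>
        prob_space.indep_set P (sigma_sets (space P) (natural_events P W (ennreal s)))
          {(\<lambda>\<omega>. W t \<omega> - W s \<omega>) -` B \<inter> space P | B. B \<in> sets borel})"

definition augmented_filtration ::
    "'w measure \<Rightarrow> (real \<Rightarrow> 'w \<Rightarrow> real^'p) \<Rightarrow> ennreal \<Rightarrow> 'w measure" where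
  "augmented_filtration P W t = sigma (space P) (natural_events P W t \<union> null_sets P)"

definition adapted :: "(ennreal \<Rightarrow> 'w measure) \<Rightarrow> (real \<Rightarrow> 'w \<Rightarrow> 'b::topological_space) \<Rightarrow> bool" where
  "adapted F H \<longleftrightarrow> (\<forall>t\<ge>0. H t \<in> borel_measurable (F (ennreal t)))"

definition progressive :: "(ennreal \<Rightarrow> 'w measure) \<Rightarrow> (real \<Rightarrow> 'w \<Rightarrow> 'b::topological_space) \<Rightarrow> bool" where
  "progressive F H \<longleftrightarrow>
     (\<forall>T\<ge>0. (\<lambda>(s, \<omega>). H s \<omega>) \<in>
        borel_measurable (restrict_space borel {0..T} \<Otimes>\<^sub>M F (ennreal T)))"

definition predictable_sigma :: "(ennreal \<Rightarrow> 'w measure) \<Rightarrow> (real \<times> 'w) measure" where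
  "predictable_sigma F = sigma ({0..} \<times> space (F 0))
     ({{0} \<times> A | A. A \<in> sets (F 0)} \<union>
      {{s<..t} \<times> A | s t A. 0 \<le> s \<and> s \<le> t \<and> A \<in> sets (F (ennreal s))})"

definition predictable :: "(ennreal \<Rightarrow> 'w measure) \<Rightarrow> (real \<Rightarrow> 'w \<Rightarrow> 'b::topological_space) \<Rightarrow> bool" where
  "predictable F H \<longleftrightarrow> (\<lambda>(s, \<omega>). H s \<omega>) \<in> borel_measurable (predictable_sigma F)"

section \<open>The spaces \<open>S\<^sup>2\<close>, \<open>M\<^sup>2\<close>, \<open>A\<^sup>2\<close>\<close>

definition horizon :: "('w \<Rightarrow> ennreal) \<Rightarrow> 'w \<Rightarrow> real set" where
  "horizon \<tau> \<omega> = {s. 0 \<le> s \<and> ennreal s \<le> \<tau> \<omega>}"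

definition cadlag :: "(real \<Rightarrow> 'b::topological_space) \<Rightarrow> bool" where
  "cadlag y \<longleftrightarrow> (\<forall>t\<ge>0. (y \<longlongrightarrow> y t) (at_right t)) \<and> (\<forall>t>0. \<exists>l. (y \<longlongrightarrow> l) (at_left t))"

definition S2 :: "'w measure \<Rightarrow> (ennreal \<Rightarrow> 'w measure) \<Rightarrow> ('w \<Rightarrow> ennreal)
    \<Rightarrow> (real \<Rightarrow> 'w \<Rightarrow> 'b::euclidean_space) set" where
  "S2 P F \<tau> = {Y. adapted F Y \<and> (AE \<omega> in P. cadlag (\<lambda>t. Y t \<omega>)) \<and>
     (\<integral>\<^sup>+\<omega>. (SUP t\<in>horizon \<tau> \<omega>. ennreal ((norm (Y t \<omega>))\<^sup>2)) \<partial>P) < \<infinity>}"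

definition sq_integrable_process :: "'w measure \<Rightarrow> ('w \<Rightarrow> ennreal)
    \<Rightarrow> (real \<Rightarrow> 'w \<Rightarrow> 'b::euclidean_space) \<Rightarrow> bool" where
  "sq_integrable_process P \<tau> Z \<longleftrightarrow>
     (\<integral>\<^sup>+\<omega>. (\<integral>\<^sup>+s\<in>horizon \<tau> \<omega>. ennreal ((norm (Z s \<omega>))\<^sup>2) \<partial>lborel) \<partial>P) < \<infinity>"

definition M2 :: "'w measure \<Rightarrow> (ennreal \<Rightarrow> 'w measure) \<Rightarrow> ('w \<Rightarrow> ennreal)
    \<Rightarrow> (real \<Rightarrow> 'w \<Rightarrow> 'b::euclidean_space) set" where
  "M2 P F \<tau> = {Z. predictable F Z \<and> sq_integrable_process P \<tau> Z}"

definition A2 :: "'w measure \<Rightarrow> (ennreal \<Rightarrow> 'w measure) \<Rightarrow> ('w \<Rightarrow> ennreal)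
    \<Rightarrow> (real \<Rightarrow> 'w \<Rightarrow> real^'d::finite) set" where
  "A2 P F \<tau> = {K \<in> S2 P F \<tau>.
     AE \<omega> in P. K 0 \<omega> = 0 \<and> (\<forall>i. mono_on {0..} (\<lambda>t. K t \<omega> $ i))}"

section \<open>The Ito integral\<close>

definition simple_integrand ::
    "(ennreal \<Rightarrow> 'w measure) \<Rightarrow> nat \<Rightarrow> (nat \<Rightarrow> real) \<Rightarrow> (nat \<Rightarrow> 'w \<Rightarrow> real^'p::finite) \<Rightarrow> bool" where
  "simple_integrand F n r \<xi> \<longleftrightarrow>
     0 \<le> r 0 \<and> (\<forall>k<n. r k \<le> r (Suc k)) \<and>
     (\<forall>k<n. \<xi> k \<in> borel_measurable (F (ennreal (r k))) \<and> bounded (\<xi> k ` space (F (ennreal (r k)))))"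

definition simple_process ::
    "nat \<Rightarrow> (nat \<Rightarrow> real) \<Rightarrow> (nat \<Rightarrow> 'w \<Rightarrow> real^'p::finite) \<Rightarrow> real \<Rightarrow> 'w \<Rightarrow> real^'p" where
  "simple_process n r \<xi> s \<omega> = (\<Sum>k<n. indicator {r k<..r (Suc k)} s *\<^sub>R \<xi> k \<omega>)"

definition simple_ito :: "(real \<Rightarrow> 'w \<Rightarrow> real^'p::finite) \<Rightarrow> nat \<Rightarrow> (nat \<Rightarrow> real)
    \<Rightarrow> (nat \<Rightarrow> 'w \<Rightarrow> real^'p) \<Rightarrow> real \<Rightarrow> 'w \<Rightarrow> real" where
  "simple_ito W n r \<xi> t \<omega> =
     (\<Sum>k<n. \<xi> k \<omega> \<bullet> (W (min t (r (Suc k))) \<omega> - W (min t (r k)) \<omega>))"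

definition null_in_prob :: "'w measure \<Rightarrow> (nat \<Rightarrow> 'w \<Rightarrow> ennreal) \<Rightarrow> bool" where
  "null_in_prob P D \<longleftrightarrow>
     (\<forall>\<epsilon>>0. (\<lambda>m. measure P {\<omega> \<in> space P. ennreal \<epsilon> < D m \<omega>}) \<longlonglongrightarrow> 0)"

text \<open>
  \<open>ito_integral P F W H I\<close>: the continuous adapted process \<open>I\<close> is (a version of) the stochastic
  integral of \<open>H\<close> from \<open>0\<close> to \<open>t\<close> against \<open>W\<close>, for progressive \<open>H\<close> with locally square integrable
  paths.  It is determined up to indistinguishability.
\<close>

definition ito_integral :: "'w measure \<Rightarrow> (ennreal \<Rightarrow> 'w measure) \<Rightarrow> (real \<Rightarrow> 'w \<Rightarrow> real^'p::finite)
    \<Rightarrow> (real \<Rightarrow> 'w \<Rightarrow> real^'p) \<Rightarrow> (real \<Rightarrow> 'w \<Rightarrow> real) \<Rightarrow> bool" where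
  "ito_integral P F W H I \<longleftrightarrow>
     progressive F H \<and> adapted F I \<and> (AE \<omega> in P. continuous_on {0..} (\<lambda>t. I t \<omega>)) \<and>
     (\<exists>n r \<xi>. (\<forall>m. simple_integrand F (n m) (r m) (\<xi> m)) \<and>
        (\<forall>T\<ge>0. null_in_prob P (\<lambda>m \<omega>.
           \<integral>\<^sup>+s\<in>{0..T}. ennreal ((norm (simple_process (n m) (r m) (\<xi> m) s \<omega> - H s \<omega>))\<^sup>2) \<partial>lborel)) \<and>
        (\<forall>t\<ge>0. null_in_prob P (\<lambda>m \<omega>.
           ennreal \<bar>simple_ito W (n m) (r m) (\<xi> m) t \<omega> - I t \<omega>\<bar>)))"

definition stop_integrand :: "('w \<Rightarrow> ennreal) \<Rightarrow> (real \<Rightarrow> 'w \<Rightarrow> 'b::real_vector) \<Rightarrow> real \<Rightarrow> 'w \<Rightarrow> 'b" where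
  "stop_integrand \<tau> H s \<omega> = indicator (horizon \<tau> \<omega>) s *\<^sub>R H s \<omega>"

text \<open>
  \<open>ito_remainder P F W \<tau> Z R\<close>: the process \<open>R\<close> is the integral of \<open>Z\<close> against \<open>W\<close> from \<open>min t \<tau>\<close>
  to \<open>\<tau>\<close>.  The integral \<open>J\<close> of the stopped integrand is constant after \<open>\<tau>\<close>, so that its value at
  \<open>\<tau>\<close>, for finite and infinite \<open>\<tau>\<close> alike, is its limit at infinity.
\<close>

definition ito_remainder :: "'w measure \<Rightarrow> (ennreal \<Rightarrow> 'w measure) \<Rightarrow> (real \<Rightarrow> 'w \<Rightarrow> real^'p::finite)
    \<Rightarrow> ('w \<Rightarrow> ennreal) \<Rightarrow> (real \<Rightarrow> 'w \<Rightarrow> real^'p) \<Rightarrow> (real \<Rightarrow> 'w \<Rightarrow> real) \<Rightarrow> bool" where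
  "ito_remainder P F W \<tau> Z R \<longleftrightarrow>
     (\<exists>J J\<^sub>\<tau>. ito_integral P F W (stop_integrand \<tau> Z) J \<and>
        (AE \<omega> in P. ((\<lambda>t. J t \<omega>) \<longlongrightarrow> J\<^sub>\<tau> \<omega>) at_top \<and> (\<forall>t\<ge>0. R t \<omega> = J\<^sub>\<tau> \<omega> - J t \<omega>)))"

section \<open>The forward equation\<close>

definition sde_solution :: "'w measure \<Rightarrow> (ennreal \<Rightarrow> 'w measure) \<Rightarrow> (real \<Rightarrow> 'w \<Rightarrow> real^'p::finite)
    \<Rightarrow> ('w \<Rightarrow> ennreal) \<Rightarrow> real \<Rightarrow> (real \<Rightarrow> 'w \<Rightarrow> real \<Rightarrow> real) \<Rightarrow> (real \<Rightarrow> 'w \<Rightarrow> real \<Rightarrow> real^'p)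
    \<Rightarrow> (real \<Rightarrow> 'w \<Rightarrow> real) \<Rightarrow> bool" where
  "sde_solution P F W \<tau> x\<^sub>0 b \<sigma> X \<longleftrightarrow>
     adapted F X \<and> (AE \<omega> in P. continuous_on {0..} (\<lambda>t. X t \<omega>)) \<and>
     (\<exists>I. ito_integral P F W (stop_integrand \<tau> (\<lambda>s \<omega>. \<sigma> s \<omega> (X s \<omega>))) I \<and>
        (AE \<omega> in P. \<forall>t\<ge>0.
           set_integrable lborel ({0..t} \<inter> horizon \<tau> \<omega>) (\<lambda>s. b s \<omega> (X s \<omega>)) \<and>
           X t \<omega> = x\<^sub>0 + (LINT s:({0..t} \<inter> horizon \<tau> \<omega>)|lborel. b s \<omega> (X s \<omega>)) + I t \<omega>))"

text \<open>\<open>X\<^sub>\<tau>\<close> is \<open>X(\<tau>)\<close>: on \<open>\<tau> = \<infinity>\<close> it is the \<open>L\<^sup>2\<close> limit of \<open>X(t)\<close> at infinity.\<close>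

definition value_at_tau :: "'w measure \<Rightarrow> ('w \<Rightarrow> ennreal) \<Rightarrow> (real \<Rightarrow> 'w \<Rightarrow> real) \<Rightarrow> ('w \<Rightarrow> real) \<Rightarrow> bool" where
  "value_at_tau P \<tau> X X\<^sub>\<tau> \<longleftrightarrow>
     X\<^sub>\<tau> \<in> borel_measurable P \<and>
     (AE \<omega> in P. \<tau> \<omega> < \<infinity> \<longrightarrow> X\<^sub>\<tau> \<omega> = X (enn2real (\<tau> \<omega>)) \<omega>) \<and>
     ((\<lambda>t. \<integral>\<^sup>+\<omega>\<in>{\<omega>. \<tau> \<omega> = \<infinity>}. ennreal ((X t \<omega> - X\<^sub>\<tau> \<omega>)\<^sup>2) \<partial>P) \<longlongrightarrow> 0) at_top"

section \<open>The obliquely reflected equation\<close>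

definition Q_set :: "('d \<Rightarrow> 'd \<Rightarrow> real) \<Rightarrow> (real^'d::finite) set" where
  "Q_set C = {y. \<forall>i j. i \<noteq> j \<longrightarrow> y $ i > y $ j - C i j}"

text \<open>
  The maximum over \<open>j \<noteq> i\<close>, taken in \<open>ereal\<close> so that it is \<open>-\<infinity>\<close> (and the barrier inactive) when
  there is only one mode.
\<close>

definition barrier :: "('d \<Rightarrow> 'd \<Rightarrow> real) \<Rightarrow> 'd \<Rightarrow> real^'d::finite \<Rightarrow> ereal" where
  "barrier C i y = (SUP j\<in>- {i}. ereal (y $ j - C i j))"

definition stop_time :: "('w \<Rightarrow> ennreal) \<Rightarrow> real \<Rightarrow> 'w \<Rightarrow> real" where
  "stop_time \<tau> t \<omega> = enn2real (min (ennreal t) (\<tau> \<omega>))"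

text \<open>
  The term \<open>\<integral> dK\<close> is \<open>K(\<tau>) - K(min t \<tau>)\<close>, where \<open>K(\<infinity>)\<close> is the limit.  In the Skorokhod condition
  \<open>Y\<close> and \<open>K\<close> are only cadlag, and the integral of a cadlag process against \<open>dK\<close> is understood, as
  usual in stochastic integration, as that of its left-limit process \<open>Y(s-)\<close>.  (It coincides with
  the integral of \<open>Y(s)\<close> if \<open>K\<close> is continuous; if \<open>K\<close> may jump, the condition on \<open>Y(s)\<close> allows
  arbitrary downward jumps of \<open>Y\<close> onto the barrier and uniqueness fails.)  The integrand is
  nonnegative, so the integral is taken as a nonnegative one.
\<close>

definition rbsde_solution :: "'w measure \<Rightarrow> (ennreal \<Rightarrow> 'w measure) \<Rightarrow> (real \<Rightarrow> 'w \<Rightarrow> real^'p::finite)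
    \<Rightarrow> ('w \<Rightarrow> ennreal) \<Rightarrow> ('d \<Rightarrow> real \<Rightarrow> 'w \<Rightarrow> real) \<Rightarrow> ('d \<Rightarrow> 'w \<Rightarrow> real)
    \<Rightarrow> (real \<Rightarrow> real) \<Rightarrow> (real \<Rightarrow> 'w \<Rightarrow> real \<Rightarrow> real \<Rightarrow> real^'p \<Rightarrow> 'd \<Rightarrow> real) \<Rightarrow> ('d \<Rightarrow> 'd \<Rightarrow> real)
    \<Rightarrow> (real \<Rightarrow> 'w \<Rightarrow> real^'d::finite) \<Rightarrow> (real \<Rightarrow> 'w \<Rightarrow> real^'p^'d) \<Rightarrow> (real \<Rightarrow> 'w \<Rightarrow> real^'d) \<Rightarrow> bool" where
  "rbsde_solution P F W \<tau> X X\<^sub>\<tau> g f C Y Z K \<longleftrightarrow>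
     Y \<in> S2 P F \<tau> \<and> Z \<in> M2 P F \<tau> \<and> K \<in> A2 P F \<tau> \<and>
     (\<forall>i. \<exists>R. ito_remainder P F W \<tau> (\<lambda>s \<omega>. Z s \<omega> $ i) R \<and>
        (AE \<omega> in P.
           set_integrable lborel (horizon \<tau> \<omega>) (\<lambda>s. f s \<omega> (X i s \<omega>) (Y s \<omega> $ i) (Z s \<omega> $ i) i) \<and>
           (\<forall>t\<ge>0. Y t \<omega> $ i = g (X\<^sub>\<tau> i \<omega>)
              + (LINT s:({t..} \<inter> horizon \<tau> \<omega>)|lborel. f s \<omega> (X i s \<omega>) (Y s \<omega> $ i) (Z s \<omega> $ i) i)
              + (Lim at_top (\<lambda>s. K (stop_time \<tau> s \<omega>) \<omega> $ i) - K (stop_time \<tau> t \<omega>) \<omega> $ i)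
              - R t \<omega>) \<and>
           (\<forall>t\<ge>0. Y t \<omega> $ i \<ge> (MAX j. Y t \<omega> $ j - C i j)) \<and>
           (\<integral>\<^sup>+s\<in>horizon \<tau> \<omega> - {0}.
              e2ennreal (ereal (Lim (at_left s) (\<lambda>r. Y r \<omega>) $ i)
                         - barrier C i (Lim (at_left s) (\<lambda>r. Y r \<omega>)))
              \<partial>interval_measure (\<lambda>s. K (max 0 s) \<omega> $ i)) = 0))"

section \<open>Switching strategies\<close>

text \<open>
  A strategy starting at time \<open>t\<close> from mode \<open>i\<close> is a pair of sequences \<open>(\<theta>, \<zeta>)\<close>.  The switching
  times do not exceed \<open>\<tau>\<close>, so the initial time is \<open>min t \<tau>\<close>.
\<close>

definition admissible :: "'w measure \<Rightarrow> (ennreal \<Rightarrow> 'w measure) \<Rightarrow> ('w \<Rightarrow> ennreal) \<Rightarrow> real \<Rightarrow> 'd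
    \<Rightarrow> (nat \<Rightarrow> 'w \<Rightarrow> ennreal) \<Rightarrow> (nat \<Rightarrow> 'w \<Rightarrow> 'd) \<Rightarrow> bool" where
  "admissible P F \<tau> t i \<theta> \<zeta> \<longleftrightarrow>
     (\<forall>k. stopping_time F (\<theta> k)) \<and>
     (\<forall>k. \<zeta> k \<in> filtration.pre_sigma (space P) F (\<theta> k) \<rightarrow>\<^sub>M count_space UNIV) \<and>
     (AE \<omega> in P. \<theta> 0 \<omega> = min (ennreal t) (\<tau> \<omega>) \<and> \<zeta> 0 \<omega> = i \<and>
        (\<forall>k. \<theta> k \<omega> \<le> \<theta> (Suc k) \<omega> \<and> \<theta> k \<omega> \<le> \<tau> \<omega>) \<and> (\<lambda>k. \<theta> k \<omega>) \<longlonglongrightarrow> \<tau> \<omega>)"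

text \<open>
  The mode process: \<open>\<zeta> k\<close> on \<open>(\<theta> k, \<theta> (k + 1)]\<close>, and \<open>\<zeta> 0\<close> at the initial time.  If \<open>\<theta> k < \<tau>\<close> for
  all \<open>k\<close>, no interval contains \<open>\<tau>\<close>; the mode at \<open>\<tau>\<close> is then the eventual value of \<open>\<zeta>\<close>.
\<close>

definition mode_at :: "(nat \<Rightarrow> 'w \<Rightarrow> ennreal) \<Rightarrow> (nat \<Rightarrow> 'w \<Rightarrow> 'd) \<Rightarrow> ennreal \<Rightarrow> 'w \<Rightarrow> 'd" where
  "mode_at \<theta> \<zeta> s \<omega> =
     (if s \<le> \<theta> 0 \<omega> then \<zeta> 0 \<omega>
      else if \<exists>k. \<theta> k \<omega> < s \<and> s \<le> \<theta> (Suc k) \<omega>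
        then \<zeta> (LEAST k. \<theta> k \<omega> < s \<and> s \<le> \<theta> (Suc k) \<omega>) \<omega>
      else (SOME l. eventually (\<lambda>k. \<zeta> k \<omega> = l) sequentially))"

text \<open>
  The switch from \<open>\<zeta> k\<close> to \<open>\<zeta> (k + 1)\<close> takes place at \<open>\<theta> (k + 1)\<close>, where the mode process changes,
  and is paid there.  Switches at \<open>\<tau>\<close> itself never show in the mode process and are not paid.
\<close>

definition switch_cost :: "('d \<Rightarrow> 'd \<Rightarrow> real) \<Rightarrow> ('w \<Rightarrow> ennreal)
    \<Rightarrow> (nat \<Rightarrow> 'w \<Rightarrow> ennreal) \<Rightarrow> (nat \<Rightarrow> 'w \<Rightarrow> 'd) \<Rightarrow> ennreal \<Rightarrow> 'w \<Rightarrow> nat \<Rightarrow> real" where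
  "switch_cost C \<tau> \<theta> \<zeta> s \<omega> k =
     (if \<theta> (Suc k) \<omega> \<le> s \<and> \<theta> (Suc k) \<omega> < \<tau> \<omega> then C (\<zeta> k \<omega>) (\<zeta> (Suc k) \<omega>) else 0)"

definition cost :: "('d \<Rightarrow> 'd \<Rightarrow> real) \<Rightarrow> ('w \<Rightarrow> ennreal)
    \<Rightarrow> (nat \<Rightarrow> 'w \<Rightarrow> ennreal) \<Rightarrow> (nat \<Rightarrow> 'w \<Rightarrow> 'd) \<Rightarrow> ennreal \<Rightarrow> 'w \<Rightarrow> real" where
  "cost C \<tau> \<theta> \<zeta> s \<omega> = (\<Sum>k. switch_cost C \<tau> \<theta> \<zeta> s \<omega> k)"

text \<open>
  With \<open>A\<close> the cost process, the costs paid after \<open>s\<close>, \<open>A(\<tau>) - A(s)\<close>, are subtracted: this is the sign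
  that goes with the constraint \<open>Y i \<ge> Y j - C i j\<close> and with a supremum over strategies.  The equation
  only makes sense if the total cost \<open>A(\<tau>)\<close> is finite.

  Since \<open>U\<close> and \<open>A\<close> are right-continuous, \<open>U(t)\<close> is the value after the switches made at the initial
  time \<open>t\<close> itself; their price is \<open>A(t)\<close>, so that the value of the strategy seen from its initial mode,
  that is \<open>U(t-)\<close>, is \<open>U(t) - A(t)\<close>.  Here \<open>A(t) = 0\<close> unless the strategy switches at \<open>t\<close>.
\<close>

definition switching_bsde_solution ::
    "'w measure \<Rightarrow> (ennreal \<Rightarrow> 'w measure) \<Rightarrow> (real \<Rightarrow> 'w \<Rightarrow> real^'p::finite)
    \<Rightarrow> ('w \<Rightarrow> ennreal) \<Rightarrow> ('d \<Rightarrow> real \<Rightarrow> 'w \<Rightarrow> real) \<Rightarrow> ('d \<Rightarrow> 'w \<Rightarrow> real)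
    \<Rightarrow> (real \<Rightarrow> real) \<Rightarrow> (real \<Rightarrow> 'w \<Rightarrow> real \<Rightarrow> real \<Rightarrow> real^'p \<Rightarrow> 'd \<Rightarrow> real) \<Rightarrow> ('d \<Rightarrow> 'd \<Rightarrow> real)
    \<Rightarrow> real \<Rightarrow> (nat \<Rightarrow> 'w \<Rightarrow> ennreal) \<Rightarrow> (nat \<Rightarrow> 'w \<Rightarrow> 'd)
    \<Rightarrow> (real \<Rightarrow> 'w \<Rightarrow> real) \<Rightarrow> (real \<Rightarrow> 'w \<Rightarrow> real^'p) \<Rightarrow> bool" where
  "switching_bsde_solution P F W \<tau> X X\<^sub>\<tau> g f C t \<theta> \<zeta> U V \<longleftrightarrow>
     U \<in> S2 P F \<tau> \<and> V \<in> M2 P F \<tau> \<and>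
     (\<exists>R. ito_remainder P F W \<tau> V R \<and>
        (AE \<omega> in P. let \<alpha> = (\<lambda>s. mode_at \<theta> \<zeta> s \<omega>); A = (\<lambda>s. cost C \<tau> \<theta> \<zeta> s \<omega>);
             F\<^sub>\<alpha> = (\<lambda>r. f r \<omega> (X (\<alpha> (ennreal r)) r \<omega>) (U r \<omega>) (V r \<omega>) (\<alpha> (ennreal r))) in
           summable (switch_cost C \<tau> \<theta> \<zeta> (\<tau> \<omega>) \<omega>) \<and>
           set_integrable lborel ({t..} \<inter> horizon \<tau> \<omega>) F\<^sub>\<alpha> \<and>
           (\<forall>s\<ge>t. U s \<omega> = g (X\<^sub>\<tau> (\<alpha> (\<tau> \<omega>)) \<omega>) - (A (\<tau> \<omega>) - A (ennreal s))
              + (LINT r:({s..} \<inter> horizon \<tau> \<omega>)|lborel. F\<^sub>\<alpha> r) - R s \<omega>)))"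

text \<open>
  The candidate strategy: leave the current mode when its component of \<open>Y\<close> meets the barrier, for
  a different mode realising the maximum.  The new mode is only prescribed on \<open>\<theta> (j + 1) < \<tau>\<close>: where
  \<open>\<theta> (j + 1) = \<tau>\<close> the barrier need not be met, no switch takes place and \<open>\<zeta> (j + 1)\<close> is immaterial.
\<close>

definition candidate_strategy :: "'w measure \<Rightarrow> (ennreal \<Rightarrow> 'w measure) \<Rightarrow> ('w \<Rightarrow> ennreal)
    \<Rightarrow> ('d \<Rightarrow> 'd \<Rightarrow> real) \<Rightarrow> (real \<Rightarrow> 'w \<Rightarrow> real^'d::finite) \<Rightarrow> real \<Rightarrow> 'd
    \<Rightarrow> (nat \<Rightarrow> 'w \<Rightarrow> ennreal) \<Rightarrow> (nat \<Rightarrow> 'w \<Rightarrow> 'd) \<Rightarrow> bool" where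
  "candidate_strategy P F \<tau> C Y t i \<theta> \<zeta> \<longleftrightarrow>
     (\<forall>\<omega>\<in>space P. \<theta> 0 \<omega> = min (ennreal t) (\<tau> \<omega>) \<and> \<zeta> 0 \<omega> = i) \<and>
     (\<forall>j. (\<forall>\<omega>\<in>space P. \<theta> (Suc j) \<omega> =
             min (INF s\<in>{s. 0 \<le> s \<and> \<theta> j \<omega> \<le> ennreal s \<and>
                           ereal (Y s \<omega> $ \<zeta> j \<omega>) = barrier C (\<zeta> j \<omega>) (Y s \<omega>)}. ennreal s) (\<tau> \<omega>)) \<and>
          \<zeta> (Suc j) \<in> filtration.pre_sigma (space P) F (\<theta> (Suc j)) \<rightarrow>\<^sub>M count_space UNIV \<and>
          (AE \<omega> in P. \<theta> (Suc j) \<omega> < \<tau> \<omega> \<longrightarrow>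
             \<zeta> (Suc j) \<omega> \<noteq> \<zeta> j \<omega> \<and>
             (let y = Y (enn2real (\<theta> (Suc j) \<omega>)) \<omega> in
                y $ \<zeta> j \<omega> = y $ \<zeta> (Suc j) \<omega> - C (\<zeta> j \<omega>) (\<zeta> (Suc j) \<omega>))))"

text \<open>
  Essential supremum of a family of random variables; \<open>esssup\<close> of the library is that of one
  function.
\<close>

definition is_ess_sup :: "'w measure \<Rightarrow> ('w \<Rightarrow> real) set \<Rightarrow> ('w \<Rightarrow> real) \<Rightarrow> bool" where
  "is_ess_sup P \<U> y \<longleftrightarrow>
     y \<in> borel_measurable P \<and> (\<forall>v\<in>\<U>. AE \<omega> in P. v \<omega> \<le> y \<omega>) \<and>
     (\<forall>y'\<in>borel_measurable P. (\<forall>v\<in>\<U>. AE \<omega> in P. v \<omega> \<le> y' \<omega>) \<longrightarrow> (AE \<omega> in P. y \<omega> \<le> y' \<omega>))"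

end

theory Submission
  imports Defs
begin

text \<open>
Along a strategy \<open>(th, ze)\<close> follow the component \<open>Y (ze k)\<close> of the reflected solution between the switching
times \<open>th k\<close> and \<open>th (k + 1)\<close>.  At a switch the obstacle lets this process lose at most the cost, and in
between the reflection only pushes it down, so that, corrected by the accumulated cost, it is a supersolution of the
equation for \<open>U\<close>, and a solution for the candidate strategy, which switches on contact with the obstacle only and
does so finitely often because a cycle of switches is never free.  Both claims on \<open>U\<close> follow
from a comparison theorem: the smoothed square of the negative part of the difference is expanded on a grid that
becomes finer, where the integrability of the Lipschitz weight \<open>u\<close> makes a discrete Gronwall argument work up to an infinite
horizon.  Uniqueness of \<open>Y\<close> is that of essential suprema; the difference of the martingale parts
of two solutions then has paths of finite variation, hence vanishes, which identifies \<open>Z\<close> and \<open>K\<close>.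
\<close>

text \<open>The Ito integral is given through convergence in probability of simple integrals. It is
  rebuilt in mean square, where the isometry makes shifting, stopping and splicing pass from
  approximants to limits; truncating the energy of simple integrands links the two notions. No chain
  rule for the integral is used, a Taylor expansion on a grid takes its place. Its cubic remainder
  is out of reach for a merely square integrable integrand. Hence each increment is compared with
  that of an elementary integrand, whose fourth moment is of the order of the squared step, and the
  error of this comparison meets a quadratic remainder only. The dependence of the drift on the
  martingale integrand is absorbed by the quadratic variation through (phi')^2 <= 2 phi phi'', which
  dictates the smoothing phi. Solutions are only cadlag a priori. Their continuity comes from the
  Skorokhod condition on left limits: modes whose reflection jumps at the same time would form a
  free cycle, the same contradiction that later stops the candidate from switching infinitely
  often.\<close>

notation tendsto (infixr "--->" 55)
notation LIMSEQ ("((_)/ ----> (_))" [60, 60] 60)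

abbreviation nsq :: "'a::real_normed_vector => ennreal" where "nsq x \<equiv> ennreal ((norm x)^2)"

syntax "_NN" :: "pttrn => real set => ennreal => ennreal" ("(NN _:_./ _)" [0, 0, 10] 10)
translations "NN x:A. f" == "CONST set_nn_integral (CONST lborel) A (\<lambda>x. f)"

section \<open>The augmented Brownian filtration\<close>

locale brownian_basis =
fixes P :: "'w measure" and W :: "real => 'w => real^'p::finite" and F :: "ennreal => 'w measure"
assumes prob_space_P: "prob_space P" and complete_P: "complete_measure P"
 and BM: "brownian_motion P W" and F_eq: "F = augmented_filtration P W"

sublocale brownian_basis \<subseteq> prob_space P
by (rule prob_space_P)

sublocale brownian_basis \<subseteq> complete_measure P
by (rule complete_P)

context brownian_basis
begin

abbreviation "Fmeas s \<equiv> borel_measurable (F (ennreal s))"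
abbreviation nn_expectation (binder "EE " 10) where "nn_expectation f \<equiv> nn_integral P f"

lemma measurable_W [measurable]: "0 <= t ==> W t \<in> borel_measurable P"
using BM by (auto simp: brownian_motion_def)

lemma natural_events_subset: "natural_events P W t \<subseteq> sets P"
unfolding natural_events_def by (auto intro!: measurable_sets[OF measurable_W])

lemma generators_Pow: "natural_events P W t \<union> null_sets P \<subseteq> Pow (space P)"
using natural_events_subset[of t] sets.sets_into_space[of _ P] by (auto simp: null_sets_def)

lemma space_F [simp]: "space (F t) = space P"
unfolding F_eq augmented_filtration_def by (rule space_measure_of[OF generators_Pow])

lemma sets_F: "sets (F t) = sigma_sets (space P) (natural_events P W t \<union> null_sets P)"
unfolding F_eq augmented_filtration_def by (rule sets_measure_of[OF generators_Pow])

lemma sets_F_le: "sets (F t) \<subseteq> sets P"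
unfolding sets_F using natural_events_subset
by (intro sets.sigma_sets_subset) (auto simp: null_sets_def)

lemma sets_F_mono: "s <= t ==> sets (F s) \<subseteq> sets (F t)"
unfolding sets_F natural_events_def by (rule sigma_sets_mono') (auto intro: order_trans)

lemma null_sets_F: "N \<in> null_sets P ==> N \<in> sets (F t)"
unfolding sets_F by (rule sigma_sets.Basic) simp

sublocale filtration "space P" F
by unfold_locales (use sets_F_mono in auto)

lemma measurable_F_P: "f \<in> F t \<rightarrow>\<^sub>M N ==> f \<in> P \<rightarrow>\<^sub>M N"
using sets_F_le[of t] unfolding measurable_def by auto

lemma measurable_F_mono: "f \<in> F s \<rightarrow>\<^sub>M N ==> s <= t ==> f \<in> F t \<rightarrow>\<^sub>M N"
using sets_F_mono[of s t] unfolding measurable_def by auto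

lemma W_measurable_F: "0 <= s ==> ennreal s <= t ==> W s \<in> borel_measurable (F t)"
unfolding measurable_def sets_F
by (auto intro!: sigma_sets.Basic simp: natural_events_def)

text \<open>Completeness of \<open>P\<close> turns every subset of a negligible set into a null set,
  and each \<open>F t\<close> contains all null sets. This is what makes adaptedness insensitive to
  modifications on null sets.\<close>

lemma subset_null_in_F:
assumes "AE w in P. w \<notin> A" "A \<subseteq> space P"
shows "A \<in> sets (F t)"
using assms by (intro null_sets_F) (simp add: null_sets_iff_AE)

lemma measurable_F_AE:
assumes f: "f \<in> F t \<rightarrow>\<^sub>M N" and eq: "AE w in P. f w = g w"
 and g: "!!w. w \<in> space P ==> g w \<in> space N"
shows "g \<in> F t \<rightarrow>\<^sub>M N"
proof (rule measurableI)
show "g w \<in> space N" if "w \<in> space (F t)" for w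
 using g that by simp
next
fix A assume A: "A \<in> sets N"
let ?D = "{w\<in>space P. f w ~= g w}"
have D: "B \<in> sets (F t)" if "B \<subseteq> ?D" for B
 using that eq by (intro subset_null_in_F) (auto elim!: eventually_mono)
have "g -` A \<inter> space (F t) = (f -` A \<inter> space (F t) - (?D - g -` A)) \<union> (?D \<inter> g -` A)"
 by (rule set_eqI) (simp, metis)
also have "... \<in> sets (F t)"
 using D[of "?D - g -` A"] D[of "?D \<inter> g -` A"]
  sets.Un[OF sets.Diff[OF measurable_sets[OF f A]]] by auto
finally show "g -` A \<inter> space (F t) \<in> sets (F t)" .
qed

lemma pred_F_AE:
assumes "Measurable.pred (F t) Q" "AE w in P. Q w = R w"
shows "Measurable.pred (F t) R"
using measurable_F_AE[of Q t "count_space UNIV" R] assms by simp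

text \<open>The sets that agree almost surely with a natural event form a sigma-algebra containing
  both kinds of generators. It serves to carry the independence of increments over to the augmented
  filtration.\<close>

lemma sets_F_natural:
assumes "A \<in> sets (F t)"
shows "EX B:sigma_sets (space P) (natural_events P W t). AE w in P. w \<in> A \<longleftrightarrow> w \<in> B"
using assms unfolding sets_F
proof (induction rule: sigma_sets.induct)
case (Basic a)
thus ?case
proof
 assume "a \<in> null_sets P"
 hence "AE w in P. w \<in> a \<longleftrightarrow> w \<in> {}"
  using AE_not_in by force
 thus ?thesis by (blast intro: sigma_sets.Empty)
qed (auto intro: sigma_sets.Basic)
next
case Empty
show ?case by (rule bexI[OF _ sigma_sets.Empty]) simp
next
case (Compl a)
then obtain b where b: "b \<in> sigma_sets (space P) (natural_events P W t)" "AE w in P. w \<in> a \<longleftrightarrow> w \<in> b"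
 by auto
thus ?case
 by (intro bexI[of _ "space P - b"] sigma_sets.Compl) (auto elim!: eventually_mono)
next
case (Union a)
then obtain b where b: "!!i::nat. b i \<in> sigma_sets (space P) (natural_events P W t)"
 "!!i. AE w in P. w \<in> a i \<longleftrightarrow> w \<in> b i"
 by metis
from b(2) have "AE w in P. ALL i. w \<in> a i \<longleftrightarrow> w \<in> b i"
 by (simp add: AE_all_countable)
with b(1) show ?case
 by (intro bexI[of _ "\<Union>i. b i"] sigma_sets.Union) (auto elim: AE_mp)
qed

section \<open>Independence and moments of Brownian increments\<close>

lemma indep_increment:
assumes "0 <= s" "s < t"
shows "indep_set (sets (F (ennreal s))) {(%w. W t w - W s w) -` B \<inter> space P | B. B \<in> sets borel}"
unfolding indep_sets2_eq
proof (intro conjI ballI)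
let ?N = "sigma_sets (space P) (natural_events P W (ennreal s))"
have ind: "indep_set ?N {(%w. W t w - W s w) -` B \<inter> space P | B. B \<in> sets borel}"
 using BM assms unfolding brownian_motion_def by blast
thus "{(%w. W t w - W s w) -` B \<inter> space P | B. B \<in> sets borel} \<subseteq> events"
 unfolding indep_sets2_eq by auto
show "sets (F (ennreal s)) \<subseteq> events" by (rule sets_F_le)
fix a b assume a: "a \<in> sets (F (ennreal s))"
 and b: "b \<in> {(%w. W t w - W s w) -` B \<inter> space P | B. B \<in> sets borel}"
obtain a' where a': "a' \<in> ?N" "AE w in P. w \<in> a \<longleftrightarrow> w \<in> a'"
 using sets_F_natural[OF a] by auto
have m: "a' \<in> events" "b \<in> events" "a \<in> events"
 using ind a'(1) b a sets_F_le[of "ennreal s"] unfolding indep_sets2_eq by (blast+)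
\<comment> \<open>Probabilities do not see the null set on which \<open>a\<close> and its natural
  version \<open>a'\<close> differ.\<close>
have "prob (a \<inter> b) = prob (a' \<inter> b)" "prob a = prob a'"
 using a'(2) m by (intro measure_eq_AE sets.Int; force)+
thus "prob (a \<inter> b) = prob a * prob b"
 using ind a'(1) b unfolding indep_sets2_eq by auto
qed

text \<open>Both generated sigma-algebras lie inside families already known to be independent: the
  first in \<open>F s\<close>, the second in the preimages of Borel sets under the increment, which
  form a sigma-algebra themselves.\<close>

lemma indep_var_increment:
assumes st: "0 <= s" "s < t" and eta: "eta \<in> Fmeas s"
 and h: "h \<in> borel_measurable borel"
shows "indep_var borel eta borel (%w. h (W t w - W s w))"
proof -
have "{eta -` A \<inter> space P |A. A \<in> sets borel} \<subseteq> sets (F (ennreal s))"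
 using measurable_sets[OF eta] by auto
hence 1: "sigma_sets (space P) {eta -` A \<inter> space P |A. A \<in> sets borel} \<subseteq> sets (F (ennreal s))"
 using sets.sigma_sets_subset[of _ "F (ennreal s)"] by simp
let ?D = "%w. W t w - W s w"
have "sigma_sets (space P) {(%w. h (?D w)) -` A \<inter> space P |A. A \<in> sets borel}
  \<subseteq> sets (vimage_algebra (space P) ?D borel)"
proof -
 have "(%w. h (?D w)) \<in> borel_measurable (vimage_algebra (space P) ?D borel)"
  by (rule measurable_compose[OF measurable_vimage_algebra1 h]) simp
 hence "{(%w. h (?D w)) -` A \<inter> space P |A. A \<in> sets borel} \<subseteq> sets (vimage_algebra (space P) ?D borel)"
  using measurable_sets[of _ "vimage_algebra (space P) ?D borel" borel] by auto
 thus ?thesis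
  using sets.sigma_sets_subset[of _ "vimage_algebra (space P) ?D borel"] by simp
qed
also have "... = {?D -` B \<inter> space P | B. B \<in> sets borel}"
 by (subst sets_vimage_algebra2) auto
finally have 2: "sigma_sets (space P) {(%w. h (?D w)) -` A \<inter> space P |A. A \<in> sets borel}
  \<subseteq> {?D -` B \<inter> space P | B. B \<in> sets borel}" .
have "?D \<in> borel_measurable P"
 using st by (intro borel_measurable_diff measurable_W) auto
hence "(%w. h (?D w)) \<in> borel_measurable P"
 using h by (rule measurable_compose)
moreover have "indep_set (sigma_sets (space P) {eta -` A \<inter> space P |A. A \<in> sets borel})
  (sigma_sets (space P) {(%w. h (?D w)) -` A \<inter> space P |A. A \<in> sets borel})"
 unfolding indep_sets2_eq
proof (intro conjI ballI)
 note * = indep_increment[OF st, unfolded indep_sets2_eq]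
 show "sigma_sets (space P) {eta -` A \<inter> space P |A. A \<in> sets borel} \<subseteq> events"
  "sigma_sets (space P) {(%w. h (?D w)) -` A \<inter> space P |A. A \<in> sets borel} \<subseteq> events"
  using * 1 2 by (meson order_trans)+
 fix a b assume "a \<in> sigma_sets (space P) {eta -` A \<inter> space P |A. A \<in> sets borel}"
  "b \<in> sigma_sets (space P) {(%w. h (?D w)) -` A \<inter> space P |A. A \<in> sets borel}"
 hence "a \<in> sets (F (ennreal s))" "b \<in> {?D -` B \<inter> space P | B. B \<in> sets borel}"
  using 1 2 by (meson subsetD)+
 thus "prob (a \<inter> b) = prob a * prob b" using * by blast
qed
ultimately show ?thesis
 using measurable_F_P[OF eta] unfolding indep_var_eq by blast
qed

lemma expectation_increment:
fixes eta h
assumes st: "0 <= s" "s < t" and eta: "eta \<in> Fmeas s" "integrable P eta"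
 and h: "h \<in> borel_measurable borel" "integrable P (%w. h (W t w - W s w) :: real)"
shows "integrable P (%w. eta w * h (W t w - W s w))"
 and "expectation (%w. eta w * h (W t w - W s w)) = expectation eta * expectation (%w. h (W t w - W s w))"
using indep_var_lebesgue_integral[OF indep_var_increment[OF st eta(1) h(1)] eta(2) h(2)]
 indep_var_integrable[OF indep_var_increment[OF st eta(1) h(1)] eta(2) h(2)] by auto

lemma increment_power:
assumes "0 <= s" "s < t"
shows "integrable P (%w. ((W t w - W s w) $ j) ^ k)" (is ?Q1)
 and "expectation (%w. ((W t w - W s w) $ j) ^ k) = (\<integral>x. normal_density 0 (sqrt (t - s)) x * x ^ k \<partial>lborel)" (is ?Q2)
proof -
have D: "distributed P lborel (%w. (W t w - W s w) $ j) (normal_density 0 (sqrt (t - s)))"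
 using BM assms unfolding brownian_motion_def by blast
have "0 < sqrt (t - s)" using assms by simp
hence "integrable lborel (%x. normal_density 0 (sqrt (t - s)) x * x ^ k)"
 using integrable_normal_moment[of "sqrt (t - s)" 0 k] by simp
thus ?Q1
 using distributed_integrable[OF D, of "%x. x ^ k"] by simp
show ?Q2
 using distributed_integral[OF D, of "%x. x ^ k"] by simp
qed

text \<open>These are the Gaussian moments of order 1, 2 and 4. The square of the step in the fourth
  one is what makes the third-order remainder disappear on fine grids.\<close>

lemma increment_moments:
assumes st: "0 <= s" "s < t"
shows "expectation (%w. (W t w - W s w) $ j) = 0" (is ?Q1)
 and "expectation (%w. ((W t w - W s w) $ j)^2) = t - s" (is ?Q2)
 and "expectation (%w. ((W t w - W s w) $ j) ^ 4) = 3 * (t - s)^2" (is ?Q3)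
proof -
have p: "0 < sqrt (t - s)" using st by simp
show ?Q1
 using increment_power(2)[OF st, of j 1] integral_normal_moment_odd[OF p, of 0 0] by simp
show ?Q2
 using increment_power(2)[OF st, of j 2] integral_normal_moment_even[OF p, of 0 1] st
 by (simp add: real_sqrt_pow2)
have "fact 4 = (24::real)" by (simp add: fact_numeral)
moreover have "sqrt (t - s) ^ 4 = (t - s)^2"
 using st power_mult[of "sqrt (t - s)" 2 2] by simp
ultimately show ?Q3
 using increment_power(2)[OF st, of j 4] integral_normal_moment_even[OF p, of 0 2] st
 by (simp add: power_divide fact_numeral)
qed

lemma expectation_increment_prod:
assumes st: "0 <= s" "s < t"
shows "integrable P (%w. (W t w - W s w) $ j * (W t w - W s w) $ l)"
 and "expectation (%w. (W t w - W s w) $ j * (W t w - W s w) $ l) = (if j = l then t - s else 0)"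
proof -
let ?D = "%j w. (W t w - W s w) $ j"
have "integrable P (?D j)" "integrable P (?D l)"
 using increment_power(1)[OF st, of _ 1] by simp_all
moreover have "indep_vars (%_. borel) ?D UNIV"
 using BM st unfolding brownian_motion_def by blast
hence "indep_var borel (?D j) borel (?D l)" if "j ~= l"
 unfolding indep_var_eq indep_sets2_eq indep_vars_def
proof safe
 let ?\<Sigma> = "%i. sigma_sets (space P) {?D i -` A \<inter> space P |A. A \<in> sets borel}"
 assume ind: "indep_sets ?\<Sigma> UNIV"
 show "a \<in> events" if "a \<in> ?\<Sigma> i" for a i
  using ind that unfolding indep_sets_def by blast
 thus "a \<in> events" if "a \<in> ?\<Sigma> i" for a i
  using that by blast
 fix a b assume "a \<in> ?\<Sigma> j" "b \<in> ?\<Sigma> l"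
 thus "prob (a \<inter> b) = prob a * prob b"
  using indep_setsD[OF ind, of "{j, l}" "%k. if k = j then a else b"] that
  by (auto simp: Int_commute)
qed auto
ultimately have "integrable P (%w. ?D j w * ?D l w) & expectation (%w. ?D j w * ?D l w) = 0" if "j ~= l"
 using that indep_var_lebesgue_integral[of "?D j" "?D l"] indep_var_integrable[of "?D j" "?D l"]
  increment_moments(1)[OF st] by simp
moreover have "integrable P (%w. ?D j w * ?D j w)" "expectation (%w. ?D j w * ?D j w) = t - s"
 using increment_power(1)[OF st, of j 2] increment_moments(2)[OF st, of j]
 by (simp_all add: power2_eq_square)
ultimately show "integrable P (%w. ?D j w * ?D l w)"
 "expectation (%w. ?D j w * ?D l w) = (if j = l then t - s else 0)"
 by (cases "j = l"; simp)+
qed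

end

section \<open>The integral of simple processes\<close>

lemma borel_measurable_vec_nth [measurable (raw)]:
fixes f :: "'a => 'b::{second_countable_topology, real_normed_vector}^'n::finite"
assumes "f \<in> borel_measurable M"
shows "(%x. f x $ j) \<in> borel_measurable M"
using assms by (rule measurable_compose)
 (intro borel_measurable_continuous_onI continuous_intros)

definition time_L2 :: "'w measure => real => (real => 'w => 'b::real_normed_vector) => ennreal" where
"time_L2 P T H = (\<integral>\<^sup>+w. (NN s:{0..T}. nsq (H s w)) \<partial>P)"

text \<open>Pairs an integrand with its integral and hides the grid, so that later arguments may
  refine or move the grid freely.\<close>

definition elementary :: "(ennreal => 'w measure) => (real => 'w => real^'p::finite)
 => (real => 'w => real^'p) => (real => 'w => real) => bool" where
"elementary F W S J \<longleftrightarrow>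
  (EX n r xi. simple_integrand F n r xi & S = simple_process n r xi & J = simple_ito W n r xi)"

lemma simple_integrand_mono:
assumes "simple_integrand F n r xi" "k <= l" "l <= n"
shows "r k <= r l"
using assms(2,3)
proof (induction l rule: dec_induct)
case (step l)
thus ?case using assms(1) by (auto simp: simple_integrand_def intro: order_trans)
qed simp

lemma simple_integrand_nonneg:
assumes "simple_integrand F n r xi" "k <= n"
shows "0 <= r k"
using simple_integrand_mono[OF assms(1), of 0 k] assms by (auto simp: simple_integrand_def)

lemma simple_integrand_SucD: "simple_integrand F (Suc n) r xi ==> simple_integrand F n r xi"
by (auto simp: simple_integrand_def)

text \<open>The grid intervals are disjoint, so at most one term of the sum is nonzero and squaring
  commutes with summation.\<close>

lemma norm_simple_process:
assumes "simple_integrand F n r xi"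
shows "(norm (simple_process n r xi s w))^2 = (\<Sum>k<n. indicator {r k<..r (Suc k)} s * (norm (xi k w))^2)"
using assms
proof (induction n)
case (Suc n)
note IH = Suc.IH[OF simple_integrand_SucD[OF Suc.prems]]
show ?case
proof (cases "s \<in> {r n<..r (Suc n)}")
 case True
 have "r (Suc k) <= r n" if "k < n" for k
  using simple_integrand_mono[OF Suc.prems, of "Suc k" n] that by simp
 hence "indicator {r k<..r (Suc k)} s = (0::real)" if "k < n" for k
  using True that by (fastforce simp: indicator_def)
 thus ?thesis using True by (simp add: simple_process_def)
qed (use IH in \<open>simp add: simple_process_def\<close>)
qed (simp add: simple_process_def)

lemma nn_integral_simple_process:
assumes S: "simple_integrand F n r xi" and t: "0 <= t"
shows "(NN s:{0..t}. nsq (simple_process n r xi s w))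
 = ennreal (\<Sum>k<n. (norm (xi k w))^2 * (min t (r (Suc k)) - min t (r k)))"
proof -
have r: "r k <= r (Suc k)" "0 <= r k" if "k < n" for k
 using S simple_integrand_nonneg[OF S, of k] that by (auto simp: simple_integrand_def)
have "(NN s:{0..t}. nsq (simple_process n r xi s w))
 = (\<integral>\<^sup>+s. (\<Sum>k<n. nsq (xi k w) * indicator {min t (r k)<..min t (r (Suc k))} s) \<partial>lborel)"
proof (rule nn_integral_cong)
 fix s :: real
 have "indicator {r k<..r (Suc k)} s * indicator {0..t} s =
   (indicator {min t (r k)<..min t (r (Suc k))} s :: real)" if "k < n" for k
  using r[OF that] by (auto simp: indicator_def)
 hence "(norm (simple_process n r xi s w))^2 * indicator {0..t} s
   = (\<Sum>k<n. (norm (xi k w))^2 * indicator {min t (r k)<..min t (r (Suc k))} s)"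
  unfolding norm_simple_process[OF S] sum_distrib_right by (intro sum.cong) (auto simp: mult_ac)
 hence "ennreal ((norm (simple_process n r xi s w))^2 * indicator {0..t} s)
   = (\<Sum>k<n. ennreal ((norm (xi k w))^2 * indicator {min t (r k)<..min t (r (Suc k))} s))"
  by (simp add: sum_ennreal)
 thus "nsq (simple_process n r xi s w) * indicator {0..t} s =
   (\<Sum>k<n. nsq (xi k w) * indicator {min t (r k)<..min t (r (Suc k))} s)"
  by (simp add: ennreal_mult' ennreal_indicator)
qed
also have "... = (\<Sum>k<n. nsq (xi k w) * ennreal (min t (r (Suc k)) - min t (r k)))"
 using r by (subst nn_integral_sum)
  (auto simp: nn_integral_cmult_indicator min.mono min.coboundedI2 intro!: sum.cong arg_cong2[where f="(*)"] emeasure_lborel_Ioc)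
also have "... = ennreal (\<Sum>k<n. (norm (xi k w))^2 * (min t (r (Suc k)) - min t (r k)))"
 using r by (subst sum_ennreal[symmetric]) (auto simp: ennreal_mult' min.coboundedI2 intro!: sum.cong mult_nonneg_nonneg)
finally show ?thesis .
qed

context brownian_basis
begin

text \<open>In coordinates, \<open>xi\<close> is independent of the increment and distinct
  coordinates of the increment are uncorrelated, so only the diagonal terms survive.\<close>

lemma increment_sq:
assumes st: "0 <= s" "s <= t" and xi: "xi \<in> Fmeas s" "bounded (xi ` space P)"
shows "integrable P (%w. (xi w \<bullet> (W t w - W s w))^2)" (is ?Q1)
 and "expectation (%w. (xi w \<bullet> (W t w - W s w))^2) = expectation (%w. (norm (xi w))^2) * (t - s)" (is ?Q2)
proof -
let ?D = "%j w. (W t w - W s w) $ j"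
obtain B where B: "!!w. w \<in> space P ==> norm (xi w) <= B"
 using xi(2) by (auto simp: bounded_iff)
have xiP: "xi \<in> borel_measurable P" by (rule measurable_F_P[OF xi(1)])
have b: "abs (xi w $ j) <= B" if "w \<in> space P" for w j
 using B[OF that] component_le_norm_cart[of "xi w" j] by linarith
have B0: "0 <= B" using b[of "SOME x. x \<in> space P"] not_empty
 by (metis (no_types) abs_ge_zero all_not_in_conv b order_trans)
have int: "integrable P (%w. xi w $ j * xi w $ l)" for j l
proof (rule integrable_const_bound[where B="B * B"])
 show "AE x in P. norm (xi x $ j * xi x $ l) <= B * B"
  using b B0 by (intro AE_I2) (auto simp: abs_mult intro!: mult_mono)
 show "(%w. xi w $ j * xi w $ l) \<in> borel_measurable P"
  using xiP by measurable
qed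
have eq: "(xi w \<bullet> (W t w - W s w))^2 = (\<Sum>j\<in>UNIV. \<Sum>l\<in>UNIV. (xi w $ j * xi w $ l) * (?D j w * ?D l w))" for w
 unfolding power2_eq_square inner_vec_def sum_product
 by (intro sum.cong) (auto simp: mult_ac)
have "(%w. xi w $ j * xi w $ l) \<in> Fmeas s" for j l
 using xi(1) by measurable
note * = expectation_increment[OF st(1) _ this int, of t "%x. x $ _ * x $ _"]
have **: "integrable P (%w. (xi w $ j * xi w $ l) * (?D j w * ?D l w)) &
  expectation (%w. (xi w $ j * xi w $ l) * (?D j w * ?D l w)) =
   (if j = l then expectation (%w. xi w $ j * xi w $ l) * (t - s) else 0)" for j l
\<comment> \<open>The Gaussian moments are available for \<open>s < t\<close> only; for a degenerate
  step the increment vanishes.\<close>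
proof (cases "s = t")
 case False
 hence "s < t" using st by simp
 thus ?thesis
  using *[of j l j l] expectation_increment_prod[OF st(1), of t j l] by simp
qed simp
show ?Q1
 unfolding eq using ** by (intro Bochner_Integration.integrable_sum) auto
have "expectation (%w. (xi w \<bullet> (W t w - W s w))^2) = (\<Sum>j\<in>UNIV. expectation (%w. xi w $ j * xi w $ j) * (t - s))"
 unfolding eq using ** by (simp add: Bochner_Integration.integral_sum Bochner_Integration.integrable_sum sum.delta)
also have "... = expectation (%w. (norm (xi w))^2) * (t - s)"
 using int by (simp add: power2_norm_eq_inner inner_vec_def Bochner_Integration.integral_sum sum_distrib_right)
finally show ?Q2 .
qed

lemma increment_orthogonal:
assumes st: "0 <= s" "s <= t" and xi: "xi \<in> Fmeas s" "bounded (xi ` space P)"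
 and Y: "Y \<in> Fmeas s" "integrable P Y"
shows "integrable P (%w. Y w * (xi w \<bullet> (W t w - W s w)))" (is ?Q1)
 and "expectation (%w. Y w * (xi w \<bullet> (W t w - W s w))) = 0" (is ?Q2)
proof -
let ?D = "%j w. (W t w - W s w) $ j"
obtain B where B: "!!w. w \<in> space P ==> norm (xi w) <= B"
 using xi(2) by (auto simp: bounded_iff)
have xiP: "xi \<in> borel_measurable P" by (rule measurable_F_P[OF xi(1)])
have YP: "Y \<in> borel_measurable P" by (rule measurable_F_P[OF Y(1)])
have b: "abs (xi w $ j) <= B" if "w \<in> space P" for w j
 using B[OF that] component_le_norm_cart[of "xi w" j] by linarith
have int: "integrable P (%w. Y w * xi w $ j)" for j
proof (rule Bochner_Integration.integrable_bound[of P "%w. B * Y w"])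
 show "integrable P (%w. B * Y w)" using Y(2) by simp
 show "(%w. Y w * xi w $ j) \<in> borel_measurable P"
  using xiP YP by measurable
 show "AE x in P. norm (Y x * xi x $ j) <= norm (B * Y x)"
 proof (rule AE_I2)
  fix x assume "x \<in> space P"
  from b[OF this, of j] show "norm (Y x * xi x $ j) <= norm (B * Y x)"
   by (simp add: abs_mult mult.commute[of "abs (Y x)"])
    (intro mult_right_mono; linarith)
 qed
qed
have "(%w. Y w * xi w $ j) \<in> Fmeas s" for j
 using xi(1) Y(1) by measurable
note * = expectation_increment[OF st(1) _ this int, of t "%x. x $ _"]
have **: "integrable P (%w. (Y w * xi w $ j) * ?D j w) &
  expectation (%w. (Y w * xi w $ j) * ?D j w) = 0" for j
proof (cases "s = t")
 case False
 hence "s < t" using st by simp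
 thus ?thesis
  using *[of j j] increment_moments(1)[OF st(1), of t j] increment_power(1)[OF st(1), of t j 1] by simp
qed simp
have eq: "Y w * (xi w \<bullet> (W t w - W s w)) = (\<Sum>j\<in>UNIV. (Y w * xi w $ j) * ?D j w)" for w
 by (simp add: inner_vec_def sum_distrib_left mult_ac)
show ?Q1
 unfolding eq using ** by (intro Bochner_Integration.integrable_sum) auto
show ?Q2
 unfolding eq using ** by (simp add: Bochner_Integration.integral_sum)
qed

text \<open>The second alternative for \<open>q\<close> says that the whole grid ends before
  \<open>q\<close>: the sum is then known at \<open>q\<close> even if it is evaluated at a later
  time. The induction for the isometry needs exactly this, with \<open>q\<close> the start of the
  last interval.\<close>

lemma simple_ito_term_measurable:
assumes S: "simple_integrand F n r xi" and t: "0 <= t" and q: "t <= q | r n <= q" and k: "k < n"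
shows "(%w. xi k w \<bullet> (W (min t (r (Suc k))) w - W (min t (r k)) w)) \<in> Fmeas q"
proof -
note r = simple_integrand_mono[OF S] simple_integrand_nonneg[OF S]
have k': "r k <= r (Suc k)" "r (Suc k) <= r n" "0 <= r k" using r(1)[of k "Suc k"] r(1)[of "Suc k" n] r(2)[of k] k by auto
show ?thesis
proof (cases "r k < t")
 case True
 hence "r k <= q" "min t (r k) <= q" "min t (r (Suc k)) <= q" using q k' by auto
 have "xi k \<in> Fmeas (r k)" using S k by (simp add: simple_integrand_def)
 hence "xi k \<in> Fmeas q"
  by (rule measurable_F_mono) (rule ennreal_leI[OF \<open>r k <= q\<close>])
 moreover have "W (min t (r (Suc k))) \<in> Fmeas q"
  "W (min t (r k)) \<in> Fmeas q"
  using k' t \<open>min t (r k) <= q\<close> \<open>min t (r (Suc k)) <= q\<close>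
  by (intro W_measurable_F ennreal_leI; simp)+
 ultimately show ?thesis by (intro borel_measurable_inner borel_measurable_diff)
next
 case False
 thus ?thesis using k' by (simp add: min_def)
qed
qed

lemma simple_ito_measurable:
assumes S: "simple_integrand F n r xi" and t: "0 <= t" and q: "t <= q | r n <= q"
shows "simple_ito W n r xi t \<in> Fmeas q"
unfolding simple_ito_def using simple_ito_term_measurable[OF assms] by (intro borel_measurable_sum) auto

text \<open>Induction on the grid: the last increment has mean zero and is orthogonal to everything
  known at its start. The integrability statements are carried along because the next step consumes
  them.\<close>

lemma simple_ito_isometry:
assumes S: "simple_integrand F n r xi" and t: "0 <= t"
shows "integrable P (%w. (simple_ito W n r xi t w)^2) & expectation (simple_ito W n r xi t) = 0 &
 integrable P (%w. \<Sum>k<n. (norm (xi k w))^2 * (min t (r (Suc k)) - min t (r k))) &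
 expectation (%w. (simple_ito W n r xi t w)^2) =
 expectation (%w. \<Sum>k<n. (norm (xi k w))^2 * (min t (r (Suc k)) - min t (r k)))"
using S
proof (induction n)
case 0
thus ?case by (simp add: simple_ito_def)
next
case (Suc n)
note S' = simple_integrand_SucD[OF Suc.prems]
note IH = Suc.IH[OF S']
note r = simple_integrand_mono[OF Suc.prems] simple_integrand_nonneg[OF Suc.prems]
show ?case
proof (cases "r n < t")
 case False
 hence "min t (r (Suc n)) = t" "min t (r n) = t"
  using r(1)[of n "Suc n"] by auto
 thus ?thesis using IH by (simp add: simple_ito_def)
next
 case True
 let ?J = "simple_ito W n r xi t"
 let ?X = "%w. xi n w \<bullet> (W (min t (r (Suc n))) w - W (r n) w)"
 have eq: "simple_ito W (Suc n) r xi t w = ?J w + ?X w" for w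
  using True by (simp add: simple_ito_def min_def)
 have st: "0 <= r n" "r n <= min t (r (Suc n))" using r(1)[of n "Suc n"] r(2)[of n] True by auto
 have xi: "xi n \<in> Fmeas (r n)" "bounded (xi n ` space P)"
  using Suc.prems by (auto simp: simple_integrand_def)
 have J: "?J \<in> Fmeas (r n)"
  using S' t by (intro simple_ito_measurable) auto
 have Ji: "integrable P ?J"
  by (rule square_integrable_imp_integrable[OF measurable_F_P[OF J]]) (use IH in blast)
 note orth = increment_orthogonal[OF st xi J Ji] and sq = increment_sq[OF st xi]
  and mean = increment_orthogonal[OF st xi borel_measurable_const[of 1]]
 obtain B where B: "!!w. w \<in> space P ==> norm (xi n w) <= B"
  using xi(2) by (auto simp: bounded_iff)
 have xii: "integrable P (%w. (norm (xi n w))^2)"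
  using measurable_F_P[OF xi(1)]
  by (intro integrable_const_bound[where B="B^2"] AE_I2) (auto intro: B power_mono)
 define G where "G w = (\<Sum>k<n. (norm (xi k w))^2 * (min t (r (Suc k)) - min t (r k)))" for w
 have G: "(\<Sum>k<Suc n. (norm (xi k w))^2 * (min t (r (Suc k)) - min t (r k))) =
  G w + (norm (xi n w))^2 * (min t (r (Suc n)) - r n)" for w
  using True by (simp add: G_def min_def)
 have sq_eq: "(?J w + ?X w)^2 = (?J w)^2 + (?X w)^2 + 2 * (?J w * ?X w)" for w
  by (simp add: power2_sum)
 have IH': "integrable P (%w. (?J w)^2)" "expectation ?J = 0" "integrable P G"
  "expectation (%w. (?J w)^2) = expectation G"
  using IH unfolding G_def by blast+
 have mean': "integrable P ?X" "expectation ?X = 0"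
  using mean by simp_all
 show ?thesis
  unfolding eq sq_eq G
  using IH' Ji xii orth sq mean' by simp
qed
qed

lemma elementary_isometry:
assumes "elementary F W S J" and t: "0 <= t"
shows "(EE w. ennreal ((J t w)^2)) = time_L2 P t S" (is ?Q1)
 and "time_L2 P t S < \<infinity>" (is ?Q2)
 and "integrable P (%w. (J t w)^2)" (is ?Q3) "expectation (J t) = 0"
 and "J t \<in> Fmeas t"
proof -
obtain n r xi where S: "simple_integrand F n r xi" and eq: "S = simple_process n r xi" "J = simple_ito W n r xi"
 using assms(1) by (auto simp: elementary_def)
note * = simple_ito_isometry[OF S t]
have nonneg: "0 <= (\<Sum>k<n. (norm (xi k w))^2 * (min t (r (Suc k)) - min t (r k)))" for w
 using S by (intro sum_nonneg mult_nonneg_nonneg) (auto simp: simple_integrand_def min_def intro: order_trans)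
have "(EE w. ennreal ((J t w)^2)) = ennreal (expectation (%w. (simple_ito W n r xi t w)^2))"
 unfolding eq using * by (intro nn_integral_eq_integral) auto
also have "... = (EE w. ennreal (\<Sum>k<n. (norm (xi k w))^2 * (min t (r (Suc k)) - min t (r k))))"
 using * nonneg by (subst nn_integral_eq_integral) auto
also have "... = time_L2 P t S"
 unfolding time_L2_def eq nn_integral_simple_process[OF S t] ..
finally show e: ?Q1 .
have "(EE w. ennreal ((J t w)^2)) < \<infinity>"
 unfolding eq using * by (simp add: nn_integral_eq_integral)
thus ?Q2 by (simp add: e)
show ?Q3 "expectation (J t) = 0" unfolding eq using * by auto
show "J t \<in> Fmeas t"
 unfolding eq using S t by (intro simple_ito_measurable) auto
qed

text \<open>Moving all grid points before \<open>q\<close> to \<open>q\<close> erases the integrand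
  up to \<open>q\<close>, and after \<open>q\<close> the factor \<open>eta\<close> is already known.
  With \<open>eta\<close> an indicator this is the building block for stopping.\<close>

lemma elementary_shift:
assumes "elementary F W S J" and q: "0 <= q"
 and eta: "eta \<in> Fmeas q" "bounded (eta ` space P)"
shows "elementary F W (%s w. (eta w * indicator {q<..} s) *\<^sub>R S s w)
 (%t w. eta w * (J t w - J (min t q) w))"
proof -
obtain n r xi where S: "simple_integrand F n r xi" and eq: "S = simple_process n r xi" "J = simple_ito W n r xi"
 using assms(1) by (auto simp: elementary_def)
let ?r = "%k. max q (r k)" and ?xi = "%k w. eta w *\<^sub>R xi k w"
obtain B where B: "!!w. w \<in> space P ==> abs (eta w) <= B"
 using eta(2) by (auto simp: bounded_iff)
have "simple_integrand F n ?r ?xi"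
 unfolding simple_integrand_def
proof (intro conjI allI impI)
 fix k assume k: "k < n"
 show "?r k <= ?r (Suc k)" using S k by (auto simp: simple_integrand_def)
 have "eta \<in> Fmeas (?r k)" "xi k \<in> Fmeas (?r k)"
  using eta(1) S k by (auto simp: simple_integrand_def elim!: measurable_F_mono intro!: ennreal_leI)
 thus "?xi k \<in> Fmeas (?r k)" by measurable
 have "bounded (xi k ` space P)"
  using S k by (simp add: simple_integrand_def)
 then obtain B' where "!!w. w \<in> space P ==> norm (xi k w) <= B'"
  by (auto simp: bounded_iff)
 hence "norm (?xi k w) <= abs B * B'" if "w \<in> space P" for w
  using B[OF that] that by (auto intro!: mult_mono)
 thus "bounded (?xi k ` space (F (ennreal (?r k))))"
  by (auto simp: bounded_iff)
qed (use q in auto)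
moreover have "(%s w. (eta w * indicator {q<..} s) *\<^sub>R S s w) = simple_process n ?r ?xi"
 unfolding eq simple_process_def scaleR_sum_right using S
 by (intro ext sum.cong) (auto simp: indicator_def simple_integrand_def)
moreover have "(%t w. eta w * (J t w - J (min t q) w)) = simple_ito W n ?r ?xi"
proof (intro ext)
 fix t w
 \<comment> \<open>The path identity behind the moved grid: the process frozen before
   \<open>q\<close> gains exactly the increments made after \<open>q\<close>.\<close>
 have w: "W (min t (max q x)) w = W (min t q) w + (W (min t x) w - W (min (min t q) x) w)" for x
  by (cases "x <= q") (auto simp: min_def max_def)
 show "eta w * (J t w - J (min t q) w) = simple_ito W n ?r ?xi t w"
  unfolding eq simple_ito_def w sum_subtractf[symmetric] sum_distrib_left
  by (intro sum.cong) (auto simp: inner_diff_right inner_add_right algebra_simps)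
qed
ultimately show ?thesis unfolding elementary_def by blast
qed

end

text \<open>Overlapping intervals are put on a common grid; sums over the grid telescope.\<close>

lemma telescope_on_grid:
fixes r :: "nat => real" and w :: "real => 'v::ab_group_add"
assumes r: "!!k l. k < l ==> l <= m ==> r k < r l"
 and pq: "p <= q" "q <= m"
shows "(\<Sum>k\<in>{k. k < m & r p <= r k & r k < r q}. w (r (Suc k)) - w (r k)) = w (r q) - w (r p)"
proof -
have r': "r k < r l \<longleftrightarrow> k < l" if "k <= m" "l <= m" for k l
 using r[of k l] r[of l k] that by (metis less_irrefl less_trans nat_neq_iff)
hence "r k <= r l \<longleftrightarrow> k <= l" if "k <= m" "l <= m" for k l
 using that by (simp add: linorder_not_less[symmetric])
with r' have "{k. k < m & r p <= r k & r k < r q} = {p..<q}"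
 using pq by auto
thus ?thesis
 using sum_Suc_diff'[OF pq(1), of "%k. w (r k)"] by simp
qed

context brownian_basis
begin

lemma elementary_sum:
fixes a b :: "'i => real" and xi :: "'i => 'w => real^'p"
assumes L: "finite L" and ab: "!!l. l \<in> L ==> 0 <= a l & a l <= b l"
 and xi: "!!l. l \<in> L ==> xi l \<in> Fmeas (a l)"
  "!!l. l \<in> L ==> bounded (xi l ` space P)"
shows "elementary F W (%s w. \<Sum>l\<in>L. indicator {a l<..b l} s *\<^sub>R xi l w)
 (%t w. \<Sum>l\<in>L. xi l w \<bullet> (W (min t (b l)) w - W (min t (a l)) w))"
proof -
\<comment> \<open>The common grid: all end points in increasing order, with \<open>0\<close> added
  so that the grid is nonempty.\<close>
define D where "D = insert 0 (a ` L \<union> b ` L)"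
define r where "r k = sorted_list_of_set D ! k" for k
define m where "m = card D - 1"
have D: "finite D" "D ~= {}" using L by (auto simp: D_def)
hence m: "card D = Suc m" by (simp add: m_def card_gt_0_iff)
have len: "length (sorted_list_of_set D) = Suc m" using m D by simp
have r: "r k < r l" if "k < l" "l <= m" for k l
 unfolding r_def using that len D strict_sorted_list_of_set[of D]
 by (intro sorted_wrt_nth_less[of "(<)"]) auto
have rD: "EX k<=m. x = r k" if "x \<in> D" for x
 using that len D by (metis in_set_conv_nth less_Suc_eq_le r_def set_sorted_list_of_set)
have Dr: "r k \<in> D" if "k <= m" for k
 using that len D by (metis less_Suc_eq_le nth_mem r_def set_sorted_list_of_set)
have r': "r k < r l \<longleftrightarrow> k < l" if "k <= m" "l <= m" for k l
 using r[of k l] r[of l k] that by (metis less_irrefl less_trans nat_neq_iff)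
define \<Xi> where "\<Xi> k w = (\<Sum>l\<in>{l\<in>L. a l <= r k & r k < b l}. xi l w)" for k w
have tele: "(\<Sum>k\<in>{k. k < m & a l <= r k & r k < b l}. w (r (Suc k)) - w (r k)) = w (b l) - w (a l)"
 if "l \<in> L" for l and w :: "real => 'v::ab_group_add"
proof -
 have "a l \<in> D" "b l \<in> D" using that by (auto simp: D_def)
 then obtain p q where pq: "p <= m" "a l = r p" "q <= m" "b l = r q" using rD by metis
 moreover have "p <= q" using ab[OF that] r[of q p] pq by force
 ultimately show ?thesis using telescope_on_grid[of m r p q w] r by auto
qed
have swap: "(\<Sum>k<m. \<Sum>l\<in>{l\<in>L. a l <= r k & r k < b l}. h k l) =
  (\<Sum>l\<in>L. \<Sum>k\<in>{k. k < m & a l <= r k & r k < b l}. h k l)" for h :: "nat => 'i => 'v::ab_group_add"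
 using sum.swap_restrict[of "{..<m}" L h "%k l. a l <= r k & r k < b l"] L
 by (simp add: lessThan_def)
have "simple_integrand F m r \<Xi>"
 unfolding simple_integrand_def
proof (intro conjI allI impI)
 have "r 0 \<in> D" using Dr by simp
 moreover have "0 <= x" if "x \<in> D" for x
  using that ab by (auto simp: D_def) (meson order_trans ab)
 ultimately show "0 <= r 0" by blast
 fix k assume k: "k < m"
 show "r k <= r (Suc k)" using r[of k "Suc k"] k by simp
 show "\<Xi> k \<in> Fmeas (r k)"
  unfolding \<Xi>_def by (intro borel_measurable_sum) (auto intro!: measurable_F_mono[OF xi(1)] ennreal_leI)
 have "EX B. ALL w:space P. norm (xi l w) <= B" if "l \<in> L" for l
  using xi(2)[OF that] by (auto simp: bounded_iff)
 then obtain B where B: "!!l w. l \<in> L ==> w \<in> space P ==> norm (xi l w) <= B l" by metis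
 have "norm (\<Xi> k w) <= (\<Sum>l\<in>{l\<in>L. a l <= r k & r k < b l}. B l)" if "w \<in> space P" for w
  unfolding \<Xi>_def using that B by (intro order_trans[OF norm_sum] sum_mono) auto
 thus "bounded (\<Xi> k ` space (F (ennreal (r k))))" by (auto simp: bounded_iff)
qed
moreover have "(%s w. \<Sum>l\<in>L. indicator {a l<..b l} s *\<^sub>R xi l w) = simple_process m r \<Xi>"
proof (intro ext)
 fix s :: real and w
 \<comment> \<open>As a difference of two step functions, the indicator telescopes over the cells of
   the grid like any other increment.\<close>
 have ind: "indicator {x<..y} s = (if s <= y then 1 else 0) - (if s <= x then 1 else (0::real))" if "x <= y" for x y
  using that by (auto simp: indicator_def)
 have "simple_process m r \<Xi> s w =
   (\<Sum>k<m. \<Sum>l\<in>{l\<in>L. a l <= r k & r k < b l}. indicator {r k<..r (Suc k)} s *\<^sub>R xi l w)"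
  by (simp add: simple_process_def \<Xi>_def scaleR_sum_right)
 also have "... = (\<Sum>l\<in>L. (\<Sum>k\<in>{k. k < m & a l <= r k & r k < b l}. indicator {r k<..r (Suc k)} s) *\<^sub>R xi l w)"
  unfolding swap scaleR_sum_left ..
 also have "... = (\<Sum>l\<in>L. indicator {a l<..b l} s *\<^sub>R xi l w)"
 proof (intro sum.cong arg_cong2[of _ _ _ _ scaleR] refl)
  fix l assume l: "l \<in> L"
  have "(\<Sum>k\<in>{k. k < m & a l <= r k & r k < b l}. indicator {r k<..r (Suc k)} s :: real) =
   (\<Sum>k\<in>{k. k < m & a l <= r k & r k < b l}. (if s <= r (Suc k) then 1 else 0) - (if s <= r k then 1 else 0))"
   using r[of _ "Suc _"] by (intro sum.cong ind refl) (auto simp: less_imp_le)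
  thus "(\<Sum>k\<in>{k. k < m & a l <= r k & r k < b l}. indicator {r k<..r (Suc k)} s :: real) = indicator {a l<..b l} s"
   using tele[OF l, of "%x. if s <= x then 1 else (0::real)"] ind[of "a l" "b l"] ab[OF l] by simp
 qed
 finally show "(\<Sum>l\<in>L. indicator {a l<..b l} s *\<^sub>R xi l w) = simple_process m r \<Xi> s w" ..
qed
moreover have "(%t w. \<Sum>l\<in>L. xi l w \<bullet> (W (min t (b l)) w - W (min t (a l)) w)) = simple_ito W m r \<Xi>"
proof (intro ext)
 fix t w
 have "simple_ito W m r \<Xi> t w = (\<Sum>k<m. \<Sum>l\<in>{l\<in>L. a l <= r k & r k < b l}.
   xi l w \<bullet> (W (min t (r (Suc k))) w - W (min t (r k)) w))"
  by (simp add: simple_ito_def \<Xi>_def inner_sum_left)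
 also have "... = (\<Sum>l\<in>L. xi l w \<bullet> (\<Sum>k\<in>{k. k < m & a l <= r k & r k < b l}. W (min t (r (Suc k))) w - W (min t (r k)) w))"
  unfolding swap inner_sum_right ..
 also have "... = (\<Sum>l\<in>L. xi l w \<bullet> (W (min t (b l)) w - W (min t (a l)) w))"
  using tele[of _ "%x. W (min t x) w"] by (intro sum.cong) auto
 finally show "(\<Sum>l\<in>L. xi l w \<bullet> (W (min t (b l)) w - W (min t (a l)) w)) = simple_ito W m r \<Xi> t w" ..
qed
ultimately show ?thesis unfolding elementary_def by blast
qed

lemma elementary_add:
assumes "elementary F W S J" "elementary F W S' J'"
shows "elementary F W (%s w. S s w + S' s w) (%t w. J t w + J' t w)"
proof -
obtain n r xi where S: "simple_integrand F n r xi" and eq: "S = simple_process n r xi" "J = simple_ito W n r xi"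
 using assms(1) by (auto simp: elementary_def)
obtain n' r' xi' where S': "simple_integrand F n' r' xi'" and eq': "S' = simple_process n' r' xi'" "J' = simple_ito W n' r' xi'"
 using assms(2) by (auto simp: elementary_def)
have "elementary F W (%s w. \<Sum>l\<in>{..<n} <+> {..<n'}. indicator {case_sum r r' l<..case_sum (%k. r (Suc k)) (%k. r' (Suc k)) l} s *\<^sub>R case_sum xi xi' l w)
 (%t w. \<Sum>l\<in>{..<n} <+> {..<n'}. case_sum xi xi' l w \<bullet> (W (min t (case_sum (%k. r (Suc k)) (%k. r' (Suc k)) l)) w - W (min t (case_sum r r' l)) w))"
 using S S' simple_integrand_nonneg[OF S] simple_integrand_nonneg[OF S']
 by (intro elementary_sum) (auto simp: simple_integrand_def)
thus ?thesis
 by (simp add: sum.Plus eq eq' simple_process_def simple_ito_def del: sum_indicator_scaleR)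
qed

lemma elementary_cmult:
assumes "elementary F W S J"
shows "elementary F W (%s w. c *\<^sub>R S s w) (%t w. c * J t w)"
proof -
obtain n r xi where S: "simple_integrand F n r xi" and eq: "S = simple_process n r xi" "J = simple_ito W n r xi"
 using assms(1) by (auto simp: elementary_def)
have "bounded ((%x. c *\<^sub>R xi k x) ` space P)" if "k < n" for k
 using S that bounded_scaling[of "xi k ` space P" c] by (simp add: simple_integrand_def image_comp o_def)
hence "simple_integrand F n r (%k w. c *\<^sub>R xi k w)"
 using S by (auto simp: simple_integrand_def)
thus ?thesis
 unfolding elementary_def eq
 by (intro exI[of _ n] exI[of _ r] exI[of _ "%k w. c *\<^sub>R xi k w"])
  (auto simp: simple_process_def simple_ito_def scaleR_sum_right sum_distrib_left fun_eq_iff mult_ac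
   simp del: sum_indicator_scaleR)
qed

lemma elementary_diff:
assumes "elementary F W S J" "elementary F W S' J'"
shows "elementary F W (%s w. S s w - S' s w) (%t w. J t w - J' t w)"
using elementary_add[OF assms(1) elementary_cmult[OF assms(2), of "- 1"]] by simp

lemma elementary_measurable:
assumes "elementary F W S J"
shows "(%(s, w). S s w) \<in> borel_measurable (borel \<Otimes>\<^sub>M P)"
proof -
obtain n r xi where S: "simple_integrand F n r xi" and eq: "S = simple_process n r xi" "J = simple_ito W n r xi"
 using assms(1) by (auto simp: elementary_def)
have [measurable]: "xi k \<in> borel_measurable P" if "k < n" for k
 using S that by (auto simp: simple_integrand_def intro: measurable_F_P)
show ?thesis
 unfolding eq simple_process_def case_prod_beta by (intro borel_measurable_sum) measurable
qed

end

section \<open>The square integrable integral\<close>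

text \<open>Young's inequality with a free parameter. A small \<open>de\<close> keeps the factor of
  the main term close to 1, which exact identities in the limit require; \<open>de = 1\<close> gives
  the crude bound with factor 2.\<close>

lemma norm_add_power2_le:
fixes x y :: "'a::real_normed_vector"
assumes "0 < de"
shows "(norm (x + y))^2 <= (1 + de) * (norm x)^2 + (1 + 1 / de) * (norm y)^2"
proof -
have "(norm (x + y))^2 <= (norm x + norm y)^2"
 by (intro power_mono norm_triangle_ineq) auto
also have "... <= (1 + de) * (norm x)^2 + (1 + 1 / de) * (norm y)^2"
proof -
 have "0 <= (de * norm x - norm y)^2 / de" using assms by simp
 thus ?thesis using assms by (simp add: power2_eq_square field_simps)
qed
finally show ?thesis .
qed

lemma nn_integral_add_power2_le:
fixes f g :: "'a => 'b::{second_countable_topology, real_normed_vector}"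
assumes [measurable]: "f \<in> borel_measurable M" "g \<in> borel_measurable M" and de: "0 < de"
shows "(\<integral>\<^sup>+x. nsq (f x + g x) \<partial>M) <=
 ennreal (1 + de) * (\<integral>\<^sup>+x. nsq (f x) \<partial>M) + ennreal (1 + 1 / de) * (\<integral>\<^sup>+x. nsq (g x) \<partial>M)"
proof -
have "(\<integral>\<^sup>+x. nsq (f x + g x) \<partial>M) <=
 (\<integral>\<^sup>+x. ennreal (1 + de) * nsq (f x) + ennreal (1 + 1 / de) * nsq (g x) \<partial>M)"
 using de norm_add_power2_le[OF de, of "f _" "g _"]
 by (intro nn_integral_mono) (simp add: ennreal_mult'[symmetric] ennreal_plus[symmetric] del: ennreal_plus)
also have "... = ennreal (1 + de) * (\<integral>\<^sup>+x. nsq (f x) \<partial>M) + ennreal (1 + 1 / de) * (\<integral>\<^sup>+x. nsq (g x) \<partial>M)"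
 by (subst nn_integral_add) (auto simp: nn_integral_cmult)
finally show ?thesis .
qed

text \<open>The shape of the hypothesis is that of two consecutive uses of the parametrised square
  inequality. With \<open>ep = de^2\<close> the error factor becomes \<open>de^2 + de\<close>, and
  \<open>de\<close> tends to 0.\<close>

lemma ennreal_le_by_approx:
fixes a b :: ennreal
assumes "!!de ep. 0 < de ==> 0 < ep ==>
 a <= ennreal (1 + de) * (ennreal (1 + de) * b + ennreal (1 + 1 / de) * ennreal ep) + ennreal (1 + 1 / de) * ennreal ep"
shows "a <= b"
proof (cases b)
case (real r)
have le: "a <= ennreal ((1 + de) * ((1 + de) * r + (de^2 + de)) + (de^2 + de))" if de: "0 < de" for de
proof -
 have "(1 + 1 / de) * de^2 = de^2 + de" using de by (simp add: field_simps power2_eq_square)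
 hence "ennreal (1 + 1 / de) * ennreal (de^2) = ennreal (de^2 + de)"
  using de by (simp add: ennreal_mult'[symmetric] del: ennreal_plus)
 thus ?thesis
  using assms[of de "de^2"] de real
  by (simp add: ennreal_mult'[symmetric] ennreal_plus[symmetric] del: ennreal_plus)
qed
have "((%de. ennreal ((1 + de) * ((1 + de) * r + (de^2 + de)) + (de^2 + de))) ---> ennreal r) (at_right 0)"
 by (intro tendsto_ennrealI) (auto intro!: tendsto_eq_intros)
hence "a <= ennreal r"
 by (rule tendsto_lowerbound) (auto simp: eventually_at_filter le)
thus ?thesis using real by simp
qed simp

text \<open>Values at negative times are irrelevant, hence the indicator.\<close>

definition joint :: "'w measure => (real => 'w => 'b::real_normed_vector) => bool" where
"joint P H \<longleftrightarrow> (%(s, w). indicator {0..} s *\<^sub>R H s w) \<in> borel_measurable (borel \<Otimes>\<^sub>M P)"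

section \<open>Joint measurability and the mean square norm over time\<close>

lemma joint_section:
assumes "joint P H" "w \<in> space P"
shows "(%s. indicator {0..} s *\<^sub>R H s w) \<in> borel_measurable borel"
using measurable_compose[OF measurable_Pair2'[OF assms(2), of borel] assms(1)[unfolded joint_def]] by simp

lemma time_integrand_eq:
"h (norm (H s w)) * indicator {0..T} s = h (norm (indicator {0..} s *\<^sub>R H s w)) * indicator {0..T} (s::real)"
for h :: "real => ennreal"
by (simp add: indicator_def)

lemma joint_section_nn:
fixes H :: "real => 'w => 'b::{second_countable_topology, real_normed_vector}"
assumes "joint P H" "w \<in> space P"
shows "(%s. nsq (H s w) * indicator {0..T} s) \<in> borel_measurable borel"
using joint_section[OF assms] unfolding time_integrand_eq[of "%x. ennreal (x^2)"] by measurable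

lemma joint_inner_measurable:
fixes H :: "real => 'w => 'b::{second_countable_topology, real_normed_vector}"
assumes "joint P H"
shows "(%w. (NN s:{0..T}. nsq (H s w))) \<in> borel_measurable P"
proof -
have "(%(w, s). indicator {0..} s *\<^sub>R H s w) \<in> borel_measurable (P \<Otimes>\<^sub>M lborel)"
 using measurable_pair_swap[OF assms[unfolded joint_def]]
 by (simp add: case_prod_beta' cong: measurable_cong_sets sets_pair_measure_cong)
hence "(%(w, s). nsq (indicator {0..} s *\<^sub>R H s w) * indicator {0..T} s) \<in> borel_measurable (P \<Otimes>\<^sub>M lborel)"
 unfolding case_prod_beta by measurable
thus ?thesis
 unfolding time_integrand_eq[of "%x. ennreal (x^2)"] by (rule lborel.borel_measurable_nn_integral)
qed

lemma joint_add:
fixes H :: "real => 'w => 'b::{second_countable_topology, real_normed_vector}"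
assumes "joint P H" "joint P G"
shows "joint P (%s w. H s w + G s w)"
using borel_measurable_add[OF assms[unfolded joint_def]]
by (simp add: joint_def case_prod_beta' scaleR_add_right)

lemma joint_cmult:
fixes H :: "real => 'w => 'b::{second_countable_topology, real_normed_vector}"
assumes "joint P H"
shows "joint P (%s w. c *\<^sub>R H s w)"
using borel_measurable_scaleR[OF borel_measurable_const[of c] assms[unfolded joint_def]]
by (simp add: joint_def case_prod_beta' mult.commute)

lemma joint_diff:
fixes H :: "real => 'w => 'b::{second_countable_topology, real_normed_vector}"
assumes "joint P H" "joint P G"
shows "joint P (%s w. H s w - G s w)"
using joint_add[OF assms(1) joint_cmult[OF assms(2), of "- 1"]] by simp

lemma time_L2_mono:
"(!!s w. 0 <= s ==> s <= T ==> w \<in> space P ==> norm (H s w) <= norm (G s w)) ==> time_L2 P T H <= time_L2 P T G"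
unfolding time_L2_def
by (intro nn_integral_mono) (auto simp: indicator_def intro!: ennreal_leI power_mono)

lemma time_L2_cong:
"(!!s w. 0 <= s ==> s <= T ==> w \<in> space P ==> norm (H s w) = norm (G s w)) ==> time_L2 P T H = time_L2 P T G"
by (intro antisym time_L2_mono) auto

lemma time_L2_mono_time: "T <= T' ==> time_L2 P T H <= time_L2 P T' H"
unfolding time_L2_def by (intro nn_integral_mono mult_left_mono) (auto simp: indicator_def)

lemma time_L2_cmult:
fixes H :: "real => 'w => 'b::{second_countable_topology, real_normed_vector}"
assumes "joint P H"
shows "time_L2 P T (%s w. c *\<^sub>R H s w) = ennreal (c^2) * time_L2 P T H"
proof -
have "time_L2 P T (%s w. c *\<^sub>R H s w) =
  (\<integral>\<^sup>+w. (\<integral>\<^sup>+s. ennreal (c^2) * (nsq (H s w) * indicator {0..T} s) \<partial>lborel) \<partial>P)"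
 unfolding time_L2_def
 by (intro nn_integral_cong) (auto simp: power_mult_distrib ennreal_mult' mult_ac)
also have "... = (\<integral>\<^sup>+w. ennreal (c^2) * (NN s:{0..T}. nsq (H s w)) \<partial>P)"
 by (intro nn_integral_cong nn_integral_cmult) (simp add: joint_section_nn[OF assms])
also have "... = ennreal (c^2) * time_L2 P T H"
 unfolding time_L2_def by (intro nn_integral_cmult joint_inner_measurable assms)
finally show ?thesis .
qed

lemma time_L2_add_le:
fixes H :: "real => 'w => 'b::{second_countable_topology, real_normed_vector}"
assumes H: "joint P H" and G: "joint P G" and de: "0 < de"
shows "time_L2 P T (%s w. H s w + G s w) <= ennreal (1 + de) * time_L2 P T H + ennreal (1 + 1 / de) * time_L2 P T G"
proof -
have "time_L2 P T (%s w. H s w + G s w) <=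
  (\<integral>\<^sup>+w. ennreal (1 + de) * (NN s:{0..T}. nsq (H s w)) +
    ennreal (1 + 1 / de) * (NN s:{0..T}. nsq (G s w)) \<partial>P)"
 unfolding time_L2_def
proof (rule nn_integral_mono)
 fix w assume w: "w \<in> space P"
 have *: "nsq (A s w) * indicator {0..T} s = nsq (indicator {0..T} s *\<^sub>R (indicator {0..} s *\<^sub>R A s w))"
  for s and A :: "real => 'w => 'b"
  by (simp add: indicator_def)
 have m: "(%s. indicator {0..T} s *\<^sub>R (indicator {0..} s *\<^sub>R A s w)) \<in> borel_measurable lborel"
  if "joint P A" for A :: "real => 'w => 'b"
  using joint_section[OF that w] by measurable
 show "(NN s:{0..T}. nsq (H s w + G s w)) <=
  ennreal (1 + de) * (NN s:{0..T}. nsq (H s w)) +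
  ennreal (1 + 1 / de) * (NN s:{0..T}. nsq (G s w))"
  using nn_integral_add_power2_le[OF m[OF H] m[OF G] de]
  unfolding *[of H] *[of G] *[of "%s w. H s w + G s w"] scaleR_add_right .
qed
also have "... = ennreal (1 + de) * time_L2 P T H + ennreal (1 + 1 / de) * time_L2 P T G"
 unfolding time_L2_def using joint_inner_measurable[OF H] joint_inner_measurable[OF G]
 by (subst nn_integral_add) (auto simp: nn_integral_cmult)
finally show ?thesis .
qed

lemma time_L2_add_le2:
fixes H :: "real => 'w => 'b::{second_countable_topology, real_normed_vector}"
assumes "joint P H" "joint P G"
shows "time_L2 P T (%s w. H s w + G s w) <= 2 * time_L2 P T H + 2 * time_L2 P T G"
using time_L2_add_le[OF assms, of 1 T] by simp

lemma time_L2_diff_le2: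
fixes H :: "real => 'w => 'b::{second_countable_topology, real_normed_vector}"
assumes "joint P H" "joint P G"
shows "time_L2 P T (%s w. H s w - G s w) <= 2 * time_L2 P T H + 2 * time_L2 P T G"
using time_L2_add_le2[OF assms(1) joint_cmult[OF assms(2), of "- 1"], of T] time_L2_cmult[OF assms(2), of T "- 1"] by simp

lemma time_L2_minus_commute: "time_L2 P T (%s w. H s w - G s w) = time_L2 P T (%s w. G s w - H s w)"
unfolding time_L2_def by (simp add: norm_minus_commute)

text \<open>Dominated convergence twice: in time for almost every path, then over the paths, where
  the time integral of the dominating process is the bound.\<close>

lemma time_L2_dominated:
fixes G :: "nat => real => 'w => 'b::{second_countable_topology, real_normed_vector}"
 and D :: "real => 'w => 'c::{second_countable_topology, real_normed_vector}"
assumes G: "!!n. joint P (G n)" and D: "joint P D" "time_L2 P T D < \<infinity>"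
 and le: "!!n. AE w in P. ALL s:{0..T}. norm (G n s w) <= norm (D s w)"
 and lim: "AE w in P. AE s in lborel. s \<in> {0..T} --> (%n. G n s w) ----> 0"
shows "(%n. time_L2 P T (G n)) ----> 0"
proof -
let ?I = "%A w. (NN s:{0..T}. nsq (A s w))"
have fin: "AE w in P. ?I D w ~= \<infinity>"
 using D(2) unfolding time_L2_def by (intro nn_integral_PInf_AE joint_inner_measurable D(1)) auto
have le': "AE w in P. ALL n. ALL s:{0..T}. norm (G n s w) <= norm (D s w)"
 using le by (simp add: AE_all_countable)
have inner: "AE w in P. (%n. ?I (G n) w) ----> 0"
 using AE_space fin lim le'
proof eventually_elim
 case (elim w)
 have "(%n. ?I (G n) w) ----> (\<integral>\<^sup>+s. 0 \<partial>(lborel::real measure))"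
 proof (rule nn_integral_dominated_convergence[where w="%s. nsq (D s w) * indicator {0..T} s"])
  show "AE s in lborel. nsq (G n s w) * indicator {0..T} s <= nsq (D s w) * indicator {0..T} s" for n
   using elim(4) by (intro AE_I2) (auto simp: indicator_def intro!: ennreal_leI power_mono)
  show "AE s in lborel. (%n. nsq (G n s w) * indicator {0..T} s) ----> 0"
   using elim(3)
  proof eventually_elim
   case (elim s)
   show ?case
   proof (cases "s \<in> {0..T}")
    case True
    hence "(%n. nsq (G n s w)) ----> nsq (0::'b)"
     using elim by (intro tendsto_ennrealI tendsto_power tendsto_norm) auto
    thus ?thesis using True by simp
   qed simp
  qed
 qed (use elim in \<open>simp_all add: joint_section_nn[OF G] joint_section_nn[OF D(1)] top.not_eq_extremum\<close>)
 thus ?case by simp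
qed
have "(%n. \<integral>\<^sup>+w. ?I (G n) w \<partial>P) ----> (\<integral>\<^sup>+w. 0 \<partial>P)"
proof (rule nn_integral_dominated_convergence[where w="?I D"])
 show "AE w in P. ?I (G n) w <= ?I D w" for n
  using le[of n] by eventually_elim (auto intro!: nn_integral_mono simp: indicator_def intro!: ennreal_leI power_mono)
qed (use D(2) inner in \<open>auto simp: joint_inner_measurable[OF G] joint_inner_measurable[OF D(1)] time_L2_def\<close>)
thus ?thesis by (simp add: time_L2_def)
qed

text \<open>Closeness is required on each interval separately, with one elementary pair for the
  integrand and for all times at once. Stated in this way, integrals are combined without
  synchronising approximating sequences.\<close>

definition ito_L2 :: "'w measure => (ennreal => 'w measure) => (real => 'w => real^'p::finite)
 => (real => 'w => real^'p) => (real => 'w => real) => bool" where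
"ito_L2 P F W H I \<longleftrightarrow>
  progressive F H & adapted F I & (AE w in P. continuous_on {0..} (%t. I t w)) &
  (ALL T>=0. time_L2 P T H < \<infinity>) &
  (ALL T>=0. ALL ep>0. EX S J. elementary F W S J & time_L2 P T (%s w. S s w - H s w) <= ennreal ep &
   (ALL t:{0..T}. (\<integral>\<^sup>+w. ennreal ((J t w - I t w)^2) \<partial>P) <= ennreal ep))"

lemma ito_L2D:
assumes "ito_L2 P F W H I"
shows "progressive F H" "adapted F I" "AE w in P. continuous_on {0..} (%t. I t w)"
 "0 <= T ==> time_L2 P T H < \<infinity>"
using assms by (auto simp: ito_L2_def)

lemma ito_L2E:
assumes "ito_L2 P F W H I" "0 <= T" "0 < ep"
obtains S J where "elementary F W S J" "time_L2 P T (%s w. S s w - H s w) <= ennreal ep"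
 "!!t. 0 <= t ==> t <= T ==> (\<integral>\<^sup>+w. ennreal ((J t w - I t w)^2) \<partial>P) <= ennreal ep"
using assms unfolding ito_L2_def by force

lemma ito_L2E_at:
assumes "ito_L2 P F W H I" "0 <= t" "0 < ep"
obtains S J where "elementary F W S J" "time_L2 P t (%s w. S s w - H s w) <= ennreal ep"
 "(\<integral>\<^sup>+w. ennreal ((J t w - I t w)^2) \<partial>P) <= ennreal ep"
proof (rule ito_L2E[OF assms])
fix S J assume "elementary F W S J" "time_L2 P t (%s w. S s w - H s w) <= ennreal ep"
 "!!r. 0 <= r ==> r <= t ==> (\<integral>\<^sup>+w. ennreal ((J r w - I r w)^2) \<partial>P) <= ennreal ep"
thus thesis using assms(2) by (intro that) auto
qed

section \<open>Isometry and mean of the square integrable integral\<close>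

context brownian_basis
begin

text \<open>On each bounded time interval progressive measurability is stronger than joint
  measurability with respect to \<open>P\<close>; the intervals up to \<open>n\<close> exhaust the
  half line.\<close>

lemma progressive_joint:
fixes H :: "real => 'w => 'b::{second_countable_topology, real_normed_vector}"
assumes "progressive F H"
shows "joint P H"
proof -
have *: "(%(s, w). indicator {0..T} s *\<^sub>R H s w) \<in> borel_measurable (borel \<Otimes>\<^sub>M P)" if T: "0 <= T" for T
proof -
 let ?R = "restrict_space (borel \<Otimes>\<^sub>M P) ({0..T} \<times> space P)"
 have [simp]: "{0..T} \<times> space P \<in> sets (borel \<Otimes>\<^sub>M P)" by (intro pair_measureI) auto
 have "(%(s, w). H s w) \<in> borel_measurable (restrict_space borel {0..T} \<Otimes>\<^sub>M F (ennreal T))"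
  using assms T by (auto simp: progressive_def)
 moreover have "(%x. (fst x, snd x)) \<in> ?R \<rightarrow>\<^sub>M (restrict_space borel {0..T} \<Otimes>\<^sub>M F (ennreal T))"
 proof (rule measurable_Pair)
  show "fst \<in> ?R \<rightarrow>\<^sub>M restrict_space borel {0..T}"
   by (intro measurable_restrict_space2 measurable_restrict_space1 measurable_fst) (auto simp: space_restrict_space)
  have "snd \<in> ?R \<rightarrow>\<^sub>M P" by (intro measurable_restrict_space1 measurable_snd)
  thus "snd \<in> ?R \<rightarrow>\<^sub>M F (ennreal T)"
   using sets_F_le[of "ennreal T"] unfolding measurable_def by auto
 qed
 ultimately have "(%x. H (fst x) (snd x)) \<in> borel_measurable ?R"
  using measurable_compose by fastforce
 hence "(%x. indicator ({0..T} \<times> space P) x *\<^sub>R H (fst x) (snd x)) \<in> borel_measurable (borel \<Otimes>\<^sub>M P)"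
  by (subst (asm) borel_measurable_restrict_space_iff) auto
 thus ?thesis
  by (rule measurable_cong[THEN iffD1, rotated]) (auto simp: space_pair_measure indicator_def)
qed
show ?thesis
 unfolding joint_def
proof (rule borel_measurable_LIMSEQ_metric)
 show "(%(s, w). indicator {0..real n} s *\<^sub>R H s w) \<in> borel_measurable (borel \<Otimes>\<^sub>M P)" for n
  by (rule *) simp
 fix x :: "real \<times> 'w"
 obtain N where N: "fst x <= real N" using real_arch_simple by blast
 have "\<forall>\<^sub>F n in sequentially. (case x of (s, w) => indicator {0..real n} s *\<^sub>R H s w) = (case x of (s, w) => indicator {0..} s *\<^sub>R H s w)"
  using eventually_ge_at_top[of N]
  by eventually_elim (use N in \<open>auto simp: indicator_def split: prod.split\<close>)
 thus "(%n. case x of (s, w) => indicator {0..real n} s *\<^sub>R H s w) ----> (case x of (s, w) => indicator {0..} s *\<^sub>R H s w)"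
  by (rule tendsto_eventually)
qed
qed

lemma elementary_joint: "elementary F W S J ==> joint P S"
using borel_measurable_scaleR[OF measurable_compose[OF measurable_fst borel_measurable_indicator[of "{0..}"]] elementary_measurable[of S J]]
by (simp add: joint_def case_prod_beta')

lemma ito_L2_joint: "ito_L2 P F W H I ==> joint P H"
by (intro progressive_joint ito_L2D)

lemma ito_L2_measurable: "ito_L2 P F W H I ==> 0 <= t ==> I t \<in> Fmeas t"
by (auto simp: ito_L2_def adapted_def)

lemma ito_L2_measurable_P: "ito_L2 P F W H I ==> 0 <= t ==> I t \<in> borel_measurable P"
by (rule measurable_F_P[OF ito_L2_measurable])

text \<open>Each inequality compares with an elementary approximant, for which the isometry is
  known, and loses only factors tending to 1.\<close>

lemma ito_L2_isometry:
assumes I: "ito_L2 P F W H I" and t: "0 <= t"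
shows "(EE w. ennreal ((I t w)^2)) = time_L2 P t H"
proof (rule antisym)
note [measurable] = ito_L2_measurable_P[OF I t]
have H: "joint P H" using I by (rule ito_L2_joint)
show "(EE w. ennreal ((I t w)^2)) <= time_L2 P t H"
proof (rule ennreal_le_by_approx)
 fix de ep :: real assume d: "0 < de" "0 < ep"
 obtain S J where SJ: "elementary F W S J" "time_L2 P t (%s w. S s w - H s w) <= ennreal ep"
  "(EE w. ennreal ((J t w - I t w)^2)) <= ennreal ep"
  by (rule ito_L2E_at[OF I t d(2)])
 note [measurable] = measurable_F_P[OF elementary_isometry(5)[OF SJ(1) t]]
 have "(EE w. ennreal ((I t w)^2)) <= ennreal (1 + de) * (EE w. ennreal ((J t w)^2))
   + ennreal (1 + 1 / de) * (EE w. ennreal ((J t w - I t w)^2))"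
  using nn_integral_add_power2_le[of "J t" P "%w. I t w - J t w" de] d by (simp add: power2_commute)
 also have "(EE w. ennreal ((J t w)^2)) = time_L2 P t S"
  using SJ(1) t by (rule elementary_isometry)
 also have "time_L2 P t S <= ennreal (1 + de) * time_L2 P t H + ennreal (1 + 1 / de) * time_L2 P t (%s w. S s w - H s w)"
  using time_L2_add_le[OF H joint_diff[OF elementary_joint[OF SJ(1)] H] d(1), of t] by simp
 finally show "(EE w. ennreal ((I t w)^2)) <=
  ennreal (1 + de) * (ennreal (1 + de) * time_L2 P t H + ennreal (1 + 1 / de) * ennreal ep) + ennreal (1 + 1 / de) * ennreal ep"
  using SJ(2,3) by (fastforce elim: order_trans intro: add_mono mult_left_mono)
qed
show "time_L2 P t H <= (EE w. ennreal ((I t w)^2))"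
proof (rule ennreal_le_by_approx)
 fix de ep :: real assume d: "0 < de" "0 < ep"
 obtain S J where SJ: "elementary F W S J" "time_L2 P t (%s w. S s w - H s w) <= ennreal ep"
  "(EE w. ennreal ((J t w - I t w)^2)) <= ennreal ep"
  by (rule ito_L2E_at[OF I t d(2)])
 note [measurable] = measurable_F_P[OF elementary_isometry(5)[OF SJ(1) t]]
 have "time_L2 P t H <= ennreal (1 + de) * time_L2 P t S + ennreal (1 + 1 / de) * time_L2 P t (%s w. H s w - S s w)"
  using time_L2_add_le[OF elementary_joint[OF SJ(1)] joint_diff[OF H elementary_joint[OF SJ(1)]] d(1), of t] by simp
 also have "time_L2 P t S = (EE w. ennreal ((J t w)^2))"
  using SJ(1) t by (rule elementary_isometry(1)[symmetric])
 also have "... <= ennreal (1 + de) * (EE w. ennreal ((I t w)^2))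
   + ennreal (1 + 1 / de) * (EE w. ennreal ((J t w - I t w)^2))"
  using nn_integral_add_power2_le[of "I t" P "%w. J t w - I t w" de] d by simp
 also have "time_L2 P t (%s w. H s w - S s w) = time_L2 P t (%s w. S s w - H s w)"
  by (rule time_L2_minus_commute)
 finally show "time_L2 P t H <= ennreal (1 + de) * (ennreal (1 + de) * (EE w. ennreal ((I t w)^2))
   + ennreal (1 + 1 / de) * ennreal ep) + ennreal (1 + 1 / de) * ennreal ep"
  using SJ(2,3) by (fastforce elim: order_trans intro: add_mono mult_left_mono)
qed
qed

lemma ito_L2_square_integrable:
assumes I: "ito_L2 P F W H I" and t: "0 <= t"
shows "integrable P (%w. (I t w)^2)" (is ?Q1) "integrable P (I t)"
proof -
show *: ?Q1
 using ito_L2_measurable_P[OF I t] ito_L2_isometry[OF I t] ito_L2D(4)[OF I t]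
 by (intro integrableI_nonneg) auto
show "integrable P (I t)"
 by (rule square_integrable_imp_integrable[OF ito_L2_measurable_P[OF I t] *])
qed

lemma expectation_square_le:
assumes "X \<in> borel_measurable P" "integrable P (%w. (X w)^2 :: real)"
shows "(expectation X)^2 <= expectation (%w. (X w)^2)"
using variance_eq[OF square_integrable_imp_integrable[OF assms] assms(2)] variance_positive[of X] by simp

lemma ito_L2_mean:
assumes I: "ito_L2 P F W H I" and t: "0 <= t"
shows "expectation (I t) = 0"
proof -
have "(expectation (I t))^2 <= ep" if ep: "0 < ep" for ep
proof -
 obtain S J where SJ: "elementary F W S J" "(EE w. ennreal ((J t w - I t w)^2)) <= ennreal ep"
  by (rule ito_L2E_at[OF I t ep])
 note e = elementary_isometry[OF SJ(1) t]
 note [measurable] = measurable_F_P[OF e(5)] ito_L2_measurable_P[OF I t]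
 have int: "integrable P (%w. (J t w - I t w)^2)"
  using SJ(2) by (intro integrableI_nonneg) (auto intro: le_less_trans)
 have "integrable P (J t)" using e(3) by (rule square_integrable_imp_integrable[rotated]) simp
 hence "expectation (%w. J t w - I t w) = - expectation (I t)"
  using e(4) ito_L2_square_integrable[OF I t] by simp
 hence "(expectation (I t))^2 <= expectation (%w. (J t w - I t w)^2)"
  using expectation_square_le[OF _ int] by simp
 moreover have "ennreal (expectation (%w. (J t w - I t w)^2)) <= ennreal ep"
  using SJ(2) int by (subst nn_integral_eq_integral[symmetric]) auto
 ultimately show ?thesis using ep by (simp add: ennreal_le_iff)
qed
hence "(expectation (I t))^2 <= 0" by (rule field_le_epsilon) simp
thus ?thesis by simp
qed

end

lemma nn_integral_add_power2_le2:
fixes f g :: "'a => real"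
assumes "f \<in> borel_measurable M" "g \<in> borel_measurable M"
shows "(\<integral>\<^sup>+x. ennreal ((f x + g x)^2) \<partial>M) <= 2 * (\<integral>\<^sup>+x. ennreal ((f x)^2) \<partial>M) + 2 * (\<integral>\<^sup>+x. ennreal ((g x)^2) \<partial>M)"
 "(\<integral>\<^sup>+x. ennreal ((f x - g x)^2) \<partial>M) <= 2 * (\<integral>\<^sup>+x. ennreal ((f x)^2) \<partial>M) + 2 * (\<integral>\<^sup>+x. ennreal ((g x)^2) \<partial>M)"
using nn_integral_add_power2_le[OF assms, of 1]
 nn_integral_add_power2_le[OF assms(1) borel_measurable_uminus[OF assms(2)], of 1] by simp_all

lemma ennreal_quarters: "a <= ennreal (ep / 4) ==> b <= ennreal (ep / 4) ==> 0 < ep ==> 2 * a + 2 * b <= ennreal ep"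
proof -
assume *: "a <= ennreal (ep / 4)" "b <= ennreal (ep / 4)" "0 < ep"
have "2 * a + 2 * b <= ennreal 2 * ennreal (ep / 4) + ennreal 2 * ennreal (ep / 4)"
 using * by (intro add_mono mult_mono) auto
also have "... = ennreal ep"
 using * by (simp add: ennreal_mult'[symmetric] ennreal_plus[symmetric] del: ennreal_plus ennreal_numeral)
finally show ?thesis .
qed

lemma progressive_add:
fixes H :: "real => 'w => 'b::{second_countable_topology, real_normed_vector}"
assumes "progressive F H" "progressive F G"
shows "progressive F (%s w. H s w + G s w)"
using assms unfolding progressive_def case_prod_beta by (auto intro: borel_measurable_add)

lemma progressive_cmult:
fixes H :: "real => 'w => 'b::{second_countable_topology, real_normed_vector}"
assumes "progressive F H"
shows "progressive F (%s w. c *\<^sub>R H s w)"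
using assms unfolding progressive_def case_prod_beta by (auto intro: borel_measurable_scaleR)

lemma stop_time_nonneg: "0 <= stop_time \<rho> t w"
by (simp add: stop_time_def)

lemma ennreal_stop_time: "0 <= t ==> ennreal (stop_time \<rho> t w) = min (ennreal t) (\<rho> w)"
by (auto simp: stop_time_def min_def ennreal_enn2real_if top_unique)

lemma stop_time_le: "0 <= t ==> stop_time \<rho> t w <= t"
using ennreal_stop_time[of t \<rho> w] by (metis ennreal_le_iff min.cobounded1)

lemma stop_time_real: "\<rho> w = ennreal r ==> 0 <= r ==> 0 <= t ==> stop_time \<rho> t w = min t r"
by (simp add: stop_time_def min_def)

lemma stop_time_top: "\<rho> w = top ==> 0 <= t ==> stop_time \<rho> t w = t"
by (simp add: stop_time_def min_def)

lemma continuous_on_stop_time: "continuous_on {0..} (%t. stop_time \<rho> t w)"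
proof (cases "\<rho> w")
case (real r)
have "continuous_on {0..} (%t. min t r)" by (intro continuous_intros)
thus ?thesis
 by (rule continuous_on_cong[THEN iffD1, rotated 2]) (auto simp: stop_time_real[where r=r] real)
next
case top
have "continuous_on {0..} (%t::real. t)" by (intro continuous_intros)
thus ?thesis
 by (rule continuous_on_cong[THEN iffD1, rotated 2]) (auto simp: stop_time_top top)
qed

lemma continuous_on_stopped:
assumes "continuous_on {0..} (y :: real => 'b::topological_space)"
shows "continuous_on {0..} (%t. y (stop_time \<rho> t w))"
by (rule continuous_on_compose2[OF assms continuous_on_stop_time]) (auto simp: stop_time_nonneg)

section \<open>Linearity, localisation, limits and stopping of the integral\<close>

context brownian_basis
begin

lemma progressive_LIMSEQ:
fixes H :: "nat => real => 'w => 'b::{second_countable_topology, real_normed_vector}"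
assumes "!!n. progressive F (H n)"
 and "!!s w. 0 <= s ==> w \<in> space P ==> (%n. H n s w) ----> G s w"
shows "progressive F G"
unfolding progressive_def
proof (intro allI impI)
fix T :: real assume T: "0 <= T"
show "(%(s, w). G s w) \<in> borel_measurable (restrict_space borel {0..T} \<Otimes>\<^sub>M F (ennreal T))"
proof (rule borel_measurable_LIMSEQ_metric)
 show "(%(s, w). H n s w) \<in> borel_measurable (restrict_space borel {0..T} \<Otimes>\<^sub>M F (ennreal T))" for n
  using assms(1)[of n] T by (simp add: progressive_def)
qed (use assms(2) in \<open>auto simp: space_pair_measure space_restrict_space\<close>)
qed

lemma progressive_shift:
fixes H :: "real => 'w => 'b::{second_countable_topology, real_normed_vector}"
assumes H: "progressive F H" and q: "0 <= q" and eta: "eta \<in> Fmeas q"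
shows "progressive F (%s w. (eta w * indicator {q<..} s) *\<^sub>R H s w)"
unfolding progressive_def
proof (intro allI impI)
fix T :: real assume T: "0 <= T"
let ?M = "restrict_space borel {0..T} \<Otimes>\<^sub>M F (ennreal T)"
have HT: "(%x. H (fst x) (snd x)) \<in> borel_measurable ?M"
 using H T by (simp add: progressive_def case_prod_beta')
show "(%(s, w). (eta w * indicator {q<..} s) *\<^sub>R H s w) \<in> borel_measurable ?M"
proof (cases "q <= T")
 case True
 hence "eta \<in> Fmeas T"
  using eta by (intro measurable_F_mono[OF eta] ennreal_leI)
 hence "(%x. eta (snd x)) \<in> borel_measurable ?M"
  by (rule measurable_compose[OF measurable_snd])
 moreover have "(%x. indicator {q<..} (fst x) :: real) \<in> borel_measurable ?M"
  by (rule measurable_compose[OF measurable_fst]) (intro measurable_restrict_space1, simp)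
 ultimately show ?thesis
  unfolding case_prod_beta using HT by (intro borel_measurable_scaleR borel_measurable_times)
next
 case False
 have "(%_. 0) \<in> borel_measurable ?M" by simp
 thus ?thesis
  by (rule measurable_cong[THEN iffD1, rotated])
   (use False in \<open>auto simp: space_pair_measure space_restrict_space indicator_def\<close>)
qed
qed

lemma measurable_F_AE_LIMSEQ:
fixes f :: "nat => 'w => real"
assumes "!!n. f n \<in> borel_measurable (F t)" "AE w in P. (%n. f n w) ----> g w"
shows "g \<in> borel_measurable (F t)"
proof (rule measurable_F_AE)
show "(%w. lim (%n. f n w)) \<in> borel_measurable (F t)"
 using assms(1) by (rule borel_measurable_lim_metric)
show "AE w in P. lim (%n. f n w) = g w"
 using assms(2) by eventually_elim (rule limI)
qed simp

lemma ito_L2_add: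
assumes I: "ito_L2 P F W H I" and I': "ito_L2 P F W H' I'"
shows "ito_L2 P F W (%s w. H s w + H' s w) (%t w. I t w + I' t w)"
unfolding ito_L2_def
proof (intro conjI allI impI)
note D = ito_L2D[OF I] ito_L2D[OF I'] and jt = ito_L2_joint[OF I] ito_L2_joint[OF I']
show "progressive F (%s w. H s w + H' s w)" using D by (intro progressive_add)
show "adapted F (%t w. I t w + I' t w)"
 using D(2,6) by (auto simp: adapted_def intro: borel_measurable_add)
show "AE w in P. continuous_on {0..} (%t. I t w + I' t w)"
 using D(3,7) by eventually_elim (rule continuous_on_add)
fix T :: real assume T: "0 <= T"
show "time_L2 P T (%s w. H s w + H' s w) < \<infinity>"
 using D(4)[OF T] D(8)[OF T] by (intro le_less_trans[OF time_L2_add_le2[OF jt]]) (auto simp: ennreal_mult_less_top)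
fix ep :: real assume ep: "0 < ep"
hence ep4: "0 < ep / 4" by simp
obtain S J where S: "elementary F W S J" "time_L2 P T (%s w. S s w - H s w) <= ennreal (ep / 4)"
 "!!t. 0 <= t ==> t <= T ==> (EE w. ennreal ((J t w - I t w)^2)) <= ennreal (ep / 4)"
 using ito_L2E[OF I T ep4] by blast
obtain S' J' where S': "elementary F W S' J'" "time_L2 P T (%s w. S' s w - H' s w) <= ennreal (ep / 4)"
 "!!t. 0 <= t ==> t <= T ==> (EE w. ennreal ((J' t w - I' t w)^2)) <= ennreal (ep / 4)"
 using ito_L2E[OF I' T ep4] by blast
show "EX S J. elementary F W S J & time_L2 P T (%s w. S s w - (H s w + H' s w)) <= ennreal ep &
 (ALL t:{0..T}. (EE w. ennreal ((J t w - (I t w + I' t w))^2)) <= ennreal ep)"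
proof (intro exI conjI ballI)
 show "elementary F W (%s w. S s w + S' s w) (%t w. J t w + J' t w)"
  using S(1) S'(1) by (rule elementary_add)
 have "time_L2 P T (%s w. (S s w - H s w) + (S' s w - H' s w)) <= ennreal ep"
  using time_L2_add_le2[OF joint_diff[OF elementary_joint[OF S(1)] jt(1)] joint_diff[OF elementary_joint[OF S'(1)] jt(2)], of T]
  by (rule order_trans) (intro ennreal_quarters S S' ep)
 thus "time_L2 P T (%s w. S s w + S' s w - (H s w + H' s w)) <= ennreal ep"
  by (simp add: add_diff_add)
 fix t assume t: "t \<in> {0..T}"
 hence t0: "0 <= t" and tT: "t <= T" by auto
 note [measurable] = measurable_F_P[OF elementary_isometry(5)[OF S(1) t0]] measurable_F_P[OF elementary_isometry(5)[OF S'(1) t0]]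
  ito_L2_measurable_P[OF I t0] ito_L2_measurable_P[OF I' t0]
 have "(EE w. ennreal (((J t w - I t w) + (J' t w - I' t w))^2)) <= ennreal ep"
  by (rule order_trans[OF nn_integral_add_power2_le2(1)])
   (measurable, intro ennreal_quarters S(3)[OF t0 tT] S'(3)[OF t0 tT] ep)
 thus "(EE w. ennreal ((J t w + J' t w - (I t w + I' t w))^2)) <= ennreal ep"
  by (simp add: add_diff_add)
qed
qed

text \<open>An approximant of the original integral, shifted in the same way, approximates the
  shifted one; \<open>eta\<close> costs a factor equal to the square of its bound.\<close>

lemma ito_L2_shift:
assumes I: "ito_L2 P F W H I" and q: "0 <= q"
 and eta: "eta \<in> Fmeas q" "bounded (eta ` space P)"
shows "ito_L2 P F W (%s w. (eta w * indicator {q<..} s) *\<^sub>R H s w) (%t w. eta w * (I t w - I (min t q) w))"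
unfolding ito_L2_def
proof (intro conjI allI impI)
note D = ito_L2D[OF I] and jt = ito_L2_joint[OF I]
obtain B where B: "!!w. w \<in> space P ==> abs (eta w) <= B" "0 < B"
 using eta(2) unfolding bounded_pos by auto
have etaP: "eta \<in> borel_measurable P" by (rule measurable_F_P[OF eta(1)])
show pr: "progressive F (%s w. (eta w * indicator {q<..} s) *\<^sub>R H s w)" using D(1) q eta(1) by (rule progressive_shift)
show "adapted F (%t w. eta w * (I t w - I (min t q) w))"
 unfolding adapted_def
proof (intro allI impI)
 fix t :: real assume t: "0 <= t"
 show "(%w. eta w * (I t w - I (min t q) w)) \<in> Fmeas t"
 proof (cases "t <= q")
  case False
  have "eta \<in> Fmeas t" "I q \<in> Fmeas t"
   using False by (auto intro!: measurable_F_mono[OF eta(1)] measurable_F_mono[OF ito_L2_measurable[OF I q]] ennreal_leI)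
  thus ?thesis using ito_L2_measurable[OF I t] False by (simp add: min_def)
 qed (simp add: min_def)
qed
show "AE w in P. continuous_on {0..} (%t. eta w * (I t w - I (min t q) w))"
 using D(3)
proof eventually_elim
 case (elim w)
 have "continuous_on {0..} (%t. I (min t q) w)"
  by (rule continuous_on_compose2[OF elim]) (use q in \<open>auto intro!: continuous_intros\<close>)
 thus ?case using elim by (intro continuous_intros)
qed
have le: "time_L2 P T (%s w. (eta w * indicator {q<..} s) *\<^sub>R A s w) <= ennreal (B^2) * time_L2 P T A"
 if "joint P A" for T and A :: "real => 'w => real^'p"
 unfolding time_L2_cmult[OF that, of T B, symmetric]
 using B by (intro time_L2_mono) (auto simp: indicator_def intro!: mult_right_mono order_trans[OF B(1)])
fix T :: real assume T: "0 <= T"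
show "time_L2 P T (%s w. (eta w * indicator {q<..} s) *\<^sub>R H s w) < \<infinity>"
 using D(4)[OF T] by (intro le_less_trans[OF le[OF jt]]) (auto simp: ennreal_mult_less_top)
fix ep :: real assume ep: "0 < ep"
\<comment> \<open>The factor \<open>B^2\<close> cancels the bound of \<open>eta\<close>; the factor
  4 leaves room for the two errors, at \<open>t\<close> and at \<open>min t q\<close>.\<close>
define ep' where "ep' = ep / (4 * B^2)"
have ep': "0 < ep'" "B^2 * ep' = ep / 4" using ep B(2) by (auto simp: ep'_def)
obtain S J where S: "elementary F W S J" "time_L2 P T (%s w. S s w - H s w) <= ennreal ep'"
 "!!t. 0 <= t ==> t <= T ==> (EE w. ennreal ((J t w - I t w)^2)) <= ennreal ep'"
 using ito_L2E[OF I T ep'(1)] by blast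
have q4: "ennreal (B^2) * x <= ennreal (ep / 4)" if "x <= ennreal ep'" for x
proof -
 have "ennreal (B^2) * x <= ennreal (B^2) * ennreal ep'" using that by (rule mult_left_mono) simp
 also have "... = ennreal (B^2 * ep')" by (simp add: ennreal_mult'[symmetric])
 also have "... = ennreal (ep / 4)" by (simp only: ep'(2))
 finally show ?thesis .
qed
show "EX S J. elementary F W S J & time_L2 P T (%s w. S s w - (eta w * indicator {q<..} s) *\<^sub>R H s w) <= ennreal ep &
 (ALL t:{0..T}. (EE w. ennreal ((J t w - eta w * (I t w - I (min t q) w))^2)) <= ennreal ep)"
proof (intro exI conjI ballI)
 show "elementary F W (%s w. (eta w * indicator {q<..} s) *\<^sub>R S s w) (%t w. eta w * (J t w - J (min t q) w))"
  using S(1) q eta by (rule elementary_shift)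
 have "time_L2 P T (%s w. (eta w * indicator {q<..} s) *\<^sub>R (S s w - H s w)) <= ennreal (ep / 4)"
  using le[OF joint_diff[OF elementary_joint[OF S(1)] jt], of T] q4[OF S(2)] by (rule order_trans)
 also have "... <= ennreal ep" using ep by (intro ennreal_leI) simp
 finally show "time_L2 P T (%s w. (eta w * indicator {q<..} s) *\<^sub>R S s w - (eta w * indicator {q<..} s) *\<^sub>R H s w) <= ennreal ep"
  by (simp add: scaleR_diff_right)
 fix t assume "t \<in> {0..T}"
 hence t: "0 <= t" "t <= T" "0 <= min t q" "min t q <= T" using q by auto
 let ?A = "%t w. B * (J t w - I t w)"
 have A: "?A r \<in> borel_measurable P" "(EE w. ennreal ((?A r w)^2)) <= ennreal (ep / 4)" if r: "0 <= r" "r <= T" for r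
 proof -
  have m: "J r \<in> borel_measurable P" "I r \<in> borel_measurable P"
   using measurable_F_P[OF elementary_isometry(5)[OF S(1) r(1)]] ito_L2_measurable_P[OF I r(1)] by auto
  thus "?A r \<in> borel_measurable P" by measurable
  have "(EE w. ennreal ((?A r w)^2)) = ennreal (B^2) * (EE w. ennreal ((J r w - I r w)^2))"
   using m by (subst nn_integral_cmult[symmetric]) (auto simp: power_mult_distrib ennreal_mult')
  also have "... <= ennreal (ep / 4)" by (rule q4[OF S(3)[OF r]])
  finally show "(EE w. ennreal ((?A r w)^2)) <= ennreal (ep / 4)" .
 qed
 have "(EE w. ennreal ((eta w * (J t w - J (min t q) w) - eta w * (I t w - I (min t q) w))^2))
  <= (EE w. ennreal ((?A t w - ?A (min t q) w)^2))"
 proof (intro nn_integral_mono ennreal_leI)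
  fix w assume "w \<in> space P"
  let ?d = "(J t w - I t w) - (J (min t q) w - I (min t q) w)"
  have "(eta w)^2 * ?d^2 <= B^2 * ?d^2"
   using B(1)[OF \<open>w \<in> space P\<close>] B(2) by (intro mult_right_mono) (auto simp: abs_le_square_iff[symmetric])
  moreover have "eta w * (J t w - J (min t q) w) - eta w * (I t w - I (min t q) w) = eta w * ?d"
   "?A t w - ?A (min t q) w = B * ?d" by (simp_all add: algebra_simps)
  ultimately show "(eta w * (J t w - J (min t q) w) - eta w * (I t w - I (min t q) w))^2 <= (?A t w - ?A (min t q) w)^2"
   by (simp add: power_mult_distrib)
 qed
 also have "... <= 2 * (EE w. ennreal ((?A t w)^2)) + 2 * (EE w. ennreal ((?A (min t q) w)^2))"
  using A(1)[OF t(1,2)] A(1)[OF t(3,4)] by (rule nn_integral_add_power2_le2)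
 also have "... <= ennreal ep"
  using A(2)[OF t(1,2)] A(2)[OF t(3,4)] ep by (rule ennreal_quarters)
 finally show "(EE w. ennreal ((eta w * (J t w - J (min t q) w) - eta w * (I t w - I (min t q) w))^2)) <= ennreal ep" .
qed
qed

lemma ito_L2_cong:
assumes I: "ito_L2 P F W H I" and H: "!!s w. 0 <= s ==> w \<in> space P ==> H s w = H' s w"
 and I': "AE w in P. ALL t>=0. I t w = I' t w"
shows "ito_L2 P F W H' I'"
unfolding ito_L2_def
proof (intro conjI allI impI)
note D = ito_L2D[OF I]
show "progressive F H'"
 using progressive_LIMSEQ[of "%_. H" H'] D(1) H by simp
show "adapted F I'"
 unfolding adapted_def
proof (intro allI impI)
 fix t :: real assume "0 <= t"
 thus "I' t \<in> Fmeas t"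
  using I' by (intro measurable_F_AE[OF ito_L2_measurable[OF I]]) (auto elim: AE_mp)
qed
show "AE w in P. continuous_on {0..} (%t. I' t w)"
 using D(3) I' by eventually_elim (erule continuous_on_cong[THEN iffD1, rotated 2], auto)
fix T :: real assume T: "0 <= T"
show "time_L2 P T H' < \<infinity>" using D(4)[OF T] time_L2_cong[of T P H H'] H by simp
fix ep :: real assume ep: "0 < ep"
obtain S J where S: "elementary F W S J" "time_L2 P T (%s w. S s w - H s w) <= ennreal ep"
 "!!t. 0 <= t ==> t <= T ==> (EE w. ennreal ((J t w - I t w)^2)) <= ennreal ep"
 using ito_L2E[OF I T ep] by blast
show "EX S J. elementary F W S J & time_L2 P T (%s w. S s w - H' s w) <= ennreal ep &
 (ALL t:{0..T}. (EE w. ennreal ((J t w - I' t w)^2)) <= ennreal ep)"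
proof (intro exI conjI ballI)
 show "elementary F W S J" by fact
 show "time_L2 P T (%s w. S s w - H' s w) <= ennreal ep"
  using S(2) time_L2_cong[of T P "%s w. S s w - H s w" "%s w. S s w - H' s w"] H by simp
 fix t assume t: "t \<in> {0..T}"
 have "(EE w. ennreal ((J t w - I' t w)^2)) = (EE w. ennreal ((J t w - I t w)^2))"
  using I' t by (intro nn_integral_cong_AE) (auto elim: AE_mp)
 thus "(EE w. ennreal ((J t w - I' t w)^2)) <= ennreal ep" using S(3)[of t] t by simp
qed
qed

lemma ito_L2_zero: "ito_L2 P F W (%_ _. 0) (%_ _. 0)"
unfolding ito_L2_def
proof (intro conjI allI impI)
fix T ep :: real assume "0 <= T" "0 < ep"
have "elementary F W (%_ _. 0) (%_ _. 0)"
 unfolding elementary_def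
 by (intro exI[of _ 0] exI[of _ "%_. 0"] exI[of _ "%_ _. 0"])
  (simp add: simple_integrand_def simple_process_def simple_ito_def fun_eq_iff)
thus "EX S J. elementary F W S J & time_L2 P T (%s w. S s w - 0) <= ennreal ep &
 (ALL t:{0..T}. (EE w. ennreal ((J t w - 0)^2)) <= ennreal ep)"
 by (intro exI[of _ "%_ _. 0"]) (simp add: time_L2_def)
qed (auto simp: progressive_def adapted_def time_L2_def)

lemma ito_L2_zero_time: "ito_L2 P F W H I ==> AE w in P. I 0 w = 0"
proof -
assume I: "ito_L2 P F W H I"
have "(NN s:{0..0::real}. h s) = 0" for h :: "real => ennreal"
 by (intro nn_integral_null_set) (simp add: finite_imp_null_set_lborel)
hence "time_L2 P 0 H = 0" by (simp add: time_L2_def)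
hence "(EE w. ennreal ((I 0 w)^2)) = 0" using ito_L2_isometry[OF I] by simp
thus ?thesis
 using ito_L2_measurable_P[OF I] by (subst (asm) nn_integral_0_iff_AE) auto
qed

lemma ito_L2_cmult:
assumes I: "ito_L2 P F W H I"
shows "ito_L2 P F W (%s w. c *\<^sub>R H s w) (%t w. c * I t w)"
unfolding ito_L2_def
proof (intro conjI allI impI)
note D = ito_L2D[OF I] and jt = ito_L2_joint[OF I]
show "progressive F (%s w. c *\<^sub>R H s w)" using D by (intro progressive_cmult)
show "adapted F (%t w. c * I t w)" using D by (auto simp: adapted_def)
show "AE w in P. continuous_on {0..} (%t. c * I t w)"
 using D(3) by eventually_elim (intro continuous_intros)
fix T :: real assume T: "0 <= T"
show "time_L2 P T (%s w. c *\<^sub>R H s w) < \<infinity>"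
 using D(4)[OF T] by (simp add: time_L2_cmult[OF jt] ennreal_mult_less_top)
fix ep :: real assume ep: "0 < ep"
define ep' where "ep' = ep / (1 + c^2)"
have c: "0 < 1 + c^2" by (simp add: add_pos_nonneg)
hence ep': "0 < ep'" using ep by (simp add: ep'_def)
have "c^2 * ep' <= (1 + c^2) * ep'" using ep' by (intro mult_right_mono) auto
also have "... = ep" using c by (simp add: ep'_def)
finally have cep: "ennreal (c^2) * x <= ennreal ep" if "x <= ennreal ep'" for x
 using mult_left_mono[OF that, of "ennreal (c^2)"] ep' ep by (auto simp: ennreal_mult'[symmetric] ennreal_le_iff intro: order_trans)
obtain S J where S: "elementary F W S J" "time_L2 P T (%s w. S s w - H s w) <= ennreal ep'"
 "!!t. 0 <= t ==> t <= T ==> (EE w. ennreal ((J t w - I t w)^2)) <= ennreal ep'"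
 using ito_L2E[OF I T ep'(1)] by blast
show "EX S J. elementary F W S J & time_L2 P T (%s w. S s w - c *\<^sub>R H s w) <= ennreal ep &
 (ALL t:{0..T}. (EE w. ennreal ((J t w - c * I t w)^2)) <= ennreal ep)"
proof (intro exI conjI ballI)
 show "elementary F W (%s w. c *\<^sub>R S s w) (%t w. c * J t w)" using S(1) by (rule elementary_cmult)
 show "time_L2 P T (%s w. c *\<^sub>R S s w - c *\<^sub>R H s w) <= ennreal ep"
  unfolding scaleR_diff_right[symmetric] time_L2_cmult[OF joint_diff[OF elementary_joint[OF S(1)] jt]]
  by (rule cep[OF S(2)])
 fix t assume "t \<in> {0..T}"
 hence t: "0 <= t" "t <= T" by auto
 note [measurable] = measurable_F_P[OF elementary_isometry(5)[OF S(1) t(1)]] ito_L2_measurable_P[OF I t(1)]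
 have "(EE w. ennreal ((c * J t w - c * I t w)^2)) = ennreal (c^2) * (EE w. ennreal ((J t w - I t w)^2))"
  by (subst nn_integral_cmult[symmetric]) (auto simp: right_diff_distrib[symmetric] power_mult_distrib ennreal_mult')
 also have "... <= ennreal ep" by (rule cep[OF S(3)[OF t]])
 finally show "(EE w. ennreal ((c * J t w - c * I t w)^2)) <= ennreal ep" .
qed
qed

lemma ito_L2_diff:
assumes "ito_L2 P F W H I" "ito_L2 P F W H' I'"
shows "ito_L2 P F W (%s w. H s w - H' s w) (%t w. I t w - I' t w)"
using ito_L2_add[OF assms(1) ito_L2_cmult[OF assms(2), of "- 1"]] by simp

lemma ito_L2_sum:
assumes "finite L" "!!l. l \<in> L ==> ito_L2 P F W (H l) (I l)"
shows "ito_L2 P F W (%s w. \<Sum>l\<in>L. H l s w) (%t w. \<Sum>l\<in>L. I l t w)"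
using assms by (induction L rule: finite_induct) (auto simp: ito_L2_zero intro: ito_L2_add)

text \<open>Convergence of the integrands makes the integrals Cauchy in mean square by the isometry.
  Hence almost sure convergence at each fixed time is enough to identify the limit, and no uniform
  convergence of paths has to be shown.\<close>

lemma ito_L2_limit:
assumes I: "!!n. ito_L2 P F W (H n) (I n)" and pr: "progressive F H'"
 and cont: "AE w in P. continuous_on {0..} (%t. I' t w)"
 and lim: "!!T. 0 <= T ==> (%n. time_L2 P T (%s w. H n s w - H' s w)) ----> 0"
 and limI: "!!t. 0 <= t ==> AE w in P. (%n. I n t w) ----> I' t w"
shows "ito_L2 P F W H' I'"
unfolding ito_L2_def
proof (intro conjI allI impI)
show "progressive F H'" by fact
show "AE w in P. continuous_on {0..} (%t. I' t w)" by fact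
note j' = progressive_joint[OF pr] and jn = ito_L2_joint[OF I]
have I'm: "I' t \<in> Fmeas t" if "0 <= t" for t
 using ito_L2_measurable[OF I that] limI[OF that] by (rule measurable_F_AE_LIMSEQ)
thus "adapted F I'" by (auto simp: adapted_def)
fix T :: real assume T: "0 <= T"
have ev: "\<forall>\<^sub>F n in sequentially. time_L2 P T (%s w. H n s w - H' s w) <= ennreal ep" if "0 < ep" for ep
 using order_tendstoD(2)[OF lim[OF T], of "ennreal ep"] that by (auto elim: eventually_mono)
obtain N where N: "time_L2 P T (%s w. H N s w - H' s w) <= ennreal 1"
 using ev[of 1] by (auto simp: eventually_sequentially)
have "time_L2 P T (%s w. H N s w - (H N s w - H' s w)) <= 2 * time_L2 P T (H N) + 2 * time_L2 P T (%s w. H N s w - H' s w)"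
 by (intro time_L2_diff_le2 jn joint_diff j')
also have "... < \<infinity>"
 using N ito_L2D(4)[OF I T] by (auto simp: ennreal_mult_less_top intro: le_less_trans)
finally show "time_L2 P T H' < \<infinity>" by simp
fix ep :: real assume ep: "0 < ep"
hence e: "0 < ep / 4" "0 < ep / 4 / 4" by auto
obtain N where N: "!!n. N <= n ==> time_L2 P T (%s w. H n s w - H' s w) <= ennreal (ep / 4 / 4)"
 using ev[OF e(2)] by (auto simp: eventually_sequentially)
have N4: "time_L2 P T (%s w. H N s w - H' s w) <= ennreal (ep / 4)"
 using ep by (intro order_trans[OF N[OF order_refl]] ennreal_leI) simp
obtain S J where S: "elementary F W S J" "time_L2 P T (%s w. S s w - H N s w) <= ennreal (ep / 4)"
 "!!t. 0 <= t ==> t <= T ==> (EE w. ennreal ((J t w - I N t w)^2)) <= ennreal (ep / 4)"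
 using ito_L2E[OF I T e(1)] by blast
show "EX S J. elementary F W S J & time_L2 P T (%s w. S s w - H' s w) <= ennreal ep &
 (ALL t:{0..T}. (EE w. ennreal ((J t w - I' t w)^2)) <= ennreal ep)"
proof (intro exI conjI ballI)
 show "elementary F W S J" by fact
 show "time_L2 P T (%s w. S s w - H' s w) <= ennreal ep"
  using time_L2_add_le2[OF joint_diff[OF elementary_joint[OF S(1)] jn[of N]] joint_diff[OF jn[of N] j'], of T]
   ennreal_quarters[OF S(2) N4 ep] by simp
 fix t assume "t \<in> {0..T}"
 hence t: "0 <= t" "t <= T" by auto
 note [measurable] = measurable_F_P[OF elementary_isometry(5)[OF S(1) t(1)]] ito_L2_measurable_P[OF I t(1)]
  measurable_F_P[OF I'm[OF t(1)]]
 \<comment> \<open>Fatou's lemma with \<open>N\<close> fixed: the distance to the limit is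
   controlled by distances between members of the sequence, which the isometry evaluates.\<close>
 have "(EE w. ennreal ((I N t w - I' t w)^2)) <= (EE w. liminf (%m. ennreal ((I N t w - I m t w)^2)))"
 proof (rule nn_integral_mono_AE)
  show "AE w in P. ennreal ((I N t w - I' t w)^2) <= liminf (%m. ennreal ((I N t w - I m t w)^2))"
   using limI[OF t(1)]
  proof eventually_elim
   case (elim w)
   hence "(%m. ennreal ((I N t w - I m t w)^2)) ----> ennreal ((I N t w - I' t w)^2)"
    by (intro tendsto_intros tendsto_ennrealI)
   from lim_imp_Liminf[OF _ this] show ?case by simp
  qed
 qed
 also have "... <= liminf (%m. (EE w. ennreal ((I N t w - I m t w)^2)))"
  by (rule nn_integral_liminf) measurable
 also have "... <= ennreal (ep / 4)"
 proof (rule Liminf_le)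
  show "\<forall>\<^sub>F m in sequentially. (EE w. ennreal ((I N t w - I m t w)^2)) <= ennreal (ep / 4)"
   using eventually_ge_at_top[of N]
  proof eventually_elim
   case (elim m)
   have "(EE w. ennreal ((I N t w - I m t w)^2)) = time_L2 P t (%s w. H N s w - H m s w)"
    by (rule ito_L2_isometry[OF ito_L2_diff[OF I I] t(1)])
   also have "... <= time_L2 P T (%s w. H N s w - H m s w)" using t(2) by (rule time_L2_mono_time)
   also have "... <= ennreal (ep / 4)"
    using time_L2_diff_le2[OF joint_diff[OF jn[of N] j'] joint_diff[OF jn[of m] j'], of T]
     ennreal_quarters[OF N[OF order_refl] N[OF elim] e(1)] by simp
   finally show ?case .
  qed
 qed simp
 finally have *: "(EE w. ennreal ((I N t w - I' t w)^2)) <= ennreal (ep / 4)" .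
 show "(EE w. ennreal ((J t w - I' t w)^2)) <= ennreal ep"
  using nn_integral_add_power2_le2(1)[of "%w. J t w - I N t w" P "%w. I N t w - I' t w"]
   ennreal_quarters[OF S(3)[OF t] * ep] by simp
qed
qed

text \<open>The stopping time is rounded up to a multiple of \<open>1 / (m + 1)\<close>. On the
  event that it falls into a given cell, the integral after the end of the cell is a shifted
  integral; finitely many of them are added and \<open>m\<close> tends to infinity.\<close>

lemma ito_L2_stop:
assumes I: "ito_L2 P F W H I" and \<rho>: "stopping_time F \<rho>"
shows "ito_L2 P F W (%s w. if \<rho> w < ennreal s then H s w else 0) (%t w. I t w - I (stop_time \<rho> t w) w)"
proof -
\<comment> \<open>\<open>q m k\<close> is the right end of cell \<open>k\<close>, where it is
  already known whether \<rho> lies in that cell. The \<open>(m + 1)^2\<close> cells used below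
  cover \<open>[0, m + 1)\<close>, so every finite value of \<rho> is eventually caught.\<close>
define q where "q m k = (real k + 1) / real (Suc m)" for m k
define B where "B m k = {w\<in>space P. ennreal (real k / real (Suc m)) <= \<rho> w & \<rho> w < ennreal (q m k)}" for m k
define Hn where "Hn m = (%s w. \<Sum>k<Suc m * Suc m. (indicator (B m k) w * indicator {q m k<..} s) *\<^sub>R H s w)" for m
define In where "In m = (%t w. \<Sum>k<Suc m * Suc m. indicator (B m k) w * (I t w - I (min t (q m k)) w))" for m
let ?H = "%s w. if \<rho> w < ennreal s then H s w else 0" and ?I = "%t w. I t w - I (stop_time \<rho> t w) w"
have q0: "0 <= q m k" for m k by (simp add: q_def)
have BF: "B m k \<in> sets (F (ennreal (q m k)))" for m k
proof -
 have "ennreal (real k / real (Suc m)) <= ennreal (q m k)" by (intro ennreal_leI) (simp add: q_def divide_right_mono)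
 hence "{w\<in>space P. \<rho> w < ennreal (real k / real (Suc m))} \<in> sets (F (ennreal (q m k)))"
  using predE[OF stopping_time_less_const[OF \<rho>]] sets_F_mono by auto
 moreover have "{w\<in>space P. \<rho> w < ennreal (q m k)} \<in> sets (F (ennreal (q m k)))"
  using predE[OF stopping_time_less_const[OF \<rho>]] by auto
 ultimately have "{w\<in>space P. \<rho> w < ennreal (q m k)} - {w\<in>space P. \<rho> w < ennreal (real k / real (Suc m))} \<in> sets (F (ennreal (q m k)))"
  by (rule sets.Diff[rotated])
 also have "{w\<in>space P. \<rho> w < ennreal (q m k)} - {w\<in>space P. \<rho> w < ennreal (real k / real (Suc m))} = B m k"
  by (auto simp: B_def not_less)
 finally show ?thesis .
qed
have ito: "ito_L2 P F W (Hn m) (In m)" for m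
 unfolding Hn_def In_def
proof (intro ito_L2_sum ito_L2_shift I q0)
 show "indicator (B m k) \<in> Fmeas (q m k)" for k
  using BF by simp
 show "bounded (indicat_real (B m k) ` space P)" for k
  by (intro boundedI[of _ 1]) (auto simp: indicator_def)
qed simp
\<comment> \<open>The index of the unique cell containing a finite value \<open>r\<close> of the
  stopping time.\<close>
define k0 where "k0 r m = nat \<lfloor>r * real (Suc m)\<rfloor>" for r m
have Bk: "w \<in> B m k \<longleftrightarrow> k = k0 r m"
 if "w \<in> space P" "\<rho> w = ennreal r" "0 <= r" for m k w r
proof -
 have "w \<in> B m k \<longleftrightarrow> real k / real (Suc m) <= r & r < (real k + 1) / real (Suc m)"
  using that by (auto simp: B_def q_def ennreal_less_iff ennreal_le_iff)
 also have "... \<longleftrightarrow> real k <= r * real (Suc m) & r * real (Suc m) < real k + 1"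
  by (simp add: pos_divide_le_eq pos_less_divide_eq)
 also have "... \<longleftrightarrow> k = k0 r m"
  using that(3) unfolding k0_def by (auto intro!: nat_eq_iff[THEN iffD2] sym[OF floor_unique]) linarith+
 finally show ?thesis .
qed
have top: "indicator (B m k) w = (0::real)" if "\<rho> w = top" for m k w
 using that by (simp add: B_def indicator_def)
have Hn_top: "Hn m s w = 0" and In_top: "In m s w = 0" if "\<rho> w = top" for m s w
 unfolding Hn_def In_def by (intro sum.neutral ballI; simp only: top[OF that] mult_zero_left scaleR_zero_left)+
have Hn_real: "Hn m s w = (if k0 r m < Suc m * Suc m & q m (k0 r m) < s then H s w else 0)"
 and In_real: "In m s w = (if k0 r m < Suc m * Suc m then I s w - I (min s (q m (k0 r m))) w else 0)"
 if "w \<in> space P" "\<rho> w = ennreal r" "0 <= r" for m w r s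
proof -
 have "Hn m s w = (\<Sum>k<Suc m * Suc m. if k = k0 r m then (if q m k < s then H s w else 0) else 0)"
  unfolding Hn_def using Bk[OF that] by (intro sum.cong) (auto simp: indicator_def)
 also have "... = (if k0 r m < Suc m * Suc m & q m (k0 r m) < s then H s w else 0)"
  by (simp only: sum.delta finite_lessThan lessThan_iff if_bool_eq_conj) auto
 finally show "Hn m s w = (if k0 r m < Suc m * Suc m & q m (k0 r m) < s then H s w else 0)" .
 have "In m s w = (\<Sum>k<Suc m * Suc m. if k = k0 r m then I s w - I (min s (q m k)) w else 0)"
  unfolding In_def using Bk[OF that] by (intro sum.cong) (auto simp: indicator_def)
 thus "In m s w = (if k0 r m < Suc m * Suc m then I s w - I (min s (q m (k0 r m))) w else 0)"
  by (simp only: sum.delta finite_lessThan lessThan_iff)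
qed
have q_gt: "r < q m (k0 r m)" and q_le: "q m (k0 r m) <= r + 1 / real (Suc m)" if "0 <= r" for r m
proof -
 have "real (k0 r m) = of_int \<lfloor>r * real (Suc m)\<rfloor>" using that by (simp add: k0_def)
 hence *: "real (k0 r m) <= r * real (Suc m)" "r * real (Suc m) < real (k0 r m) + 1" by linarith+
 have "r + 1 / real (Suc m) = (r * real (Suc m) + 1) / real (Suc m)"
  by (simp add: add_divide_distrib del: of_nat_Suc)
 with * show "r < q m (k0 r m)" "q m (k0 r m) <= r + 1 / real (Suc m)"
  by (simp_all add: q_def pos_less_divide_eq divide_right_mono del: of_nat_Suc)
qed
have q_lim: "(%m. q m (k0 r m)) ----> r" if "0 <= r" for r
proof (rule tendsto_sandwich[of "%_. r" _ _ "%m. r + 1 / real (Suc m)"])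
 show "(%m. r + 1 / real (Suc m)) ----> r"
  using tendsto_add[OF tendsto_const LIMSEQ_Suc[OF lim_1_over_n], of r] by simp
qed (use q_gt[OF that] q_le[OF that] in \<open>auto intro!: always_eventually less_imp_le\<close>)
have k0_lt: "\<forall>\<^sub>F m in sequentially. k0 r m < Suc m * Suc m" if "0 <= r" for r
proof -
 obtain M where "r < real M" using reals_Archimedean2 by blast
 hence "k0 r m < Suc m * Suc m" if "M <= m" for m
 proof -
  have "r * real (Suc m) < real (Suc m) * real (Suc m)"
   using \<open>r < real M\<close> that by (intro mult_strict_right_mono) auto
  hence "\<lfloor>r * real (Suc m)\<rfloor> < int (Suc m * Suc m)"
   by (simp add: floor_less_iff del: mult_Suc mult_Suc_right of_nat_Suc)
  hence "nat \<lfloor>r * real (Suc m)\<rfloor> < nat (int (Suc m * Suc m))"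
   by (subst nat_mono_iff) (simp_all only: of_nat_0_less_iff zero_less_Suc nat_0_less_mult_iff)
  thus ?thesis unfolding k0_def by (simp only: nat_int)
 qed
 thus ?thesis by (auto simp: eventually_sequentially)
qed
have lim: "(%m. Hn m s w) ----> ?H s w" if s: "0 <= s" and w: "w \<in> space P" for s w
proof (cases "\<rho> w")
 case (real r)
 show ?thesis
 proof (cases "r < s")
  case True
  have "\<forall>\<^sub>F m in sequentially. q m (k0 r m) < s"
   using order_tendstoD(2)[OF q_lim[OF real(1)] True] .
  with k0_lt[OF real(1)] have "\<forall>\<^sub>F m in sequentially. Hn m s w = ?H s w"
   by eventually_elim (use True Hn_real[OF w real(2,1)] real in \<open>auto simp: ennreal_less_iff\<close>)
  thus ?thesis by (rule tendsto_eventually)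
 next
  case False
  hence "Hn m s w = ?H s w" for m
   using Hn_real[OF w real(2,1), of m s] q_gt[OF real(1), of m] real by (auto simp: ennreal_less_iff)
  thus ?thesis by simp
 qed
next
 case top
 thus ?thesis by (simp add: Hn_top)
qed
show ?thesis
proof (rule ito_L2_limit[OF ito])
 show pr: "progressive F ?H"
  by (rule progressive_LIMSEQ[OF ito_L2D(1)[OF ito]]) (rule lim)
 show "AE w in P. continuous_on {0..} (%t. ?I t w)"
  using ito_L2D(3)[OF I]
  by eventually_elim (intro continuous_on_diff continuous_on_stopped)
 fix T :: real assume T: "0 <= T"
 show "(%n. time_L2 P T (%s w. Hn n s w - ?H s w)) ----> 0"
 proof (rule time_L2_dominated[OF _ ito_L2_joint[OF I] ito_L2D(4)[OF I T]])
  show "joint P (%s w. Hn n s w - ?H s w)" for n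
   by (intro joint_diff ito_L2_joint[OF ito] progressive_joint pr)
  show "AE w in P. ALL s:{0..T}. norm (Hn n s w - ?H s w) <= norm (H s w)" for n
  proof (rule AE_I2, rule ballI)
   fix s w assume w: "w \<in> space P"
   show "norm (Hn n s w - ?H s w) <= norm (H s w)"
    by (cases "\<rho> w") (auto simp: Hn_real[OF w] Hn_top)
  qed
  show "AE w in P. AE s in lborel. s \<in> {0..T} --> (%n. Hn n s w - ?H s w) ----> 0"
   using lim by (intro AE_I2 impI LIM_zero) auto
 qed
next
 fix t :: real assume t: "0 <= t"
 show "AE w in P. (%n. In n t w) ----> ?I t w"
  using AE_space ito_L2D(3)[OF I]
 proof eventually_elim
  case (elim w)
  show ?case
  proof (cases "\<rho> w")
   case (real r)
   have "((%s. I s w) ---> I (min t r) w) (at (min t r) within {0..})"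
    using elim(2) t real(1) by (auto simp: continuous_on_def)
   moreover have "(%m. min t (q m (k0 r m))) ----> min t r"
    using q_lim[OF real(1)] by (intro tendsto_intros)
   ultimately have "(%m. I (min t (q m (k0 r m))) w) ----> I (min t r) w"
    using continuous_on_tendsto_compose[OF elim(2), of "%m. min t (q m (k0 r m))" "min t r" sequentially] t q0 real(1) by auto
   hence "(%m. I t w - I (min t (q m (k0 r m))) w) ----> ?I t w"
    using t real by (intro tendsto_intros) (auto simp: stop_time_real[where r=r])
   moreover have "\<forall>\<^sub>F m in sequentially. I t w - I (min t (q m (k0 r m))) w = In m t w"
    using k0_lt[OF real(1)] by eventually_elim (simp add: In_real[OF elim(1) real(2,1)])
   ultimately show ?thesis by (rule Lim_transform_eventually)
  next
   case top
   thus ?thesis using t by (simp add: In_top stop_time_top)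
  qed
 qed
qed
qed

text \<open>The part of the integral after \<rho> has a vanishing integrand, hence is zero at each
  fixed time by the isometry. Continuity of paths upgrades this from rational times to all times at
  once.\<close>

lemma ito_L2_const_after:
assumes I: "ito_L2 P F W H I" and \<rho>: "stopping_time F \<rho>"
 and H: "!!s w. 0 <= s ==> w \<in> space P ==> \<rho> w < ennreal s ==> H s w = 0"
shows "AE w in P. ALL t>=0. I t w = I (stop_time \<rho> t w) w"
proof -
note S = ito_L2_stop[OF I \<rho>]
have *: "AE w in P. I t w = I (stop_time \<rho> t w) w" if t: "0 <= t" for t
proof -
 have "time_L2 P t (%s w. if \<rho> w < ennreal s then H s w else 0) = time_L2 P t (%_ _. 0 :: real^'p)"
  using H by (intro time_L2_cong) auto
 hence "(EE w. ennreal ((I t w - I (stop_time \<rho> t w) w)^2)) = 0"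
  using ito_L2_isometry[OF S t] by (simp add: time_L2_def)
 thus ?thesis
  using ito_L2_measurable_P[OF S t] by (subst (asm) nn_integral_0_iff_AE) auto
qed
hence "AE w in P. ALL t:\<rat> \<inter> {0..}. I t w = I (stop_time \<rho> t w) w"
 by (subst AE_ball_countable) (auto intro: countable_rat countable_subset)
thus ?thesis
 using ito_L2D(3)[OF I]
proof eventually_elim
 case (elim w)
 have cont: "continuous_on {0..} (%t. I t w - I (stop_time \<rho> t w) w)"
  using elim(2) by (intro continuous_on_diff continuous_on_stopped)
 have dense: "{0..} \<subseteq> closure (\<rat> \<inter> {0::real..})"
 proof
  fix x :: real assume x: "x \<in> {0..}"
  show "x \<in> closure (\<rat> \<inter> {0..})"
   unfolding closure_approachable
  proof (intro allI impI)
   fix e :: real assume "0 < e"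
   then obtain r where "r \<in> \<rat>" "x < r" "r < x + e" using Rats_dense_in_real[of x "x + e"] by auto
   thus "EX y:\<rat> \<inter> {0..}. dist y x < e" using x by (intro bexI[of _ r]) (auto simp: dist_real_def)
  qed
 qed
 show ?case
 proof (intro allI impI)
  fix t :: real assume t: "0 <= t"
  have "t \<in> closure (\<rat> \<inter> {0..})" using dense t by auto
  then obtain x where x: "!!n. x n \<in> \<rat> \<inter> {0..}" "x ----> t" by (auto simp: closure_sequential)
  have "(%n. I (x n) w - I (stop_time \<rho> (x n) w) w) ----> I t w - I (stop_time \<rho> t w) w"
   using continuous_on_tendsto_compose[OF cont x(2)] t x(1) by auto
  moreover have "(%n. I (x n) w - I (stop_time \<rho> (x n) w) w) = (%_. 0)"
   using elim(1) x(1) by auto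
  ultimately show "I t w = I (stop_time \<rho> t w) w"
   using LIMSEQ_unique[of "%_. 0" "I t w - I (stop_time \<rho> t w) w" 0] by simp
 qed
qed
qed

end

section \<open>From convergence in probability to convergence in mean square\<close>

context prob_space
begin

lemma nn_integral_tail:
assumes [measurable]: "h \<in> borel_measurable M" and fin: "(\<integral>\<^sup>+x. h x \<partial>M) < \<infinity>"
shows "(%n. \<integral>\<^sup>+x. h x * indicator {x. of_nat n < h x} x \<partial>M) ----> 0"
proof -
have "AE x in M. h x ~= \<infinity>" using fin by (intro nn_integral_PInf_AE) auto
hence "AE x in M. (%n. h x * indicator {x. of_nat n < h x} x) ----> 0"
proof eventually_elim
 case (elim x)
 then obtain N :: nat where "h x < of_nat N"
  using ennreal_Ex_less_of_nat[of "h x"] by (auto simp: top.not_eq_extremum)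
 hence "h x * indicator {x. of_nat n < h x} x = 0" if "N <= n" for n
  using that by (auto simp: indicator_def) (meson leD less_trans not_le of_nat_mono order.strict_trans1)
 thus ?case by (intro tendsto_eventually) (auto simp: eventually_sequentially)
qed
moreover have "AE x in M. h x * indicator {x. of_nat n < h x} x <= h x" for n
 by (intro AE_I2) (auto simp: indicator_def)
ultimately have "(%n. \<integral>\<^sup>+x. h x * indicator {x. of_nat n < h x} x \<partial>M) ----> (\<integral>\<^sup>+x. 0 \<partial>M)"
 using fin by (intro nn_integral_dominated_convergence[where w=h]) auto
thus ?thesis by simp
qed

text \<open>Absolute continuity of the integral: below the level \<open>n\<close> the integral over
  \<open>A m\<close> is at most \<open>n\<close> times its probability, above the level it is a tail
  independent of \<open>m\<close>.\<close>

lemma nn_integral_uniformly_small: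
fixes A :: "nat => 'a set"
assumes [measurable]: "h \<in> borel_measurable M" "!!m. A m \<in> sets M" and fin: "(\<integral>\<^sup>+x. h x \<partial>M) < \<infinity>"
 and lim: "(%m. prob (A m)) ----> 0" and ep: "0 < ep"
shows "\<forall>\<^sub>F m in sequentially. (\<integral>\<^sup>+x. h x * indicator (A m) x \<partial>M) <= ennreal ep"
proof -
have "\<forall>\<^sub>F n in sequentially. (\<integral>\<^sup>+x. h x * indicator {x. of_nat n < h x} x \<partial>M) < ennreal (ep / 2)"
 using ep by (intro order_tendstoD(2)[OF nn_integral_tail] fin) auto
then obtain n where n: "(\<integral>\<^sup>+x. h x * indicator {x. of_nat n < h x} x \<partial>M) < ennreal (ep / 2)"
 by (auto simp: eventually_sequentially)
have "(%m. real n * prob (A m)) ----> real n * 0" using lim by (intro tendsto_intros)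
hence "\<forall>\<^sub>F m in sequentially. real n * prob (A m) < ep / 2"
 using ep by (intro order_tendstoD(2)) auto
thus ?thesis
proof eventually_elim
 case (elim m)
 have "(\<integral>\<^sup>+x. h x * indicator (A m) x \<partial>M) <=
  (\<integral>\<^sup>+x. of_nat n * indicator (A m) x + h x * indicator {x. of_nat n < h x} x \<partial>M)"
  by (intro nn_integral_mono) (auto simp: indicator_def not_less)
 also have "... = of_nat n * emeasure M (A m) + (\<integral>\<^sup>+x. h x * indicator {x. of_nat n < h x} x \<partial>M)"
  by (subst nn_integral_add) (auto simp: nn_integral_cmult_indicator)
 also have "of_nat n * emeasure M (A m) = ennreal (real n * prob (A m))"
  by (simp add: emeasure_eq_measure ennreal_mult' ennreal_of_nat_eq_real_of_nat)
 also have "ennreal (real n * prob (A m)) + (\<integral>\<^sup>+x. h x * indicator {x. of_nat n < h x} x \<partial>M) <= ennreal (ep / 2) + ennreal (ep / 2)"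
  using elim n by (intro add_mono ennreal_leI) auto
 also have "... = ennreal ep" using ep by (simp add: ennreal_plus[symmetric] del: ennreal_plus)
 finally show ?case .
qed
qed

lemma prob_tail:
assumes [measurable]: "h \<in> borel_measurable M" and fin: "(\<integral>\<^sup>+x. h x \<partial>M) < \<infinity>"
shows "(%n. prob {x\<in>space M. of_nat n < h x}) ----> 0"
proof -
have "(%n. prob {x\<in>space M. of_nat n < h x}) ----> prob (\<Inter>n. {x\<in>space M. of_nat n < h x})"
 by (intro finite_Lim_measure_decseq) (auto simp: decseq_def intro: le_less_trans[OF of_nat_mono])
moreover have "prob (\<Inter>n. {x\<in>space M. of_nat n < h x}) = 0"
proof -
 have "AE x in M. h x ~= \<infinity>" using fin by (intro nn_integral_PInf_AE) auto
 hence "AE x in M. x \<notin> (\<Inter>n. {x\<in>space M. of_nat n < h x})"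
 proof eventually_elim
  case (elim x)
  then obtain N :: nat where "h x < of_nat N"
   using ennreal_Ex_less_of_nat[of "h x"] by (auto simp: top.not_eq_extremum)
  thus ?case by (auto intro!: exI[of _ N])
 qed
 thus ?thesis by (subst prob_eq_0) auto
qed
ultimately show ?thesis by simp
qed

text \<open>A subsequence converges almost surely, and Fatou's lemma along it preserves the mean
  square bound.\<close>

lemma nn_integral_square_limit_le:
fixes A :: "nat => 'a => real"
assumes [measurable]: "!!l. A l \<in> borel_measurable M" "A' \<in> borel_measurable M" "X \<in> borel_measurable M"
 and lim: "!!de. 0 < de ==> (%l. prob {x\<in>space M. de < abs (A l x - A' x)}) ----> 0"
 and le: "\<forall>\<^sub>F l in sequentially. (\<integral>\<^sup>+x. ennreal ((X x - A l x)^2) \<partial>M) <= e"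
shows "(\<integral>\<^sup>+x. ennreal ((X x - A' x)^2) \<partial>M) <= e"
proof -
obtain L where L: "!!l. L <= l ==> (\<integral>\<^sup>+x. ennreal ((X x - A l x)^2) \<partial>M) <= e"
 using le by (auto simp: eventually_sequentially)
\<comment> \<open>The rate \<open>(1/2)^k\<close> bounds both the size of the deviation and its
  probability, so that the exceptional events are summable.\<close>
have "EX l>=L. prob {x\<in>space M. (1/2) ^ k < abs (A l x - A' x)} < (1/2) ^ k" for k
proof -
 have "\<forall>\<^sub>F l in sequentially. prob {x\<in>space M. (1/2) ^ k < abs (A l x - A' x)} < (1/2) ^ k"
  by (rule order_tendstoD(2)[OF lim]) auto
 hence "\<forall>\<^sub>F l in sequentially. L <= l & prob {x\<in>space M. (1/2) ^ k < abs (A l x - A' x)} < (1/2) ^ k"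
  using eventually_ge_at_top by (rule eventually_conj[rotated])
 thus ?thesis by (auto simp: eventually_sequentially)
qed
hence "ALL k. EX l. L <= l & prob {x\<in>space M. (1/2) ^ k < abs (A l x - A' x)} < (1/2) ^ k"
 by blast
from choice[OF this] obtain s where s: "!!k. L <= s k"
 "!!k. prob {x\<in>space M. (1/2) ^ k < abs (A (s k) x - A' x)} < (1/2) ^ k"
 by blast
have "AE x in M. \<forall>\<^sub>F k in sequentially. x \<in> space M - {x\<in>space M. (1/2) ^ k < abs (A (s k) x - A' x)}"
proof (rule borel_cantelli_AE1)
 show "summable (%k. prob {x\<in>space M. (1/2) ^ k < abs (A (s k) x - A' x)})"
  by (rule summable_comparison_test'[OF summable_geometric[of "1/2::real"]]) (use s(2) in \<open>auto simp: less_imp_le\<close>)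
qed (auto simp: emeasure_eq_measure)
hence lim_AE: "AE x in M. (%k. A (s k) x) ----> A' x"
proof eventually_elim
 case (elim x)
 hence "\<forall>\<^sub>F k in sequentially. norm (A (s k) x - A' x) <= (1/2) ^ k"
  by eventually_elim auto
 hence "(%k. A (s k) x - A' x) ----> 0"
  by (rule Lim_null_comparison) (rule LIMSEQ_power_zero, simp)
 thus ?case by (simp add: LIM_zero_iff)
qed
have "(\<integral>\<^sup>+x. ennreal ((X x - A' x)^2) \<partial>M) <= (\<integral>\<^sup>+x. liminf (%k. ennreal ((X x - A (s k) x)^2)) \<partial>M)"
proof (rule nn_integral_mono_AE)
 show "AE x in M. ennreal ((X x - A' x)^2) <= liminf (%k. ennreal ((X x - A (s k) x)^2))"
  using lim_AE
 proof eventually_elim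
  case (elim x)
  hence "(%k. ennreal ((X x - A (s k) x)^2)) ----> ennreal ((X x - A' x)^2)"
   by (intro tendsto_intros tendsto_ennrealI)
  from lim_imp_Liminf[OF _ this] show ?case by simp
 qed
qed
also have "... <= liminf (%k. \<integral>\<^sup>+x. ennreal ((X x - A (s k) x)^2) \<partial>M)"
 by (rule nn_integral_liminf) measurable
also have "... <= e"
 using L s(1) by (intro Liminf_le) auto
finally show ?thesis .
qed

text \<open>Markov's inequality at the level \<open>ep\<close>.\<close>

lemma null_in_prob_of_nn_integral:
assumes [measurable]: "!!m. D m \<in> borel_measurable M" and lim: "(%m. \<integral>\<^sup>+x. D m x \<partial>M) ----> 0"
shows "null_in_prob M D"
unfolding null_in_prob_def
proof (intro allI impI)
fix ep :: real assume ep: "0 < ep"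
have le: "ennreal (prob {w\<in>space M. ennreal ep < D m w}) <= ennreal (1 / ep) * (\<integral>\<^sup>+x. D m x \<partial>M)" for m
proof -
 have "emeasure M {w\<in>space M. ennreal ep < D m w} <= emeasure M ({w\<in>space M. 1 <= ennreal (1 / ep) * D m w})"
 proof (rule emeasure_mono[rotated])
  show "{w\<in>space M. 1 <= ennreal (1 / ep) * D m w} \<in> sets M" by measurable
  show "{w\<in>space M. ennreal ep < D m w} \<subseteq> {w\<in>space M. 1 <= ennreal (1 / ep) * D m w}"
  proof safe
   fix w assume "ennreal ep < D m w"
   hence "ennreal (1 / ep) * ennreal ep <= ennreal (1 / ep) * D m w"
    by (intro mult_left_mono) (auto simp: less_imp_le)
   moreover have "ennreal (1 / ep) * ennreal ep = 1"
    using ep by (subst ennreal_mult'[symmetric]) auto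
   ultimately show "1 <= ennreal (1 / ep) * D m w" by (simp only:)
  qed
 qed
 also have "... <= ennreal (1 / ep) * (\<integral>\<^sup>+x\<in>space M. D m x \<partial>M)"
  using nn_integral_Markov_inequality[of "D m" "space M" M "ennreal (1 / ep)"] by simp
 also have "(\<integral>\<^sup>+x\<in>space M. D m x \<partial>M) = (\<integral>\<^sup>+x. D m x \<partial>M)" by (intro nn_integral_cong) simp
 finally show ?thesis by (simp add: emeasure_eq_measure)
qed
have "(%m. ennreal (1 / ep) * (\<integral>\<^sup>+x. D m x \<partial>M)) ----> ennreal (1 / ep) * 0"
 using lim by (intro ennreal_tendsto_cmult) auto
hence up: "(%m. ennreal (1 / ep) * (\<integral>\<^sup>+x. D m x \<partial>M)) ----> ennreal 0" by simp
have "(%m. ennreal (prob {w\<in>space M. ennreal ep < D m w})) ----> ennreal 0"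
 by (rule tendsto_sandwich[OF _ _ tendsto_const up]) (rule always_eventually, rule allI, (rule le | simp))+
thus "(%m. measure M {w\<in>space M. ennreal ep < D m w}) ----> 0"
 by (rule tendsto_ennrealD) simp_all
qed

end

text \<open>Partial sums of nonnegative terms never fall back below \<open>c\<close>, so the terms
  that are kept form an initial segment whose sum is at most \<open>c\<close>.\<close>

lemma truncated_sum_le:
fixes a :: "nat => real"
assumes "!!k. k < n ==> 0 <= a k" "0 <= c"
shows "(\<Sum>k<n. if (\<Sum>j\<le>k. a j) <= c then a k else 0) <= c"
using assms(1)
proof (induction n)
case (Suc n)
show ?case
proof (cases "(\<Sum>j\<le>n. a j) <= c")
 case True
 have "(\<Sum>k<Suc n. if (\<Sum>j\<le>k. a j) <= c then a k else 0) <= (\<Sum>k<Suc n. a k)"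
  using Suc.prems by (intro sum_mono) auto
 thus ?thesis using True by (simp add: lessThan_Suc_atMost)
qed (use Suc in auto)
qed (use assms(2) in simp)

section \<open>Truncation, and the equivalence of the two notions of integral\<close>

context brownian_basis
begin

text \<open>A cell is switched off if the energy up to and including that cell exceeds
  \<open>c\<close>. The value on the cell is known at its left end, so this decision is too, and the
  truncated integrand is still simple. Nothing changes on paths whose total energy is at most
  \<open>c\<close>.\<close>

lemma elementary_truncate:
assumes S: "simple_integrand F n r xi" and c: "0 <= c" and T: "0 <= T"
obtains S' J' where "elementary F W S' J'"
 "!!w. (NN s:{0..T}. nsq (S' s w)) <= ennreal c"
 "!!w. (NN s:{0..T}. nsq (simple_process n r xi s w)) <= ennreal c ==>
   (ALL s. S' s w = simple_process n r xi s w) & (ALL t. J' t w = simple_ito W n r xi t w)"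
proof -
define a where "a k w = (norm (xi k w))^2 * (min T (r (Suc k)) - min T (r k))" for k w
define xi' where "xi' k w = (if (\<Sum>j\<le>k. a j w) <= c then xi k w else 0)" for k w
have r: "r k <= r (Suc k)" if "k < n" for k using S that by (simp add: simple_integrand_def)
have a: "0 <= a k w" if "k < n" for k w
 unfolding a_def using r[OF that] by (intro mult_nonneg_nonneg) auto
have S': "simple_integrand F n r xi'"
 unfolding simple_integrand_def
proof (intro conjI allI impI)
 fix k assume k: "k < n"
 have xim: "xi j \<in> Fmeas (r k)" if "j <= k" for j
 proof (rule measurable_F_mono)
  show "xi j \<in> Fmeas (r j)" using S k that by (simp add: simple_integrand_def)
  show "ennreal (r j) <= ennreal (r k)" using simple_integrand_mono[OF S that] k by (intro ennreal_leI) simp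
 qed
 have "(%w. \<Sum>j\<le>k. a j w) \<in> Fmeas (r k)"
 proof (rule borel_measurable_sum)
  fix j assume "j \<in> {..k}"
  hence [measurable]: "xi j \<in> Fmeas (r k)" using xim by simp
  show "a j \<in> Fmeas (r k)" unfolding a_def by measurable
 qed
 thus "xi' k \<in> Fmeas (r k)"
  unfolding xi'_def by (intro measurable_If xim order_refl borel_measurable_const) (rule borel_measurable_le; simp)
 have "bounded (xi k ` space P)" using S k by (simp add: simple_integrand_def)
 then obtain B where "!!w. w \<in> space P ==> norm (xi k w) <= B" by (auto simp: bounded_iff)
 hence "norm (xi' k w) <= abs B" if "w \<in> space P" for w
  using that by (auto simp: xi'_def intro: order_trans[OF _ abs_ge_self])
 thus "bounded (xi' k ` space (F (ennreal (r k))))" by (auto simp: bounded_iff)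
qed (use S in \<open>auto simp: simple_integrand_def\<close>)
show thesis
proof (rule that)
 show "elementary F W (simple_process n r xi') (simple_ito W n r xi')"
  using S' by (auto simp: elementary_def)
 fix w
 have "(\<Sum>k<n. (norm (xi' k w))^2 * (min T (r (Suc k)) - min T (r k))) =
  (\<Sum>k<n. if (\<Sum>j\<le>k. a j w) <= c then a k w else 0)"
  by (intro sum.cong) (auto simp: xi'_def a_def)
 also have "... <= c" using a c by (intro truncated_sum_le) auto
 finally show "(NN s:{0..T}. nsq (simple_process n r xi' s w)) <= ennreal c"
  unfolding nn_integral_simple_process[OF S' T] by (rule ennreal_leI)
 assume "(NN s:{0..T}. nsq (simple_process n r xi s w)) <= ennreal c"
 hence *: "(\<Sum>k<n. a k w) <= c"
  unfolding nn_integral_simple_process[OF S T] using c by (simp add: ennreal_le_iff a_def)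
 have "(\<Sum>j\<le>k. a j w) <= c" if "k < n" for k
  using that a by (intro order_trans[OF sum_mono2 *]) auto
 hence "xi' k w = xi k w" if "k < n" for k using that by (simp add: xi'_def)
 thus "(ALL s. simple_process n r xi' s w = simple_process n r xi s w) & (ALL t. simple_ito W n r xi' t w = simple_ito W n r xi t w)"
  by (auto simp: simple_process_def simple_ito_def intro!: sum.cong)
qed
qed

text \<open>The approximants converge in probability only and may have uncontrolled second moments.
  Truncating their energy at a level rarely reached by that of \<open>H\<close> gives mean square
  convergence, while the integrals are altered on events of small probability only.\<close>

lemma ito_L2_of_ito_integral:
assumes I: "ito_integral P F W H I" and fin: "!!T. 0 <= T ==> time_L2 P T H < \<infinity>"
shows "ito_L2 P F W H I"
proof -
obtain n r xi where S: "!!m. simple_integrand F (n m) (r m) (xi m)"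
 and D: "!!T. 0 <= T ==> null_in_prob P (%m w. (NN s:{0..T}. nsq (simple_process (n m) (r m) (xi m) s w - H s w)))"
 and E: "!!t. 0 <= t ==> null_in_prob P (%m w. ennreal (abs (simple_ito W (n m) (r m) (xi m) t w - I t w)))"
 and pr: "progressive F H" and ad: "adapted F I" and cont: "AE w in P. continuous_on {0..} (%t. I t w)"
 using I unfolding ito_integral_def by blast
note jH = progressive_joint[OF pr]
have el: "elementary F W (simple_process (n m) (r m) (xi m)) (simple_ito W (n m) (r m) (xi m))" for m
 using S by (auto simp: elementary_def)
note jS = elementary_joint[OF el]
have Im: "I t \<in> borel_measurable P" if "0 <= t" for t
 using ad that by (auto simp: adapted_def intro: measurable_F_P)
have "EX S J. elementary F W S J & time_L2 P T (%s w. S s w - H s w) <= ennreal ep &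
   (ALL t:{0..T}. (EE w. ennreal ((J t w - I t w)^2)) <= ennreal ep)" if T: "0 <= T" and ep: "0 < ep" for T ep
proof -
 define h where "h w = (NN s:{0..T}. nsq (H s w))" for w
 define d where "d m w = (NN s:{0..T}. nsq (simple_process (n m) (r m) (xi m) s w - H s w))" for m w
 define e where "e m w = (NN s:{0..T}. nsq (simple_process (n m) (r m) (xi m) s w))" for m w
 have hm [measurable]: "h \<in> borel_measurable P" unfolding h_def by (rule joint_inner_measurable[OF jH])
 have dm [measurable]: "d m \<in> borel_measurable P" for m
  unfolding d_def by (rule joint_inner_measurable[OF joint_diff[OF jS jH]])
 have em [measurable]: "e m \<in> borel_measurable P" for m
  unfolding e_def by (rule joint_inner_measurable[OF jS])
 have hfin: "(EE w. h w) < \<infinity>" using fin[OF T] by (simp add: time_L2_def h_def)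
 have inner_le: "(NN s:{0..T}. nsq (A s w - B s w)) <=
   2 * (NN s:{0..T}. nsq (A s w)) + 2 * (NN s:{0..T}. nsq (B s w))"
  if "joint P A" "joint P B" "w \<in> space P" for A B :: "real => 'w => real^'p" and w
 proof -
  have "(NN s:{0..T}. nsq (A s w - B s w)) <=
    (\<integral>\<^sup>+s. 2 * (nsq (A s w) * indicator {0..T} s) + 2 * (nsq (B s w) * indicator {0..T} s) \<partial>lborel)"
  proof (rule nn_integral_mono)
   fix s :: real
   have "nsq (A s w - B s w) <= ennreal (2 * (norm (A s w))^2 + 2 * (norm (B s w))^2)"
    using norm_add_power2_le[of 1 "A s w" "- B s w"] by (intro ennreal_leI) simp
   also have "... = 2 * nsq (A s w) + 2 * nsq (B s w)"
    by (simp add: ennreal_mult')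
   finally show "nsq (A s w - B s w) * indicator {0..T} s <=
    2 * (nsq (A s w) * indicator {0..T} s) + 2 * (nsq (B s w) * indicator {0..T} s)"
    by (simp add: indicator_def)
  qed
  also have "... = 2 * (NN s:{0..T}. nsq (A s w)) + 2 * (NN s:{0..T}. nsq (B s w))"
   using joint_section_nn[OF that(1,3)] joint_section_nn[OF that(2,3)]
   by (subst nn_integral_add) (auto simp: nn_integral_cmult)
  finally show ?thesis .
 qed
 have Dlim: "(%m. prob {w\<in>space P. ennreal \<kappa> < d m w}) ----> 0" if "0 < \<kappa>" for \<kappa>
  using D[OF T] that by (simp add: null_in_prob_def d_def)
 have approx: "EX m>=l. EX S' J'. elementary F W S' J' & time_L2 P T (%s w. S' s w - H s w) <= ennreal ep &
   (ALL t. prob {w\<in>space P. J' t w ~= simple_ito W (n m) (r m) (xi m) t w} <= ep)"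
  if ep: "0 < ep" for ep l
 proof -
  have "\<forall>\<^sub>F n in sequentially. (EE x. h x * indicator {x. of_nat n < h x} x) < ennreal (ep / 3 / 10)"
   using ep by (intro order_tendstoD(2)[OF nn_integral_tail] hfin) auto
  moreover have "\<forall>\<^sub>F n in sequentially. prob {x\<in>space P. of_nat n < h x} < ep / 2"
   using ep by (intro order_tendstoD(2)[OF prob_tail] hfin) auto
  ultimately have "\<forall>\<^sub>F n in sequentially. (EE x. h x * indicator {x. of_nat n < h x} x) < ennreal (ep / 3 / 10)
    & prob {x\<in>space P. of_nat n < h x} < ep / 2 & 1 <= n"
   using eventually_ge_at_top[of 1] by eventually_elim auto
  then obtain N where N: "(EE x. h x * indicator {x. of_nat N < h x} x) < ennreal (ep / 3 / 10)"
   "prob {x\<in>space P. of_nat N < h x} < ep / 2" "1 <= N"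
   by (auto simp: eventually_sequentially)
  define \<kappa> where "\<kappa> = min (ep / 3) (real N)"
  have \<kappa>: "0 < \<kappa>" "\<kappa> <= ep / 3" "\<kappa> <= real N" using ep N(3) by (auto simp: \<kappa>_def)
  \<comment> \<open>If \<open>d m w\<close> is at most \<kappa>, hence at most \<open>N\<close>, and
    \<open>h w\<close> is at most \<open>N\<close>, then the energy of the approximant is at most
    \<open>2 N + 2 N\<close>, so the truncation leaves this path alone.\<close>
  define c where "c = 4 * real N"
  have "\<forall>\<^sub>F m in sequentially. (EE w. (2 * ennreal c + 2 * h w) * indicator {w\<in>space P. ennreal \<kappa> < d m w} w) <= ennreal (ep / 3)"
  proof (rule nn_integral_uniformly_small)
   have "(EE w. 2 * ennreal c + 2 * h w) = 2 * ennreal c + 2 * (EE w. h w)"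
    by (subst nn_integral_add) (auto simp: nn_integral_cmult emeasure_space_1)
   also have "... < \<infinity>" using hfin by (auto simp: ennreal_mult_less_top)
   finally show "(EE w. 2 * ennreal c + 2 * h w) < \<infinity>" .
  qed (use Dlim \<kappa>(1) ep in \<open>auto\<close>)
  moreover have "\<forall>\<^sub>F m in sequentially. prob {w\<in>space P. ennreal \<kappa> < d m w} < ep / 2"
   using ep by (intro order_tendstoD(2)[OF Dlim[OF \<kappa>(1)]]) auto
  ultimately have "\<forall>\<^sub>F m in sequentially. (EE w. (2 * ennreal c + 2 * h w) * indicator {w\<in>space P. ennreal \<kappa> < d m w} w) <= ennreal (ep / 3)
    & prob {w\<in>space P. ennreal \<kappa> < d m w} < ep / 2 & l <= m"
   using eventually_ge_at_top[of l] by eventually_elim auto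
  then obtain m where m: "(EE w. (2 * ennreal c + 2 * h w) * indicator {w\<in>space P. ennreal \<kappa> < d m w} w) <= ennreal (ep / 3)"
   "prob {w\<in>space P. ennreal \<kappa> < d m w} < ep / 2" "l <= m"
   by (auto simp: eventually_sequentially)
  obtain S' J' where S': "elementary F W S' J'"
   "!!w. (NN s:{0..T}. nsq (S' s w)) <= ennreal c"
   "!!w. e m w <= ennreal c ==>
     (ALL s. S' s w = simple_process (n m) (r m) (xi m) s w) & (ALL t. J' t w = simple_ito W (n m) (r m) (xi m) t w)"
   using elementary_truncate[OF S[of m], of c T] T unfolding e_def by (auto simp: c_def)
  have e_le: "e m w <= ennreal c" if w: "w \<in> space P" and "~ ennreal \<kappa> < d m w" "~ of_nat N < h w" for w
  proof -
   have "e m w <= 2 * d m w + 2 * h w"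
    using inner_le[OF joint_diff[OF jS[of m] jH] joint_cmult[OF jH, of "- 1"] w]
    by (simp add: e_def d_def h_def)
   also have "... <= 2 * ennreal (real N) + 2 * ennreal (real N)"
    using that \<kappa>(3) by (intro add_mono mult_left_mono) (auto simp: not_less ennreal_of_nat_eq_real_of_nat intro: order_trans[OF _ ennreal_leI])
   also have "... = ennreal c"
    by (simp add: c_def ennreal_mult' ennreal_plus[symmetric] del: ennreal_plus) (simp add: ennreal_mult'[symmetric] mult_2[symmetric])
   finally show ?thesis .
  qed
  \<comment> \<open>The three summands belong to the three cases: no truncation, a bad
    approximation, and large energy of \<open>H\<close>. In the last case \<open>2 c = 8 N\<close>
    is below \<open>8 h\<close>, whence the factor 10, matched by the tail bound
    \<open>ep / 3 / 10\<close>.\<close>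
  have g: "(NN s:{0..T}. nsq (S' s w - H s w)) <=
    ennreal \<kappa> + (2 * ennreal c + 2 * h w) * indicator {w\<in>space P. ennreal \<kappa> < d m w} w
    + 10 * (h w * indicator {x. of_nat N < h x} w)" (is "?g <= ?R") if w: "w \<in> space P" for w
  proof -
   have "?g <= 2 * (NN s:{0..T}. nsq (S' s w)) + 2 * h w"
    unfolding h_def by (rule inner_le[OF elementary_joint[OF S'(1)] jH w])
   hence le2: "?g <= 2 * ennreal c + 2 * h w"
    by (rule order_trans) (intro add_mono mult_left_mono S'(2); simp)
   consider "ennreal \<kappa> < d m w" | "of_nat N < h w" | "~ ennreal \<kappa> < d m w" "~ of_nat N < h w" by blast
   thus ?thesis
   proof cases
    case 1
    thus ?thesis using le2 w by (auto intro: order_trans add_increasing add_increasing2)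
   next
    case 2
    have "2 * ennreal c = 8 * of_nat N"
     by (simp add: c_def ennreal_mult' ennreal_of_nat_eq_real_of_nat mult.assoc[symmetric])
    also have "... <= 8 * h w" using 2 by (intro mult_left_mono) auto
    finally have "2 * ennreal c + 2 * h w <= 8 * h w + 2 * h w" by (rule add_right_mono)
    also have "... = 10 * h w" by (simp add: distrib_right[symmetric])
    finally show ?thesis using le2 2 by (auto intro: order_trans add_increasing add_increasing2)
   next
    case 3
    hence "?g = d m w" using S'(3)[OF e_le[OF w 3]] by (simp add: d_def)
    hence "?g <= ennreal \<kappa>" using 3 by (simp add: not_less)
    thus ?thesis by (simp add: add_increasing2 add.assoc)
   qed
  qed
  have "time_L2 P T (%s w. S' s w - H s w) <= (EE w. ennreal \<kappa> +
   ((2 * ennreal c + 2 * h w) * indicator {w\<in>space P. ennreal \<kappa> < d m w} w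
    + 10 * (h w * indicator {x. of_nat N < h x} w)))"
   unfolding time_L2_def using g by (intro nn_integral_mono) (simp add: add.assoc)
  also have "... = ennreal \<kappa> + ((EE w. (2 * ennreal c + 2 * h w) * indicator {w\<in>space P. ennreal \<kappa> < d m w} w)
    + 10 * (EE w. h w * indicator {x. of_nat N < h x} w))"
   by (simp add: nn_integral_add nn_integral_cmult emeasure_space_1)
  also have "... <= ennreal (ep / 3) + (ennreal (ep / 3) + ennreal 10 * ennreal (ep / 3 / 10))"
   using \<kappa> m(1) N(1) by (intro add_mono ennreal_leI mult_mono) auto
  also have "... = ennreal ep"
   using ep by (simp add: ennreal_mult'[symmetric] ennreal_plus[symmetric] del: ennreal_plus ennreal_numeral)
  finally have *: "time_L2 P T (%s w. S' s w - H s w) <= ennreal ep" .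
  have "prob {w\<in>space P. J' t w ~= simple_ito W (n m) (r m) (xi m) t w} <= ep" for t
  proof -
  have "prob {w\<in>space P. J' t w ~= simple_ito W (n m) (r m) (xi m) t w} <=
   prob ({w\<in>space P. ennreal \<kappa> < d m w} \<union> {w\<in>space P. of_nat N < h w})"
   using e_le S'(3) by (intro finite_measure_mono) auto
  also have "... <= prob {w\<in>space P. ennreal \<kappa> < d m w} + prob {w\<in>space P. of_nat N < h w}"
   by (rule measure_Un_le) auto
  also have "... <= ep" using m(2) N(2) by simp
  finally show ?thesis .
  qed
  thus ?thesis using * S'(1) m(3) by blast
 qed
 \<comment> \<open>The condition \<open>l <= m\<close> forces the chosen indices to infinity, so
   that convergence in probability passes to them.\<close>
 define good where "good l m S' J' \<longleftrightarrow> l <= m & elementary F W S' J' & time_L2 P T (%s w. S' s w - H s w) <= ennreal (1 / real (Suc l)) &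
   (ALL t. prob {w\<in>space P. J' t w ~= simple_ito W (n m) (r m) (xi m) t w} <= 1 / real (Suc l))" for l m S' J'
 have "ALL l. EX m S' J'. good l m S' J'"
  unfolding good_def using approx[of "1 / real (Suc _)"] by (meson of_nat_0_less_iff zero_less_Suc zero_less_divide_1_iff)
 from choice[OF this] obtain m where "ALL l. EX S' J'. good l (m l) S' J'" by blast
 from choice[OF this] obtain S' where "ALL l. EX J'. good l (m l) (S' l) J'" by blast
 from choice[OF this] obtain J' where good: "!!l. good l (m l) (S' l) (J' l)" by blast
 have S': "!!l. l <= m l" "!!l. elementary F W (S' l) (J' l)"
  "!!l. time_L2 P T (%s w. S' l s w - H s w) <= ennreal (1 / real (Suc l))"
  "!!l t. prob {w\<in>space P. J' l t w ~= simple_ito W (n (m l)) (r (m l)) (xi (m l)) t w} <= 1 / real (Suc l)"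
  using good unfolding good_def by blast+
 obtain l where l: "1 / real (Suc l) < ep / 4" using nat_approx_posE[of "ep / 4"] ep by auto
 have l4: "time_L2 P T (%s w. S' k s w - H s w) <= ennreal (ep / 4)" if "l <= k" for k
 proof -
  have "1 / real (Suc k) <= 1 / real (Suc l)" using that by (intro divide_left_mono) auto
  thus ?thesis using l by (intro order_trans[OF S'(3)] ennreal_leI) simp
 qed
 show ?thesis
 proof (intro exI conjI ballI)
  show "elementary F W (S' l) (J' l)" by (rule S'(2))
  show "time_L2 P T (%s w. S' l s w - H s w) <= ennreal ep"
   using ep by (intro order_trans[OF l4[OF order_refl]] ennreal_leI) simp
  fix t assume "t \<in> {0..T}"
  hence t: "0 <= t" "t <= T" by auto
  note J'm = measurable_F_P[OF elementary_isometry(5)[OF S'(2) t(1)]]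
  show "(EE w. ennreal ((J' l t w - I t w)^2)) <= ennreal ep"
  \<comment> \<open>The truncated integrals still converge to \<open>I t\<close> in probability,
    since they differ from the original ones with probability at most \<open>1 / (k + 1)\<close>;
    their mutual mean square distances come from the isometry.\<close>
  proof (rule nn_integral_square_limit_le[of "%k. J' k t"])
   show "\<forall>\<^sub>F k in sequentially. (EE w. ennreal ((J' l t w - J' k t w)^2)) <= ennreal ep"
    using eventually_ge_at_top[of l]
   proof eventually_elim
    case (elim k)
    have "(EE w. ennreal ((J' l t w - J' k t w)^2)) = time_L2 P t (%s w. S' l s w - S' k s w)"
     by (rule elementary_isometry(1)[OF elementary_diff[OF S'(2) S'(2)] t(1)])
    also have "... <= time_L2 P T (%s w. S' l s w - S' k s w)" using t(2) by (rule time_L2_mono_time)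
    also have "... <= ennreal ep"
     using time_L2_diff_le2[OF joint_diff[OF elementary_joint[OF S'(2)[of l]] jH] joint_diff[OF elementary_joint[OF S'(2)[of k]] jH], of T]
      ennreal_quarters[OF l4[OF order_refl] l4[OF elim] ep] by simp
    finally show ?case .
   qed
   fix de :: real assume de: "0 < de"
   have [measurable]: "simple_ito W (n k) (r k) (xi k) t \<in> borel_measurable P" for k
    by (rule measurable_F_P[OF elementary_isometry(5)[OF el t(1)]])
   note [measurable] = J'm Im[OF t(1)]
   have lim0: "(%k. prob {w\<in>space P. de < abs (simple_ito W (n k) (r k) (xi k) t w - I t w)}) ----> 0"
    using E[OF t(1)] de by (simp add: null_in_prob_def ennreal_less_iff)
   have "(%k. prob {w\<in>space P. de < abs (simple_ito W (n (m k)) (r (m k)) (xi (m k)) t w - I t w)} + 1 / real (Suc k)) ----> 0 + 0"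
    by (intro tendsto_add filterlim_compose[OF lim0] filterlim_at_top_mono[OF filterlim_ident] LIMSEQ_Suc[OF lim_1_over_n])
     (use S'(1) in auto)
   hence up: "(%k. prob {w\<in>space P. de < abs (simple_ito W (n (m k)) (r (m k)) (xi (m k)) t w - I t w)} + 1 / real (Suc k)) ----> 0"
    by (simp only: add_0_right)
   show "(%k. prob {w\<in>space P. de < abs (J' k t w - I t w)}) ----> 0"
   proof (rule tendsto_sandwich[OF _ _ tendsto_const up])
    show "\<forall>\<^sub>F k in sequentially. prob {w\<in>space P. de < abs (J' k t w - I t w)} <=
     prob {w\<in>space P. de < abs (simple_ito W (n (m k)) (r (m k)) (xi (m k)) t w - I t w)} + 1 / real (Suc k)"
    proof (rule always_eventually, rule allI)
     fix k
     let ?N = "{w\<in>space P. J' k t w ~= simple_ito W (n (m k)) (r (m k)) (xi (m k)) t w}"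
     have "prob {w\<in>space P. de < abs (J' k t w - I t w)} <=
      prob ({w\<in>space P. de < abs (simple_ito W (n (m k)) (r (m k)) (xi (m k)) t w - I t w)} \<union> ?N)"
      by (intro finite_measure_mono) auto
     also have "... <= prob {w\<in>space P. de < abs (simple_ito W (n (m k)) (r (m k)) (xi (m k)) t w - I t w)} + prob ?N"
      by (rule measure_Un_le) auto
     also have "prob ?N <= 1 / real (Suc k)"
      by (rule S'(4))
     finally show "prob {w\<in>space P. de < abs (J' k t w - I t w)} <=
      prob {w\<in>space P. de < abs (simple_ito W (n (m k)) (r (m k)) (xi (m k)) t w - I t w)} + 1 / real (Suc k)" by simp
    qed
   qed auto
  qed (use J'm Im[OF t(1)] in auto)
 qed
qed
thus ?thesis using pr ad cont fin unfolding ito_L2_def by blast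
qed

text \<open>The way back, needed to exhibit integrals constructed here as integrals in the sense of
  the equations. The approximant number \<open>m\<close> is accurate to \<open>1 / (m + 1)\<close>
  on \<open>[0, m]\<close>, and Markov's inequality gives convergence in probability.\<close>

lemma ito_integral_of_ito_L2:
assumes I: "ito_L2 P F W H I"
shows "ito_integral P F W H I"
proof -
define good where "good m n r xi \<longleftrightarrow> simple_integrand F n r xi &
 time_L2 P (real m) (%s w. simple_process n r xi s w - H s w) <= ennreal (1 / real (Suc m)) &
 (ALL t:{0..real m}. (EE w. ennreal ((simple_ito W n r xi t w - I t w)^2)) <= ennreal (1 / real (Suc m)))" for m n r xi
have "EX n r xi. good m n r xi" for m
proof -
 obtain S J where SJ: "elementary F W S J"
  "time_L2 P (real m) (%s w. S s w - H s w) <= ennreal (1 / real (Suc m))"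
  "!!t. 0 <= t ==> t <= real m ==> (EE w. ennreal ((J t w - I t w)^2)) <= ennreal (1 / real (Suc m))"
  using ito_L2E[OF I, of "real m" "1 / real (Suc m)"] by (auto simp del: of_nat_Suc)
 obtain n r xi where "simple_integrand F n r xi" "S = simple_process n r xi" "J = simple_ito W n r xi"
  using SJ(1) unfolding elementary_def by blast
 hence "good m n r xi" using SJ(2,3) unfolding good_def by auto
 thus ?thesis by blast
qed
hence "ALL m. EX n r xi. good m n r xi" by blast
from choice[OF this] obtain n where "ALL m. EX r xi. good m (n m) r xi" by blast
from choice[OF this] obtain r where "ALL m. EX xi. good m (n m) (r m) xi" by blast
from choice[OF this] obtain xi where good: "!!m. good m (n m) (r m) (xi m)" by blast
have S: "simple_integrand F (n m) (r m) (xi m)" for m using good[of m] by (simp add: good_def)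
have el: "elementary F W (simple_process (n m) (r m) (xi m)) (simple_ito W (n m) (r m) (xi m))" for m
 using S by (auto simp: elementary_def)
have lim: "(%m. a m) ----> 0" if "!!m. T <= real m ==> a m <= ennreal (1 / real (Suc m))" for a :: "nat => ennreal" and T
proof (rule tendsto_sandwich[OF _ _ tendsto_const])
 have "(%m. ennreal (1 / real (Suc m))) ----> ennreal 0"
  by (intro tendsto_ennrealI LIMSEQ_Suc[OF lim_1_over_n])
 thus "(%m. ennreal (1 / real (Suc m))) ----> 0" by simp
 obtain N where "T <= real N" using real_arch_simple by blast
 hence "a m <= ennreal (1 / real (Suc m))" if "N <= m" for m
  using that by (intro \<open>!!m. T <= real m ==> a m <= ennreal (1 / real (Suc m))\<close>) simp
 thus "\<forall>\<^sub>F m in sequentially. a m <= ennreal (1 / real (Suc m))"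
  by (auto simp: eventually_sequentially)
qed simp
show ?thesis
 unfolding ito_integral_def
proof (intro conjI exI allI impI)
 show "progressive F H" "adapted F I" "AE w in P. continuous_on {0..} (%t. I t w)"
  using ito_L2D[OF I] by auto
 show "simple_integrand F (n m) (r m) (xi m)" for m by (rule S)
 fix T :: real assume T: "0 <= T"
 show "null_in_prob P (%m w. (NN s:{0..T}. nsq (simple_process (n m) (r m) (xi m) s w - H s w)))"
 proof (rule null_in_prob_of_nn_integral)
  show "(%w. (NN s:{0..T}. nsq (simple_process (n m) (r m) (xi m) s w - H s w))) \<in> borel_measurable P" for m
   by (intro joint_inner_measurable joint_diff elementary_joint[OF el] ito_L2_joint[OF I])
  have "time_L2 P T (%s w. simple_process (n m) (r m) (xi m) s w - H s w) <= ennreal (1 / real (Suc m))" if "T <= real m" for m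
   using good[of m] by (intro order_trans[OF time_L2_mono_time[OF that]]) (simp add: good_def)
  thus "(%m. (EE w. (NN s:{0..T}. nsq (simple_process (n m) (r m) (xi m) s w - H s w)))) ----> 0"
   unfolding time_L2_def by (rule lim)
 qed
next
 fix t :: real assume t: "0 <= t"
 have m: "(%w. simple_ito W (n m) (r m) (xi m) t w - I t w) \<in> borel_measurable P" for m
  by (intro borel_measurable_diff measurable_F_P[OF elementary_isometry(5)[OF el t]] ito_L2_measurable_P[OF I t])
 have "null_in_prob P (%m w. ennreal ((simple_ito W (n m) (r m) (xi m) t w - I t w)^2))"
 proof (rule null_in_prob_of_nn_integral)
  show "(%w. ennreal ((simple_ito W (n m) (r m) (xi m) t w - I t w)^2)) \<in> borel_measurable P" for m
   using m by measurable
  show "(%m. (EE w. ennreal ((simple_ito W (n m) (r m) (xi m) t w - I t w)^2))) ----> 0"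
   by (rule lim[of t]) (use good t in \<open>auto simp: good_def\<close>)
 qed
 thus "null_in_prob P (%m w. ennreal (abs (simple_ito W (n m) (r m) (xi m) t w - I t w)))"
  unfolding null_in_prob_def
 proof (intro allI impI)
  fix ep :: real assume *: "ALL ep>0. (%m. prob {w\<in>space P. ennreal ep < ennreal ((simple_ito W (n m) (r m) (xi m) t w - I t w)^2)}) ----> 0"
   and ep: "0 < ep"
  have "ennreal ep < ennreal (abs x) \<longleftrightarrow> ennreal (ep^2) < ennreal (x^2)" for x
   using ep abs_less_iff power_strict_mono[of ep "abs x" 2] power_mono[of "abs x" ep 2] by (auto simp: ennreal_less_iff not_less[symmetric])
  thus "(%m. prob {w\<in>space P. ennreal ep < ennreal (abs (simple_ito W (n m) (r m) (xi m) t w - I t w))}) ----> 0"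
   using *[rule_format, of "ep^2"] ep by simp
 qed
qed
qed

end

section \<open>A smooth version of the squared negative part\<close>

definition cut :: "nat => real => real" where
"cut k y = (max 0 y) ^ k / fact k"

text \<open>\<open>npart 1\<close> is \<open>min 1 (max 0 (- x))\<close> and each next index is a
  primitive up to sign. Thus \<open>npart 3\<close> has second derivative \<open>npart 1\<close>,
  bounded and Lipschitz; it is convex and decreasing, vanishes for \<open>x >= 0\<close>, and grows
  quadratically at minus infinity.\<close>

definition npart :: "nat => real => real" where
"npart k x = cut k (- x) - cut k (- x - 1)"

lemma cut_derivative: "(cut (Suc (Suc k)) has_real_derivative cut (Suc k) y) (at y)"
proof -
have fact: "real (Suc (Suc k)) * y ^ Suc k / fact (Suc (Suc k)) = y ^ Suc k / fact (Suc k)" for y :: real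
 by (simp add: fact_Suc[of "Suc k"] del: fact_Suc of_nat_Suc power_Suc)
consider "y < 0" | "y = 0" | "0 < y" by linarith
thus ?thesis
proof cases
 case 1
 have "\<forall>\<^sub>F z in nhds y. z < 0" using eventually_nhds_in_open[of "{..<0}" y] 1 by simp
 hence ev: "\<forall>\<^sub>F z in nhds y. 0 = cut (Suc (Suc k)) z"
  by eventually_elim (simp add: cut_def)
 have "((%_. 0) has_real_derivative 0) (at y)" by simp
 hence "(cut (Suc (Suc k)) has_real_derivative 0) (at y)"
  by (rule DERIV_cong_ev[OF refl ev refl, THEN iffD1])
 thus ?thesis using 1 by (simp add: cut_def)
next
 case 2
 have "(%h. (cut (Suc (Suc k)) (0 + h) - cut (Suc (Suc k)) 0) / h) \<midarrow>0\<rightarrow> 0"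
 proof (rule Lim_null_comparison)
  show "\<forall>\<^sub>F h in at 0. norm ((cut (Suc (Suc k)) (0 + h) - cut (Suc (Suc k)) 0) / h) <= abs h ^ Suc k"
  proof (rule eventually_at_filter[THEN iffD2], rule always_eventually, intro allI impI)
   fix h :: real assume "h ~= 0"
   have "cut (Suc (Suc k)) h <= (max 0 h) ^ Suc (Suc k)"
    using divide_left_mono[of 1 "fact (Suc (Suc k))" "(max 0 h) ^ Suc (Suc k)"] fact_ge_1[of "Suc (Suc k)"]
    by (simp add: cut_def del: fact_Suc power_Suc)
   also have "... <= abs h ^ Suc (Suc k)" by (intro power_mono) auto
   finally have "cut (Suc (Suc k)) h <= abs h ^ Suc (Suc k)" .
   moreover have "0 <= cut (Suc (Suc k)) h" by (simp add: cut_def)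
   ultimately have "abs (cut (Suc (Suc k)) h / h) <= abs h ^ Suc k"
    using \<open>h ~= 0\<close> by (simp add: divide_le_eq mult_ac)
   thus "norm ((cut (Suc (Suc k)) (0 + h) - cut (Suc (Suc k)) 0) / h) <= abs h ^ Suc k"
    by (simp add: cut_def)
  qed
  show "((%h::real. abs h ^ Suc k) ---> 0) (at 0)"
   by (auto intro!: tendsto_eq_intros)
 qed
 thus ?thesis using 2 by (simp add: DERIV_def cut_def)
next
 case 3
 have "((%y. y ^ Suc (Suc k) / fact (Suc (Suc k))) has_real_derivative real (Suc (Suc k)) * y ^ Suc k / fact (Suc (Suc k))) (at y)"
  using DERIV_cdivide[OF DERIV_pow[of "Suc (Suc k)" y]] by (simp del: fact_Suc of_nat_Suc power_Suc)
 moreover have "\<forall>\<^sub>F z in nhds y. 0 < z" using eventually_nhds_in_open[of "{0<..}" y] 3 by simp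
 hence "\<forall>\<^sub>F z in nhds y. z ^ Suc (Suc k) / fact (Suc (Suc k)) = cut (Suc (Suc k)) z"
  by eventually_elim (simp add: cut_def)
 ultimately have "(cut (Suc (Suc k)) has_real_derivative y ^ Suc k / fact (Suc k)) (at y)"
  unfolding fact by (rule DERIV_cong_ev[OF refl _ refl, THEN iffD1, rotated])
 thus ?thesis using 3 by (simp add: cut_def)
qed
qed

lemma npart_derivative: "(npart (Suc (Suc k)) has_real_derivative - npart (Suc k) x) (at x)"
unfolding npart_def
by (rule derivative_eq_intros DERIV_chain2[OF cut_derivative] refl | simp)+

lemma npart_cases:
"x >= 0 ==> npart (Suc k) x = 0"
"- 1 <= x ==> x <= 0 ==> npart (Suc k) x = (- x) ^ Suc k / fact (Suc k)"
"x <= - 1 ==> npart (Suc k) x = ((- x) ^ Suc k - (- x - 1) ^ Suc k) / fact (Suc k)"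
by (auto simp: npart_def cut_def max_def diff_divide_distrib)

lemma npart_1: "npart (Suc 0) x = min 1 (max 0 (- x))"
by (auto simp: npart_def cut_def)

lemma npart_2: "npart 2 x = (if x >= 0 then 0 else if - 1 <= x then x^2 / 2 else - x - 1 / 2)"
using npart_cases[of x 1] by (auto simp: numeral_2_eq_2 power2_eq_square algebra_simps add_divide_distrib)

lemma npart_3: "npart 3 x = (if x >= 0 then 0 else if - 1 <= x then (- x) ^ 3 / 6 else x^2 / 2 + x / 2 + 1 / 6)"
proof -
have "((- x) ^ 3 - (- x - 1) ^ 3) / 6 = x^2 / 2 + x / 2 + 1 / 6"
 by (simp add: power3_eq_cube power2_eq_square algebra_simps add_divide_distrib)
moreover have "fact 3 = (6::real)" by (simp add: fact_numeral)
ultimately show ?thesis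
 using npart_cases[of x 2] by (auto simp: numeral_3_eq_3)
qed

lemma npart_nonneg: "0 <= npart (Suc 0) x" "0 <= npart 2 x" "0 <= npart 3 x" "npart (Suc 0) x <= 1"
proof -
show "0 <= npart 3 x"
proof (cases "x >= 0 | - 1 <= x")
 case False
 have "0 <= (x + 1 / 2)^2" by simp
 thus ?thesis using False by (simp add: npart_3 power2_eq_square algebra_simps)
qed (auto simp: npart_3 intro!: divide_nonneg_nonneg zero_le_power)
qed (auto simp: npart_1 npart_2)

lemma npart_3_pos: "x < 0 ==> 0 < npart 3 x"
proof (cases "- 1 <= x")
case False
have "0 <= (x + 1 / 2)^2" by simp
thus ?thesis using False by (simp add: npart_3 power2_eq_square algebra_simps)
qed (auto simp: npart_3)

lemma npart_2_le: "npart 2 x <= abs x"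
proof (cases "x >= 0 | x < - 1")
case False
hence "x^2 <= - x * 1" using mult_left_mono[of "- x" 1 "- x"] by (simp add: power2_eq_square)
thus ?thesis using False by (simp add: npart_2)
qed (auto simp: npart_2)

lemma npart_3_le: "npart 3 x <= x^2"
proof (cases "x >= 0 | x < - 1")
case True
have "0 <= (x + 1 / 2)^2" by simp
thus ?thesis using True by (auto simp: npart_3 power2_eq_square algebra_simps)
next
case False
hence "(- x) ^ 3 <= (- x)^2" by (intro power_decreasing) auto
hence "- (x ^ 3) <= x^2" by simp
hence "- (x ^ 3) / 6 <= x^2" using zero_le_power2[of x] by linarith
thus ?thesis using False by (simp add: npart_3)
qed

text \<open>With phi = \<open>npart 3\<close> this bounds |phi' x| by 3 phi, with equality on
  \<open>[-1, 0]\<close>, where phi is a cubic. The 3 reappears in the Gronwall exponent.\<close>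

lemma npart_2_mult_le: "npart 2 x * abs x <= 3 * npart 3 x"
proof (cases "x >= 0 | - 1 <= x")
case False
have "0 <= (x + 1)^2" by simp
thus ?thesis using False by (simp add: npart_2 npart_3 power2_eq_square algebra_simps)
qed (auto simp: npart_2 npart_3 power3_eq_cube power2_eq_square)

lemma npart_2_square_le: "(npart 2 x)^2 <= 2 * (npart (Suc 0) x * npart 3 x)"
proof (cases "x >= 0 | - 1 <= x")
case True
show ?thesis
proof (cases "x >= 0")
 case False
 with True have *: "npart (Suc 0) x = - x" "npart 2 x = x^2 / 2" "npart 3 x = (- x) ^ 3 / 6"
  by (auto simp: npart_1 npart_2 npart_3)
 have "(x^2 / 2)^2 = x ^ 4 / 4" "2 * (- x * ((- x) ^ 3 / 6)) = x ^ 4 / 3"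
  by (simp_all add: power2_eq_square power3_eq_cube power4_eq_xxxx)
 moreover have "0 <= x ^ 4" by simp
 ultimately show ?thesis unfolding * by linarith
qed (auto simp: npart_2 npart_1)
qed (auto simp: npart_1 npart_2 npart_3 power2_eq_square algebra_simps)

lemma npart_3_antimono: "x <= y ==> npart 3 y <= npart 3 x"
proof (erule DERIV_nonpos_imp_nonincreasing)
fix z assume "x <= z" "z <= y"
show "EX d. DERIV (npart 3) z :> d & d <= 0"
 using npart_derivative[of 1 z] npart_nonneg(2)[of z] by (auto simp: numeral_3_eq_3 numeral_2_eq_2)
qed

lemma DERIV_linear_bound:
fixes f :: "real => real"
assumes "!!z. (f has_real_derivative f' z) (at z)" "!!z. abs z <= abs h ==> abs (f' z) <= B"
shows "abs (f h - f 0) <= B * abs h"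
proof -
have "norm (f h - f 0) <= B * norm (h - 0)"
 using assms by (intro field_differentiable_bound[of "cball 0 (abs h)" f f' B]) (auto intro: DERIV_subset)
thus ?thesis by simp
qed

text \<open>Two lower Taylor bounds. The cubic error comes from the Lipschitz second derivative; the
  quadratic one from convexity and the bound 1 on the second derivative, and suits increments with
  second moments only.\<close>

lemma npart_taylor:
"npart 3 x - npart 2 x * h + npart (Suc 0) x * h^2 / 2 - abs h ^ 3 <= npart 3 (x + h)"
"npart 3 x - npart 2 x * h + npart (Suc 0) x * h^2 / 2 - h^2 <= npart 3 (x + h)"
proof -
have d3: "(npart 3 has_real_derivative - npart 2 z) (at z)"
 and d2: "(npart 2 has_real_derivative - npart (Suc 0) z) (at z)" for z
 using npart_derivative[of 1 z] npart_derivative[of 0 z] by (simp_all add: numeral_3_eq_3 numeral_2_eq_2)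
have b2: "abs ((- npart 2 (x + z) + npart 2 x - npart (Suc 0) x * z)) <= abs z * abs z" for z
proof -
 have "abs ((- npart 2 (x + z) + npart 2 x - npart (Suc 0) x * z) - (- npart 2 (x + 0) + npart 2 x - npart (Suc 0) x * 0)) <= abs z * abs z"
 proof (rule DERIV_linear_bound[where f'="%y. npart (Suc 0) (x + y) - npart (Suc 0) x"])
  fix y
  show "((%y. - npart 2 (x + y) + npart 2 x - npart (Suc 0) x * y) has_real_derivative npart (Suc 0) (x + y) - npart (Suc 0) x) (at y)"
   by (rule derivative_eq_intros DERIV_chain2[OF d2] refl | simp)+
  assume "abs y <= abs z"
  thus "abs (npart (Suc 0) (x + y) - npart (Suc 0) x) <= abs z" by (auto simp: npart_1)
 qed
 thus ?thesis by simp
qed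
have "abs ((npart 3 (x + h) - npart 3 x + npart 2 x * h - npart (Suc 0) x * h^2 / 2) - (npart 3 (x + 0) - npart 3 x + npart 2 x * 0 - npart (Suc 0) x * 0^2 / 2)) <= (abs h * abs h) * abs h"
proof (rule DERIV_linear_bound[where f'="%y. - npart 2 (x + y) + npart 2 x - npart (Suc 0) x * y"])
 fix y
 show "((%y. npart 3 (x + y) - npart 3 x + npart 2 x * y - npart (Suc 0) x * y^2 / 2) has_real_derivative - npart 2 (x + y) + npart 2 x - npart (Suc 0) x * y) (at y)"
  by (rule derivative_eq_intros DERIV_chain2[OF d3] refl | simp)+
 assume "abs y <= abs h"
 thus "abs (- npart 2 (x + y) + npart 2 x - npart (Suc 0) x * y) <= abs h * abs h"
  by (intro order_trans[OF b2] mult_mono) auto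
qed
thus "npart 3 x - npart 2 x * h + npart (Suc 0) x * h^2 / 2 - abs h ^ 3 <= npart 3 (x + h)"
 by (simp add: power3_eq_cube abs_le_iff)
have lip: "abs (- npart 2 (x + z) + npart 2 x) <= abs z" for z
proof -
 have "abs ((- npart 2 (x + z) + npart 2 x) - (- npart 2 (x + 0) + npart 2 x)) <= 1 * abs z"
 proof (rule DERIV_linear_bound[where f'="%y. npart (Suc 0) (x + y)"])
  show "((%y. - npart 2 (x + y) + npart 2 x) has_real_derivative npart (Suc 0) (x + y)) (at y)" for y
   by (rule derivative_eq_intros DERIV_chain2[OF d2] refl | simp)+
 qed (auto simp: npart_1)
 thus ?thesis by simp
qed
have conv: "0 <= npart 3 (x + h) - npart 3 x + npart 2 x * h"
proof -
 obtain z where z: "abs z <= abs h" "0 <= z * h" "npart 3 (x + h) - npart 3 x = - npart 2 (x + z) * h"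
 proof (cases "h = 0")
  case False
  show ?thesis
  proof (cases "0 < h")
   case True
   then obtain z where "x < z" "z < x + h" "npart 3 (x + h) - npart 3 x = (x + h - x) * (- npart 2 z)"
    using MVT2[of x "x + h" "npart 3" "%z. - npart 2 z"] d3 by auto
   thus ?thesis using True by (intro that[of "z - x"]) auto
  next
   case h: False
   then obtain z where "x + h < z" "z < x" "npart 3 x - npart 3 (x + h) = (x - (x + h)) * (- npart 2 z)"
    using MVT2[of "x + h" x "npart 3" "%z. - npart 2 z"] d3 \<open>h ~= 0\<close> by auto
   thus ?thesis using h \<open>h ~= 0\<close> by (intro that[of "z - x"]) (auto simp: mult_nonpos_nonpos algebra_simps)
  qed
 qed (use that[of 0] in simp)
 have "0 <= (npart 2 x - npart 2 (x + z)) * h"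
 proof -
  have anti: "a <= b ==> npart 2 b <= npart 2 a" for a b
   by (rule DERIV_nonpos_imp_nonincreasing) (use d2 npart_nonneg(1) in force)+
  show ?thesis
  proof (cases "0 <= h")
   case True
   hence "0 <= z | h = 0" using z(2) by (auto simp: zero_le_mult_iff)
   thus ?thesis using True anti[of x "x + z"] by (cases "h = 0") (auto intro!: mult_nonneg_nonneg)
  next
   case False
   hence "z <= 0" using z(2) by (auto simp: zero_le_mult_iff)
   thus ?thesis using False anti[of "x + z" x] by (intro mult_nonpos_nonpos) auto
  qed
 qed
 thus ?thesis using z(3) by (simp add: algebra_simps)
qed
have "npart (Suc 0) x * h^2 / 2 <= h^2"
 using mult_right_mono[OF npart_nonneg(4)[of x], of "h^2"] zero_le_power2[of h] by linarith
thus "npart 3 x - npart 2 x * h + npart (Suc 0) x * h^2 / 2 - h^2 <= npart 3 (x + h)"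
 using conv by linarith
qed

text \<open>Splitting at \<open>abs a = de\<close> trades the third power for a small multiple of
  the second and a large multiple of the fourth, whose expectations are both available.\<close>

lemma cube_le:
fixes a :: real
assumes "0 < de"
shows "abs a ^ 3 <= de * a^2 + a ^ 4 / de"
proof (cases "abs a <= de")
case True
have "abs a ^ 3 = abs a * a^2" by (simp add: power3_eq_cube power2_eq_square)
also have "... <= de * a^2" using True by (intro mult_right_mono) auto
finally show ?thesis using assms by (simp add: add_increasing2)
next
case False
have "abs a ^ 3 * de <= abs a ^ 3 * abs a" using False by (intro mult_left_mono) auto
also have "... = a ^ 4" by (simp add: power3_eq_cube power4_eq_xxxx)
finally have "abs a ^ 3 <= a ^ 4 / de" using assms by (simp add: pos_le_divide_eq)
thus ?thesis using assms by (simp add: add_increasing)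
qed

text \<open>
One step of the grid: \<open>x\<close> moves to \<open>y\<close>, dominated by a martingale increment \<open>N\<close> (approximately \<open>a\<close>)
plus a drift.  As \<open>npart 3\<close> is decreasing, any further decrease of \<open>y\<close> is harmless.  The term
\<open>npart (Suc 0) x * N^2 / 2\<close> compensates the part \<open>R\<close> of the drift that depends on the integrand.
\<close>

lemma npart_step:
fixes x y N a U S Osc R V G de :: real
assumes de: "0 < de"
 and drift: "y - x - N <= U * abs x + Osc + R" "y - x - N <= U * S + R"
 and nonneg: "0 <= U" "0 <= Osc" "0 <= R" "0 <= V" "0 <= G" "0 <= S"
 and R: "R^2 <= V * G"
shows "npart 3 x + npart (Suc 0) x * N^2 / 2 - npart 2 x * N <=
 npart 3 y + (3 * U + V) * npart 3 x + npart (Suc 0) x * G / 2 + npart 2 x * Osc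
 + (de * N^2 + (8 + 1 / de) * (2 * (U * S)^2 + 2 * (V * G)) + 8 * (de * a^2 + a ^ 4 / de) + 8 * (N - a)^2)"
proof -
\<comment> \<open>\<open>B\<close> is the upward part of the drift. Replacing \<open>y\<close> by
  the larger value \<open>x + N + B\<close> only lowers \<open>npart 3\<close>.\<close>
define B where "B = max 0 (y - x - N)"
have B: "0 <= B" "y <= x + (N + B)" "B <= U * abs x + Osc + R" "B <= U * S + R"
 using drift nonneg by (auto simp: B_def)
have B2: "B^2 <= 2 * (U * S)^2 + 2 * (V * G)"
proof -
 have "B^2 <= (U * S + R)^2" using B by (intro power_mono) auto
 also have "... <= 2 * (U * S)^2 + 2 * R^2" using norm_add_power2_le[of 1 "U * S" R] by simp
 finally show ?thesis using R by linarith
qed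
let ?h = "N + B"
have rem: "npart 3 x - npart 2 x * ?h + npart (Suc 0) x * ?h^2 / 2 - (8 * (de * a^2 + a ^ 4 / de) + 8 * (N - a)^2 + 8 * B^2) <= npart 3 (x + ?h)"
\<comment> \<open>If the elementary increment \<open>a\<close> dominates, then \<open>abs ?h\<close>
  is at most \<open>2 * abs a\<close> and the cubic remainder is used, with \<open>2^3 = 8\<close>.
  Otherwise the step is governed by the error \<open>N - a\<close> and the drift, and the quadratic
  remainder is used.\<close>
proof (cases "abs a >= abs ((N - a) + B)")
 case True
 have "abs ?h ^ 3 <= (2 * abs a) ^ 3" using True by (intro power_mono) auto
 also have "... = 8 * abs a ^ 3" by (simp add: power_mult_distrib)
 also have "... <= 8 * (de * a^2 + a ^ 4 / de)" using cube_le[OF de, of a] by simp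
 finally have "abs ?h ^ 3 <= 8 * (de * a^2 + a ^ 4 / de)" .
 moreover have "0 <= 8 * (N - a)^2 + 8 * B^2" by simp
 ultimately show ?thesis using npart_taylor(1)[of x ?h] by linarith
next
 case False
 have "abs ?h <= 2 * abs ((N - a) + B)" using False abs_triangle_ineq[of a "(N - a) + B"] by simp
 hence "?h^2 <= (2 * abs ((N - a) + B))^2" by (intro power2_le_iff_abs_le[THEN iffD2]) auto
 also have "... = 4 * ((N - a) + B)^2" by (simp add: power_mult_distrib)
 also have "... <= 8 * (N - a)^2 + 8 * B^2"
  using norm_add_power2_le[of 1 "N - a" B] by simp
 finally have "?h^2 <= 8 * (N - a)^2 + 8 * B^2" .
 moreover have "0 <= 8 * (de * a^2 + a ^ 4 / de)" using de by simp
 ultimately show ?thesis using npart_taylor(2)[of x ?h] by linarith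
qed
\<comment> \<open>The cross term \<open>N * B\<close> is split by Young's inequality; this is the
  origin of \<open>1 / de\<close> next to the 8 in the factor of the squared drift.\<close>
have quad: "npart (Suc 0) x * N^2 / 2 - de * N^2 - B^2 / de <= npart (Suc 0) x * ?h^2 / 2"
proof -
 have "abs N * B <= de * N^2 + B^2 / de"
 proof -
  have "0 <= (2 * de * abs N - B)^2 / (4 * de)" using de by simp
  also have "... = de * N^2 - abs N * B + B^2 / (4 * de)" using de by (simp add: power2_eq_square field_simps)
  also have "B^2 / (4 * de) <= B^2 / de" using de by (intro divide_left_mono) auto
  finally show ?thesis by simp
 qed
 moreover have "- (abs N * B) <= npart (Suc 0) x * (N * B)"
 proof -
  have "abs (npart (Suc 0) x * (N * B)) <= 1 * (abs N * B)"
   unfolding abs_mult using npart_nonneg(1,4)[of x] B(1) by (intro mult_mono) auto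
  thus ?thesis by (simp add: abs_le_iff)
 qed
 moreover have "npart (Suc 0) x * ?h^2 / 2 = npart (Suc 0) x * N^2 / 2 + npart (Suc 0) x * (N * B) + npart (Suc 0) x * B^2 / 2"
  by (simp add: power2_sum algebra_simps add_divide_distrib)
 moreover have "0 <= npart (Suc 0) x * B^2 / 2" using npart_nonneg(1)[of x] by simp
 ultimately show ?thesis by linarith
qed
have drift: "npart 2 x * B <= (3 * U + V) * npart 3 x + npart (Suc 0) x * G / 2 + npart 2 x * Osc"
proof -
 have "npart 2 x * B <= npart 2 x * (U * abs x + Osc + R)"
  using B(3) npart_nonneg(2)[of x] by (rule mult_left_mono)
 also have "... = U * (npart 2 x * abs x) + npart 2 x * Osc + npart 2 x * R" by (simp add: algebra_simps)
 also have "U * (npart 2 x * abs x) <= U * (3 * npart 3 x)"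
  using npart_2_mult_le[of x] nonneg(1) by (rule mult_left_mono)
 also have "npart 2 x * R <= npart (Suc 0) x * G / 2 + V * npart 3 x"
 \<comment> \<open>The square of the left side is at most four times the product of the two
   summands, hence at most the square of their sum.\<close>
 proof (rule power2_le_imp_le)
  have "(npart 2 x * R)^2 <= (2 * (npart (Suc 0) x * npart 3 x)) * (V * G)"
   unfolding power_mult_distrib using npart_2_square_le[of x] R npart_nonneg[of x] by (intro mult_mono) auto
  also have "... = 4 * ((npart (Suc 0) x * G / 2) * (V * npart 3 x))" by simp
  also have "... <= (npart (Suc 0) x * G / 2 + V * npart 3 x)^2"
   using zero_le_power2[of "npart (Suc 0) x * G / 2 - V * npart 3 x"]
   by (simp add: power2_eq_square algebra_simps)
  finally show "(npart 2 x * R)^2 <= (npart (Suc 0) x * G / 2 + V * npart 3 x)^2" .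
  show "0 <= npart (Suc 0) x * G / 2 + V * npart 3 x" using npart_nonneg[of x] nonneg by simp
 qed
 finally show ?thesis by (simp add: algebra_simps)
qed
have "npart 3 (x + ?h) <= npart 3 y" using B(2) by (rule npart_3_antimono)
moreover have "(8 + 1 / de) * B^2 <= (8 + 1 / de) * (2 * (U * S)^2 + 2 * (V * G))"
 using B2 de by (intro mult_left_mono) auto
hence "8 * B^2 + B^2 / de <= (8 + 1 / de) * (2 * (U * S)^2 + 2 * (V * G))"
 by (simp add: distrib_right)
moreover have "npart 2 x * ?h = npart 2 x * N + npart 2 x * B" by (simp add: distrib_left)
ultimately show ?thesis using rem quad drift by linarith
qed

text \<open>The recursion runs backwards. For \<open>0 <= c <= 1 / 2\<close> one has
  \<open>1 <= (1 - c) * exp (2 * c)\<close>, which explains both the restriction on \<open>c\<close>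
  and the factor 2 in the exponent.\<close>

lemma discrete_gronwall:
fixes e c r :: "nat => real"
assumes step: "!!k. k < n ==> e k <= e (Suc k) + c k * e k + r k"
 and c: "!!k. k < n ==> 0 <= c k & c k <= 1 / 2" and r: "!!k. k < n ==> 0 <= r k" and e: "!!k. k <= n ==> 0 <= e k"
shows "e 0 <= exp (2 * (\<Sum>k<n. c k)) * (e n + (\<Sum>k<n. r k))"
using assms
proof (induction n)
case (Suc n)
have "e 0 <= exp (2 * (\<Sum>k<n. c k)) * (e n + (\<Sum>k<n. r k))"
 using Suc.prems by (intro Suc.IH) auto
also have "e n <= exp (2 * c n) * (e (Suc n) + r n)"
proof -
 have c: "0 <= c n" "c n <= 1 / 2" using Suc.prems(2)[of n] by auto
 have "(1 - c n) * e n <= e (Suc n) + r n" using Suc.prems(1)[of n] by (simp add: algebra_simps)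
 moreover have "1 <= (1 - c n) * exp (2 * c n)"
 proof -
  have "0 <= c n * (1 - 2 * c n)" using c by simp
  hence "1 <= (1 - c n) * (1 + 2 * c n)" by (simp add: algebra_simps)
  also have "... <= (1 - c n) * exp (2 * c n)" using c exp_ge_add_one_self[of "2 * c n"] by (intro mult_left_mono) auto
  finally show ?thesis .
 qed
 ultimately have "e n <= exp (2 * c n) * ((1 - c n) * e n)"
  using mult_right_mono[of 1 "(1 - c n) * exp (2 * c n)" "e n"] Suc.prems(4)[of n] by (simp add: mult_ac)
 also have "... <= exp (2 * c n) * (e (Suc n) + r n)"
  using \<open>(1 - c n) * e n <= e (Suc n) + r n\<close> by (intro mult_left_mono) auto
 finally show ?thesis .
qed
also have "(\<Sum>k<n. r k) <= exp (2 * c n) * (\<Sum>k<n. r k)"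
 using mult_right_mono[of 1 "exp (2 * c n)" "\<Sum>k<n. r k"] Suc.prems(2)[of n]
  sum_nonneg[of "{..<n}" r] Suc.prems(3) by simp
also have "exp (2 * (\<Sum>k<n. c k)) * (exp (2 * c n) * (e (Suc n) + r n) + exp (2 * c n) * (\<Sum>k<n. r k)) =
 exp (2 * (\<Sum>k<Suc n. c k)) * (e (Suc n) + (\<Sum>k<Suc n. r k))"
 by (simp add: exp_add distrib_left algebra_simps)
finally show ?case by simp
qed simp

lemma nn_integral_grid:
fixes f :: "real => ennreal"
assumes [measurable]: "f \<in> borel_measurable borel" and g: "!!k. k < n ==> g k <= g (Suc k)"
shows "(\<Sum>k<n. (NN r:{g k<..g (Suc k)}. f r)) = (NN r:{g 0<..g n}. f r)"
using g
proof (induction n)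
case (Suc n)
have "g 0 <= g n" using Suc.prems by (induction n) (auto intro: order_trans)
moreover have "g n <= g (Suc n)" using Suc.prems by simp
ultimately have "(NN r:{g 0<..g (Suc n)}. f r) =
 (\<integral>\<^sup>+r. f r * indicator {g 0<..g n} r + f r * indicator {g n<..g (Suc n)} r \<partial>lborel)"
 by (intro nn_integral_cong) (auto simp: indicator_def)
also have "... = (NN r:{g 0<..g n}. f r) + (NN r:{g n<..g (Suc n)}. f r)"
 by (rule nn_integral_add) measurable
finally show ?case using Suc by simp
qed simp

lemma sum_power4_le:
fixes f :: "'i => real"
shows "(\<Sum>i\<in>L. f i) ^ 4 <= real (card L) ^ 3 * (\<Sum>i\<in>L. f i ^ 4)"
proof -
have "(\<Sum>i\<in>L. f i) ^ 4 = ((\<Sum>i\<in>L. f i)^2)^2" by simp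
also have "... <= (real (card L) * (\<Sum>i\<in>L. (f i)^2))^2"
 using sum_squared_le_sum_of_squares[of f L] by (intro power_mono) (auto simp: mult.commute)
also have "... = (real (card L))^2 * (\<Sum>i\<in>L. (f i)^2)^2" by (simp add: power_mult_distrib)
also have "... <= (real (card L))^2 * (real (card L) * (\<Sum>i\<in>L. ((f i)^2)^2))"
 using sum_squared_le_sum_of_squares[of "%i. (f i)^2" L] by (intro mult_left_mono) (auto simp: mult.commute)
also have "... = real (card L) ^ 3 * (\<Sum>i\<in>L. f i ^ 4)"
 by (simp add: power3_eq_cube power2_eq_square power4_eq_xxxx mult.assoc)
finally show ?thesis .
qed

section \<open>Increments of the integral: conditional isometry, orthogonality, fourth
  moments\<close>

context brownian_basis
begin

lemma progressive_late:
fixes xi :: "'w => 'b::{second_countable_topology, real_normed_vector}"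
assumes q: "0 <= q" and xi: "xi \<in> Fmeas q"
shows "progressive F (%s w. indicator {q<..} s *\<^sub>R xi w)"
unfolding progressive_def
proof (intro allI impI)
fix T :: real assume T: "0 <= T"
let ?M = "restrict_space borel {0..T} \<Otimes>\<^sub>M F (ennreal T)"
show "(%(s, w). indicator {q<..} s *\<^sub>R xi w) \<in> borel_measurable ?M"
proof (cases "q <= T")
 case True
 hence "xi \<in> Fmeas T"
  using xi by (intro measurable_F_mono[OF xi] ennreal_leI)
 hence "(%x. xi (snd x)) \<in> borel_measurable ?M"
  by (rule measurable_compose[OF measurable_snd])
 moreover have "(%x. indicator {q<..} (fst x) :: real) \<in> borel_measurable ?M"
  by (rule measurable_compose[OF measurable_fst]) (intro measurable_restrict_space1, simp)
 ultimately show ?thesis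
  unfolding case_prod_beta by (intro borel_measurable_scaleR)
next
 case False
 have "(%_. 0) \<in> borel_measurable ?M" by simp
 thus ?thesis
  by (rule measurable_cong[THEN iffD1, rotated])
   (use False in \<open>auto simp: space_pair_measure space_restrict_space indicator_def\<close>)
qed
qed

lemma progressive_sum:
fixes H :: "'i => real => 'w => 'b::{second_countable_topology, real_normed_vector}"
assumes "!!i. i \<in> L ==> progressive F (H i)"
shows "progressive F (%s w. \<Sum>i\<in>L. H i s w)"
using assms unfolding progressive_def case_prod_beta by (auto intro!: borel_measurable_sum)

lemma W_continuous: "AE w in P. continuous_on {0..} (%t. W t w)"
using BM unfolding brownian_motion_def by (auto elim: AE_mp)

lemma elementary_ito_L2:
assumes "elementary F W S J"
shows "ito_L2 P F W S J"
unfolding ito_L2_def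
proof (intro conjI allI impI)
obtain n r xi where S: "simple_integrand F n r xi" and eq: "S = simple_process n r xi" "J = simple_ito W n r xi"
 using assms(1) by (auto simp: elementary_def)
note iso = elementary_isometry[OF assms]
have "progressive F (%s w. \<Sum>k<n. indicator {r k<..} s *\<^sub>R xi k w + (- 1) *\<^sub>R (indicator {r (Suc k)<..} s *\<^sub>R xi k w))"
proof (intro progressive_sum progressive_add progressive_cmult progressive_late)
 fix k assume k: "k \<in> {..<n}"
 show xi: "xi k \<in> Fmeas (r k)" using S k by (simp add: simple_integrand_def)
 show "xi k \<in> Fmeas (r (Suc k))"
  using S k by (intro measurable_F_mono[OF xi] ennreal_leI) (simp add: simple_integrand_def)
 show "0 <= r k" "0 <= r (Suc k)" using simple_integrand_nonneg[OF S] k by auto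
qed
also have "(%s w. \<Sum>k<n. indicator {r k<..} s *\<^sub>R xi k w + (- 1) *\<^sub>R (indicator {r (Suc k)<..} s *\<^sub>R xi k w)) = S"
 unfolding eq simple_process_def using S
 by (intro ext sum.cong) (auto simp: indicator_def simple_integrand_def)
finally show "progressive F S" .
show "adapted F J" using iso(5) by (auto simp: adapted_def)
show "AE w in P. continuous_on {0..} (%t. J t w)"
 using W_continuous
proof eventually_elim
 case (elim w)
 have "continuous_on {0..} (%t. W (min t q) w)" if "0 <= q" for q
  by (rule continuous_on_compose2[OF elim]) (use that in \<open>auto intro!: continuous_intros\<close>)
 thus ?case
  unfolding eq simple_ito_def using simple_integrand_nonneg[OF S] by (intro continuous_intros) auto
qed
fix T :: real assume T: "0 <= T"
show "time_L2 P T S < \<infinity>" by (rule iso(2)[OF T])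
fix ep :: real assume ep: "0 < ep"
show "EX S' J'. elementary F W S' J' & time_L2 P T (%s w. S' s w - S s w) <= ennreal ep &
 (ALL t:{0..T}. (EE w. ennreal ((J' t w - J t w)^2)) <= ennreal ep)"
 using assms by (intro exI[of _ S] exI[of _ J]) (simp add: time_L2_def)
qed

text \<open>Mean and isometry conditional on \<open>F s\<close>, expressed by testing against
  bounded \<open>eta\<close>: they are the unconditional statements for the shifted
  integral.\<close>

lemma ito_L2_increment:
assumes I: "ito_L2 P F W H I" and s: "0 <= s" "s <= s'"
 and eta: "eta \<in> Fmeas s" "bounded (eta ` space P)"
shows "(EE w. ennreal ((eta w * (I s' w - I s w))^2)) =
  (EE w. ennreal ((eta w)^2) * (NN r:{s<..s'}. nsq (H r w)))" (is ?Q1)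
 and "expectation (%w. eta w * (I s' w - I s w)) = 0" (is ?Q2)
 and "integrable P (%w. (eta w * (I s' w - I s w))^2)" (is ?Q3)
proof -
note sh = ito_L2_shift[OF I s(1) eta]
have s'0: "0 <= s'" using s by simp
have min: "min s' s = s" using s by simp
show ?Q2
 using ito_L2_mean[OF sh s'0] by (simp add: min)
show ?Q3
 using ito_L2_square_integrable(1)[OF sh s'0] by (simp add: min)
have "(EE w. ennreal ((eta w * (I s' w - I s w))^2)) = time_L2 P s' (%r w. (eta w * indicator {s<..} r) *\<^sub>R H r w)"
 using ito_L2_isometry[OF sh s'0] by (simp add: min)
also have "... = (EE w. ennreal ((eta w)^2) * (NN r:{s<..s'}. nsq (H r w)))"
 unfolding time_L2_def
proof (rule nn_integral_cong)
 fix w assume w: "w \<in> space P"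
 have "(%r. nsq (H r w) * indicator {0..s'} r) \<in> borel_measurable borel"
  by (rule joint_section_nn[OF ito_L2_joint[OF I] w])
 hence m: "(%r. nsq (H r w) * indicator {0..s'} r * indicator {s<..s'} r) \<in> borel_measurable borel"
  by measurable
 have eq: "nsq (H r w) * indicator {0..s'} r * indicator {s<..s'} r = nsq (H r w) * indicator {s<..s'} r" for r
  using s by (auto simp: indicator_def)
 have "(NN r:{0..s'}. nsq ((eta w * indicator {s<..} r) *\<^sub>R H r w)) =
  (\<integral>\<^sup>+r. ennreal ((eta w)^2) * (nsq (H r w) * indicator {s<..s'} r) \<partial>lborel)"
  using s by (intro nn_integral_cong) (auto simp: indicator_def power_mult_distrib ennreal_mult')
 also have "... = ennreal ((eta w)^2) * (NN r:{s<..s'}. nsq (H r w))"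
  using m unfolding eq by (intro nn_integral_cmult) simp
 finally show "(NN r:{0..s'}. nsq ((eta w * indicator {s<..} r) *\<^sub>R H r w)) =
  ennreal ((eta w)^2) * (NN r:{s<..s'}. nsq (H r w))" .
qed
finally show ?Q1 .
qed

text \<open>The quadratic variation over one step as a real number. The default 0 for an infinite
  integral concerns a null set only.\<close>

definition energy :: "(real => 'w => real^'p) => real => real => 'w => real" where
"energy H s s' w = enn2real (NN r:{s<..s'}. nsq (H r w))"

lemma energy_nonneg: "0 <= energy H s s' w"
by (simp add: energy_def)

lemma energy_measurable:
assumes "ito_L2 P F W H I" "0 <= s" "s <= s'"
shows "(%w. (NN r:{s<..s'}. nsq (H r w))) \<in> borel_measurable P" (is ?Q1)
 "energy H s s' \<in> borel_measurable P" (is ?Q2)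
 "AE w in P. (NN r:{s<..s'}. nsq (H r w)) = ennreal (energy H s s' w)" (is ?Q3)
proof -
note j = ito_L2_joint[OF assms(1)]
let ?H = "%r w. indicator {s<..} r *\<^sub>R H r w"
have "(%p. indicator {s<..} (fst p) *\<^sub>R (case p of (r, w) => indicator {0..} r *\<^sub>R H r w)) \<in> borel_measurable (borel \<Otimes>\<^sub>M P)"
 by (rule borel_measurable_scaleR[OF measurable_compose[OF measurable_fst borel_measurable_indicator] j[unfolded joint_def]]) simp
hence "joint P ?H"
 unfolding joint_def by (simp add: case_prod_beta' mult.commute)
note inner = joint_inner_measurable[OF this, of s']
have eq: "(NN r:{0..s'}. nsq (?H r w)) = (NN r:{s<..s'}. nsq (H r w))" for w
 using assms(2,3) by (intro nn_integral_cong) (auto simp: indicator_def)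
show m: ?Q1
 using inner unfolding eq .
thus ?Q2 unfolding energy_def[abs_def] by measurable
have "(EE w. (NN r:{s<..s'}. nsq (H r w))) <= time_L2 P s' H"
 unfolding time_L2_def using assms(2) by (intro nn_integral_mono) (auto simp: indicator_def)
also have "... < \<infinity>" using ito_L2D(4)[OF assms(1), of s'] assms(2,3) by simp
finally have "AE w in P. (NN r:{s<..s'}. nsq (H r w)) ~= \<infinity>"
 by (intro nn_integral_PInf_AE m) simp
thus ?Q3
 by eventually_elim (simp add: energy_def less_top)
qed

text \<open>The conditional isometry is applied to \<open>sqrt eta\<close>, since the weight enters
  it squared.\<close>

lemma ito_L2_increment_real:
assumes I: "ito_L2 P F W H I" and s: "0 <= s" "s <= s'"
 and eta: "eta \<in> Fmeas s" "!!w. 0 <= eta w" "!!w. eta w <= 1"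
shows "integrable P (%w. eta w * (I s' w - I s w)^2)" (is ?Q1) "integrable P (%w. eta w * energy H s s' w)" (is ?Q2)
 "expectation (%w. eta w * (I s' w - I s w)^2) = expectation (%w. eta w * energy H s s' w)" (is ?Q3)
proof -
let ?r = "%w. sqrt (eta w)"
have r: "?r \<in> Fmeas s" "bounded (?r ` space P)"
 using eta by (auto intro!: boundedI[of _ 1] borel_measurable_sqrt)
have sq: "(?r w * d)^2 = eta w * d^2" for w d using eta(2) by (simp add: power_mult_distrib)
note inc = ito_L2_increment[OF I s r, unfolded sq]
show int: ?Q1 by (rule inc(3))
have "(EE w. ennreal ((sqrt (eta w))^2) * (NN r:{s<..s'}. nsq (H r w))) = (EE w. ennreal (eta w * energy H s s' w))"
 using energy_measurable(3)[OF I s]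
 by (intro nn_integral_cong_AE) (auto simp: ennreal_mult' eta(2) elim!: AE_mp)
hence eq: "(EE w. ennreal (eta w * (I s' w - I s w)^2)) = (EE w. ennreal (eta w * energy H s s' w))"
 using inc(1) by simp
have m: "(%w. eta w * energy H s s' w) \<in> borel_measurable P"
 by (intro borel_measurable_times measurable_F_P[OF eta(1)] energy_measurable(2)[OF I s])
show ?Q2
proof (rule integrableI_nonneg[OF m])
 show "(EE w. ennreal (eta w * energy H s s' w)) < \<infinity>"
  unfolding eq[symmetric] using int eta(2) by (subst nn_integral_eq_integral) auto
qed (use eta(2) in \<open>simp add: energy_nonneg\<close>)
show ?Q3
 using int m eq eta(2) by (subst (1 2) integral_eq_nn_integral) (auto simp: energy_nonneg)
qed

lemma ito_L2_increment_square:
assumes I: "ito_L2 P F W H I" and s: "0 <= s" "s <= s'"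
shows "integrable P (%w. (I s' w - I s w)^2)" "integrable P (energy H s s')"
 "expectation (%w. (I s' w - I s w)^2) = expectation (energy H s s')"
using ito_L2_increment_real[OF I s, of "%_. 1"] by auto

lemma integrable_product:
fixes f g :: "'w => real"
assumes "f \<in> borel_measurable P" "g \<in> borel_measurable P" "integrable P (%w. (f w)^2)" "integrable P (%w. (g w)^2)"
shows "integrable P (%w. f w * g w)"
proof (rule Bochner_Integration.integrable_bound)
show "integrable P (%w. (f w)^2 + (g w)^2)" using assms(3,4) by simp
show "AE w in P. norm (f w * g w) <= norm ((f w)^2 + (g w)^2)"
proof (rule AE_I2)
 fix w
 have "0 <= (abs (f w) - abs (g w))^2" "0 <= abs (f w) * abs (g w)" by simp_all
 hence "abs (f w) * abs (g w) <= (f w)^2 + (g w)^2"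
  unfolding power2_diff power2_abs by linarith
 thus "norm (f w * g w) <= norm ((f w)^2 + (g w)^2)" by (simp add: abs_mult)
qed
qed (use assms(1,2) in measurable)

text \<open>Truncating \<open>Y\<close> at the levels \<open>n\<close> and \<open>- n\<close>
  reduces the claim to bounded factors; the products are dominated by the integrable product
  itself.\<close>

lemma ito_L2_increment_orthogonal:
assumes I: "ito_L2 P F W H I" and s: "0 <= s" "s <= s'"
 and Y: "Y \<in> Fmeas s" "integrable P (%w. (Y w)^2)"
shows "integrable P (%w. Y w * (I s' w - I s w))" "expectation (%w. Y w * (I s' w - I s w)) = 0"
proof -
let ?N = "%w. I s' w - I s w"
have N: "?N \<in> borel_measurable P" using s by (intro borel_measurable_diff ito_L2_measurable_P[OF I]) auto
have YP: "Y \<in> borel_measurable P" by (rule measurable_F_P[OF Y(1)])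
show int: "integrable P (%w. Y w * ?N w)"
 using YP N Y(2) ito_L2_increment_square(1)[OF I s] by (rule integrable_product)
let ?Y = "%n w. max (- real n) (min (real n) (Y w))"
have "(%n. expectation (%w. ?Y n w * ?N w)) ----> expectation (%w. Y w * ?N w)"
proof (rule integral_dominated_convergence[where w="%w. abs (Y w * ?N w)"])
 show "AE w in P. (%n. ?Y n w * ?N w) ----> Y w * ?N w"
 proof (rule AE_I2, rule tendsto_eventually)
  fix w
  obtain m where "abs (Y w) <= real m" using real_arch_simple by blast
  thus "\<forall>\<^sub>F n in sequentially. ?Y n w * ?N w = Y w * ?N w"
   by (intro eventually_mono[OF eventually_ge_at_top[of m]]) (auto simp: min_def max_def)
 qed
 show "AE w in P. norm (?Y n w * ?N w) <= abs (Y w * ?N w)" for n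
  by (intro AE_I2) (auto simp: abs_mult intro!: mult_right_mono)
qed (use int YP N in \<open>auto\<close>)
moreover have "expectation (%w. ?Y n w * ?N w) = 0" for n
 using Y(1) by (intro ito_L2_increment(2)[OF I s]) (auto intro!: boundedI[of _ "real n"])
ultimately show "expectation (%w. Y w * ?N w) = 0"
 by (simp add: LIMSEQ_const_iff)
qed

lemma increment_fourth:
assumes "0 <= s" "s <= s'"
shows "integrable P (%w. ((W s' w - W s w) $ j) ^ 4)" "expectation (%w. ((W s' w - W s w) $ j) ^ 4) = 3 * (s' - s)^2"
using increment_power(1)[of s s' j 4] increment_moments(3)[of s s' j] assms
by (cases "s = s'"; simp)+

text \<open>Up to bounded factors the increment is a finite sum of Gaussian variables of variance at
  most \<open>s' - s\<close>. The constant depends on the elementary process but not on the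
  interval.\<close>

lemma elementary_fourth:
assumes el: "elementary F W S J"
shows "EX C>=0. ALL s s'. 0 <= s & s <= s' --> integrable P (%w. (J s' w - J s w) ^ 4) &
 expectation (%w. (J s' w - J s w) ^ 4) <= C * (s' - s)^2"
proof -
obtain n r xi where S: "simple_integrand F n r xi" and eq: "S = simple_process n r xi" "J = simple_ito W n r xi"
 using el by (auto simp: elementary_def)
have "EX B. ALL w:space P. norm (xi k w) <= B" if "k < n" for k
 using S that by (auto simp: simple_integrand_def bounded_iff)
then obtain b where b: "!!k w. k < n ==> w \<in> space P ==> norm (xi k w) <= b k" by metis
define B where "B = (\<Sum>k<n. abs (b k))"
have B: "norm (xi k w) <= B" if "k < n" "w \<in> space P" for k w
 using b[OF that] member_le_sum[of k "{..<n}" "%k. abs (b k)"] that by (simp add: B_def)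
define L where "L = {..<n} \<times> (UNIV :: 'p set)"
\<comment> \<open>The cube of \<open>card L\<close> comes from the fourth power of a sum,
  \<open>B ^ 4\<close> from the bounded coefficients, and 3 from the Gaussian fourth moment of each
  of the \<open>card L\<close> terms.\<close>
define C where "C = real (card L) ^ 3 * (B ^ 4 * (real (card L) * 3))"
have "0 <= C" by (simp add: C_def)
moreover have "integrable P (%w. (J s' w - J s w) ^ 4) & expectation (%w. (J s' w - J s w) ^ 4) <= C * (s' - s)^2"
 if s: "0 <= s" "s <= s'" for s s'
proof -
 define p where "p k = min s' (max s (r k))" for k
 have p: "s <= p k" "p k <= p (Suc k)" "p (Suc k) - p k <= s' - s" if "k < n" for k
  using S s that by (auto simp: p_def simple_integrand_def min_def max_def)
 define D where "D k w = W (p (Suc k)) w - W (p k) w" for k w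
 have inc: "J s' w - J s w = (\<Sum>k<n. xi k w \<bullet> D k w)" for w
 proof -
  have w: "W (min s' (max s x)) w = W s w + (W (min s' x) w - W (min s x) w)" for x
   using s by (cases "x <= s") (auto simp: min_def max_def)
  show ?thesis
   unfolding eq simple_ito_def D_def p_def w sum_subtractf[symmetric]
   by (intro sum.cong) (auto simp: inner_diff_right inner_add_right)
 qed
 have "J s' \<in> borel_measurable P" "J s \<in> borel_measurable P"
  using s by (auto intro!: measurable_F_P[OF elementary_isometry(5)[OF el]])
 hence m: "(%w. (J s' w - J s w) ^ 4) \<in> borel_measurable P" by measurable
 have intD: "integrable P (%w. (D k w $ j) ^ 4)" and ED: "expectation (%w. (D k w $ j) ^ 4) <= 3 * (s' - s)^2" if "k < n" for k j
 proof -
  have p0: "0 <= p k" "p k <= p (Suc k)" using p[OF that] s by auto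
  show "integrable P (%w. (D k w $ j) ^ 4)" unfolding D_def by (rule increment_fourth[OF p0])
  have "(p (Suc k) - p k)^2 <= (s' - s)^2" using p[OF that] by (intro power_mono) auto
  thus "expectation (%w. (D k w $ j) ^ 4) <= 3 * (s' - s)^2"
   unfolding D_def increment_fourth(2)[OF p0] by simp
 qed
 define Q where "Q w = real (card L) ^ 3 * (B ^ 4 * (\<Sum>(k, j)\<in>L. (D k w $ j) ^ 4))" for w
 have Q: "integrable P Q" "expectation Q <= C * (s' - s)^2"
 proof -
  have i: "integrable P (%w. \<Sum>(k, j)\<in>L. (D k w $ j) ^ 4)"
   using intD by (intro Bochner_Integration.integrable_sum) (auto simp: L_def)
  thus "integrable P Q" unfolding Q_def by simp
  have "expectation (%w. \<Sum>(k, j)\<in>L. (D k w $ j) ^ 4) = (\<Sum>(k, j)\<in>L. expectation (%w. (D k w $ j) ^ 4))"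
   using intD by (subst Bochner_Integration.integral_sum) (auto simp: L_def split_beta)
  also have "... <= (\<Sum>(k, j)\<in>L. 3 * (s' - s)^2)"
   using ED by (intro sum_mono) (auto simp: L_def)
  finally have "expectation (%w. \<Sum>(k, j)\<in>L. (D k w $ j) ^ 4) <= real (card L) * 3 * (s' - s)^2" by simp
  hence "real (card L) ^ 3 * (B ^ 4 * expectation (%w. \<Sum>(k, j)\<in>L. (D k w $ j) ^ 4)) <=
   real (card L) ^ 3 * (B ^ 4 * (real (card L) * 3 * (s' - s)^2))"
   by (intro mult_left_mono) auto
  moreover have "expectation Q = real (card L) ^ 3 * (B ^ 4 * expectation (%w. \<Sum>(k, j)\<in>L. (D k w $ j) ^ 4))"
   unfolding Q_def by simp
  ultimately show "expectation Q <= C * (s' - s)^2" by (simp add: C_def mult.assoc)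
 qed
 have le: "(J s' w - J s w) ^ 4 <= Q w" if "w \<in> space P" for w
 proof -
  have "J s' w - J s w = (\<Sum>(k, j)\<in>L. xi k w $ j * D k w $ j)"
   unfolding inc by (simp add: inner_vec_def L_def sum.cartesian_product)
  hence "(J s' w - J s w) ^ 4 <= real (card L) ^ 3 * (\<Sum>(k, j)\<in>L. (xi k w $ j * D k w $ j) ^ 4)"
   using sum_power4_le[of "%(k, j). xi k w $ j * D k w $ j" L] by (simp add: L_def split_beta)
  also have "... <= real (card L) ^ 3 * (\<Sum>(k, j)\<in>L. B ^ 4 * (D k w $ j) ^ 4)"
  proof (intro mult_left_mono sum_mono)
   fix x assume "x \<in> L"
   then obtain k j where x: "x = (k, j)" "k < n" by (auto simp: L_def)
   have "abs (xi k w $ j) ^ 4 <= B ^ 4"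
    using B[OF x(2) that] component_le_norm_cart[of "xi k w" j] by (intro power_mono) auto
   thus "(case x of (k, j) => (xi k w $ j * D k w $ j) ^ 4) <= (case x of (k, j) => B ^ 4 * (D k w $ j) ^ 4)"
    using x by (auto simp: power_mult_distrib intro!: mult_right_mono)
  qed simp
  also have "... = Q w" by (simp add: Q_def sum_distrib_left split_beta)
  finally show ?thesis .
 qed
 have int: "integrable P (%w. (J s' w - J s w) ^ 4)"
  using le by (intro Bochner_Integration.integrable_bound[OF Q(1) m] AE_I2) (auto intro: order_trans[OF _ abs_ge_self])
 thus ?thesis using integral_mono[OF int Q(1) le] Q(2) by auto
qed
ultimately show ?thesis by blast
qed

end

section \<open>Comparison\<close>

lemma npart_continuous: "isCont (npart (Suc (Suc k))) x"
using npart_derivative[of k x] by (rule DERIV_isCont)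

lemma npart_measurable [measurable]:
"npart 3 \<in> borel_measurable borel" "npart 2 \<in> borel_measurable borel" "npart (Suc 0) \<in> borel_measurable borel"
proof -
show "npart 3 \<in> borel_measurable borel" "npart 2 \<in> borel_measurable borel"
 unfolding numeral_3_eq_3 numeral_2_eq_2
 by (intro borel_measurable_continuous_onI continuous_at_imp_continuous_on ballI npart_continuous)+
have "npart (Suc 0) = (%x. min 1 (max 0 (- x)))" using npart_1 by auto
thus "npart (Suc 0) \<in> borel_measurable borel" by simp
qed

lemma (in brownian_basis) sum_energy_le:
assumes I: "ito_L2 P F W H I" and g: "0 <= g 0" "!!k. k < n ==> g k <= g (Suc k)"
 and m: "time_L2 P (g n) H <= ennreal m" "0 <= m"
shows "(\<Sum>k<n. expectation (energy H (g k) (g (Suc k)))) <= m"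
proof -
have g0: "0 <= g k" if "k <= n" for k using that g by (induction k) (auto intro: order_trans)
have gs: "0 <= g k" "g k <= g (Suc k)" if "k < n" for k using g0[of k] g(2)[of k] that by auto
have "ennreal (\<Sum>k<n. expectation (energy H (g k) (g (Suc k)))) = (\<Sum>k<n. ennreal (expectation (energy H (g k) (g (Suc k)))))"
 by (subst sum_ennreal) (auto intro!: integral_nonneg_AE simp: energy_nonneg)
also have "... = (\<Sum>k<n. \<integral>\<^sup>+w. (NN r:{g k<..g (Suc k)}. nsq (H r w)) \<partial>P)"
proof (rule sum.cong)
 fix k assume "k \<in> {..<n}"
 hence k: "0 <= g k" "g k <= g (Suc k)" using gs by auto
 have "ennreal (expectation (energy H (g k) (g (Suc k)))) = (\<integral>\<^sup>+w. ennreal (energy H (g k) (g (Suc k)) w) \<partial>P)"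
  by (rule nn_integral_eq_integral[symmetric]) (auto simp: energy_nonneg ito_L2_increment_square[OF I k])
 also have "... = (\<integral>\<^sup>+w. (NN r:{g k<..g (Suc k)}. nsq (H r w)) \<partial>P)"
  using energy_measurable(3)[OF I k] by (intro nn_integral_cong_AE) (auto elim: AE_mp)
 finally show "ennreal (expectation (energy H (g k) (g (Suc k)))) = (\<integral>\<^sup>+w. (NN r:{g k<..g (Suc k)}. nsq (H r w)) \<partial>P)" .
qed simp
also have "... = (\<integral>\<^sup>+w. (\<Sum>k<n. (NN r:{g k<..g (Suc k)}. nsq (H r w))) \<partial>P)"
 by (rule nn_integral_sum[symmetric]) (auto intro!: energy_measurable(1)[OF I] gs)
also have "... <= time_L2 P (g n) H"
 unfolding time_L2_def
proof (rule nn_integral_mono)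
 fix w assume w: "w \<in> space P"
 let ?f = "%r. nsq (H r w) * indicator {0..g n} r"
 have f: "?f \<in> borel_measurable borel" by (rule joint_section_nn[OF ito_L2_joint[OF I] w])
 have up: "g (Suc k) <= g n" if "k < n" for k
 proof -
  have "g (Suc k) <= g m" if "Suc k <= m" "m <= n" for m
   using that by (induction m rule: dec_induct) (use g in \<open>auto intro: order_trans\<close>)
  thus ?thesis using that by simp
 qed
 have "(\<Sum>k<n. (NN r:{g k<..g (Suc k)}. nsq (H r w))) = (\<Sum>k<n. (NN r:{g k<..g (Suc k)}. ?f r))"
 proof (intro sum.cong nn_integral_cong refl)
  fix k r assume "k \<in> {..<n}"
  thus "nsq (H r w) * indicator {g k<..g (Suc k)} r = ?f r * indicator {g k<..g (Suc k)} r"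
   using up[of k] gs[of k] by (auto simp: indicator_def)
 qed
 also have "... = (NN r:{g 0<..g n}. ?f r)" using f g(2) by (rule nn_integral_grid)
 also have "... <= (NN r:{0..g n}. nsq (H r w))"
  by (intro nn_integral_mono) (auto simp: indicator_def)
 finally show "(\<Sum>k<n. (NN r:{g k<..g (Suc k)}. nsq (H r w))) <=
  (NN r:{0..g n}. nsq (H r w))" .
qed
also have "... <= ennreal m" by (rule m(1))
finally show ?thesis using m(2) by (simp add: ennreal_le_iff)
qed

lemma square_add_le: "((a::real) + b)^2 <= 2 * a^2 + 2 * b^2"
using sum_squares_bound[of a b] by (simp add: power2_sum)

lemma integrable_square_add:
fixes f g :: "'a => real"
assumes [measurable]: "f \<in> borel_measurable M" "g \<in> borel_measurable M"
 and "integrable M (%w. (f w)^2)" "integrable M (%w. (g w)^2)"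
shows "integrable M (%w. (f w + g w)^2)"
proof (rule Bochner_Integration.integrable_bound)
show "integrable M (%w. 2 * (f w)^2 + 2 * (g w)^2)" using assms by simp
show "AE w in M. norm ((f w + g w)^2) <= norm (2 * (f w)^2 + 2 * (g w)^2)"
 using square_add_le by (intro AE_I2) simp
qed measurable

definition wint :: "(real => real) => real => real => real" where "wint v a b = enn2real (NN r:{a<..b}. ennreal (v r))"

lemma wint:
assumes v: "integrable lborel v" "!!r. 0 <= v r"
shows "(NN r:{a<..b}. ennreal (v r)) = ennreal (wint v a b)" (is ?Q1) "0 <= wint v a b"
 "a <= b ==> (!!r. v r <= B) ==> wint v a b <= B * (b - a)"
 "(!!k. k < n ==> g k <= g (Suc k)) ==> (\<Sum>k<n. wint v (g k) (g (Suc k))) <= (\<integral>r. v r \<partial>lborel)"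
proof -
have le: "(NN r:{a<..b}. ennreal (v r)) <= ennreal (\<integral>r. v r \<partial>lborel)" for a b
 unfolding nn_integral_eq_integral[OF v(1) AE_I2[OF v(2)], symmetric]
 by (intro nn_integral_mono) (auto simp: indicator_def)
have eq: "(NN r:{a<..b}. ennreal (v r)) = ennreal (wint v a b)" for a b
 using le_less_trans[OF le[of a b]] by (simp add: wint_def)
thus ?Q1 .
show "0 <= wint v a b" by (simp add: wint_def)
show "wint v a b <= B * (b - a)" if "a <= b" "!!r. v r <= B"
proof -
 have "(NN r:{a<..b}. ennreal (v r)) <= (\<integral>\<^sup>+r. ennreal B * indicator {a<..b} r \<partial>lborel)"
  using that by (intro nn_integral_mono mult_right_mono ennreal_leI) auto
 moreover have "0 <= B" using v(2) that(2) order_trans by blast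
 ultimately show ?thesis
  using that(1) unfolding eq by (simp add: nn_integral_cmult_indicator ennreal_mult'[symmetric] ennreal_le_iff)
qed
assume g: "!!k. k < n ==> g k <= g (Suc k)"
have "ennreal (\<Sum>k<n. wint v (g k) (g (Suc k))) = (\<Sum>k<n. (NN r:{g k<..g (Suc k)}. ennreal (v r)))"
 unfolding eq by (subst sum_ennreal) (auto simp: wint_def)
also have "... = (NN r:{g 0<..g n}. ennreal (v r))"
 using v(1) by (intro nn_integral_grid g) auto
also have "... <= ennreal (\<integral>r. v r \<partial>lborel)" by (rule le)
finally show "(\<Sum>k<n. wint v (g k) (g (Suc k))) <= (\<integral>r. v r \<partial>lborel)"
 using v(2) by (simp add: ennreal_le_iff integral_nonneg_AE)
qed

lemma Cauchy_Schwarz_NN: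
assumes [measurable]: "f \<in> borel_measurable borel" "g \<in> borel_measurable borel" "A \<in> sets borel"
 and nn: "!!r. r \<in> A ==> 0 <= f r" "!!r. r \<in> A ==> 0 <= g r"
shows "(NN r:A. ennreal (f r * g r))^2 <= (NN r:A. ennreal ((f r)^2)) * (NN r:A. ennreal ((g r)^2))"
proof -
have "(\<integral>\<^sup>+r. (ennreal (f r) * indicator A r) * (ennreal (g r) * indicator A r) \<partial>lborel)^2 <=
 (\<integral>\<^sup>+r. (ennreal (f r) * indicator A r)^2 \<partial>lborel) * (\<integral>\<^sup>+r. (ennreal (g r) * indicator A r)^2 \<partial>lborel)"
 by (rule Cauchy_Schwarz_nn_integral) measurable
moreover have "(\<integral>\<^sup>+r. (ennreal (f r) * indicator A r) * (ennreal (g r) * indicator A r) \<partial>lborel) = (NN r:A. ennreal (f r * g r))"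
 using nn by (intro nn_integral_cong) (auto simp: indicator_def ennreal_mult')
moreover have "(\<integral>\<^sup>+r. (ennreal (h r) * indicator A r)^2 \<partial>lborel) = (NN r:A. ennreal ((h r)^2))" if "!!r. r \<in> A ==> 0 <= h r" for h
 using that by (intro nn_integral_cong) (auto simp: indicator_def ennreal_power)
ultimately show ?thesis using nn by simp
qed

text \<open>\<open>x\<close> stands for a signed difference of two solutions and \<open>ze\<close>
  for the difference of their integrands. Only the upper side of the drift is controlled, so
  additional decrease is allowed, and \<open>x\<close> may jump at negligible times.
  \<open>M\<close> bounds the energy independently of the horizon. The outcome is that
  \<open>x\<close> is nonnegative at \<open>t\<close>.\<close>

locale comparison = brownian_basis P W F
for P :: "'w measure" and W :: "real => 'w => real^'p::finite" and F :: "ennreal => 'w measure" +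
fixes ze :: "real => 'w => real^'p" and I x :: "real => 'w => real" and S :: "'w => real"
 and u :: "real => real" and t B M :: real
assumes I: "ito_L2 P F W ze I" and zeM: "!!T. 0 <= T ==> time_L2 P T ze <= ennreal M" and M0: "0 <= M"
 and u: "u \<in> borel_measurable borel" "!!r. 0 <= u r" "!!r. u r <= B" "integrable lborel u" "integrable lborel (%r. (u r)^2)"
 and t: "0 <= t" and x: "!!s. t <= s ==> x s \<in> Fmeas s"
 and S: "S \<in> borel_measurable P" "!!w. 0 <= S w" "integrable P (%w. (S w)^2)"
 and bound: "AE w in P. ALL s>=t. abs (x s w) <= S w"
 and cont: "AE w in P. AE r in lborel. t < r --> isCont (%r. x r w) r"
 and lim: "AE w in P. ((%s. x s w) ---> 0) at_top"
 and incr: "AE w in P. ALL s s'. t <= s & s <= s' --> ennreal (x s' w - x s w - (I s' w - I s w)) <=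
   (NN r:{s..s'}. ennreal (u r * (abs (x r w) + norm (ze r w))))"
begin

lemma B0: "0 <= B" using u(2,3) order_trans by blast

lemma xP: "t <= s ==> x s \<in> borel_measurable P"
using x measurable_F_P by blast

abbreviation "uint \<equiv> wint u"
abbreviation "u2int \<equiv> wint (%r. (u r)^2)"
abbreviation "Ui \<equiv> (\<integral>r. u r \<partial>lborel)"
abbreviation "Vi \<equiv> (\<integral>r. (u r)^2 \<partial>lborel)"
abbreviation "SS \<equiv> expectation (%w. (S w)^2)"
abbreviation "E3 s \<equiv> expectation (%w. npart 3 (x s w))"

lemmas uint = wint[OF u(4,2)] and u2int = wint[OF u(5) zero_le_power2]

lemma Ui0: "0 <= Ui" using u(2) by (simp add: integral_nonneg_AE)

context
fixes T :: real
assumes T: "t < T"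
begin

definition mesh :: "nat => real" where "mesh n = (T - t) / real (Suc n)"
definition pt :: "nat => nat => real" where "pt n k = t + mesh n * real k"
definition xg :: "nat => real => 'w => real" where "xg n r w = x (pt n (nat \<lfloor>(r - t) / mesh n\<rfloor>)) w"
text \<open>No joint measurability of \<open>x\<close> is assumed. The limit of the left-end
  discretisations is jointly measurable and agrees with \<open>x\<close> at almost every time after
  \<open>t\<close>.\<close>

definition xt :: "real => 'w => real" where "xt r w = lim (%n. xg n r w)"

lemma mesh: "0 < mesh n" "mesh ----> 0"
proof -
show "0 < mesh n" using T by (simp add: mesh_def)
have "(%n. (T - t) * (1 / real (Suc n))) ----> (T - t) * 0"
 by (intro tendsto_intros LIMSEQ_Suc[OF lim_1_over_n])
thus "mesh ----> 0" by (simp add: mesh_def[abs_def])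
qed

lemma pt: "t <= pt n k" "pt n k <= pt n (Suc k)" "pt n (Suc k) - pt n k = mesh n" "pt n 0 = t" "pt n (Suc n) = T" "0 <= pt n k"
proof -
show 1: "t <= pt n k" using mesh(1)[of n] by (simp add: pt_def)
thus "0 <= pt n k" using t by simp
show "pt n (Suc k) - pt n k = mesh n" by (simp add: pt_def algebra_simps)
thus "pt n k <= pt n (Suc k)" using mesh(1)[of n] by linarith
show "pt n 0 = t" by (simp add: pt_def)
show "pt n (Suc n) = T" unfolding pt_def mesh_def by simp
qed

lemma xg_cell: "pt n k < r ==> r < pt n (Suc k) ==> xg n r w = x (pt n k) w"
proof -
assume "pt n k < r" "r < pt n (Suc k)"
hence "real k < (r - t) / mesh n" "(r - t) / mesh n < real k + 1"
 using mesh(1)[of n] by (simp_all add: pt_def pos_less_divide_eq pos_divide_less_eq algebra_simps)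
hence "\<lfloor>(r - t) / mesh n\<rfloor> = int k" by (intro floor_unique) auto
thus ?thesis by (simp add: xg_def)
qed

lemma xg_measurable: "(%(r, w). xg n r w) \<in> borel_measurable (borel \<Otimes>\<^sub>M P)"
unfolding xg_def case_prod_beta
proof (rule measurable_compose_countable)
show "(%p. x (pt n k) (snd p)) \<in> borel_measurable (borel \<Otimes>\<^sub>M P)" for k
 by (rule measurable_compose[OF measurable_snd xP[OF pt(1)]])
show "(%p. nat \<lfloor>(fst p - t) / mesh n\<rfloor>) \<in> borel \<Otimes>\<^sub>M P \<rightarrow>\<^sub>M count_space UNIV"
 by measurable
qed

lemma xt_measurable: "(%(r, w). xt r w) \<in> borel_measurable (borel \<Otimes>\<^sub>M P)"
unfolding xt_def case_prod_beta
using xg_measurable by (intro borel_measurable_lim_metric) (simp add: case_prod_beta')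

lemma section_measurable:
"(%(r, w). f r w) \<in> borel_measurable (borel \<Otimes>\<^sub>M P) ==> w \<in> space P ==> (%r. f r w) \<in> borel_measurable (borel :: real measure)"
using measurable_compose[OF measurable_Pair2'[of w P borel]] by fastforce

lemma xg_tendsto: "t < r ==> isCont (%r. x r w) r ==> (%n. xg n r w) ----> x r w"
proof -
assume r: "t < r" "isCont (%r. x r w) r"
have le: "pt n (nat \<lfloor>(r - t) / mesh n\<rfloor>) <= r" "r - mesh n <= pt n (nat \<lfloor>(r - t) / mesh n\<rfloor>)" for n
proof -
 have "0 <= (r - t) / mesh n" using r mesh(1)[of n] by simp
 hence "real (nat \<lfloor>(r - t) / mesh n\<rfloor>) = of_int \<lfloor>(r - t) / mesh n\<rfloor>" by simp
 hence "real (nat \<lfloor>(r - t) / mesh n\<rfloor>) <= (r - t) / mesh n" "(r - t) / mesh n <= real (nat \<lfloor>(r - t) / mesh n\<rfloor>) + 1"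
  by linarith+
 thus "pt n (nat \<lfloor>(r - t) / mesh n\<rfloor>) <= r" "r - mesh n <= pt n (nat \<lfloor>(r - t) / mesh n\<rfloor>)"
  using mesh(1)[of n] by (simp_all add: pt_def pos_le_divide_eq pos_divide_le_eq algebra_simps)
qed
have "(%n. r - mesh n) ----> r - 0" by (intro tendsto_intros mesh)
hence low: "(%n. r - mesh n) ----> r" by simp
have "(%n. pt n (nat \<lfloor>(r - t) / mesh n\<rfloor>)) ----> r"
 by (rule tendsto_sandwich[OF _ _ low tendsto_const]) (rule always_eventually, rule allI, rule le)+
thus ?thesis unfolding xg_def by (rule isCont_tendsto_compose[OF r(2)])
qed

lemma xt_eq: "AE w in P. AE r in lborel. t < r --> (%n. xg n r w) ----> x r w & xt r w = x r w"
using cont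
proof eventually_elim
case (elim w)
thus ?case
 by eventually_elim (auto simp: xt_def intro: xg_tendsto limI)
qed

text \<open>The price of freezing \<open>x\<close> at the left end of each cell, weighted by
  \<open>u\<close>; almost everywhere continuity makes it vanish as the grid is refined.\<close>

definition osc :: "nat => real => real => 'w => ennreal" where
"osc n a b w = (NN r:{a<..b}. ennreal (u r * abs (xt r w - xg n r w)))"

lemma osc_measurable [measurable]: "osc n a b \<in> borel_measurable P"
proof -
have "(%p. ennreal (u (fst p) * abs ((case p of (r, w) => xt r w) - (case p of (r, w) => xg n r w))) * indicator {a<..b} (fst p)) \<in> borel_measurable (borel \<Otimes>\<^sub>M P)"
 using xt_measurable xg_measurable[of n] u(1) by measurable
hence "(%(w, r). ennreal (u r * abs (xt r w - xg n r w)) * indicator {a<..b} r) \<in> borel_measurable (P \<Otimes>\<^sub>M lborel)"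
 by (subst measurable_pair_swap_iff) (simp add: case_prod_beta' cong: measurable_cong_sets sets_pair_measure_cong)
thus ?thesis
 unfolding osc_def[abs_def] by (rule lborel.borel_measurable_nn_integral)
qed

lemma osc_bound:
"AE w in P. AE r in lborel. t < r --> (ALL n. abs (xt r w - xg n r w) <= 2 * S w) & abs (xt r w) <= S w"
using xt_eq bound
proof eventually_elim
case (elim w)
from elim(1) show ?case
proof eventually_elim
 case (elim r)
 show ?case
 proof (intro impI conjI allI)
  assume r: "t < r"
  thus "abs (xt r w) <= S w" using elim \<open>ALL s>=t. abs (x s w) <= S w\<close> by auto
  fix n
  have "abs (xg n r w) <= S w" unfolding xg_def using \<open>ALL s>=t. abs (x s w) <= S w\<close> pt(1) by simp
  with \<open>abs (xt r w) <= S w\<close> show "abs (xt r w - xg n r w) <= 2 * S w" by linarith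
 qed
qed
qed

lemma osc_integrand_le: "AE w in P. AE r in lborel. ALL n a b. t <= a -->
 ennreal (u r * abs (xt r w - xg n r w)) * indicator {a<..b} r <= ennreal (2 * S w) * ennreal (u r)"
using osc_bound
proof eventually_elim
case (elim w)
thus ?case
proof (eventually_elim, intro allI impI)
 fix r a b :: real and n
 assume r: "t < r --> (ALL n. abs (xt r w - xg n r w) <= 2 * S w) & abs (xt r w) <= S w" and a: "t <= a"
 show "ennreal (u r * abs (xt r w - xg n r w)) * indicator {a<..b} r <= ennreal (2 * S w) * ennreal (u r)"
 proof (cases "a < r")
  case True
  hence "u r * abs (xt r w - xg n r w) <= u r * (2 * S w)" using r a u(2) by (intro mult_left_mono) auto
  moreover have "ennreal (2 * S w) * ennreal (u r) = ennreal (2 * S w * u r)"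
   using S(2) u(2) by (intro ennreal_mult'[symmetric]) auto
  ultimately show ?thesis by (auto simp: indicator_def mult.commute intro!: ennreal_leI)
 qed (simp add: indicator_def)
qed
qed

lemma osc_le: "AE w in P. ALL n a b. t <= a --> osc n a b w <= ennreal (2 * S w * Ui) & norm (S w * enn2real (osc n a b w)) <= 2 * Ui * (S w)^2"
using osc_integrand_le
proof (eventually_elim, intro allI impI)
fix w n a b
assume w: "AE r in lborel. ALL n a b. t <= a --> ennreal (u r * abs (xt r w - xg n r w)) * indicator {a<..b} r <= ennreal (2 * S w) * ennreal (u r)"
 and a: "t <= a"
have "osc n a b w <= (\<integral>\<^sup>+r. ennreal (2 * S w) * ennreal (u r) \<partial>lborel)"
 unfolding osc_def by (rule nn_integral_mono_AE, rule eventually_mono[OF w]) (use a in blast)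
also have "... = ennreal (2 * S w * Ui)"
 using u S(2)[of w] by (simp add: nn_integral_cmult nn_integral_eq_integral ennreal_mult')
finally have le: "osc n a b w <= ennreal (2 * S w * Ui)" .
hence "enn2real (osc n a b w) <= 2 * S w * Ui" using Ui0 S(2) by (intro enn2real_leI) auto
hence "S w * enn2real (osc n a b w) <= S w * (2 * S w * Ui)" using S(2) by (intro mult_left_mono)
thus "osc n a b w <= ennreal (2 * S w * Ui) & norm (S w * enn2real (osc n a b w)) <= 2 * Ui * (S w)^2"
 using le S(2) by (simp add: abs_mult power2_eq_square mult_ac)
qed

abbreviation "EO n a b \<equiv> expectation (%w. S w * enn2real (osc n a b w))"

lemma integrable_S_osc: "t <= a ==> integrable P (%w. S w * enn2real (osc n a b w))"
proof (rule Bochner_Integration.integrable_bound[where f="%w. 2 * Ui * (S w)^2"])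
assume "t <= a"
with osc_le show "AE w in P. norm (S w * enn2real (osc n a b w)) <= norm (2 * Ui * (S w)^2)"
 using Ui0 by (auto elim!: eventually_mono)
qed (use S in \<open>auto\<close>)

text \<open>Dominated convergence in time with majorant \<open>2 S u\<close>, then over the paths
  with majorant \<open>2 Ui S^2\<close>.\<close>

lemma osc_limit: "(%n. EO n t T) ----> 0"
proof -
have "(%n. EO n t T) ----> expectation (%w. 0)"
proof (rule integral_dominated_convergence[where w="%w. 2 * Ui * (S w)^2"])
 show "AE w in P. norm (S w * enn2real (osc n t T w)) <= 2 * Ui * (S w)^2" for n
  using osc_le by eventually_elim blast
 show "AE w in P. (%n. S w * enn2real (osc n t T w)) ----> 0"
  using xt_eq osc_integrand_le AE_space
 proof eventually_elim
  case (elim w)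
  have "(%n. osc n t T w) ----> (\<integral>\<^sup>+r. 0 \<partial>(lborel :: real measure))"
   unfolding osc_def
  proof (rule nn_integral_dominated_convergence[where w="%r. ennreal (2 * S w) * ennreal (u r)"])
   note [measurable] = section_measurable[OF xt_measurable elim(3)] section_measurable[OF xg_measurable elim(3)] u(1)
   show "(%r. ennreal (u r * abs (xt r w - xg n r w)) * indicator {t<..T} r) \<in> borel_measurable lborel" for n by measurable
   show "(%r. ennreal (2 * S w) * ennreal (u r)) \<in> borel_measurable lborel" by measurable
   show "(\<integral>\<^sup>+r. ennreal (2 * S w) * ennreal (u r) \<partial>lborel) < \<infinity>"
    using u S(2)[of w] by (simp add: nn_integral_cmult nn_integral_eq_integral ennreal_mult_less_top)
   show "AE r in lborel. ennreal (u r * abs (xt r w - xg n r w)) * indicator {t<..T} r <= ennreal (2 * S w) * ennreal (u r)" for n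
    using elim(2) by (rule eventually_mono) blast
   show "AE r in lborel. (%n. ennreal (u r * abs (xt r w - xg n r w)) * indicator {t<..T} r) ----> 0"
    using elim(1)
   proof eventually_elim
    case (elim r)
    show ?case
    proof (cases "t < r")
     case True
     hence "(%n. ennreal (u r * abs (xt r w - xg n r w))) ----> ennreal (u r * abs (xt r w - xt r w))"
      using elim by (intro tendsto_ennrealI tendsto_intros) auto
     thus ?thesis using True by (auto simp: indicator_def)
    qed (simp add: indicator_def)
   qed
  qed simp
  hence "(%n. enn2real (osc n t T w)) ----> enn2real 0"
   by (intro tendsto_enn2real) auto
  thus ?case using tendsto_mult_right_zero[of _ sequentially "S w"] by simp
 qed
qed (use S in auto)
thus ?thesis by simp
qed

text \<open>One cell of the grid. The part \<open>R\<close> of the drift due to \<open>ze\<close>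
  satisfies \<open>R^2 <= V * G\<close> by the Cauchy-Schwarz inequality, with \<open>V\<close> the
  integral of \<open>u^2\<close> and \<open>G\<close> the energy over the cell.\<close>

lemma step_pathwise:
fixes J :: "real => 'w => real"
assumes de: "0 < de"
shows "AE w in P. ALL k<Suc n. let a = pt n k; b = pt n (Suc k); N = I b w - I a w; A = J b w - J a w in
 npart 3 (x a w) + npart (Suc 0) (x a w) * N^2 / 2 - npart 2 (x a w) * N <=
 npart 3 (x b w) + (3 * uint a b + u2int a b) * npart 3 (x a w) + npart (Suc 0) (x a w) * energy ze a b w / 2
 + S w * enn2real (osc n a b w)
 + (de * N^2 + (8 + 1 / de) * (2 * (uint a b * S w)^2 + 2 * (u2int a b * energy ze a b w))
   + 8 * (de * A^2 + A ^ 4 / de) + 8 * (N - A)^2)"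
proof -
have en: "AE w in P. ALL k. (NN r:{pt n k<..pt n (Suc k)}. nsq (ze r w)) = ennreal (energy ze (pt n k) (pt n (Suc k)) w)"
 using energy_measurable(3)[OF I pt(6) pt(2)] by (simp add: AE_all_countable)
show ?thesis
 using incr bound xt_eq osc_bound osc_le en AE_space
proof eventually_elim
 case (elim w)
 note w = elim
 show ?case
 proof (intro allI impI)
  fix k assume "k < Suc n"
  define a b where ab_def: "a = pt n k" "b = pt n (Suc k)"
  have ab: "t <= a" "a <= b" "0 <= a" using pt by (auto simp: ab_def)
  define zn where "zn r = norm (indicator {0..} r *\<^sub>R ze r w)" for r
  have zn_eq: "zn r = norm (ze r w)" if "a < r" for r using that ab by (simp add: zn_def)
  have zn0: "0 <= zn r" for r by (simp add: zn_def)
  have xtm [measurable]: "(%r. xt r w) \<in> borel_measurable borel" by (rule section_measurable[OF xt_measurable w(7)])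
  have xgm [measurable]: "(%r. xg n r w) \<in> borel_measurable borel" by (rule section_measurable[OF xg_measurable w(7)])
  have znm [measurable]: "zn \<in> borel_measurable borel"
   unfolding zn_def[abs_def] using joint_section[OF ito_L2_joint[OF I] w(7)] by measurable
  note [measurable] = u(1)
  let ?G = "energy ze a b w" and ?O = "enn2real (osc n a b w)"
  define R where "R = enn2real (NN r:{a<..b}. ennreal (u r * zn r))"
  have G: "(NN r:{a<..b}. ennreal ((zn r)^2)) = ennreal ?G"
  proof -
   have "(NN r:{a<..b}. ennreal ((zn r)^2)) = (NN r:{a<..b}. nsq (ze r w))"
    by (intro nn_integral_cong) (auto simp: indicator_def zn_eq)
   thus ?thesis using w(6) by (simp add: ab_def)
  qed
  have CS: "(NN r:{a<..b}. ennreal (u r * zn r))^2 <= ennreal (u2int a b * ?G)"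
   using Cauchy_Schwarz_NN[OF u(1) znm, of "{a<..b}"] u(2) zn0 u2int(2) by (simp add: u2int(1) G ennreal_mult')
  hence "(NN r:{a<..b}. ennreal (u r * zn r))^2 < \<infinity>" by (rule le_less_trans) simp
  hence "(NN r:{a<..b}. ennreal (u r * zn r)) < \<infinity>"
   by (simp add: power_less_top_ennreal)
  hence R: "(NN r:{a<..b}. ennreal (u r * zn r)) = ennreal R" "0 <= R" by (simp_all add: R_def)
  have R2: "R^2 <= u2int a b * ?G"
   using CS u2int(2)[of a b] energy_nonneg[of ze a b w] unfolding R(1) by (simp add: R(2) ennreal_power ennreal_le_iff)
  have "osc n a b w <= ennreal (2 * S w * Ui)" using w(5) ab by simp
  hence "osc n a b w < \<infinity>" by (rule le_less_trans) simp
  hence O: "osc n a b w = ennreal ?O" by simp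
  have "ennreal (x b w - x a w - (I b w - I a w)) <= (NN r:{a..b}. ennreal (u r * (abs (x r w) + norm (ze r w))))"
   using w(1) ab by simp
  also have "... = (NN r:{a<..b}. ennreal (u r * (abs (xt r w) + zn r)))"
  proof (rule nn_integral_cong_AE)
   show "AE r in lborel. ennreal (u r * (abs (x r w) + norm (ze r w))) * indicator {a..b} r =
    ennreal (u r * (abs (xt r w) + zn r)) * indicator {a<..b} r"
    using w(3) AE_lborel_singleton[of a]
    by eventually_elim (use ab in \<open>auto simp: indicator_def zn_eq\<close>)
  qed
  finally have key: "ennreal (x b w - x a w - (I b w - I a w)) <= (NN r:{a<..b}. ennreal (u r * (abs (xt r w) + zn r)))" .
  have d1: "x b w - x a w - (I b w - I a w) <= uint a b * abs (x a w) + ?O + R"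
  proof -
   have "(NN r:{a<..b}. ennreal (u r * (abs (xt r w) + zn r))) <=
    (\<integral>\<^sup>+r. ennreal (abs (x a w)) * (ennreal (u r) * indicator {a<..b} r) + (ennreal (u r * abs (xt r w - xg n r w)) * indicator {a<..b} r + ennreal (u r * zn r) * indicator {a<..b} r) \<partial>lborel)"
   proof (rule nn_integral_mono_AE)
    show "AE r in lborel. ennreal (u r * (abs (xt r w) + zn r)) * indicator {a<..b} r <=
     ennreal (abs (x a w)) * (ennreal (u r) * indicator {a<..b} r) + (ennreal (u r * abs (xt r w - xg n r w)) * indicator {a<..b} r + ennreal (u r * zn r) * indicator {a<..b} r)"
     using AE_lborel_singleton[of b]
    proof eventually_elim
     case (elim r)
     show ?case
     proof (cases "r \<in> {a<..b}")
      case True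
      hence "xg n r w = x a w" using elim xg_cell[of n k r w] by (simp add: ab_def)
      hence "abs (xt r w) <= abs (x a w) + abs (xt r w - xg n r w)" by linarith
      hence "u r * (abs (xt r w) + zn r) <= u r * (abs (x a w) + abs (xt r w - xg n r w) + zn r)"
       using u(2) by (intro mult_left_mono) auto
      hence "u r * (abs (xt r w) + zn r) <= abs (x a w) * u r + (u r * abs (xt r w - xg n r w) + u r * zn r)"
       by (simp add: algebra_simps)
      hence "ennreal (u r * (abs (xt r w) + zn r)) <= ennreal (abs (x a w) * u r + (u r * abs (xt r w - xg n r w) + u r * zn r))"
       by (rule ennreal_leI)
      thus ?thesis using True u(2) zn0 by (simp add: ennreal_mult' mult_nonneg_nonneg)
     qed simp
    qed
   qed
   also have "... = ennreal (abs (x a w)) * (NN r:{a<..b}. ennreal (u r)) + (osc n a b w + (NN r:{a<..b}. ennreal (u r * zn r)))"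
    unfolding osc_def by (simp add: nn_integral_add nn_integral_cmult)
   also have "... = ennreal (uint a b * abs (x a w) + ?O + R)"
    unfolding uint(1) R(1) by (subst O) (simp add: ennreal_mult' uint(2) R(2) mult.commute add.assoc)
   finally show ?thesis
    using key uint(2)[of a b] R(2) by (subst ennreal_le_iff[symmetric]) auto
  qed
  \<comment> \<open>The cruder drift bound by \<open>S\<close> serves the error terms: its square
    has an expectation of second order in the weight of the cell.\<close>
  have d2: "x b w - x a w - (I b w - I a w) <= uint a b * S w + R"
  proof -
   have "(NN r:{a<..b}. ennreal (u r * (abs (xt r w) + zn r))) <=
    (\<integral>\<^sup>+r. ennreal (S w) * (ennreal (u r) * indicator {a<..b} r) + ennreal (u r * zn r) * indicator {a<..b} r \<partial>lborel)"
   proof (rule nn_integral_mono_AE)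
    show "AE r in lborel. ennreal (u r * (abs (xt r w) + zn r)) * indicator {a<..b} r <=
     ennreal (S w) * (ennreal (u r) * indicator {a<..b} r) + ennreal (u r * zn r) * indicator {a<..b} r"
     using w(4)
    proof eventually_elim
     case (elim r)
     show ?case
     proof (cases "r \<in> {a<..b}")
      case True
      hence "abs (xt r w) <= S w" using elim ab by auto
      hence "u r * (abs (xt r w) + zn r) <= u r * (S w + zn r)"
       using u(2) by (intro mult_left_mono) auto
      hence "ennreal (u r * (abs (xt r w) + zn r)) <= ennreal (S w * u r + u r * zn r)"
       by (intro ennreal_leI) (simp add: algebra_simps)
      thus ?thesis using True u(2) zn0 S(2) by (simp add: ennreal_mult' mult_nonneg_nonneg)
     qed simp
    qed
   qed
   also have "... = ennreal (S w) * (NN r:{a<..b}. ennreal (u r)) + (NN r:{a<..b}. ennreal (u r * zn r))"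
    by (simp add: nn_integral_add nn_integral_cmult)
   also have "... = ennreal (uint a b * S w + R)"
    unfolding uint(1) R(1) using S(2) by (simp add: ennreal_mult' uint(2) R(2) mult.commute)
   finally show ?thesis
    using key uint(2)[of a b] R(2) S(2)[of w] by (subst ennreal_le_iff[symmetric]) auto
  qed
  have "npart 2 (x a w) * ?O <= S w * ?O"
   using npart_2_le[of "x a w"] w(2) ab by (intro mult_right_mono) (auto intro: order_trans)
  thus "let a = pt n k; b = pt n (Suc k); N = I b w - I a w; A = J b w - J a w in
   npart 3 (x a w) + npart (Suc 0) (x a w) * N^2 / 2 - npart 2 (x a w) * N <=
   npart 3 (x b w) + (3 * uint a b + u2int a b) * npart 3 (x a w) + npart (Suc 0) (x a w) * energy ze a b w / 2
   + S w * enn2real (osc n a b w)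
   + (de * N^2 + (8 + 1 / de) * (2 * (uint a b * S w)^2 + 2 * (u2int a b * energy ze a b w))
     + 8 * (de * A^2 + A ^ 4 / de) + 8 * (N - A)^2)"
   using npart_step[OF de d1 d2 uint(2) _ R(2) u2int(2) energy_nonneg S(2) R2, of "J b w - J a w"]
   unfolding Let_def ab_def[symmetric] by simp
 qed
qed
qed

lemma npart_3_integrable: "t <= s ==> integrable P (%w. npart 3 (x s w))"
proof (rule Bochner_Integration.integrable_bound[OF S(3)])
assume s: "t <= s"
note [measurable] = xP[OF s]
show "(%w. npart 3 (x s w)) \<in> borel_measurable P" by measurable
show "AE w in P. norm (npart 3 (x s w)) <= norm ((S w)^2)"
 using bound
proof eventually_elim
 case (elim w)
 have "(x s w)^2 <= (S w)^2" using elim s S(2)[of w] by (intro power2_le_iff_abs_le[THEN iffD2]) auto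
 thus ?case using npart_3_le[of "x s w"] npart_nonneg(3)[of "x s w"] by simp
qed
qed

lemma x_square_integrable: "t <= s ==> integrable P (%w. (npart 2 (x s w))^2)"
proof (rule Bochner_Integration.integrable_bound[OF S(3)])
assume s: "t <= s"
note [measurable] = xP[OF s]
show "(%w. (npart 2 (x s w))^2) \<in> borel_measurable P" by measurable
show "AE w in P. norm ((npart 2 (x s w))^2) <= norm ((S w)^2)"
 using bound
proof eventually_elim
 case (elim w)
 have "npart 2 (x s w) <= S w" using elim s npart_2_le[of "x s w"] by (auto intro: order_trans)
 thus ?case using npart_nonneg(2)[of "x s w"] by (simp add: power_mono)
qed
qed

text \<open>In expectation the first-order term vanishes by orthogonality, and the squared increment
  and the energy, both weighted by \<open>npart (Suc 0) (x a)\<close>, cancel by the conditional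
  isometry.\<close>

lemma expectation_step:
assumes de: "0 < de" and el: "elementary F W Z J" and k: "k < Suc n"
 and C: "!!s s'. 0 <= s ==> s <= s' ==> integrable P (%w. (J s' w - J s w) ^ 4) &
  expectation (%w. (J s' w - J s w) ^ 4) <= C * (s' - s)^2"
defines "a \<equiv> pt n k" and "b \<equiv> pt n (Suc k)"
shows "E3 a <= E3 b
 + (3 * uint a b + u2int a b) * E3 a
 + (EO n a b + de * expectation (energy ze a b)
  + (8 + 1 / de) * (2 * ((uint a b)^2 * SS) + 2 * (u2int a b * expectation (energy ze a b)))
  + 8 * (de * (2 * expectation (energy ze a b) + 2 * expectation (energy (%s w. ze s w - Z s w) a b)) + C * (mesh n)^2 / de)
  + 8 * expectation (energy (%s w. ze s w - Z s w) a b))"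
proof -
have ab: "t <= a" "t <= b" "0 <= a" "a <= b" using pt by (auto simp: a_def b_def)
have xa: "x a \<in> Fmeas a" using x ab by auto
let ?N = "%w. I b w - I a w" and ?A = "%w. J b w - J a w" and ?q = "%w. npart (Suc 0) (x a w)" and ?p = "%w. npart 2 (x a w)"
let ?G = "energy ze a b" and ?D = "energy (%s w. ze s w - Z s w) a b"
have q: "?q \<in> Fmeas a" and p: "?p \<in> Fmeas a"
 by (rule measurable_compose[OF xa npart_measurable(3)] measurable_compose[OF xa npart_measurable(2)])+
note i3 = npart_3_integrable[OF ab(1)] npart_3_integrable[OF ab(2)]
note iq = ito_L2_increment_real[OF I ab(3,4) q npart_nonneg(1,4)]
note ip = ito_L2_increment_orthogonal[OF I ab(3,4) p x_square_integrable[OF ab(1)]]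
note iN = ito_L2_increment_square[OF I ab(3,4)]
note iD = ito_L2_increment_square[OF ito_L2_diff[OF I elementary_ito_L2[OF el]] ab(3,4)]
have Deq: "I b w - J b w - (I a w - J a w) = ?N w - ?A w" for w by simp
note iD' = iD[unfolded Deq]
note iA = ito_L2_increment_square[OF elementary_ito_L2[OF el] ab(3,4)]
have i4: "integrable P (%w. (?A w) ^ 4)" "expectation (%w. (?A w) ^ 4) <= C * (mesh n)^2"
 using C[OF ab(3,4)] pt(3)[of n k] by (auto simp: a_def b_def)
note iO = integrable_S_osc[OF ab(1), of n b]
have EA: "expectation (%w. (?A w)^2) <= 2 * expectation ?G + 2 * expectation ?D"
proof -
 have "expectation (%w. (?A w)^2) <= expectation (%w. 2 * (?N w)^2 + 2 * (?N w - ?A w)^2)"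
 proof (rule integral_mono[OF iA(1)])
  show "integrable P (%w. 2 * (?N w)^2 + 2 * (?N w - ?A w)^2)" using iN(1) iD'(1) by simp
  show "(?A w)^2 <= 2 * (?N w)^2 + 2 * (?N w - ?A w)^2" for w
   using norm_add_power2_le[of 1 "?N w" "- (?N w - ?A w)"] by (simp add: power2_commute)
 qed
 also have "... = 2 * expectation ?G + 2 * expectation ?D"
  using iN(1) iD'(1) by (simp add: iN(3) iD'(3))
 finally show ?thesis .
qed
let ?L = "%w. npart 3 (x a w) + ?q w * (?N w)^2 / 2 - ?p w * ?N w"
let ?E = "%w. de * (?N w)^2 + (8 + 1 / de) * (2 * (uint a b * S w)^2 + 2 * (u2int a b * ?G w))
   + 8 * (de * (?A w)^2 + (?A w) ^ 4 / de) + 8 * (?N w - ?A w)^2"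
let ?R = "%w. npart 3 (x b w) + (3 * uint a b + u2int a b) * npart 3 (x a w) + ?q w * ?G w / 2
 + S w * enn2real (osc n a b w) + ?E w"
have iL: "integrable P ?L" "expectation ?L = E3 a + expectation (%w. ?q w * ?G w) / 2"
 using i3 iq ip by simp_all
have iE: "integrable P ?E" "expectation ?E = de * expectation ?G
  + (8 + 1 / de) * (2 * ((uint a b)^2 * SS) + 2 * (u2int a b * expectation ?G))
  + 8 * (de * expectation (%w. (?A w)^2) + expectation (%w. (?A w) ^ 4) / de) + 8 * expectation ?D"
 using iN iD' iA(1) i4(1) S(3) unfolding power_mult_distrib by simp_all
have iR: "integrable P ?R" "expectation ?R = E3 b
  + (3 * uint a b + u2int a b) * E3 a + expectation (%w. ?q w * ?G w) / 2
  + EO n a b + expectation ?E"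
 using i3 iq(2) iO iE(1) by simp_all
have LR: "expectation ?L <= expectation ?R"
proof (rule integral_mono_AE[OF iL(1) iR(1)])
 show "AE w in P. ?L w <= ?R w"
  using step_pathwise[OF de, of n J]
 proof eventually_elim
  case (elim w)
  from elim[rule_format, OF k] show ?case unfolding Let_def a_def b_def by simp
 qed
qed
have Y: "de * expectation (%w. (?A w)^2) + expectation (%w. (?A w) ^ 4) / de <=
 de * (2 * expectation ?G + 2 * expectation ?D) + C * (mesh n)^2 / de"
 using EA i4(2) de by (intro add_mono mult_left_mono divide_right_mono) auto
have arith: "v1 <= v2 + v3 + (v4 + v5 + v6 + 8 * Y' + v7)"
 if "v1 + w <= v2 + v3 + w + v4 + (v5 + v6 + 8 * Y + v7)" "Y <= Y'" for v1 v2 v3 v4 v5 v6 v7 w Y Y' :: real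
 using that by linarith
show ?thesis by (rule arith[OF LR[unfolded iL(2) iR(2) iE(2)] Y])
qed

text \<open>The sum of all error terms over the grid, with \<open>e\<close> the oscillation and
  \<open>h\<close> the mesh. For \<open>e = h = 0\<close> only terms proportional to
  \<open>de\<close> are left.\<close>

definition bd :: "real => real => real => real => real" where
"bd de C e h = e + de * M + (8 + 1 / de) * (2 * (B * h * Ui * SS) + 2 * (B^2 * h * M))
  + 8 * (de * (2 * M + 2 * de) + C * (T - t) * h / de) + 8 * de"

lemma expectation_grid:
assumes de: "0 < de" and el: "elementary F W Z J"
 and close: "time_L2 P T (%s w. Z s w - ze s w) <= ennreal de"
 and C: "!!s s'. 0 <= s ==> s <= s' ==> integrable P (%w. (J s' w - J s w) ^ 4) &
  expectation (%w. (J s' w - J s w) ^ 4) <= C * (s' - s)^2" "0 <= C"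
 and small: "3 * (B * mesh n) + B^2 * mesh n <= 1 / 2"
shows "E3 t <= exp (2 * (3 * Ui + Vi)) * (E3 T
 + bd de C (EO n t T) (mesh n))"
proof -
let ?a = "%k. pt n k" and ?b = "%k. pt n (Suc k)" and ?D = "%s w. ze s w - Z s w"
define Uk Vk where "Uk k = uint (?a k) (?b k)" "Vk k = u2int (?a k) (?b k)" for k
define Ge De where "Ge k = expectation (energy ze (?a k) (?b k))" "De k = expectation (energy ?D (?a k) (?b k))" for k
define Oe where "Oe k = EO n (?a k) (?b k)" for k
define rr where "rr k = Oe k + de * Ge k + (8 + 1 / de) * (2 * ((Uk k)^2 * SS) + 2 * (Vk k * Ge k))
  + 8 * (de * (2 * Ge k + 2 * De k) + C * (mesh n)^2 / de) + 8 * De k" for k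
define e where "e k = E3 (?a k)" for k
define c where "c k = 3 * Uk k + Vk k" for k
have nonneg: "0 <= Uk k" "0 <= Vk k" "0 <= Ge k" "0 <= De k" "0 <= Oe k" for k
 unfolding Uk_Vk_def Ge_De_def Oe_def using S(2)
 by (auto intro!: integral_nonneg_AE simp: uint(2) u2int(2) energy_nonneg)
have SS0: "0 <= SS" by (auto intro!: integral_nonneg_AE)
have le: "Uk k <= B * mesh n" "Vk k <= B^2 * mesh n" for k
 unfolding Uk_Vk_def using uint(3)[OF pt(2)[of n k] u(3)] u2int(3)[OF pt(2)[of n k] power_mono[OF u(3,2)]] pt(3)[of n k] by auto
have main: "e 0 <= exp (2 * (\<Sum>k<Suc n. c k)) * (e (Suc n) + (\<Sum>k<Suc n. rr k))"
proof (rule discrete_gronwall)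
 fix k assume k: "k < Suc n"
 show "e k <= e (Suc k) + c k * e k + rr k"
  using expectation_step[OF de el k C(1)] unfolding e_def c_def rr_def Uk_Vk_def Ge_De_def Oe_def by simp
 show "0 <= c k & c k <= 1 / 2" using nonneg(1,2)[of k] le[of k] small unfolding c_def by linarith
 show "0 <= rr k" unfolding rr_def using nonneg[of k] SS0 de C(2)
  by (intro add_nonneg_nonneg mult_nonneg_nonneg divide_nonneg_nonneg) auto
qed (auto simp: e_def npart_nonneg intro!: integral_nonneg_AE)
have cs: "(\<Sum>k<Suc n. c k) <= 3 * Ui + Vi"
 using uint(4)[of "Suc n" "pt n"] u2int(4)[of "Suc n" "pt n"] pt(2) unfolding c_def Uk_Vk_def sum.distrib sum_distrib_left[symmetric]
 by (intro add_mono mult_left_mono) auto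
have rs: "(\<Sum>k<Suc n. rr k) <= bd de C (EO n t T) (mesh n)"
proof -
 have sG: "(\<Sum>k<Suc n. Ge k) <= M"
  unfolding Ge_De_def by (rule sum_energy_le[OF I]) (use pt t T zeM M0 in auto)
 have sD: "(\<Sum>k<Suc n. De k) <= de"
  unfolding Ge_De_def
  by (rule sum_energy_le[OF ito_L2_diff[OF I elementary_ito_L2[OF el]]])
   (use pt t T de close time_L2_minus_commute[of P T ze Z] in auto)
 have sO: "(\<Sum>k<Suc n. Oe k) = EO n t T"
 proof -
  have "(\<Sum>k<Suc n. Oe k) = expectation (%w. \<Sum>k<Suc n. S w * enn2real (osc n (?a k) (?b k) w))"
   unfolding Oe_def by (rule Bochner_Integration.integral_sum[symmetric]) (rule integrable_S_osc[OF pt(1)])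
  also have "... = EO n t T"
  proof (rule integral_cong_AE)
   show "AE w in P. (\<Sum>k<Suc n. S w * enn2real (osc n (?a k) (?b k) w)) = S w * enn2real (osc n t T w)"
    using osc_le AE_space
   proof eventually_elim
    case (elim w)
    have fin: "osc n (?a k) b w < top" for k b
    proof -
     have "osc n (?a k) b w <= ennreal (2 * S w * Ui)" using elim(1) pt(1) by blast
     thus ?thesis by (rule le_less_trans) simp
    qed
    have [measurable]: "(%r. xt r w) \<in> borel_measurable borel" "(%r. xg n r w) \<in> borel_measurable borel"
     by (rule section_measurable[OF xt_measurable elim(2)] section_measurable[OF xg_measurable elim(2)])+
    note [measurable] = u(1)
    have "(\<Sum>k<Suc n. osc n (?a k) (?b k) w) = osc n (?a 0) (?a (Suc n)) w"
     unfolding osc_def by (rule nn_integral_grid) (measurable, rule pt(2))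
    hence "osc n t T w = (\<Sum>k<Suc n. osc n (?a k) (?b k) w)" by (simp add: pt)
    hence "enn2real (osc n t T w) = (\<Sum>k<Suc n. enn2real (osc n (?a k) (?b k) w))"
     using fin by (simp only: enn2real_sum o_def)
    thus ?case by (simp only: sum_distrib_left)
   qed
  qed (use S in measurable)
  finally show ?thesis .
 qed
 \<comment> \<open>A sum of squares is at most the largest term times the sum, which yields a factor
   \<open>mesh n\<close>.\<close>
 have sU: "(\<Sum>k<Suc n. (Uk k)^2) <= B * mesh n * Ui"
 proof -
  have "(\<Sum>k<Suc n. (Uk k)^2) <= (\<Sum>k<Suc n. B * mesh n * Uk k)"
   using le nonneg unfolding power2_eq_square by (intro sum_mono mult_right_mono) auto
  also have "... = B * mesh n * (\<Sum>k<Suc n. Uk k)" by (rule sum_distrib_left[symmetric])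
  also have "... <= B * mesh n * Ui"
   using uint(4)[of "Suc n" "pt n"] pt(2) B0 mesh(1)[of n] unfolding Uk_Vk_def by (intro mult_left_mono) auto
  finally show ?thesis .
 qed
 have sV: "(\<Sum>k<Suc n. Vk k * Ge k) <= B^2 * mesh n * M"
 proof -
  have "(\<Sum>k<Suc n. Vk k * Ge k) <= (\<Sum>k<Suc n. B^2 * mesh n * Ge k)"
   using le nonneg by (intro sum_mono mult_right_mono) auto
  also have "... = B^2 * mesh n * (\<Sum>k<Suc n. Ge k)" by (rule sum_distrib_left[symmetric])
  also have "... <= B^2 * mesh n * M" using sG mesh(1)[of n] by (intro mult_left_mono) auto
  finally show ?thesis .
 qed
 have sC: "(\<Sum>k<Suc n. C * (mesh n)^2 / de) = C * (T - t) * mesh n / de"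
 proof -
  have "real (Suc n) * mesh n = T - t" by (simp add: mesh_def)
  hence "C * (real (Suc n) * mesh n) * mesh n / de = C * (T - t) * mesh n / de" by simp
  thus ?thesis by (simp add: power2_eq_square mult_ac del: sum.lessThan_Suc of_nat_Suc)
 qed
 have "(\<Sum>k<Suc n. rr k) = (\<Sum>k<Suc n. Oe k) + de * (\<Sum>k<Suc n. Ge k) + (8 + 1 / de) * (2 * ((\<Sum>k<Suc n. (Uk k)^2) * SS) + 2 * (\<Sum>k<Suc n. Vk k * Ge k))
  + 8 * (de * (2 * (\<Sum>k<Suc n. Ge k) + 2 * (\<Sum>k<Suc n. De k)) + (\<Sum>k<Suc n. C * (mesh n)^2 / de)) + 8 * (\<Sum>k<Suc n. De k)"
  unfolding rr_def by (simp only: sum.distrib sum_distrib_left[symmetric] sum_distrib_right[symmetric])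
 also have "... <= bd de C (EO n t T) (mesh n)"
  unfolding sO sC bd_def using sG sD sU sV SS0 de
  by (intro add_mono mult_left_mono mult_right_mono order_refl) auto
 finally show ?thesis .
qed
have "0 <= (\<Sum>k<Suc n. rr k)"
 unfolding rr_def using nonneg SS0 de C(2)
 by (intro sum_nonneg add_nonneg_nonneg mult_nonneg_nonneg divide_nonneg_nonneg) auto
moreover have "0 <= e (Suc n)" by (auto simp: e_def npart_nonneg intro!: integral_nonneg_AE)
ultimately have pos: "0 <= e (Suc n) + (\<Sum>k<Suc n. rr k)" by simp
note main
also have "exp (2 * (\<Sum>k<Suc n. c k)) * (e (Suc n) + (\<Sum>k<Suc n. rr k)) <= exp (2 * (3 * Ui + Vi)) * (e (Suc n) + (\<Sum>k<Suc n. rr k))"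
 using cs pos by (intro mult_right_mono) (simp_all only: exp_le_cancel_iff mult_le_cancel_left_pos zero_less_numeral)
also have "... <= exp (2 * (3 * Ui + Vi)) * (e (Suc n) + bd de C (EO n t T) (mesh n))"
 using rs by (intro mult_left_mono add_left_mono) simp_all
finally show ?thesis by (simp add: e_def pt)
qed

text \<open>The order of limits matters: \<open>de\<close> and the elementary approximant are fixed,
  so that \<open>C\<close> is a constant; then the mesh tends to 0, and only afterwards
  \<open>de\<close>.\<close>

lemma expectation_horizon:
"E3 t <= exp (2 * (3 * Ui + Vi)) * E3 T"
proof -
define K where "K = exp (2 * (3 * Ui + Vi))"
define eT where "eT = E3 T"
have *: "E3 t <= K * (eT + (de * M + 8 * (de * (2 * M + 2 * de)) + 8 * de))"
 if de: "0 < de" for de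
proof -
 have T0: "0 <= T" using t T by simp
 obtain Z J where ZJ: "elementary F W Z J" "time_L2 P T (%s w. Z s w - ze s w) <= ennreal de"
  by (rule ito_L2E_at[OF I T0 de])
 obtain C where C: "0 <= C" "!!s s'. 0 <= s ==> s <= s' ==> integrable P (%w. (J s' w - J s w) ^ 4) &
  expectation (%w. (J s' w - J s w) ^ 4) <= C * (s' - s)^2"
  using elementary_fourth[OF ZJ(1)] by blast
 let ?r = "%n. K * (eT + bd de C (EO n t T) (mesh n))"
 have "?r ----> K * (eT + bd de C 0 0)"
  unfolding bd_def using de by (intro tendsto_intros mesh(2) osc_limit) auto
 moreover have "(%n. 3 * (B * mesh n) + B^2 * mesh n) ----> 3 * (B * 0) + B^2 * 0"
  by (intro tendsto_intros mesh(2))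
 hence "\<forall>\<^sub>F n in sequentially. 3 * (B * mesh n) + B^2 * mesh n < 1 / 2"
  by (rule order_tendstoD(2)) simp
 hence "\<forall>\<^sub>F n in sequentially. E3 t <= ?r n"
  by eventually_elim
   (unfold K_def eT_def, rule expectation_grid[OF de ZJ C(2,1)], auto)
 ultimately have "E3 t <= K * (eT + bd de C 0 0)"
  by (intro tendsto_lowerbound[of ?r]) auto
 thus ?thesis by (simp add: bd_def)
qed
have "((%de. K * (eT + (de * M + 8 * (de * (2 * M + 2 * de)) + 8 * de))) ---> K * (eT + (0 * M + 8 * (0 * (2 * M + 2 * 0)) + 8 * 0))) (at_right 0)"
 by (intro tendsto_intros)
hence "E3 t <= K * (eT + (0 * M + 8 * (0 * (2 * M + 2 * 0)) + 8 * 0))"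
 by (rule tendsto_lowerbound) (auto simp: eventually_at_filter *)
thus ?thesis by (simp add: K_def eT_def)
qed

end

text \<open>The Gronwall factor contains only the total integrals of \<open>u\<close> and
  \<open>u^2\<close>, so it is the same for every horizon. Letting the horizon tend to infinity
  kills the final value, and an expectation of a nonnegative function that is 0 forces
  \<open>npart 3 (x t w) = 0\<close>.\<close>

theorem nonneg: "AE w in P. 0 <= x t w"
proof -
define K where "K = exp (2 * (3 * Ui + Vi))"
have n3m: "(%w. npart 3 (x s w)) \<in> borel_measurable P" if "t <= s" for s
 by (rule measurable_compose[OF xP[OF that] npart_measurable(1)])
have le: "npart 3 (x s w) <= (S w)^2" if "t <= s" "ALL s>=t. abs (x s w) <= S w" for s w
proof -
 have "(x s w)^2 <= (S w)^2" using that S(2)[of w] by (intro power2_le_iff_abs_le[THEN iffD2]) auto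
 thus ?thesis using npart_3_le[of "x s w"] by linarith
qed
let ?T = "%n. t + real (Suc n)"
have "(%n. E3 (?T n)) ----> expectation (%w. 0)"
proof (rule integral_dominated_convergence[where w="%w. (S w)^2"])
 show "AE w in P. norm (npart 3 (x (?T n) w)) <= (S w)^2" for n
  using bound by eventually_elim (use le npart_nonneg(3) in auto)
 show "AE w in P. (%n. npart 3 (x (?T n) w)) ----> 0"
  using lim
 proof eventually_elim
  case (elim w)
  have "filterlim ?T at_top sequentially"
   by (intro filterlim_tendsto_add_at_top[OF tendsto_const] filterlim_compose[OF filterlim_real_sequentially filterlim_Suc])
  with elim have "(%n. x (?T n) w) ----> 0" by (rule filterlim_compose)
  moreover have "isCont (npart 3) 0" using npart_continuous[of 0 "Suc 0"] by (simp add: numeral_3_eq_3)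
  ultimately have "(%n. npart 3 (x (?T n) w)) ----> npart 3 0" by (rule isCont_tendsto_compose[rotated])
  thus ?case by (simp add: npart_3)
 qed
qed (use S n3m in auto)
hence "(%n. K * E3 (?T n)) ----> K * expectation (%w. 0)"
 by (rule tendsto_mult_left)
hence L: "(%n. K * E3 (?T n)) ----> 0" by simp
have le': "E3 t <= K * E3 (?T n)" for n
 unfolding K_def by (rule expectation_horizon) simp
have "E3 t <= 0"
 by (rule tendsto_lowerbound[OF L always_eventually[OF allI[OF le']]]) simp
moreover have "0 <= E3 t" by (auto simp: npart_nonneg intro!: integral_nonneg_AE)
ultimately have z: "E3 t = 0" by simp
\<comment> \<open>The lemma lives in a context with a horizon beyond \<open>t\<close>; any such
  horizon will do, here \<open>t + 1\<close>.\<close>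
have int: "integrable P (%w. npart 3 (x t w))"
 by (rule npart_3_integrable[of "t + 1"]) auto
have "AE w in P. npart 3 (x t w) = 0"
 using integral_nonneg_eq_0_iff_AE[OF int] z by (simp add: npart_nonneg)
thus ?thesis
proof eventually_elim
 case (elim w)
 thus ?case using npart_3_pos[of "x t w"] by linarith
qed
qed

end

section \<open>Paths of reflected equations\<close>

text \<open>At a maximiser \<open>a\<close> of \<open>y\<close> on \<open>S\<close> the successor
  \<open>b\<close> must also be a maximiser and the switch must be free, and likewise from
  \<open>b\<close> to \<open>c\<close>. Then the strict triangle inequality gives
  \<open>C a c < 0\<close>, also when \<open>c = a\<close>.\<close>

lemma no_free_cycle:
fixes C :: "'d::finite => 'd => real" and y :: "'d => real"
assumes C0: "!!i j. 0 <= C i j" and C3: "!!i j l. i ~= j ==> j ~= l ==> C i l < C i j + C j l"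
 and S: "!!a. a \<in> S ==> EX b:S. b ~= a & y a <= y b - C a b"
shows "S = {}"
proof (rule ccontr)
assume ne: "S ~= {}"
have "Max (y ` S) \<in> y ` S" using ne by (intro Max_in) auto
then obtain a where a: "a \<in> S" "Max (y ` S) = y a" by auto
have max: "y b <= y a" if "b \<in> S" for b
 unfolding a(2)[symmetric] using that by (intro Max_ge) auto
obtain b where b: "b \<in> S" "b ~= a" "y a <= y b - C a b" using S[OF a(1)] by auto
hence ab: "C a b = 0" "y b = y a" using max[OF b(1)] C0[of a b] by auto
obtain c where c: "c \<in> S" "c ~= b" "y b <= y c - C b c" using S[OF b(1)] by auto
hence "C b c = 0" using max[OF c(1)] ab C0[of b c] by auto
thus False using C3[of a b c] C0[of a c] ab b(2) c(2) by auto
qed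

lemma eventually_at_left_Ioo:
fixes b :: real
shows "eventually P (at_left b) ==> a < b ==> EX c. a < c & c < b & (ALL r. c < r --> r < b --> P r)"
proof -
assume P: "eventually P (at_left b)" and ab: "a < b"
obtain c where "c < b" "ALL r>c. r < b --> P r" using P eventually_at_left[OF ab] by auto
thus ?thesis using ab by (intro exI[of _ "max c ((a + b) / 2)"]) (auto simp: less_max_iff_disj)
qed

text \<open>What a single path inherits from the reflected equation. Only the sum
  \<open>y + k\<close> is known to be left-continuous, because the equation gives it as a continuous
  path; the aim is the continuity of \<open>k\<close> alone.\<close>

locale reflected_path =
fixes y k :: "real => real^'d::finite" and C :: "'d => 'd => real" and T :: ennreal
assumes C0: "!!i j. 0 <= C i j" and C3: "!!i j l. i ~= j ==> j ~= l ==> C i l < C i j + C j l"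
 and cadlag_y: "cadlag y" and cadlag_k: "cadlag k" and mono_k: "!!i. mono_on {0..} (%s. k s $ i)"
 and cont_yk: "!!s. 0 < s ==> ennreal s <= T ==> ((%r. y r + k r) ---> y s + k s) (at_left s)"
 and obstacle: "!!s i j. 0 <= s ==> y s $ j - C i j <= y s $ i"
 and skorokhod: "!!i. (\<integral>\<^sup>+s\<in>{s. 0 <= s & ennreal s <= T} - {0}.
  e2ennreal (ereal (Lim (at_left s) y $ i) - barrier C i (Lim (at_left s) y))
  \<partial>interval_measure (%s. k (max 0 s) $ i)) = 0"
begin

lemma left_limit: "0 < s ==> (y ---> Lim (at_left s) y) (at_left s)"
using cadlag_y unfolding cadlag_def by (metis tendsto_Lim trivial_limit_at_left_real)

text \<open>Away from the obstacle by \<open>c\<close>, the Skorokhod integrand is at least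
  \<open>c\<close> on \<open>(a, b]\<close>, so \<open>dk\<close> does not charge this interval. The
  end \<open>b\<close> is included since the integrand takes left limits, which see only times
  before \<open>b\<close>.\<close>

lemma constant_below_barrier:
assumes ab: "0 <= a" "a < b" "ennreal b <= T" and c: "0 < c"
 and gap: "!!r j. a < r ==> r < b ==> j ~= i ==> c <= y r $ i - y r $ j + C i j"
shows "k b $ i = k a $ i"
proof -
let ?F = "%s. k (max 0 s) $ i" and ?L = "%s. Lim (at_left s) y"
have mono: "mono ?F" using mono_k[of i] by (auto simp: mono_def mono_on_def)
have rc: "continuous (at_right s) ?F" for s
proof (cases "0 <= s")
 case True
 hence "(k ---> k s) (at_right s)" using cadlag_k by (auto simp: cadlag_def)
 hence "((%r. k r $ i) ---> k s $ i) (at_right s)" by (rule tendsto_vec_nth)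
 moreover have "eventually (%r. k r $ i = ?F r) (at_right s)"
  using True by (auto simp: eventually_at_topological max_absorb2 intro!: exI[of _ UNIV])
 ultimately have "(?F ---> k s $ i) (at_right s)" by (rule Lim_transform_eventually)
 thus ?thesis using True by (simp add: continuous_within max_absorb2)
next
 case False
 hence "eventually (%r. ?F r = ?F s) (at_right s)"
  by (auto simp: eventually_at_right[of s 0] intro!: exI[of _ 0])
 thus ?thesis unfolding continuous_within by (rule tendsto_eventually)
qed
have L: "c <= ?L r $ i - ?L r $ j + C i j" if r: "a < r" "r <= b" and j: "j ~= i" for r j
proof (rule tendsto_lowerbound)
 have lim: "(y ---> ?L r) (at_left r)" using r ab by (intro left_limit) auto
 show "((%r. y r $ i - y r $ j + C i j) ---> ?L r $ i - ?L r $ j + C i j) (at_left r)"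
  by (intro tendsto_intros lim)
 show "eventually (%r'. c <= y r' $ i - y r' $ j + C i j) (at_left r)"
  unfolding eventually_at_left[OF r(1)] using gap[OF _ _ j] r by (auto intro!: exI[of _ a])
qed simp
have "(\<integral>\<^sup>+s. ennreal c * indicator {a<..b} s \<partial>interval_measure ?F) <= (\<integral>\<^sup>+s\<in>{s. 0 <= s & ennreal s <= T} - {0}.
  e2ennreal (ereal (?L s $ i) - barrier C i (?L s)) \<partial>interval_measure ?F)"
proof (intro nn_integral_mono)
 fix s
 show "ennreal c * indicator {a<..b} s <= e2ennreal (ereal (?L s $ i) - barrier C i (?L s)) * indicator ({s. 0 <= s & ennreal s <= T} - {0}) s"
 proof (cases "s \<in> {a<..b}")
  case True
  hence "ennreal s <= T" using ab(3) by (auto intro: order_trans[OF ennreal_leI])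
  moreover have "ereal c <= ereal (?L s $ i) - barrier C i (?L s)"
  proof -
   have "barrier C i (?L s) <= ereal (?L s $ i - c)"
    unfolding barrier_def by (rule SUP_least) (use True L[of s] in force)
   hence "ereal (?L s $ i) - ereal (?L s $ i - c) <= ereal (?L s $ i) - barrier C i (?L s)"
    by (rule ereal_minus_mono[OF order_refl])
   thus ?thesis by simp
  qed
  hence "ennreal c <= e2ennreal (ereal (?L s $ i) - barrier C i (?L s))"
   using e2ennreal_mono by fastforce
  ultimately show ?thesis using True ab(1) by (auto simp: indicator_def)
 qed simp
qed
hence "ennreal c * emeasure (interval_measure ?F) {a<..b} = 0"
 using skorokhod[of i] by (simp add: nn_integral_cmult_indicator)
moreover have "emeasure (interval_measure ?F) {a<..b} = ennreal (?F b - ?F a)"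
 using mono rc ab(2) by (intro emeasure_interval_measure_Ioc) (auto simp: mono_def)
ultimately have "?F b - ?F a <= 0" using c by (simp add: ennreal_eq_0_iff)
thus ?thesis using mono_k[of i] ab by (auto simp: mono_on_def max_absorb2 intro: antisym)
qed

text \<open>A jump of \<open>k\<close> in component \<open>i\<close> requires the left limit of
  \<open>y\<close> to touch the obstacle of \<open>i\<close> through some \<open>j\<close>. As
  \<open>y + k\<close> does not jump, \<open>y\<close> falls in component \<open>i\<close>, and the
  constraint at \<open>s\<close> then forces a jump in component \<open>j\<close> too. The jumping
  modes would contain a free cycle.\<close>

lemma left_continuous_k:
assumes s: "0 < s" "ennreal s <= T"
shows "(k ---> k s) (at_left s)"
proof -
define l where "l = Lim (at_left s) k"
have l: "(k ---> l) (at_left s)" using cadlag_k s unfolding cadlag_def l_def by (metis tendsto_Lim trivial_limit_at_left_real)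
define L where "L = Lim (at_left s) y"
have L: "(y ---> L) (at_left s)" unfolding L_def using s by (intro left_limit)
have yk: "L + l = y s + k s"
 using tendsto_unique[OF _ tendsto_add[OF L l] cont_yk[OF s]] by simp
have le: "l $ i <= k s $ i" for i
proof (rule tendsto_upperbound[OF tendsto_vec_nth[OF l]])
 show "eventually (%r. k r $ i <= k s $ i) (at_left s)"
  unfolding eventually_at_left[OF s(1)] using mono_k[of i] s by (auto intro!: exI[of _ 0] simp: mono_on_def)
qed simp
have "{i. l $ i < k s $ i} = {}"
proof (rule no_free_cycle[OF C0 C3, where y="%i. L $ i"])
 fix i assume i: "i \<in> {i. l $ i < k s $ i}"
 have "EX j. j ~= i & L $ i <= L $ j - C i j"
 proof (rule ccontr)
  assume "~ ?thesis"
  hence pos: "0 < L $ i - L $ j + C i j" if "j ~= i" for j using that by force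
  \<comment> \<open>Half of the smallest gap, so that the strict gap survives for times shortly
    before \<open>s\<close>; the 1 covers the case of a single mode.\<close>
  define c where "c = Min (insert 1 ((%j. L $ i - L $ j + C i j) ` (- {i}))) / 2"
  have c0: "0 < c" unfolding c_def using pos by auto
  have c: "c < L $ i - L $ j + C i j" if "j ~= i" for j
  proof -
   have "2 * c <= L $ i - L $ j + C i j" unfolding c_def using that by (auto intro!: Min_le)
   thus ?thesis using c0 by linarith
  qed
  have "eventually (%r. j ~= i --> c < y r $ i - y r $ j + C i j) (at_left s)" for j
  proof (cases "j = i")
   case False
   have "eventually (%r. c < y r $ i - y r $ j + C i j) (at_left s)"
    by (rule order_tendstoD(1)[OF _ c[OF False]]) (intro tendsto_intros L)
   thus ?thesis by (rule eventually_mono) simp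
  qed simp
  hence "eventually (%r. ALL j. j ~= i --> c < y r $ i - y r $ j + C i j) (at_left s)"
   by (rule eventually_all_finite)
  from eventually_at_left_Ioo[OF this s(1)]
  obtain a where a: "0 < a" "a < s" "!!r j. a < r ==> r < s ==> j ~= i ==> c < y r $ i - y r $ j + C i j" by blast
  have const: "k s $ i = k r $ i" if "a < r" "r < s" for r
   by (rule constant_below_barrier[where c=c]) (use that a(1) s c0 in \<open>auto intro!: less_imp_le a(3)\<close>)
  have "((%r. k r $ i) ---> k s $ i) (at_left s)"
   by (rule tendsto_eventually) (unfold eventually_at_left[OF a(2)], use const a(2) in \<open>auto intro!: exI[of _ a]\<close>)
  hence "l $ i = k s $ i" by (intro tendsto_unique[OF _ tendsto_vec_nth[OF l]]) auto
  thus False using i by simp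
 qed
 then obtain j where j: "j ~= i" "L $ i <= L $ j - C i j" by blast
 \<comment> \<open>If component \<open>j\<close> did not jump, \<open>y\<close> would violate the
   constraint between \<open>i\<close> and \<open>j\<close> at \<open>s\<close>.\<close>
 have "y s $ a = L $ a + l $ a - k s $ a" for a using arg_cong[OF yk, of "%v. v $ a"] by simp
 hence "l $ j < k s $ j" using i j obstacle[of s j i] s by auto
 thus "EX b:{i. l $ i < k s $ i}. b ~= i & L $ i <= L $ b - C i b" using j by auto
qed
hence "l $ i = k s $ i" for i using le[of i] by (auto simp: less_le)
hence "l = k s" by (simp add: vec_eq_iff)
thus ?thesis using l by simp
qed

lemma continuous_k: "continuous_on {s. 0 <= s & ennreal s <= T} k"
proof (rule continuous_on_subset[of "{0..} \<inter> {s. 0 <= s & ennreal s <= T}"], unfold continuous_on_def, intro ballI)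
fix s assume s: "s \<in> {0..} \<inter> {s. 0 <= s & ennreal s <= T}"
have r: "(k ---> k s) (at_right s)" using cadlag_k s by (auto simp: cadlag_def)
show "(k ---> k s) (at s within {0..} \<inter> {s. 0 <= s & ennreal s <= T})"
proof (cases "s = 0")
 case True
 hence "(k ---> k s) (at s within {0..})" using r by (simp add: at_within_Ici_at_right)
 thus ?thesis by (rule tendsto_within_subset) auto
next
 case False
 hence "(k ---> k s) (at_left s)" using s by (intro left_continuous_k) auto
 hence "(k ---> k s) (at s)" using r by (simp add: filterlim_at_split)
 thus ?thesis by (rule tendsto_within_subset) auto
qed
qed auto

end

section \<open>A square integrable bound for the paths of a process\<close>

context brownian_basis
begin

text \<open>The supremum over rational times is measurable and below the one in the definition of
  the space. Right-continuity extends the bound to all times strictly before \<tau>; at \<tau>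
  itself there may be no rational time to the right.\<close>

lemma S2_bound:
fixes Y :: "real => 'w => 'b::euclidean_space"
assumes Y: "Y \<in> S2 P F \<tau>" and \<tau>: "stopping_time F \<tau>"
obtains S where "S \<in> borel_measurable P" "!!w. 0 <= S w" "integrable P (%w. (S w)^2)"
 "AE w in P. ALL s. 0 <= s & ennreal s < \<tau> w --> norm (Y s w) <= S w"
proof -
let ?D = "{q \<in> \<rat>. (0::real) <= q}"
define h where "h q w = (if ennreal q < \<tau> w then nsq (Y q w) else 0)" for q w
define H where "H w = (SUP q\<in>?D. h q w)" for w
have [measurable]: "Y q \<in> borel_measurable P" if "0 <= q" for q
 using Y that by (intro measurable_F_P[of _ "ennreal q"]) (simp add: S2_def adapted_def)
have [measurable]: "Measurable.pred P (%w. ennreal q < \<tau> w)" for q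
 using stopping_timeD2[OF \<tau>] by (rule measurable_F_P)
have "countable ?D" using countable_rat by (rule countable_subset[rotated]) auto
hence Hm [measurable]: "H \<in> borel_measurable P"
 unfolding H_def h_def by (intro borel_measurable_SUP) auto
have le: "H w <= (SUP t\<in>horizon \<tau> w. nsq (Y t w))" for w
 unfolding H_def h_def by (intro SUP_least) (auto simp: horizon_def intro!: SUP_upper)
have "(EE w. H w) <= (EE w. (SUP t\<in>horizon \<tau> w. nsq (Y t w)))"
 using le by (intro nn_integral_mono) auto
hence fin: "(EE w. H w) < \<infinity>" using Y by (auto simp: S2_def)
hence ae: "AE w in P. H w ~= \<infinity>" by (intro nn_integral_PInf_AE) auto
show thesis
proof (rule that[of "%w. sqrt (enn2real (H w))"])
 have "(EE w. ennreal (enn2real (H w))) = (EE w. H w)"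
  using ae by (intro nn_integral_cong_AE) (auto simp: less_top)
 thus "integrable P (%w. (sqrt (enn2real (H w)))^2)"
  using fin by (intro integrableI_nonneg) auto
 have "AE w in P. cadlag (%t. Y t w)" using Y by (simp add: S2_def)
 with ae show "AE w in P. ALL s. 0 <= s & ennreal s < \<tau> w --> norm (Y s w) <= sqrt (enn2real (H w))"
 proof (eventually_elim, intro allI impI)
  fix w s assume fin: "H w ~= \<infinity>" and cad: "cadlag (%t. Y t w)" and s: "0 <= s & ennreal s < \<tau> w"
  let ?S = "sqrt (enn2real (H w))"
  have q: "norm (Y q w) <= ?S" if "q \<in> ?D" "ennreal q < \<tau> w" for q
  proof -
   have "nsq (Y q w) <= H w"
    unfolding H_def using SUP_upper[OF that(1), of "%q. h q w"] that(2) by (simp add: h_def)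
   also have "... = ennreal (enn2real (H w))" using fin by (simp add: less_top)
   finally show ?thesis by (intro real_le_rsqrt) simp
  qed
  show "norm (Y s w) <= ?S"
  proof (rule ccontr)
   assume "~ ?thesis"
   moreover have "((%r. norm (Y r w)) ---> norm (Y s w)) (at_right s)"
    using cad s by (intro tendsto_norm) (simp add: cadlag_def)
   ultimately have "eventually (%r. ?S < norm (Y r w)) (at_right s)"
    by (intro order_tendstoD) auto
   moreover have "eventually (%r. ennreal r < \<tau> w) (at_right s)"
    by (rule order_tendstoD[OF tendsto_ennrealI[OF tendsto_ident_at]]) (use s in auto)
   ultimately have "eventually (%r. ?S < norm (Y r w) & ennreal r < \<tau> w) (at_right s)"
    by (rule eventually_conj)
   then obtain b where b: "s < b" "!!r. s < r ==> r < b ==> ?S < norm (Y r w) & ennreal r < \<tau> w"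
    unfolding eventually_at_right_field by blast
   obtain q where "q \<in> \<rat>" "s < q" "q < b" using Rats_dense_in_real[OF b(1)] by blast
   thus False using q[of q] b(2)[of q] s by auto
  qed
 qed
qed (auto intro: Hm)
qed

end

definition prim :: "(real => real) => real => real" where
"prim h s = (LINT r:{0..s}|lborel. h r)"

lemma prim:
assumes h: "integrable lborel h"
shows prim_continuous: "continuous_on UNIV (prim h)" (is ?Q1)
 and prim_diff: "0 <= s ==> s <= s' ==> prim h s' - prim h s = (LINT r:{s..s'}|lborel. h r)"
 and prim_tail: "(!!r. r < 0 ==> h r = 0) ==> 0 <= s ==> (LINT r:{s..}|lborel. h r) = integral\<^sup>L lborel h - prim h s"
 and prim_tendsto: "(!!r. r < 0 ==> h r = 0) ==> (prim h ---> integral\<^sup>L lborel h) at_top"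
proof -
have si: "set_integrable lborel A h" if "A \<in> sets lborel" for A
 unfolding set_integrable_def using integrable_mult_indicator[OF that h] by simp
show ?Q1
 unfolding prim_def by (rule continuous_on_LBINT) (auto intro: si)
have split: "(LINT r:A \<union> B|lborel. h r) = (LINT r:A|lborel. h r) + (LINT r:B|lborel. h r)"
 if "A \<inter> B = {s}" "A \<in> sets lborel" "B \<in> sets lborel" for A B s
 using that AE_lborel_singleton[of s] by (intro set_integral_Un_AE si) (auto elim!: eventually_mono)
show "prim h s' - prim h s = (LINT r:{s..s'}|lborel. h r)" if "0 <= s" "s <= s'"
 using split[of "{0..s}" "{s..s'}" s] that unfolding prim_def by (auto simp: ivl_disj_un Int_absorb)
assume 0: "!!r. r < 0 ==> h r = 0"
hence eq: "integral\<^sup>L lborel h = (LINT r:{0..}|lborel. h r)"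
 unfolding set_lebesgue_integral_def by (intro Bochner_Integration.integral_cong) (auto simp: indicator_def)
show "(LINT r:{s..}|lborel. h r) = integral\<^sup>L lborel h - prim h s" if "0 <= s"
proof -
 have "{0..s} \<union> {s..} = {0..}" using that by auto
 thus ?thesis using split[of "{0..s}" "{s..}" s] that unfolding prim_def eq by auto
qed
have "prim h s = (\<integral>x. indicator {..s} x *\<^sub>R h x \<partial>lborel)" for s
 unfolding prim_def set_lebesgue_integral_def using 0
 by (intro Bochner_Integration.integral_cong) (auto simp: indicator_def)
hence "prim h = (%s. \<integral>x. indicator {..s} x *\<^sub>R h x \<partial>lborel)" by auto
thus "(prim h ---> integral\<^sup>L lborel h) at_top" using tendsto_integral_at_top[OF _ h] by simp
qed

lemma set_lebesgue_integral_indicator: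
"(LINT r:A \<inter> B|M. h r) = (LINT r:A|M. indicator B r * (h r :: real))"
by (simp add: set_lebesgue_integral_def indicator_inter_arith ac_simps)

section \<open>Stopped integrands\<close>

context brownian_basis
begin

definition sq_total :: "('w => ennreal) => (real => 'w => 'b::euclidean_space) => real" where
"sq_total \<tau> Z = enn2real (EE w. (NN s:horizon \<tau> w. nsq (Z s w)))"

lemma time_L2_stop_integrand:
assumes Z: "Z \<in> M2 P F \<tau>" and V: "AE w in P. ALL s. norm (V s w) <= norm (Z s w)"
shows "time_L2 P T (stop_integrand \<tau> V) <= ennreal (sq_total \<tau> Z)"
proof -
have "time_L2 P T (stop_integrand \<tau> V) <= (EE w. (NN s:horizon \<tau> w. nsq (Z s w)))"
 unfolding time_L2_def
proof (rule nn_integral_mono_AE, use V in eventually_elim)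
 fix w assume V: "ALL s. norm (V s w) <= norm (Z s w)"
 show "(NN s:{0..T}. nsq (stop_integrand \<tau> V s w)) <= (NN s:horizon \<tau> w. nsq (Z s w))"
  using V by (intro nn_integral_mono) (auto simp: stop_integrand_def indicator_def intro!: ennreal_leI power_mono)
qed
also have "... = ennreal (sq_total \<tau> Z)"
 using Z by (auto simp: M2_def sq_integrable_process_def sq_total_def)
finally show ?thesis .
qed

text \<open>The integral of the stopped integrand is constant after \<tau>, so for finite \<tau> its
  limit at infinity is attained at \<tau> already.\<close>

lemma ito_remainderE:
assumes R: "ito_remainder P F W \<tau> V R" and Z: "Z \<in> M2 P F \<tau>"
 and V: "!!s w. norm (V s w) <= norm (Z s w)" and \<tau>: "stopping_time F \<tau>"
obtains J JT where "ito_L2 P F W (stop_integrand \<tau> V) J"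
 "AE w in P. (ALL s>=0. R s w = JT w - J s w) & ((%s. J s w) ---> JT w) at_top
  & (ALL s>=0. \<tau> w <= ennreal s --> J s w = JT w) & continuous_on {0..} (%s. J s w)"
proof -
obtain J JT where J: "ito_integral P F W (stop_integrand \<tau> V) J"
 and lim: "AE w in P. ((%t. J t w) ---> JT w) at_top & (ALL t>=0. R t w = JT w - J t w)"
 using R unfolding ito_remainder_def by blast
have I: "ito_L2 P F W (stop_integrand \<tau> V) J"
 using J by (rule ito_L2_of_ito_integral) (rule le_less_trans[OF time_L2_stop_integrand[OF Z]], use V in auto)
have "AE w in P. ALL t>=0. J t w = J (stop_time \<tau> t w) w"
 by (rule ito_L2_const_after[OF I \<tau>]) (auto simp: stop_integrand_def horizon_def)
with lim ito_L2D(3)[OF I]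
have "AE w in P. (ALL s>=0. R s w = JT w - J s w) & ((%s. J s w) ---> JT w) at_top
  & (ALL s>=0. \<tau> w <= ennreal s --> J s w = JT w) & continuous_on {0..} (%s. J s w)"
proof eventually_elim
 fix w assume lim: "((%t. J t w) ---> JT w) at_top & (ALL t>=0. R t w = JT w - J t w)"
  and st: "ALL t>=0. J t w = J (stop_time \<tau> t w) w" and c: "continuous_on {0..} (%t. J t w)"
 have "J s w = JT w" if s: "0 <= s" "\<tau> w <= ennreal s" for s
 proof -
  have "J r w = J s w" if "s <= r" for r
  proof -
   have "\<tau> w <= ennreal r" using s that by (meson ennreal_leI order_trans)
   hence "stop_time \<tau> r w = stop_time \<tau> s w" using s by (simp add: stop_time_def min_absorb2)
   thus ?thesis using st s that by (metis order_trans)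
  qed
  hence "((%r. J r w) ---> J s w) at_top"
   by (intro tendsto_eventually eventually_at_top_linorderI[of s])
  thus ?thesis using lim tendsto_unique[OF trivial_limit_at_top_linorder] by blast
 qed
 thus "(ALL s>=0. R s w = JT w - J s w) & ((%s. J s w) ---> JT w) at_top
  & (ALL s>=0. \<tau> w <= ennreal s --> J s w = JT w) & continuous_on {0..} (%s. J s w)" using lim c by auto
qed
thus thesis using that I by blast
qed

end

section \<open>The pathwise form of the reflected equation\<close>

locale switching = brownian_basis P W F
for P :: "'w measure" and W :: "real => 'w => real^'p::finite" and F :: "ennreal => 'w measure" +
fixes \<tau> :: "'w => ennreal" and X :: "'d::finite => real => 'w => real" and XT :: "'d => 'w => real"
 and g :: "real => real" and f :: "real => 'w => real => real => real^'p => 'd => real"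
 and C :: "'d => 'd => real" and u :: "real => real"
assumes \<tau>: "stopping_time F \<tau>"
 and u_pos: "!!s. s >= 0 ==> 0 < u s" and u_bdd: "bounded (u ` {0..})"
 and u_int: "set_integrable lborel {0..} u" and u2_int: "set_integrable lborel {0..} (%s. (u s)^2)"
 and Lip_f: "!!s w x x' y y' z z' i. s >= 0 ==> w \<in> space P ==>
  abs (f s w x y z i - f s w x' y' z' i) <= u s * (abs (x - x') + abs (y - y') + norm (z - z'))"
 and C0: "!!i j. 0 <= C i j" and C3: "!!i j l. i ~= j ==> j ~= l ==> C i l < C i j + C j l"
begin

abbreviation "hor \<equiv> horizon \<tau>"
abbreviation "ubar r \<equiv> indicator {0..} r * u r"

lemma u_bar:
"ubar \<in> borel_measurable borel" "0 <= ubar r"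
"ubar r <= (SUP r\<in>{0..}. u r)" "integrable lborel ubar"
"integrable lborel (%r. (ubar r)^2)"
proof -
have bdd: "bdd_above (u ` {0..})" using bounded_imp_bdd_above[OF u_bdd] .
show i: "integrable lborel ubar" using u_int by (simp add: set_integrable_def)
have "(ubar r)^2 = indicator {0..} r * (u r)^2" for r by (simp add: power2_eq_square indicator_def)
thus "integrable lborel (%r. (ubar r)^2)" using u2_int by (simp add: set_integrable_def)
have "u 0 <= (SUP r\<in>{0..}. u r)" by (rule cSUP_upper[OF _ bdd]) simp
hence "0 <= (SUP r\<in>{0..}. u r)" using u_pos[of 0] by simp
thus "ubar r <= (SUP r\<in>{0..}. u r)"
 using cSUP_upper[OF _ bdd, of r] by (auto simp: indicator_def)
show "0 <= ubar r" using u_pos[of r] by (auto simp: indicator_def less_imp_le)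
show "ubar \<in> borel_measurable borel" using borel_measurable_integrable[OF i] by simp
qed


text \<open>The indicator of the horizon turns all integrals up to \<tau> into integrals over the
  line, for finite and infinite \<tau> alike.\<close>

definition driver :: "(real => 'w => real^'d) => (real => 'w => real^'p^'d) => 'd => 'w => real => real" where
"driver Y Z i w s = indicator (hor w) s * f s w (X i s w) (Y s w $ i) (Z s w $ i) i"

definition stopped :: "(real => 'w => 'b) => 'w => real => 'b" where
"stopped K w s = K (stop_time \<tau> s w) w"

text \<open>The pathwise content of the reflected equation, with \<open>J i\<close> the stochastic integral of the
stopped row \<open>Z i\<close>.\<close>

definition solves :: "(real => 'w => real^'d) => (real => 'w => real^'p^'d) => (real => 'w => real^'d)
 => ('d => real => 'w => real) => 'w => bool" where
"solves Y Z K J w \<longleftrightarrow>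
  continuous_on {0..} (%s. Y s w) & continuous_on {0..} (stopped K w) &
  (ALL i. integrable lborel (driver Y Z i w)) & (ALL i. continuous_on {0..} (%s. J i s w)) &
  (ALL i. mono_on {0..} (%s. stopped K w s $ i)) & K 0 w = 0 &
  (ALL i s s'. 0 <= s --> s <= s' --> Y s' w $ i - Y s w $ i =
   J i s' w - J i s w - (prim (driver Y Z i w) s' - prim (driver Y Z i w) s)
   - (stopped K w s' $ i - stopped K w s $ i)) &
  (ALL i s. 0 <= s --> \<tau> w <= ennreal s --> Y s w $ i = g (XT i w)) &
  (ALL i. ((%s. Y s w $ i) ---> g (XT i w)) at_top) &
  (ALL i j s. 0 <= s --> Y s w $ j - C i j <= Y s w $ i) &
  (ALL i a b c. 0 <= a --> a < b --> ennreal b <= \<tau> w --> 0 < c -->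
   (ALL r j. a < r --> r < b --> j ~= i --> c <= Y r w $ i - Y r w $ j + C i j) -->
   stopped K w b $ i = stopped K w a $ i)"

lemma stopped_horizon: "0 <= s ==> ennreal s <= \<tau> w ==> stopped K w s = K s w"
by (simp add: stopped_def stop_time_def min_absorb1)

lemma hor_iff: "s \<in> hor w \<longleftrightarrow> 0 <= s & ennreal s <= \<tau> w"
by (simp add: horizon_def)

lemma stop_in_hor: "0 <= s ==> stop_time \<tau> s w \<in> hor w"
by (simp add: hor_iff stop_time_nonneg ennreal_stop_time)

lemma stop_after: "0 <= s ==> \<tau> w <= ennreal s ==> stop_time \<tau> s w = enn2real (\<tau> w)"
by (simp add: stop_time_def min_absorb2)

lemma mono_bounded_tendsto:
fixes h :: "real => real"
assumes "mono_on {0..} h" "!!s. 0 <= s ==> h s <= B"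
shows "EX l. (h ---> l) at_top"
proof
have bdd: "bdd_above (h ` {0..})" using assms(2) by (auto intro!: bdd_aboveI[of _ B])
show "(h ---> (SUP s\<in>{0..}. h s)) at_top"
proof (rule increasing_tendsto)
 show "eventually (%s. h s <= (SUP s\<in>{0..}. h s)) at_top"
  using bdd by (intro eventually_at_top_linorderI[of 0] cSUP_upper) auto
 fix x assume "x < (SUP s\<in>{0..}. h s)"
 then obtain s where "0 <= s" "x < h s" using less_cSUP_iff[OF _ bdd, of x] by auto
 thus "eventually (%s. x < h s) at_top"
  using assms(1) by (intro eventually_at_top_linorderI[of s]) (auto simp: mono_on_def intro: less_le_trans)
qed
qed

lemma prim_after:
assumes h: "integrable lborel h" "!!r. r \<notin> hor w ==> h r = 0" and s: "0 <= s" "\<tau> w <= ennreal s"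
shows "prim h s = integral\<^sup>L lborel h"
proof -
have "(LINT r:{s..}|lborel. h r) = (LINT r|(lborel :: real measure). 0)"
 unfolding set_lebesgue_integral_def
proof (rule Bochner_Integration.integral_cong_AE)
 have "h r = 0" if "s < r" for r
  using s that by (intro h(2)) (auto simp: hor_iff not_le intro: le_less_trans ennreal_lessI)
 thus "AE r in lborel. indicator {s..} r *\<^sub>R h r = 0"
  using AE_lborel_singleton[of s] by (auto elim!: eventually_mono simp: indicator_def)
qed (use h in auto)
thus ?thesis using prim_tail[OF h(1) _ s(1)] h(2) by (simp add: hor_iff)
qed

text \<open>The equation writes \<open>Y\<close> plus the stopped \<open>K\<close> as a constant
  plus a continuous path, which is the input of \<open>reflected_path\<close>. Continuity of
  \<open>K\<close> on the horizon, and with it that of \<open>Y\<close>, is the output.\<close>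

lemma solves_pathI:
assumes Y: "cadlag (%s. Y s w)" and K: "cadlag (%s. K s w)" "K 0 w = 0" "!!i. mono_on {0..} (%s. K s w $ i)"
 and B: "!!s. 0 <= s ==> ennreal s < \<tau> w ==> norm (K s w) <= B"
 and h: "!!i. integrable lborel (driver Y Z i w)"
 and J: "!!i. continuous_on {0..} (%s. J i s w)" "!!i. ((%s. J i s w) ---> JT i) at_top"
  "!!i s. 0 <= s ==> \<tau> w <= ennreal s ==> J i s w = JT i"
 and eq: "!!i s. 0 <= s ==> Y s w $ i = g (XT i w) + (integral\<^sup>L lborel (driver Y Z i w) - prim (driver Y Z i w) s)
  + (Lim at_top (%s. stopped K w s $ i) - stopped K w s $ i) - (JT i - J i s w)"
 and obst: "!!i j s. 0 <= s ==> Y s w $ j - C i j <= Y s w $ i"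
 and sk: "!!i. (\<integral>\<^sup>+s\<in>{s. 0 <= s & ennreal s <= \<tau> w} - {0}.
  e2ennreal (ereal (Lim (at_left s) (%r. Y r w) $ i) - barrier C i (Lim (at_left s) (%r. Y r w)))
  \<partial>interval_measure (%s. K (max 0 s) w $ i)) = 0"
shows "solves Y Z K J w"
proof -
let ?h = "%i. driver Y Z i w" and ?k = "%i s. stopped K w s $ i"
have h0: "?h i r = 0" if "r \<notin> hor w" for i r using that by (simp add: driver_def)
have h00: "?h i r = 0" if "r < 0" for i r using that by (intro h0) (simp add: hor_iff)
have kmono: "mono_on {0..} (?k i)" for i
 unfolding mono_on_def stopped_def
proof (intro allI impI)
 fix r s :: real assume "r \<in> {0..} & s \<in> {0..} & r <= s"
 hence "stop_time \<tau> r w <= stop_time \<tau> s w"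
  unfolding stop_time_def by (intro enn2real_mono min.mono ennreal_leI) (auto simp: min_less_iff_disj)
 thus "K (stop_time \<tau> r w) w $ i <= K (stop_time \<tau> s w) w $ i"
  using K(3)[of i] stop_time_nonneg[of \<tau> r w] stop_time_nonneg[of \<tau> s w] by (auto simp: mono_on_def)
qed
\<comment> \<open>A bound is needed for the limit of the stopped \<open>K\<close> to exist.
  \<open>B\<close> is available only strictly before \<tau>, so the value at \<tau> enters
  separately.\<close>
have kbd: "?k i s <= max B (norm (K (enn2real (\<tau> w)) w))" if "0 <= s" for i s
proof (cases "ennreal s < \<tau> w")
 case True
 hence "?k i s <= norm (K s w)" using component_le_norm_cart[of "K s w" i] that
  by (simp add: stopped_horizon less_imp_le abs_le_iff)
 thus ?thesis using B[OF that True] by linarith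
next
 case False
 thus ?thesis using component_le_norm_cart[of "K (enn2real (\<tau> w)) w" i] that
  by (simp add: stopped_def stop_after abs_le_iff le_max_iff_disj)
qed
have klim: "(?k i ---> Lim at_top (?k i)) at_top" for i
 using mono_bounded_tendsto[OF kmono kbd, of i] tendsto_Lim[OF trivial_limit_at_top_linorder] by metis
have kafter: "Lim at_top (?k i) = ?k i s" if "0 <= s" "\<tau> w <= ennreal s" for i s
proof (rule tendsto_Lim)
 show "(?k i ---> ?k i s) at_top"
 proof (intro tendsto_eventually eventually_at_top_linorderI[of s])
  fix r assume "s <= r"
  thus "?k i r = ?k i s" using that order_trans[OF that(2) ennreal_leI, of r] by (simp add: stopped_def stop_after)
 qed
qed simp
define G where "G s = (\<chi> i. J i s w - prim (?h i) s)" for s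
define c where "c = (\<chi> i. g (XT i w) + integral\<^sup>L lborel (?h i) + Lim at_top (?k i) - JT i)"
have G: "continuous_on {0..} G"
 unfolding G_def using J(1) continuous_on_subset[OF prim_continuous[OF h]] by (intro continuous_intros) auto
have YG: "Y s w + stopped K w s = c + G s" if "0 <= s" for s
 using eq[OF that] by (simp add: vec_eq_iff c_def G_def)
interpret reflected_path "%s. Y s w" "%s. K s w" C "\<tau> w"
proof
 fix s :: real assume s: "0 < s" "ennreal s <= \<tau> w"
 have "isCont G s" using continuous_on_subset[OF G, of "{0<..}"] s(1) by (fastforce simp: continuous_on_eq_continuous_at)
 hence "((%r. c + G r) ---> c + G s) (at_left s)"
  by (intro tendsto_intros) (simp add: isCont_def filterlim_at_split)
 moreover have "eventually (%r. c + G r = Y r w + K r w) (at_left s)"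
  unfolding eventually_at_left[OF s(1)]
 proof (intro exI[of _ 0] conjI allI impI)
  fix r :: real assume r: "0 < r" "r < s"
  hence "ennreal r <= \<tau> w" using s(2) by (meson ennreal_leI less_imp_le order_trans)
  thus "c + G r = Y r w + K r w" using YG[of r] r by (simp add: stopped_horizon)
 qed (use s in auto)
 ultimately show "((%r. Y r w + K r w) ---> Y s w + K s w) (at_left s)"
  using YG[of s] s by (simp add: stopped_horizon Lim_transform_eventually)
qed (use Y K obst sk C0 C3 in auto)
have ck: "continuous_on {0..} (stopped K w)"
 unfolding stopped_def by (rule continuous_on_compose2[OF continuous_k continuous_on_stop_time])
  (use stop_in_hor in \<open>auto simp: hor_iff\<close>)
have "continuous_on {0..} (%s. c + G s - stopped K w s)" using G ck by (intro continuous_intros)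
hence cY: "continuous_on {0..} (%s. Y s w)"
 by (rule continuous_on_eq) (simp add: YG[symmetric])
have fin: "Y s w $ i = g (XT i w)" if "0 <= s" "\<tau> w <= ennreal s" for i s
 using eq[OF that(1)] kafter[OF that] J(3)[OF that] prim_after[OF h h0 that] by simp
have lim0: "((%s. g (XT i w) + (integral\<^sup>L lborel (?h i) - prim (?h i) s) + (Lim at_top (?k i) - ?k i s) - (JT i - J i s w)) --->
  g (XT i w) + (integral\<^sup>L lborel (?h i) - integral\<^sup>L lborel (?h i)) + (Lim at_top (?k i) - Lim at_top (?k i)) - (JT i - JT i)) at_top" for i
 by (intro tendsto_intros klim J(2) prim_tendsto h h00)
have lim: "((%s. Y s w $ i) ---> g (XT i w)) at_top" for i
 by (rule Lim_transform_eventually[OF lim0[of i, simplified]]) (auto intro!: eventually_at_top_linorderI[of 0] simp: eq)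
have "Y s' w $ i - Y s w $ i = J i s' w - J i s w - (prim (?h i) s' - prim (?h i) s) - (?k i s' - ?k i s)"
 if "0 <= s" "s <= s'" for i s s' using eq[of s i] eq[of s' i] that by simp
moreover have "?k i b = ?k i a" if a: "0 <= a" "a < b" "ennreal b <= \<tau> w" "0 < c"
 "ALL r j. a < r --> r < b --> j ~= i --> c <= Y r w $ i - Y r w $ j + C i j" for i a b c
proof -
 have "ennreal a <= \<tau> w" using a(2,3) by (meson ennreal_leI less_imp_le order_trans)
 thus ?thesis using constant_below_barrier[OF a(1-4), of i] a(1,2,3,5) by (simp add: stopped_horizon)
qed
ultimately show ?thesis
 unfolding solves_def using cY ck h J(1) kmono K(2) fin lim obst by blast
qed

theorem rbsde_solves:
assumes sol: "rbsde_solution P F W \<tau> X XT g f C Y Z K"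
obtains J where "!!i. ito_L2 P F W (stop_integrand \<tau> (%s w. Z s w $ i)) (J i)" "AE w in P. solves Y Z K J w"
proof -
have Y: "Y \<in> S2 P F \<tau>" and Z: "Z \<in> M2 P F \<tau>" and KA: "K \<in> A2 P F \<tau>"
 using sol by (auto simp: rbsde_solution_def)
hence K: "K \<in> S2 P F \<tau>" by (simp add: A2_def)
let ?Q = "%i JJ. ito_L2 P F W (stop_integrand \<tau> (%s w. Z s w $ i)) (fst JJ) & (AE w in P.
  continuous_on {0..} (%s. fst JJ s w) & ((%s. fst JJ s w) ---> snd JJ w) at_top &
  (ALL s>=0. \<tau> w <= ennreal s --> fst JJ s w = snd JJ w) &
  integrable lborel (driver Y Z i w) &
  (ALL s>=0. Y s w $ i = g (XT i w) + (integral\<^sup>L lborel (driver Y Z i w) - prim (driver Y Z i w) s)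
   + (Lim at_top (%s. stopped K w s $ i) - stopped K w s $ i) - (snd JJ w - fst JJ s w)) &
  (ALL s>=0. ALL j. Y s w $ j - C i j <= Y s w $ i) &
  (\<integral>\<^sup>+s\<in>{s. 0 <= s & ennreal s <= \<tau> w} - {0}.
   e2ennreal (ereal (Lim (at_left s) (%r. Y r w) $ i) - barrier C i (Lim (at_left s) (%r. Y r w)))
   \<partial>interval_measure (%s. K (max 0 s) w $ i)) = 0)"
have "EX JJ. ?Q i JJ" for i
proof -
 obtain R where R: "ito_remainder P F W \<tau> (%s w. Z s w $ i) R" and ae: "AE w in P.
     set_integrable lborel (hor w) (%s. f s w (X i s w) (Y s w $ i) (Z s w $ i) i) &
     (ALL t>=0. Y t w $ i = g (XT i w)
      + (LINT s:({t..} \<inter> hor w)|lborel. f s w (X i s w) (Y s w $ i) (Z s w $ i) i)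
      + (Lim at_top (%s. K (stop_time \<tau> s w) w $ i) - K (stop_time \<tau> t w) w $ i)
      - R t w) &
     (ALL t>=0. Y t w $ i >= (MAX j. Y t w $ j - C i j)) &
     (\<integral>\<^sup>+s\<in>hor w - {0}.
      e2ennreal (ereal (Lim (at_left s) (%r. Y r w) $ i) - barrier C i (Lim (at_left s) (%r. Y r w)))
      \<partial>interval_measure (%s. K (max 0 s) w $ i)) = 0"
  using sol unfolding rbsde_solution_def by blast
 obtain J JT where J: "ito_L2 P F W (stop_integrand \<tau> (%s w. Z s w $ i)) J" and R':
  "AE w in P. (ALL s>=0. R s w = JT w - J s w) & ((%s. J s w) ---> JT w) at_top
  & (ALL s>=0. \<tau> w <= ennreal s --> J s w = JT w) & continuous_on {0..} (%s. J s w)"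
  by (rule ito_remainderE[OF R Z _ \<tau>]) (auto intro: Finite_Cartesian_Product.norm_nth_le)
 have "?Q i (J, JT)"
  unfolding fst_conv snd_conv
 proof (intro conjI J, use ae R' in eventually_elim, elim conjE, intro conjI)
  fix w assume i: "set_integrable lborel (hor w) (%s. f s w (X i s w) (Y s w $ i) (Z s w $ i) i)"
   and eq: "ALL t>=0. Y t w $ i = g (XT i w)
      + (LINT s:({t..} \<inter> hor w)|lborel. f s w (X i s w) (Y s w $ i) (Z s w $ i) i)
      + (Lim at_top (%s. K (stop_time \<tau> s w) w $ i) - K (stop_time \<tau> t w) w $ i) - R t w"
   and R: "ALL s>=0. R s w = JT w - J s w" and ob: "ALL t>=0. Y t w $ i >= (MAX j. Y t w $ j - C i j)"
  show h: "integrable lborel (driver Y Z i w)"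
   using i unfolding set_integrable_def driver_def by simp
  have tail: "(LINT s:({t..} \<inter> hor w)|lborel. f s w (X i s w) (Y s w $ i) (Z s w $ i) i) =
    integral\<^sup>L lborel (driver Y Z i w) - prim (driver Y Z i w) t" if "0 <= t" for t
   unfolding set_lebesgue_integral_indicator using prim_tail[OF h _ that] by (simp add: driver_def hor_iff)
  show "ALL s>=0. Y s w $ i = g (XT i w) + (integral\<^sup>L lborel (driver Y Z i w) - prim (driver Y Z i w) s)
   + (Lim at_top (%s. stopped K w s $ i) - stopped K w s $ i) - (JT w - J s w)"
   using eq R tail by (simp add: stopped_def)
  show "ALL s>=0. ALL j. Y s w $ j - C i j <= Y s w $ i" using ob by simp
 qed (auto simp: horizon_def)
 thus ?thesis by blast
qed
hence "ALL i. EX JJ. ?Q i JJ" by blast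
from choice[OF this] obtain JJ where JJ: "ALL i. ?Q i (JJ i)" by blast
obtain S where S: "AE w in P. ALL s. 0 <= s & ennreal s < \<tau> w --> norm (K s w) <= S w" by (rule S2_bound[OF K \<tau>])
show thesis
proof (rule that[of "%i. fst (JJ i)"])
 show "ito_L2 P F W (stop_integrand \<tau> (%s w. Z s w $ i)) (fst (JJ i))" for i using JJ by blast
 have "AE w in P. cadlag (%s. Y s w)" using Y by (simp add: S2_def)
 moreover have "AE w in P. cadlag (%s. K s w)" using K by (simp add: S2_def)
 moreover have "AE w in P. K 0 w = 0 & (ALL i. mono_on {0..} (%s. K s w $ i))" using KA by (simp add: A2_def)
 moreover have "AE w in P. ALL i:UNIV.
  continuous_on {0..} (%s. fst (JJ i) s w) & ((%s. fst (JJ i) s w) ---> snd (JJ i) w) at_top &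
  (ALL s>=0. \<tau> w <= ennreal s --> fst (JJ i) s w = snd (JJ i) w) &
  integrable lborel (driver Y Z i w) &
  (ALL s>=0. Y s w $ i = g (XT i w) + (integral\<^sup>L lborel (driver Y Z i w) - prim (driver Y Z i w) s)
   + (Lim at_top (%s. stopped K w s $ i) - stopped K w s $ i) - (snd (JJ i) w - fst (JJ i) s w)) &
  (ALL s>=0. ALL j. Y s w $ j - C i j <= Y s w $ i) &
  (\<integral>\<^sup>+s\<in>{s. 0 <= s & ennreal s <= \<tau> w} - {0}.
   e2ennreal (ereal (Lim (at_left s) (%r. Y r w) $ i) - barrier C i (Lim (at_left s) (%r. Y r w)))
   \<partial>interval_measure (%s. K (max 0 s) w $ i)) = 0"
  using JJ by (intro AE_finite_allI) auto
 ultimately show "AE w in P. solves Y Z K (%i. fst (JJ i)) w" using S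
 proof eventually_elim
  case (elim w)
  thus ?case by (intro solves_pathI[where JT="%i. snd (JJ i) w" and B="S w"]) blast+
 qed
qed
qed

end

section \<open>Paths of switching strategies\<close>

text \<open>A path of a strategy is a sequence of switching times \<open>r 1 <= r 2 <= ...\<close>, with value \<open>\<infinity>\<close> for switches
that do not take place, and of modes \<open>z 0, z 1, ...\<close>.  Taking only the first \<open>n\<close> switches into account,
\<open>rmode\<close> and \<open>lmode\<close> are the right- and left-continuous mode paths, \<open>paid\<close> is the cost, and \<open>splice\<close>
concatenates the increments of the paths \<open>h (z k)\<close>.\<close>

primrec rmode :: "(nat => ennreal) => (nat => 'd) => nat => ennreal => 'd" where
"rmode r z 0 s = z 0"
| "rmode r z (Suc n) s = (if r (Suc n) <= s & r (Suc n) < top then z (Suc n) else rmode r z n s)"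

primrec lmode :: "(nat => ennreal) => (nat => 'd) => nat => ennreal => 'd" where
"lmode r z 0 s = z 0"
| "lmode r z (Suc n) s = (if r (Suc n) < s then z (Suc n) else lmode r z n s)"

definition paid :: "('d => 'd => real) => (nat => ennreal) => (nat => 'd) => nat => ennreal => real" where
"paid C r z n s = (\<Sum>k<n. if r (Suc k) <= s & r (Suc k) < top then C (z k) (z (Suc k)) else 0)"

primrec splice :: "(nat => ennreal) => (nat => 'd) => ('d => real => real) => nat => real => real" where
"splice r z h 0 s = h (z 0) s"
| "splice r z h (Suc n) s = (if r (Suc n) <= ennreal s
  then splice r z h n (enn2real (r (Suc n))) + h (z (Suc n)) s - h (z (Suc n)) (enn2real (r (Suc n)))
  else splice r z h n s)"

text \<open>Switches after the index \<open>m\<close> change neither the mode nor the cost, so the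
  paths truncated at any later index coincide with those truncated at \<open>m\<close>.\<close>

definition settled :: "('d => 'd => real) => (nat => ennreal) => (nat => 'd) => nat => bool" where
"settled C r z m \<longleftrightarrow> (ALL k>=m. r (Suc k) < top --> z (Suc k) = z k & C (z k) (z (Suc k)) = 0)"

lemma ennreal_le_realE:
assumes "r <= ennreal s" "0 <= s"
obtains a where "r = ennreal a" "0 <= a" "a <= s"
using assms by (cases r) (auto simp: ennreal_le_iff top_unique)

lemma rmode_last: "r n <= s & r n < top | n = 0 ==> rmode r z n s = z n"
by (cases n) auto

lemma splice_last:
"r n <= ennreal a | n = 0 ==> a <= b ==> splice r z h n b - splice r z h n a = h (z n) b - h (z n) a"
by (cases n) (auto dest: order_trans[OF _ ennreal_leI])

lemma splice_diff: "splice r z (%j s. p j s - q j s) n s = splice r z p n s - splice r z q n s"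
by (induction n arbitrary: s) auto

lemma mode_cong:
assumes "!!k. k < n ==> r (Suc k) <= s & r (Suc k) < top \<longleftrightarrow> r (Suc k) <= s' & r (Suc k) < top"
shows "rmode r z n s = rmode r z n s'" (is ?Q1) "paid C r z n s = paid C r z n s'" (is ?Q2)
proof -
show ?Q1 using assms by (induction n) auto
show ?Q2 unfolding paid_def using assms by (intro sum.cong) auto
qed

lemma rmode_eq_lmode:
assumes "!!k. k < n ==> r (Suc k) <= s & r (Suc k) < top \<longleftrightarrow> r (Suc k) < s'"
shows "rmode r z n s = lmode r z n s'"
using assms by (induction n) auto

lemma splice_continuous:
assumes "!!j. continuous_on {0..} (h j)"
shows "continuous_on {0..} (splice r z h n)"
proof (induction n)
case (Suc n)
show ?case
proof (cases "r (Suc n)")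
 case (real a)
 have "continuous_on {0..} (%s. splice r z h n (min s a) + h (z (Suc n)) (max s a) - h (z (Suc n)) a)"
  using real by (intro continuous_intros continuous_on_compose2[OF Suc.IH] continuous_on_compose2[OF assms]) auto
 thus ?thesis by (rule continuous_on_eq) (use real in \<open>auto simp: ennreal_le_iff min_def max_def\<close>)
next
 case top
 have "~ top <= ennreal s" for s by (simp add: top_unique)
 thus ?thesis using Suc.IH by (auto simp: top)
qed
qed (use assms in simp)

lemma splice_prim:
assumes h: "!!j. integrable lborel (h j)" and s: "0 <= s"
shows "integrable lborel (%x. h (lmode r z n (ennreal x)) x) &
 splice r z (%j. prim (h j)) n s = prim (%x. h (lmode r z n (ennreal x)) x) s"
using s
proof (induction n arbitrary: s)
case (Suc n)
let ?p = "%n x. h (lmode r z n (ennreal x)) x" and ?A = "{x. r (Suc n) < ennreal x}"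
have p: "integrable lborel (?p n)" using Suc.IH[of 0] by simp
have A: "?A \<in> sets lborel" by measurable
have "integrable lborel (%x. indicator ?A x *\<^sub>R h (z (Suc n)) x + indicator (- ?A) x *\<^sub>R ?p n x)"
 using A by (intro Bochner_Integration.integrable_add integrable_mult_indicator h p) auto
hence i: "integrable lborel (?p (Suc n))"
 by (rule Bochner_Integration.integrable_cong[THEN iffD1, rotated 2]) (auto simp: indicator_def)
have same: "prim (?p (Suc n)) s = prim (?p n) s" if "ennreal s <= r (Suc n)" for s
 unfolding prim_def
proof (rule set_lebesgue_integral_cong)
 show "ALL x. x \<in> {0..s} --> ?p (Suc n) x = ?p n x" using that by (auto dest: order_trans[OF ennreal_leI])
qed simp
show ?case
proof (intro conjI i, cases "r (Suc n) <= ennreal s")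
 case True
 then obtain a where a: "r (Suc n) = ennreal a" "0 <= a" "a <= s" using Suc.prems by (rule ennreal_le_realE)
 have "prim (?p (Suc n)) s - prim (?p (Suc n)) a = prim (h (z (Suc n))) s - prim (h (z (Suc n))) a"
  unfolding prim_diff[OF i a(2,3)] prim_diff[OF h a(2,3)]
 proof (rule set_lebesgue_integral_cong_AE)
  show "AE x\<in>{a..s} in lborel. ?p (Suc n) x = h (z (Suc n)) x"
   using AE_lborel_singleton[of a] by (rule AE_mp) (use a in \<open>auto simp: ennreal_less_iff\<close>)
 qed (use i h in auto)
 thus "splice r z (%j. prim (h j)) (Suc n) s = prim (?p (Suc n)) s"
  using True a same[of a] Suc.IH[of a] by simp
qed (use same[of s] Suc.IH[OF Suc.prems] in auto)
qed (use h in simp)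

lemma settled_stable:
assumes r: "!!k. r k <= r (Suc k)" and m: "settled C r z m" and n: "m <= n"
shows "rmode r z n s = rmode r z m s" (is ?Q1) "lmode r z n s = lmode r z m s" (is ?Q2)
 "0 <= a ==> splice r z h n a = splice r z h m a" "paid C r z n s = paid C r z m s" (is ?Q3)
proof -
have step: "z (Suc k) = z k" "C (z k) (z (Suc k)) = 0" "r k < top" if "m <= k" "r (Suc k) < top" for k
 using m that le_less_trans[OF r[of k]] by (auto simp: settled_def)
show ?Q1 using n
proof (induction n rule: dec_induct)
 case (step k)
 thus ?case using rmode_last[of r k s z] order_trans[OF r[of k], of s] le_less_trans[OF r[of k], of top] \<open>!!k. m <= k ==> r (Suc k) < top ==> z (Suc k) = z k\<close>[of k]
  by auto
qed simp
have ll: "lmode r z k s = z k" if "r k < s | k = 0" for k using that by (cases k) auto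
show ?Q2 using n
proof (induction n rule: dec_induct)
 case (step k)
 thus ?case using ll[of k] le_less_trans[OF r[of k], of s] less_le_trans[OF _ top_greatest, of "r (Suc k)" s] \<open>!!k. m <= k ==> r (Suc k) < top ==> z (Suc k) = z k\<close>[of k]
  by auto
qed simp
show "splice r z h n a = splice r z h m a" if "0 <= a" using n
proof (induction n rule: dec_induct)
 case (step k)
 show ?case
 proof (cases "r (Suc k) <= ennreal a")
  case True
  then obtain b where b: "r (Suc k) = ennreal b" "0 <= b" "b <= a" using \<open>0 <= a\<close> by (rule ennreal_le_realE)
  hence "splice r z h k a - splice r z h k b = h (z (Suc k)) a - h (z (Suc k)) b"
   using splice_last[of r k b a z h] r[of k] \<open>!!k. m <= k ==> r (Suc k) < top ==> z (Suc k) = z k\<close>[of k] step by simp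
  thus ?thesis using True b step by simp
 qed (use step in simp)
qed simp
show ?Q3
 unfolding paid_def using n step(2) by (intro sum.mono_neutral_right) (auto simp: not_less)
qed

text \<open>The sign \<open>ep\<close> makes the lemma cover both inequalities, so that it also yields equations.\<close>

lemma splice_inequality:
fixes y G :: "'d => real => real" and ep :: real
assumes r: "!!k. r k <= r (Suc k)" "!!k. ennreal t <= r (Suc k)" and t: "0 <= t"
 and stay: "!!k a b. k <= n ==> t <= a ==> a <= b ==> r k <= ennreal a | k = 0 ==>
  ennreal b <= (if k < n then r (Suc k) else T) ==> ep * (y (z k) b - y (z k) a - (G (z k) b - G (z k) a)) <= 0"
 and jump: "!!k s. k < n ==> t <= s ==> r (Suc k) = ennreal s ==>
  ep * (y (z (Suc k)) s - y (z k) s - C (z k) (z (Suc k))) <= 0"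
 and ab: "t <= a" "a <= b" "ennreal b <= T"
shows "ep * (y (rmode r z n (ennreal b)) b - y (rmode r z n (ennreal a)) a
 - (paid C r z n (ennreal b) - paid C r z n (ennreal a)) - (splice r z G n b - splice r z G n a)) <= 0"
using stay jump ab
proof (induction n arbitrary: a b T)
case 0
thus ?case using "0.prems"(1)[of 0 a b] by (simp add: paid_def)
next
case (Suc n)
have rmono: "r i <= r j" if "i <= j" for i j using lift_Suc_mono_le[of r, OF r(1) that] .
\<comment> \<open>The induction hypothesis is used with the time of the next switch as horizon:
  until then only the first \<open>n\<close> switches matter.\<close>
have IH: "ep * (y (rmode r z n (ennreal b)) b - y (rmode r z n (ennreal a)) a
 - (paid C r z n (ennreal b) - paid C r z n (ennreal a)) - (splice r z G n b - splice r z G n a)) <= 0"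
 if "t <= a" "a <= b" "ennreal b <= r (Suc n)" for a b
proof (rule Suc.IH[OF _ _ that])
 fix k a b assume k: "k <= n" "t <= a" "a <= b" "r k <= ennreal a | k = 0" "ennreal b <= (if k < n then r (Suc k) else r (Suc n))"
 hence "ennreal b <= r (Suc k)" by (cases "k = n") auto
 thus "ep * (y (z k) b - y (z k) a - (G (z k) b - G (z k) a)) <= 0"
  using k by (intro Suc.prems(1)) auto
qed (use Suc.prems(2) in auto)
have last: "ep * (y (z (Suc n)) b - y (z (Suc n)) a - (G (z (Suc n)) b - G (z (Suc n)) a)) <= 0"
 if "t <= a" "a <= b" "r (Suc n) <= ennreal a" "ennreal b <= T" for a b
 by (rule Suc.prems(1)) (use that in auto)
have paid_const: "paid C r z m (ennreal b) = paid C r z m (ennreal a)"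
 if "r m <= ennreal a | m = 0" "a <= b" for a b m
proof (rule mode_cong)
 fix k assume "k < m"
 hence "r (Suc k) <= r m" by (intro rmono) auto
 hence "r (Suc k) <= ennreal a" "ennreal a <= ennreal b" using that \<open>k < m\<close> by (auto intro: ennreal_leI)
 thus "(r (Suc k) <= ennreal b & r (Suc k) < top) = (r (Suc k) <= ennreal a & r (Suc k) < top)"
  by (auto intro: order_trans)
qed
show ?case
proof (cases "r (Suc n) <= ennreal b")
 case False
 hence "~ r (Suc n) <= ennreal a" using Suc.prems by (meson ennreal_leI order_trans)
 thus ?thesis using IH[of a b] False Suc.prems by (simp add: paid_def)
next
 case True
 then obtain s where s: "r (Suc n) = ennreal s" "0 <= s" "s <= b" using t Suc.prems by (elim ennreal_le_realE) auto
 have ts: "t <= s" using r(2)[of n] s by (simp add: ennreal_le_iff)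
 have a0: "0 <= a" using t Suc.prems by simp
 show ?thesis
 proof (cases "s <= a")
  case True
  have "ep * (y (z (Suc n)) b - y (z (Suc n)) a - (G (z (Suc n)) b - G (z (Suc n)) a)) <= 0"
   using Suc.prems True s(1) by (intro last) (auto intro: ennreal_leI)
  moreover have "paid C r z (Suc n) (ennreal b) = paid C r z (Suc n) (ennreal a)"
   using Suc.prems True s(1) by (intro paid_const) (auto intro: ennreal_leI)
  moreover have "ennreal s <= ennreal a" "ennreal s <= ennreal b" using True s by (auto intro: ennreal_leI)
  ultimately show ?thesis by (simp add: s(1))
 next
  case False
  hence as: "a < s" by simp
  have rn: "rmode r z n (ennreal s) = z n" using r(1)[of n] s by (intro rmode_last) (auto intro: le_less_trans)
  have pb: "paid C r z n (ennreal b) = paid C r z n (ennreal s)" using r(1)[of n] s by (intro paid_const) auto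
  \<comment> \<open>A switch at \<open>s\<close> inside the interval: the three inequalities cover
    the time before \<open>s\<close>, the jump at \<open>s\<close> and the time after it. Their sum
    is the claim, since \<open>y\<close> changes component exactly at \<open>s\<close>.\<close>
  have 1: "ep * (y (z n) s - y (rmode r z n (ennreal a)) a
   - (paid C r z n (ennreal b) - paid C r z n (ennreal a)) - (splice r z G n s - splice r z G n a)) <= 0"
   using IH[of a s] Suc.prems as s unfolding rn pb by simp
  have 2: "ep * (y (z (Suc n)) s - y (z n) s - C (z n) (z (Suc n))) <= 0" using Suc.prems(2)[OF _ ts s(1)] by simp
  have 3: "ep * (y (z (Suc n)) b - y (z (Suc n)) s - (G (z (Suc n)) b - G (z (Suc n)) s)) <= 0"
   using Suc.prems s ts by (intro last) auto
  have "ennreal s <= ennreal b" "~ ennreal s <= ennreal a" using as a0 s by (auto simp: ennreal_le_iff)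
  hence m: "rmode r z (Suc n) (ennreal b) = z (Suc n)" "rmode r z (Suc n) (ennreal a) = rmode r z n (ennreal a)"
   "paid C r z (Suc n) (ennreal b) = paid C r z n (ennreal b) + C (z n) (z (Suc n))"
   "paid C r z (Suc n) (ennreal a) = paid C r z n (ennreal a)"
   "splice r z G (Suc n) b = splice r z G n s + G (z (Suc n)) b - G (z (Suc n)) s"
   "splice r z G (Suc n) a = splice r z G n a"
   using s by (simp_all add: paid_def)
  show ?thesis using 1 2 3 unfolding m by (simp add: algebra_simps)
 qed
qed
qed

lemma eventually_le_ennreal:
shows "0 <= s ==> eventually (%s'. (c <= ennreal s') = (c <= ennreal s)) (at_right s)"
 and "0 < s ==> eventually (%s'. (c <= ennreal s' & c < top) = (c < ennreal s)) (at_left s)"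
proof -
show "eventually (%s'. (c <= ennreal s') = (c <= ennreal s)) (at_right s)" if s: "0 <= s"
proof (cases c)
 case (real a)
 show ?thesis
 proof (cases "a <= s")
  case True
  thus ?thesis using real s by (auto simp: ennreal_le_iff eventually_at_right_field intro!: exI[of _ "s + 1"])
 next
  case False
  thus ?thesis using real s by (auto simp: ennreal_le_iff eventually_at_right_field intro!: exI[of _ a])
 qed
qed (simp add: top_unique)
show "eventually (%s'. (c <= ennreal s' & c < top) = (c < ennreal s)) (at_left s)" if s: "0 < s"
proof (cases c)
 case (real a)
 show ?thesis
 proof (cases "a < s")
  case True
  thus ?thesis using real s unfolding eventually_at_left_field
   by (intro exI[of _ "max a 0"]) (auto simp: ennreal_le_iff ennreal_less_iff)
 next
  case False
  thus ?thesis using real s unfolding eventually_at_left_field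
   by (intro exI[of _ 0]) (auto simp: ennreal_le_iff ennreal_less_iff)
 qed
qed (simp add: top_unique)
qed

lemma rmode_eventually:
shows "0 <= s ==> eventually (%s'. rmode r z n (ennreal s') = rmode r z n (ennreal s)) (at_right s)"
 and "0 < s ==> eventually (%s'. rmode r z n (ennreal s') = lmode r z n (ennreal s)) (at_left s)"
 and "0 < s ==> s \<notin> (%k. enn2real (r (Suc k))) ` {..<n} ==> eventually (%s'.
  rmode r z n (ennreal s') = rmode r z n (ennreal s) & paid C r z n (ennreal s') = paid C r z n (ennreal s)) (at s)"
proof -
have R: "eventually (%s'. ALL k:{..<n}. (r (Suc k) <= ennreal s') = (r (Suc k) <= ennreal s)) (at_right s)" if "0 <= s"
 using eventually_le_ennreal(1)[OF that] by (intro eventually_ball_finite) auto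
thus "0 <= s ==> eventually (%s'. rmode r z n (ennreal s') = rmode r z n (ennreal s)) (at_right s)"
 by (rule eventually_mono) (auto intro: mode_cong)
have L: "eventually (%s'. ALL k:{..<n}. (r (Suc k) <= ennreal s' & r (Suc k) < top) = (r (Suc k) < ennreal s)) (at_left s)" if "0 < s"
 using eventually_le_ennreal(2)[OF that] by (intro eventually_ball_finite) auto
thus "0 < s ==> eventually (%s'. rmode r z n (ennreal s') = lmode r z n (ennreal s)) (at_left s)"
 by (rule eventually_mono) (auto intro: rmode_eq_lmode)
assume s: "0 < s" "s \<notin> (%k. enn2real (r (Suc k))) ` {..<n}"
have eq: "r (Suc k) < ennreal s \<longleftrightarrow> r (Suc k) <= ennreal s & r (Suc k) < top" if "k < n" for k
proof -
 have "r (Suc k) ~= ennreal s"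
  using s that by (metis (mono_tags, lifting) enn2real_ennreal image_eqI less_imp_le lessThan_iff)
 thus ?thesis by (auto simp: less_le top_unique)
qed
have "eventually (%s'. ALL k:{..<n}. (r (Suc k) <= ennreal s' & r (Suc k) < top) = (r (Suc k) <= ennreal s & r (Suc k) < top)) (at s)"
 using L[OF s(1)] R[OF less_imp_le[OF s(1)]] unfolding eventually_at_split by (auto elim!: eventually_mono simp: eq)
thus "eventually (%s'. rmode r z n (ennreal s') = rmode r z n (ennreal s) &
  paid C r z n (ennreal s') = paid C r z n (ennreal s)) (at s)"
 by (rule eventually_mono) (auto intro!: mode_cong)
qed

lemma mode_eventually_final:
"eventually (%s. rmode r z n (ennreal s) = rmode r z n top & paid C r z n (ennreal s) = paid C r z n top) at_top"
proof -
have "eventually (%s. (c <= ennreal s & c < top) = (c <= top & c < top)) at_top" for c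
proof (cases c)
 case (real a)
 thus ?thesis by (auto intro!: eventually_at_top_linorderI[of a] ennreal_leI)
qed simp
hence "eventually (%s. ALL k:{..<n}. (r (Suc k) <= ennreal s & r (Suc k) < top) = (r (Suc k) <= top & r (Suc k) < top)) at_top"
 by (intro eventually_ball_finite) auto
thus ?thesis by (rule eventually_mono) (auto intro!: mode_cong)
qed

section \<open>Strategies of finite cost and their eventual mode\<close>

context switching
begin

text \<open>A switch at \<tau> is neither visible nor paid, so it is moved to infinity and treated
  as one that never happens.\<close>

definition rho :: "(nat => 'w => ennreal) => 'w => nat => ennreal" where
"rho th w n = (if th n w < \<tau> w then th n w else top)"

definition strategy_path :: "(nat => 'w => ennreal) => (nat => 'w => 'd) => real => 'd => 'w => bool" where
"strategy_path th ze t i w \<longleftrightarrow> th 0 w = min (ennreal t) (\<tau> w) & ze 0 w = i &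
   (ALL k. th k w <= th (Suc k) w & th k w <= \<tau> w) & (%k. th k w) ----> \<tau> w"

lemma rho_less_top: "rho th w n < top \<longleftrightarrow> th n w < \<tau> w"
using less_le_trans[OF _ top_greatest] by (auto simp: rho_def)

lemma rho_le_iff: "rho th w n <= s & rho th w n < top \<longleftrightarrow> th n w <= s & th n w < \<tau> w"
using rho_less_top[of th w n] by (auto simp: rho_def)

lemma rho_less_iff: "rho th w n < s \<longleftrightarrow> th n w < s & th n w < \<tau> w"
by (auto simp: rho_def)

abbreviation "sld th ze w \<equiv> settled C (rho th w) (%k. ze k w)"
abbreviation "lmd th ze w \<equiv> lmode (rho th w) (%k. ze k w)"
abbreviation "rmd th ze w \<equiv> rmode (rho th w) (%k. ze k w)"
abbreviation "pyd th ze w \<equiv> paid C (rho th w) (%k. ze k w)"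

lemma cost_eq_paid:
assumes m: "sld th ze w m"
shows "summable (switch_cost C \<tau> th ze s w)" (is ?Q1) "cost C \<tau> th ze s w = pyd th ze w m s" (is ?Q2)
proof -
have sc: "switch_cost C \<tau> th ze s w k =
  (if rho th w (Suc k) <= s & rho th w (Suc k) < top then C (ze k w) (ze (Suc k) w) else 0)" for k
 unfolding switch_cost_def rho_le_iff ..
have 0: "switch_cost C \<tau> th ze s w k = 0" if "k \<notin> {..<m}" for k using m that
 unfolding sc settled_def by (cases "rho th w (Suc k) < top") (auto simp: not_less)
thus ?Q1 by (rule summable_finite[OF finite_lessThan])
have "(\<Sum>k. switch_cost C \<tau> th ze s w k) = (\<Sum>k<m. switch_cost C \<tau> th ze s w k)"
 by (rule suminf_finite[OF finite_lessThan 0])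
thus ?Q2 by (simp only: cost_def paid_def sc)
qed

context
fixes th :: "nat => 'w => ennreal" and ze :: "nat => 'w => 'd" and t :: real and i :: 'd and w :: 'w
assumes path: "strategy_path th ze t i w"
begin

lemma theta_mono: "j <= k ==> th j w <= th k w"
using path lift_Suc_mono_le[of "%k. th k w"] by (simp add: strategy_path_def)

lemma rho_mono: "rho th w k <= rho th w (Suc k)"
using path le_less_trans[of "th k w" "th (Suc k) w" "\<tau> w"] by (auto simp: rho_def strategy_path_def)

lemma rho_ge: "ennreal t <= rho th w (Suc k)"
using path theta_mono[of 0 "Suc k"] by (auto simp: rho_def strategy_path_def min_def split: if_splits)

text \<open>Two consecutive free switches contradict the triangle inequality, so a strategy of finite cost
changes its mode at most once after the last switch that has a price.\<close>

lemma settled_of_summable: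
assumes "summable (switch_cost C \<tau> th ze (\<tau> w) w)"
obtains m where "sld th ze w m"
proof -
\<comment> \<open>The smallest positive cost, which exists because there are finitely many modes;
  the 1 covers the case that all costs vanish. Summable costs are eventually below \<open>c\<close>,
  hence zero.\<close>
define c where "c = Min (insert 1 {C a b | a b. 0 < C a b})"
have finC: "finite {C a b | a b. 0 < C a b}"
 by (rule finite_subset[of _ "range (%(a, b). C a b)"]) auto
have c: "0 < c" "!!a b. 0 < C a b ==> c <= C a b"
 unfolding c_def using finC by (auto intro: Min_le)
have "(%k. switch_cost C \<tau> th ze (\<tau> w) w k) ----> 0" using assms by (rule summable_LIMSEQ_zero)
from order_tendstoD(2)[OF this c(1)] obtain n where n: "!!k. n <= k ==> switch_cost C \<tau> th ze (\<tau> w) w k < c"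
 unfolding eventually_sequentially by blast
have free: "C (ze k w) (ze (Suc k) w) = 0" if "n <= k" "rho th w (Suc k) < top" for k
proof -
 have "th (Suc k) w < \<tau> w" using that(2) by (simp only: rho_less_top)
 hence "C (ze k w) (ze (Suc k) w) < c" using n[OF that(1)] by (simp add: switch_cost_def less_imp_le)
 thus ?thesis using c(2)[of "ze k w" "ze (Suc k) w"] C0[of "ze k w" "ze (Suc k) w"] by force
qed
let ?ch = "%k. rho th w (Suc k) < top & ze (Suc k) w ~= ze k w"
show thesis
proof (cases "EX k>=n. ?ch k")
 case True
 then obtain k where k: "n <= k" "?ch k" by blast
 have "sld th ze w (Suc k)"
  unfolding settled_def
 proof (intro allI impI conjI free)
  have *: "rho th w (Suc l) < top ==> ze (Suc l) w = ze (Suc k) w" if "Suc k <= l" for l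
   using that
  proof (induction l rule: nat_induct_at_least)
   case base
   \<comment> \<open>After the first free change, a further free change would give a negative cost
     from the old mode to the newest one.\<close>
   thus ?case using free[of k] free[of "Suc k"] k C3[of "ze k w" "ze (Suc k) w" "ze (Suc (Suc k)) w"]
    C0[of "ze k w" "ze (Suc (Suc k)) w"] by force
  next
   case (Suc l)
   hence "ze (Suc l) w = ze (Suc k) w" using le_less_trans[OF rho_mono] by blast
   thus ?case using Suc free[of k] free[of "Suc l"] k C3[of "ze k w" "ze (Suc k) w" "ze (Suc (Suc l)) w"]
    C0[of "ze k w" "ze (Suc (Suc l)) w"] by force
  qed
  show "ze (Suc l) w = ze l w" if l: "Suc k <= l" "rho th w (Suc l) < top" for l
  proof (cases "l = Suc k")
   case False
   hence "ze (Suc (l - 1)) w = ze (Suc k) w" using l le_less_trans[OF rho_mono] by (intro *) auto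
   thus ?thesis using *[OF l] l by simp
  qed (use *[OF l] in simp)
 qed (use k in auto)
 thus thesis by (rule that)
next
 case False
 hence "sld th ze w n" using free by (auto simp: settled_def)
 thus thesis by (rule that)
qed
qed

context
fixes m assumes m: "sld th ze w m"
begin

lemma lmode_stable: "lmd th ze w n s = lmd th ze w m s"
if "m <= n" using settled_stable(2)[OF rho_mono m that] .

lemma interval_mode:
assumes k: "th k w < s" "s <= th (Suc k) w" "s <= \<tau> w"
shows "mode_at th ze s w = lmd th ze w m s"
proof -
define l where "l = (LEAST k. th k w < s & s <= th (Suc k) w)"
have l: "th l w < s" "s <= th (Suc l) w"
 unfolding l_def using LeastI[of "%k. th k w < s & s <= th (Suc k) w" k] k by auto
have "~ s <= th 0 w" using theta_mono[of 0 l] l by (simp add: not_le le_less_trans)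
hence "mode_at th ze s w = ze l w" using k l_def by (auto simp: mode_at_def)
moreover have "lmd th ze w n s = ze l w" if "l <= n" for n
 using that
proof (induction n rule: nat_induct_at_least)
 case base
 have "th l w < \<tau> w" using l k by (meson less_le_trans)
 thus ?case using l by (cases l) (auto simp: rho_less_iff)
next
 case (Suc n)
 thus ?case using l theta_mono[of "Suc l" "Suc n"] by (auto simp: rho_less_iff)
qed
ultimately show ?thesis using lmode_stable[of "l + m" s] by auto
qed

lemma mode_at_lmode:
assumes s: "t < s" "ennreal s < \<tau> w" and t: "0 <= t"
shows "mode_at th ze (ennreal s) w = lmd th ze w m (ennreal s)"
proof -
have "(%k. th k w) ----> \<tau> w" using path by (simp add: strategy_path_def)
from eventually_happens'[OF _ order_tendstoD(1)[OF this s(2)]] obtain n where n: "ennreal s <= th n w"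
 by (auto intro: less_imp_le)
define k where "k = (LEAST k. ennreal s <= th k w)"
have "th 0 w < ennreal s" using path s t by (auto simp: strategy_path_def ennreal_less_iff min_less_iff_disj)
moreover have k: "ennreal s <= th k w" unfolding k_def using n by (rule LeastI)
ultimately obtain j where j: "k = Suc j" by (cases k) auto
hence "th j w < ennreal s" using not_less_Least[of j "%k. ennreal s <= th k w"] by (simp add: k_def)
thus ?thesis using k j s by (intro interval_mode) auto
qed

text \<open>If the switching times never reach \<tau>, the default in \<open>mode_at\<close> picks
  the eventual mode, which exists because the strategy is settled. Otherwise \<tau> belongs to a
  last interval and the left mode at \<tau> is the final one.\<close>

lemma mode_at_end: "mode_at th ze (\<tau> w) w = rmd th ze w m top"
proof (cases "ALL k. th k w < \<tau> w")
case True
hence fin: "rho th w (Suc k) < top" for k by (simp only: rho_less_top)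
have st: "ze (Suc k) w = ze k w" if "m <= k" for k using m fin[of k] that unfolding settled_def by blast
have "ze k w = ze m w" if "m <= k" for k
 using that by (induction k rule: nat_induct_at_least) (auto simp: st)
hence ev: "eventually (%k. ze k w = ze m w) sequentially" unfolding eventually_sequentially by blast
have "l = ze m w" if "eventually (%k. ze k w = l) sequentially" for l
 using eventually_happens'[OF sequentially_bot eventually_conj[OF that ev]] by auto
hence some: "(SOME l. eventually (%k. ze k w = l) sequentially) = ze m w"
 using ev by (intro some_equality) blast+
have "~ \<tau> w <= th k w" for k using True by (simp add: not_le)
hence 1: "mode_at th ze (\<tau> w) w = ze m w" unfolding mode_at_def some by simp
have "rho th w m < top" unfolding rho_less_top using True by blast
hence "rho th w m <= top & rho th w m < top | m = 0" using top_greatest by blast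
hence "rmd th ze w m top = ze m w" by (rule rmode_last)
thus ?thesis by (simp only: 1)
next
case False
define k where "k = (LEAST k. \<tau> w <= th k w)"
have k: "\<tau> w <= th k w" unfolding k_def by (rule LeastI_ex) (use False in \<open>simp add: not_less\<close>)
have "rmd th ze w m top = lmd th ze w m (\<tau> w)"
 by (rule rmode_eq_lmode) (simp only: top_greatest rho_less_top rho_less_iff[of _ _ _ "\<tau> w"] simp_thms)
moreover have "mode_at th ze (\<tau> w) w = lmd th ze w m (\<tau> w)"
proof (cases k)
 case 0
 hence "~ th n w < \<tau> w" for n using k theta_mono[of 0 n] by (simp add: not_less)
 hence "lmd th ze w n (\<tau> w) = ze 0 w" for n by (induction n) (auto simp: rho_less_iff)
 thus ?thesis using k 0 by (simp add: mode_at_def)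
next
 case (Suc j)
 hence "th j w < \<tau> w" using not_less_Least[of j "%k. \<tau> w <= th k w"] by (simp add: k_def)
 thus ?thesis using k Suc by (intro interval_mode) auto
qed
ultimately show ?thesis by simp
qed

lemma rmode_end:
assumes "\<tau> w <= s"
shows "rmd th ze w n s = rmd th ze w n top" (is ?Q1)
 "pyd th ze w n s = pyd th ze w n top" (is ?Q2)
proof -
have "rho th w (Suc k) <= s & rho th w (Suc k) < top \<longleftrightarrow> rho th w (Suc k) <= top & rho th w (Suc k) < top" for k
 unfolding rho_le_iff using assms by auto
from mode_cong[of n "rho th w" s top, OF this] show ?Q1
 ?Q2 .
qed

end

end

end

section \<open>Integrals along a strategy\<close>

locale strategy = switching P W F \<tau> X XT g f C u
for P :: "'w measure" and W :: "real => 'w => real^'p::finite" and F :: "ennreal => 'w measure"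
 and \<tau> and X :: "'d::finite => real => 'w => real" and XT g f C u +
fixes th :: "nat => 'w => ennreal" and ze :: "nat => 'w => 'd" and t :: real and i :: 'd
assumes t0: "0 <= t" and th: "!!k. stopping_time F (th k)"
 and ze: "!!k. ze k \<in> pre_sigma (th k) \<rightarrow>\<^sub>M count_space UNIV"
 and ze0: "!!w. w \<in> space P ==> ze 0 w = i"
 and paths: "AE w in P. strategy_path th ze t i w"
 and settles: "AE w in P. EX m. sld th ze w m"
begin

abbreviation "lm n s w \<equiv> lmd th ze w n s"
abbreviation "rm n s w \<equiv> rmd th ze w n s"
abbreviation "spl n h w \<equiv> splice (rho th w) (%k. ze k w) h n"
abbreviation "pay n s w \<equiv> pyd th ze w n s"

lemma switched_measurable:
"Measurable.pred (F s) (%w. (th k w < \<tau> w & ze k w = j) & th k w <= s)"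
proof -
have [measurable]: "ze k \<in> pre_sigma (th k) \<rightarrow>\<^sub>M count_space UNIV" by (rule ze)
have [measurable]: "Measurable.pred (pre_sigma (th k)) (%w. th k w < \<tau> w)" by (rule stopping_time_less[OF th \<tau>])
have "Measurable.pred (pre_sigma (th k)) (%w. th k w < \<tau> w & ze k w = j)" by measurable
hence "{w \<in> space P. th k w < \<tau> w & ze k w = j} \<in> sets (pre_sigma (th k))"
 by (simp add: pred_def space_pre_sigma)
from sets_pre_sigmaD[OF th this, of s] show ?thesis by (simp add: pred_def conj_ac)
qed

text \<open>The time of switch \<open>k\<close> if it leads to mode \<open>j\<close>, and infinity
  otherwise. The random choice of a mode is thus encoded by finitely many stopping times.\<close>

definition hit :: "nat => 'd => 'w => ennreal" where
"hit k j w = (if th k w < \<tau> w & ze k w = j then th k w else top)"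

lemma hit_stopping: "stopping_time F (hit k j)"
proof
fix s :: ennreal
have "(%w. hit k j w <= s) = (%w. s = top | (th k w < \<tau> w & ze k w = j) & th k w <= s)"
 by (auto simp: hit_def top_unique)
thus "Measurable.pred (F s) (%w. hit k j w <= s)" using switched_measurable by simp
qed

lemma hit_rho: "hit k j w = (if ze k w = j then rho th w k else top)"
by (auto simp: hit_def rho_def)

text \<open>At switch \<open>n + 1\<close> the integrand is corrected, after each time
  \<open>hit (Suc n) j\<close>, by the difference between row \<open>j\<close> and the current
  integrand; at most one of these times is finite, and \<open>ito_L2_stop\<close> integrates each
  correction.\<close>

lemma splice_ito:
assumes H: "!!j. ito_L2 P F W (H j) (J j)"
shows "ito_L2 P F W (%s w. H (lm n (ennreal s) w) s w) (%s w. spl n (%j s. J j s w) w s)"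
proof (induction n)
case 0
show ?case
 by (rule ito_L2_cong[OF H[of i]]) (use ze0 in auto)
next
case (Suc n)
let ?H = "%s w. H (lm n (ennreal s) w) s w" and ?J = "%s w. spl n (%j s. J j s w) w s"
have "ito_L2 P F W (%s w. ?H s w + (\<Sum>j\<in>UNIV. if hit (Suc n) j w < ennreal s then H j s w - ?H s w else 0))
 (%s w. ?J s w + (\<Sum>j\<in>UNIV. (J j s w - ?J s w) -
  (J j (stop_time (hit (Suc n) j) s w) w - ?J (stop_time (hit (Suc n) j) s w) w)))"
 by (intro ito_L2_add[OF Suc.IH] ito_L2_sum ito_L2_stop[OF ito_L2_diff[OF H Suc.IH] hit_stopping]) simp
thus ?case
proof (rule ito_L2_cong)
 fix s w
 have "(\<Sum>j\<in>UNIV. if hit (Suc n) j w < ennreal s then H j s w - ?H s w else 0) =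
  (\<Sum>j\<in>UNIV. if j = ze (Suc n) w then (if rho th w (Suc n) < ennreal s then H (ze (Suc n) w) s w - ?H s w else 0) else 0)"
  by (intro sum.cong) (auto simp: hit_rho)
 thus "?H s w + (\<Sum>j\<in>UNIV. if hit (Suc n) j w < ennreal s then H j s w - ?H s w else 0) =
   H (lm (Suc n) (ennreal s) w) s w" by simp
next
 show "AE w in P. ALL s>=0. ?J s w + (\<Sum>j\<in>UNIV. (J j s w - ?J s w) -
  (J j (stop_time (hit (Suc n) j) s w) w - ?J (stop_time (hit (Suc n) j) s w) w)) = spl (Suc n) (%j s. J j s w) w s"
 proof (intro AE_I2 allI impI)
  fix w and s :: real assume s: "0 <= s"
  let ?r = "rho th w (Suc n)" and ?z = "ze (Suc n) w"
  have "(\<Sum>j\<in>UNIV. (J j s w - ?J s w) - (J j (stop_time (hit (Suc n) j) s w) w - ?J (stop_time (hit (Suc n) j) s w) w)) =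
   (\<Sum>j\<in>UNIV. if j = ?z then (if ?r <= ennreal s then (J ?z s w - ?J s w) - (J ?z (enn2real ?r) w - ?J (enn2real ?r) w) else 0) else 0)"
  proof (rule sum.cong)
   fix j
   have st: "stop_time (hit (Suc n) j) s w = (if j = ?z & ?r <= ennreal s then enn2real ?r else s)"
    using s by (auto simp: stop_time_def hit_rho min_absorb2 min_def)
   show "J j s w - ?J s w - (J j (stop_time (hit (Suc n) j) s w) w - ?J (stop_time (hit (Suc n) j) s w) w) =
    (if j = ?z then (if ?r <= ennreal s then (J ?z s w - ?J s w) - (J ?z (enn2real ?r) w - ?J (enn2real ?r) w) else 0) else 0)"
    unfolding st by auto
  qed simp
  thus "?J s w + (\<Sum>j\<in>UNIV. (J j s w - ?J s w) -
   (J j (stop_time (hit (Suc n) j) s w) w - ?J (stop_time (hit (Suc n) j) s w) w)) = spl (Suc n) (%j s. J j s w) w s"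
   by simp
 qed
qed
qed

lemma predictable_generators: "{{0} \<times> A | A. A \<in> sets (F 0)} \<union>
 {{s<..t} \<times> A | s t A. 0 <= s & s <= t & A \<in> sets (F (ennreal s))} \<subseteq> Pow ({0..} \<times> space (F 0))"
proof -
have "A \<subseteq> space P" if "A \<in> sets (F r)" for A r using sets.sets_into_space[OF that] by simp
thus ?thesis by fastforce
qed

lemma space_predictable: "space (predictable_sigma F) = {0..} \<times> space P"
unfolding predictable_sigma_def by (subst space_measure_of[OF predictable_generators]) simp

text \<open>The open stochastic interval is a countable union of rectangles \<open>(q, N]\<close>
  times an event of \<open>F q\<close>, with \<open>q\<close> rational; these are generators of the
  predictable sigma-algebra.\<close>

lemma hit_predictable: "{(s, w). 0 <= s & w \<in> space P & hit k j w < ennreal s} \<in> sets (predictable_sigma F)"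
proof -
let ?A = "%(q, N). {q<..real N} \<times> {w \<in> space P. hit k j w <= ennreal q}"
let ?I = "({0 :: real..} \<inter> \<rat>) \<times> (UNIV :: nat set)"
have "{(s, w). 0 <= s & w \<in> space P & hit k j w < ennreal s} = (\<Union>p\<in>?I. ?A p)"
proof (intro equalityI subsetI)
 fix x assume "x \<in> {(s, w). 0 <= s & w \<in> space P & hit k j w < ennreal s}"
 then obtain s w where x: "x = (s, w)" "0 <= s" "w \<in> space P" "hit k j w < ennreal s" by auto
 then obtain a where a: "hit k j w = ennreal a" "0 <= a" "a < s" by (cases "hit k j w") (auto simp: ennreal_less_iff)
 obtain q where q: "q \<in> \<rat>" "a < q" "q < s" using Rats_dense_in_real[OF a(3)] by blast
 obtain N where "s <= real N" using real_arch_simple by blast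
 hence "x \<in> ?A (q, N)" "(q, N) \<in> ?I" using x q a by (auto intro: ennreal_leI)
 thus "x \<in> (\<Union>p\<in>?I. ?A p)" by blast
next
 fix x assume "x \<in> (\<Union>p\<in>?I. ?A p)"
 then obtain q N s w where x: "x = (s, w)" "0 <= q" "q < s" "w \<in> space P" "hit k j w <= ennreal q" by auto
 hence "hit k j w < ennreal s" using le_less_trans[OF x(5) ennreal_lessI] by simp
 thus "x \<in> {(s, w). 0 <= s & w \<in> space P & hit k j w < ennreal s}" using x by simp
qed
moreover have "(\<Union>p\<in>?I. ?A p) \<in> sets (predictable_sigma F)"
proof (rule sets.countable_UN'')
 show "countable ?I" by (intro countable_SIGMA countable_Int2 countable_rat countableI_type)
 fix p assume "p \<in> ?I"
 then obtain q N where p: "p = (q, N)" "0 <= q" by auto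
 show "?A p \<in> sets (predictable_sigma F)"
 proof (cases "q <= real N")
  case True
  have "{w \<in> space P. hit k j w <= ennreal q} \<in> sets (F (ennreal q))"
   using stopping_timeD[OF hit_stopping] by (simp add: pred_def)
  hence "?A p \<in> {{s<..t} \<times> A | s t A. 0 <= s & s <= t & A \<in> sets (F (ennreal s))}" using p(2) True unfolding p(1) prod.case by blast
  thus ?thesis unfolding predictable_sigma_def
   by (subst sets_measure_of[OF predictable_generators]) (intro sigma_sets.Basic UnI2)
 qed (use p in auto)
qed
ultimately show ?thesis by simp
qed


lemma lmode_predictable: "(%(s, w). lm n (ennreal s) w) \<in> predictable_sigma F \<rightarrow>\<^sub>M count_space UNIV"
proof (induction n)
case 0
thus ?case by (subst measurable_cong[where g="%_. i"]) (auto simp: space_predictable ze0)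
next
case (Suc n)
note Suc[measurable]
have [measurable]: "Measurable.pred (predictable_sigma F) (%x. hit (Suc n) j (snd x) < ennreal (fst x))" for j
 using hit_predictable[of "Suc n" j] unfolding pred_def by (rule back_subst[of "%A. A \<in> sets _"]) (auto simp: space_predictable)
have "(%(s, w). lm (Suc n) (ennreal s) w) -` {j} \<inter> space (predictable_sigma F) \<in> sets (predictable_sigma F)" for j
proof -
 have "(%(s, w). lm (Suc n) (ennreal s) w) -` {j} \<inter> space (predictable_sigma F) =
  {x \<in> space (predictable_sigma F). hit (Suc n) j (snd x) < ennreal (fst x) |
   (ALL l:UNIV. ~ hit (Suc n) l (snd x) < ennreal (fst x)) & (case x of (s, w) => lm n (ennreal s) w) = j}"
  by (auto simp: hit_rho split: if_splits)
 also have "... \<in> sets (predictable_sigma F)" by measurable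
 finally show ?thesis .
qed
thus ?case by (simp add: measurable_count_space_eq2)
qed

text \<open>The index from which a path is settled is random. A limit over \<open>n\<close> avoids
  selecting it measurably; the sequence is eventually constant on almost every path.\<close>

definition along :: "(real => 'w => real^'p^'d) => real => 'w => real^'p" where
"along Z s w = lim (%n. Z s w $ lm n (ennreal s) w)"

definition along_int :: "('d => real => 'w => real) => real => 'w => real" where
"along_int J s w = lim (%n. spl n (%j s. J j s w) w s)"

lemma along_settled:
assumes "strategy_path th ze t i w" "sld th ze w m"
shows "(%n. Z s w $ lm n (ennreal s) w) ----> Z s w $ lm m (ennreal s) w" (is ?Q1) "along Z s w = Z s w $ lm m (ennreal s) w" (is ?Q2)
 "0 <= s ==> (%n. spl n (%j s. J j s w) w s) ----> spl m (%j s. J j s w) w s" "0 <= s ==> along_int J s w = spl m (%j s. J j s w) w s"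
proof -
have st: "lm n (ennreal s) w = lm m (ennreal s) w" "0 <= s ==> spl n (%j s. J j s w) w s = spl m (%j s. J j s w) w s" if "m <= n" for n s J
 using settled_stable(2,3)[OF rho_mono[OF assms(1)] assms(2) that] by auto
show 1: ?Q1
proof (rule tendsto_eventually)
 have "ALL n>=m. Z s w $ lm n (ennreal s) w = Z s w $ lm m (ennreal s) w" using st(1)[of _ s] by metis
 thus "\<forall>\<^sub>F n in sequentially. Z s w $ lm n (ennreal s) w = Z s w $ lm m (ennreal s) w"
  unfolding eventually_sequentially by blast
qed
thus ?Q2 unfolding along_def by (rule limI)
show 2: "(%n. spl n (%j s. J j s w) w s) ----> spl m (%j s. J j s w) w s" if "0 <= s"
 by (rule tendsto_eventually) (unfold eventually_sequentially, use st(2)[OF _ that] in blast)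
thus "0 <= s ==> along_int J s w = spl m (%j s. J j s w) w s" unfolding along_int_def by (intro limI)
qed

lemma along_norm: "AE w in P. ALL s. norm (along Z s w) <= norm (Z s w)"
using paths settles by eventually_elim (auto simp: along_settled(2) Finite_Cartesian_Product.norm_nth_le)

lemma along_M2:
assumes Z: "Z \<in> M2 P F \<tau>"
shows "along Z \<in> M2 P F \<tau>"
proof -
have Zm: "(%x. Z (fst x) (snd x)) \<in> borel_measurable (predictable_sigma F)"
 using Z by (simp add: M2_def predictable_def case_prod_unfold)
have "(%x. Z (fst x) (snd x) $ (case x of (s, w) => lm n (ennreal s) w)) \<in> borel_measurable (predictable_sigma F)" for n
 by (rule measurable_compose_countable'[where f="%l x. Z (fst x) (snd x) $ l", OF borel_measurable_vec_nth[OF Zm] lmode_predictable])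
  (simp add: countable_finite)
hence "(%x. lim (%n. Z (fst x) (snd x) $ (case x of (s, w) => lm n (ennreal s) w))) \<in> borel_measurable (predictable_sigma F)"
 by (rule borel_measurable_lim_metric)
hence "predictable F (along Z)" unfolding predictable_def along_def by (simp add: case_prod_unfold)
moreover have "(EE w. (NN s:hor w. nsq (along Z s w))) <=
  (EE w. (NN s:hor w. nsq (Z s w)))"
 using along_norm[of Z] by (intro nn_integral_mono_AE) (auto elim!: eventually_mono intro!: nn_integral_mono mult_right_mono ennreal_leI power_mono)
ultimately show ?thesis using Z by (auto simp: M2_def sq_integrable_process_def)
qed

text \<open>The integrals along the first \<open>n\<close> switches are spliced integrals. Their
  integrands are dominated by the norm of \<open>Z\<close>, and both sequences are eventually
  constant on almost every path, so the limit lemma applies.\<close>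

theorem along_ito:
assumes Z: "Z \<in> M2 P F \<tau>" and J: "!!j. ito_L2 P F W (stop_integrand \<tau> (%s w. Z s w $ j)) (J j)"
shows "ito_L2 P F W (stop_integrand \<tau> (along Z)) (along_int J)"
proof -
let ?H = "%n s w. stop_integrand \<tau> (%s w. Z s w $ lm n (ennreal s) w) s w"
have I: "ito_L2 P F W (?H n) (%s w. spl n (%j s. J j s w) w s)" for n
 using splice_ito[where H="%j. stop_integrand \<tau> (%s w. Z s w $ j)" and n=n, OF J] by (simp add: stop_integrand_def)
have lim_eq: "stop_integrand \<tau> (along Z) s w = lim (%n. ?H n s w)" for s w
 by (cases "s \<in> hor w") (auto simp: stop_integrand_def along_def limI)
have cont: "AE w in P. ALL j:UNIV. continuous_on {0..} (%s. J j s w)"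
 using ito_L2D(3)[OF J] by (intro AE_finite_allI) auto
have pr: "progressive F (stop_integrand \<tau> (along Z))"
 unfolding progressive_def lim_eq
proof (intro allI impI)
 fix T :: real assume "0 <= T"
 hence "(%x. lim (%n. (case x of (s, w) => ?H n s w))) \<in> borel_measurable (restrict_space borel {0..T} \<Otimes>\<^sub>M F (ennreal T))"
  using ito_L2D(1)[OF I] unfolding progressive_def by (intro borel_measurable_lim_metric) blast
 thus "(%(s, w). lim (%n. ?H n s w)) \<in> borel_measurable (restrict_space borel {0..T} \<Otimes>\<^sub>M F (ennreal T))"
  by (simp add: case_prod_unfold)
qed
show ?thesis
proof (rule ito_L2_limit[OF I pr])
 show "AE w in P. continuous_on {0..} (%s. along_int J s w)"
  using paths settles cont
 proof eventually_elim
  case (elim w)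
  then obtain m where m: "sld th ze w m" by blast
  have "continuous_on {0..} (spl m (%j s. J j s w) w)" using elim by (intro splice_continuous) auto
  thus ?case by (rule continuous_on_eq) (use along_settled(4)[OF elim(1) m] in auto)
 qed
 show "AE w in P. (%n. spl n (%j s. J j s w) w s) ----> along_int J s w" if "0 <= s" for s
  using paths settles
 proof eventually_elim
  case (elim w)
  thus ?case using along_settled(3,4)[OF elim(1) _ that] by auto
 qed
 fix T :: real assume T: "0 <= T"
 \<comment> \<open>The norm of \<open>Z\<close> is rebuilt from its rows because joint measurability
   is known for each stopped row.\<close>
 define D where "D s w = sqrt (\<Sum>j\<in>UNIV. (norm (stop_integrand \<tau> (%s w. Z s w $ j) s w))^2)" for s w
 have D: "D s w = norm (stop_integrand \<tau> Z s w)" for s w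
  unfolding D_def norm_vec_def L2_set_def by (simp add: stop_integrand_def)
 have [measurable]: "(%x. indicator {0..} (fst x) *\<^sub>R stop_integrand \<tau> (%s w. Z s w $ j) (fst x) (snd x)) \<in> borel_measurable (borel \<Otimes>\<^sub>M P)" for j
  using ito_L2_joint[OF J[of j]] unfolding joint_def by (simp add: case_prod_unfold)
 have "(%(s, w). indicator {0..} s *\<^sub>R D s w) = (%x. sqrt (\<Sum>j\<in>UNIV. (norm
   (indicator {0..} (fst x) *\<^sub>R stop_integrand \<tau> (%s w. Z s w $ j) (fst x) (snd x)))^2))"
  by (auto simp: D_def fun_eq_iff indicator_def)
 moreover have "... \<in> borel_measurable (borel \<Otimes>\<^sub>M P)" by measurable
 ultimately have jD: "joint P D" unfolding joint_def by (simp only:)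
 show "(%n. time_L2 P T (%s w. ?H n s w - stop_integrand \<tau> (along Z) s w)) ----> 0"
 proof (rule time_L2_dominated[where D="%s w. 2 *\<^sub>R D s w"])
  show "joint P (%s w. ?H n s w - stop_integrand \<tau> (along Z) s w)" for n
   by (intro joint_diff ito_L2_joint[OF I] progressive_joint pr)
  show "joint P (%s w. 2 *\<^sub>R D s w)" using jD by (rule joint_cmult)
  have "time_L2 P T D = time_L2 P T (stop_integrand \<tau> Z)" unfolding time_L2_def D by simp
  also have "... < \<infinity>" by (rule le_less_trans[OF time_L2_stop_integrand[OF Z]]) auto
  finally show "time_L2 P T (%s w. 2 *\<^sub>R D s w) < \<infinity>"
   unfolding time_L2_cmult[OF jD] by (simp add: ennreal_mult_less_top)
  show "AE w in P. ALL s:{0..T}. norm (?H n s w - stop_integrand \<tau> (along Z) s w) <= norm (2 *\<^sub>R D s w)" for n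
   using along_norm[of Z]
  proof eventually_elim
   case (elim w)
   show ?case
   proof
    fix s
    have "norm (Z s w $ lm n (ennreal s) w - along Z s w) <= norm (Z s w) + norm (Z s w)"
     using elim by (intro order_trans[OF norm_triangle_ineq4] add_mono Finite_Cartesian_Product.norm_nth_le) auto
    thus "norm (?H n s w - stop_integrand \<tau> (along Z) s w) <= norm (2 *\<^sub>R D s w)"
     by (simp add: D stop_integrand_def indicator_def)
   qed
  qed
  show "AE w in P. AE s in lborel. s \<in> {0..T} --> (%n. ?H n s w - stop_integrand \<tau> (along Z) s w) ----> 0"
   using paths settles
  proof eventually_elim
   case (elim w)
   then obtain m where m: "sld th ze w m" by blast
   have "(%n. ?H n s w - stop_integrand \<tau> (along Z) s w) ----> ?H m s w - stop_integrand \<tau> (along Z) s w" for s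
    unfolding stop_integrand_def by (intro tendsto_intros along_settled(1)[OF elim(1) m])
   thus ?case by (auto simp: stop_integrand_def along_settled(2)[OF elim(1) m])
  qed
 qed
qed
qed

end

section \<open>The reflected solution along a strategy, compared with the switched equation\<close>

locale strategy_solution = strategy P W F \<tau> X XT g f C u th ze t i
for P :: "'w measure" and W :: "real => 'w => real^'p::finite" and F :: "ennreal => 'w measure"
 and \<tau> and X :: "'d::finite => real => 'w => real" and XT g f C u th ze t i +
fixes Y :: "real => 'w => real^'d" and Z :: "real => 'w => real^'p^'d" and K :: "real => 'w => real^'d"
 and J :: "'d => real => 'w => real"
assumes YS: "Y \<in> S2 P F \<tau>" and ZM: "Z \<in> M2 P F \<tau>"
 and J: "!!j. ito_L2 P F W (stop_integrand \<tau> (%s w. Z s w $ j)) (J j)"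
 and sol: "AE w in P. solves Y Z K J w"
begin

definition Yalong :: "real => 'w => real" where
"Yalong s w = lim (%n. Y s w $ rm n (ennreal s) w)"

lemma Yalong_settled:
assumes "strategy_path th ze t i w" "sld th ze w m"
shows "(%n. Y s w $ rm n (ennreal s) w) ----> Yalong s w" (is ?Q1) "Yalong s w = Y s w $ rm m (ennreal s) w" (is ?Q2)
proof -
have "ALL n>=m. Y s w $ rm n (ennreal s) w = Y s w $ rm m (ennreal s) w"
 using settled_stable(1)[OF rho_mono[OF assms(1)] assms(2)] by metis
hence 1: "(%n. Y s w $ rm n (ennreal s) w) ----> Y s w $ rm m (ennreal s) w"
 by (intro tendsto_eventually) (unfold eventually_sequentially, blast)
thus ?Q2 unfolding Yalong_def by (rule limI)
thus ?Q1 using 1 by simp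
qed

lemma rmode_measurable: "(%w. rm n s w) \<in> F s \<rightarrow>\<^sub>M count_space UNIV"
proof (induction n)
case 0
thus ?case by (subst measurable_cong[where g="%_. i"]) (auto simp: ze0)
next
case (Suc n)
note Suc[measurable] and switched_measurable[measurable]
have "(%w. rm (Suc n) s w) -` {j} \<inter> space (F s) \<in> sets (F s)" for j
proof -
 have "(%w. rm (Suc n) s w) -` {j} \<inter> space (F s) =
  {w \<in> space (F s). ((th (Suc n) w < \<tau> w & ze (Suc n) w = j) & th (Suc n) w <= s) |
   (ALL l:UNIV. ~ ((th (Suc n) w < \<tau> w & ze (Suc n) w = l) & th (Suc n) w <= s)) & rm n s w = j}"
  by (auto simp only: rmode.simps rho_le_iff vimage_def mem_Collect_eq singleton_iff if_split_eq1)
 also have "... \<in> sets (F s)" by measurable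
 finally show ?thesis .
qed
thus ?case by (simp add: measurable_count_space_eq2)
qed

lemma Y_measurable: "0 <= s ==> Y s \<in> Fmeas s"
using YS by (simp add: S2_def adapted_def)

lemma Yalong_measurable:
assumes s: "0 <= s"
shows "Yalong s \<in> Fmeas s"
proof (rule measurable_F_AE_LIMSEQ)
show "(%w. Y s w $ rm n (ennreal s) w) \<in> Fmeas s" for n
 by (rule measurable_compose_countable'[where f="%l w. Y s w $ l", OF borel_measurable_vec_nth[OF Y_measurable[OF s]] rmode_measurable])
  (simp add: countable_finite)
show "AE w in P. (%n. Y s w $ rm n (ennreal s) w) ----> Yalong s w"
 using paths settles by eventually_elim (auto simp: Yalong_settled(1))
qed

lemma Yalong_final:
assumes "strategy_path th ze t i w" "sld th ze w m" "solves Y Z K J w"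
shows "((%s. Yalong s w) ---> g (XT (rm m top w) w)) at_top" (is ?Q1)
 "0 <= s ==> \<tau> w <= ennreal s ==> Yalong s w = g (XT (rm m top w) w)"
proof -
have "((%s. Y s w $ rm m top w) ---> g (XT (rm m top w) w)) at_top" using assms(3) by (simp add: solves_def)
moreover have "eventually (%s. Y s w $ rm m top w = Yalong s w) at_top"
 using mode_eventually_final[of "rho th w" "%k. ze k w" m C]
 by (rule eventually_mono) (simp add: Yalong_settled(2)[OF assms(1,2)])
ultimately show ?Q1 by (rule Lim_transform_eventually)
show "0 <= s ==> \<tau> w <= ennreal s ==> Yalong s w = g (XT (rm m top w) w)"
 using assms(3) rmode_end(1)[OF assms(1,2), of "ennreal s" m] by (simp add: solves_def Yalong_settled(2)[OF assms(1,2)])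
qed

text \<open>The part of \<open>Y j\<close> that does not come from the reflection.\<close>

abbreviation "free w j s \<equiv> J j s w - prim (driver Y Z j w) s"

lemma spl_free:
assumes "solves Y Z K J w" "0 <= s"
shows "integrable lborel (%r. driver Y Z (lm m (ennreal r) w) w r)" (is ?Q1)
 "spl m (free w) w s = spl m (%j s. J j s w) w s - prim (%r. driver Y Z (lm m (ennreal r) w) w r) s" (is ?Q2)
proof -
have "integrable lborel (driver Y Z j w)" for j using assms by (simp add: solves_def)
thus ?Q1
 ?Q2
 using splice_prim[of "%j. driver Y Z j w" s "rho th w" "%k. ze k w" m] assms(2) by (simp_all add: splice_diff)
qed

text \<open>For \<open>ep = 1\<close>, the process \<open>Yalong\<close> minus the cost paid and
  minus its free part is nonincreasing. Both signs together make it constant, so that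
  \<open>Yalong\<close> satisfies the equation of \<open>U\<close>.\<close>

definition path_ineq :: "real => 'w => bool" where
"path_ineq ep w \<longleftrightarrow> (ALL m s s'. sld th ze w m --> t <= s --> s <= s' -->
  ep * (Yalong s' w - Yalong s w - (pay m (ennreal s') w - pay m (ennreal s) w)
   - (spl m (free w) w s' - spl m (free w) w s)) <= 0)"

definition path_eq where
"path_eq U V JU JT h m w \<longleftrightarrow> (ALL s>=t. U s w = g (XT (rm m top w) w) - (pay m top w - pay m (ennreal s) w)
    + (integral\<^sup>L lborel (h w) - prim (h w) s) - (JT w - JU s w)) &
   (ALL r>t. ennreal r < \<tau> w --> h w r = f r w (X (lm m (ennreal r) w) r w) (U r w) (V r w) (lm m (ennreal r) w))"

lemma bsde_path:
assumes U: "switching_bsde_solution P F W \<tau> X XT g f C t th ze U V"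
obtains JU JT h where "ito_L2 P F W (stop_integrand \<tau> V) JU"
 "AE w in P. continuous_on {0..} (%s. JU s w) & ((%s. JU s w) ---> JT w) at_top &
  (ALL s>=0. \<tau> w <= ennreal s --> JU s w = JT w) & integrable lborel (h w) & (ALL r. r \<notin> {t..} \<inter> hor w --> h w r = 0) &
  (ALL m. sld th ze w m --> path_eq U V JU JT h m w)"
proof -
let ?F = "%w r. f r w (X (mode_at th ze (ennreal r) w) r w) (U r w) (V r w) (mode_at th ze (ennreal r) w)"
define h where "h = (%w r. indicator ({t..} \<inter> hor w) r * ?F w r)"
let ?ae = "%R w. set_integrable lborel ({t..} \<inter> hor w) (?F w) &
 (ALL s>=t. U s w = g (XT (mode_at th ze (\<tau> w) w) w) - (cost C \<tau> th ze (\<tau> w) w - cost C \<tau> th ze (ennreal s) w)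
  + (LINT r:({s..} \<inter> hor w)|lborel. ?F w r) - R s w)"
obtain R where V: "V \<in> M2 P F \<tau>" and R: "ito_remainder P F W \<tau> V R" and ae: "AE w in P. ?ae R w"
 using U unfolding switching_bsde_solution_def Let_def by (auto elim: eventually_mono)
obtain JU JT where JU: "ito_L2 P F W (stop_integrand \<tau> V) JU" and R':
 "AE w in P. (ALL s>=0. R s w = JT w - JU s w) & ((%s. JU s w) ---> JT w) at_top
  & (ALL s>=0. \<tau> w <= ennreal s --> JU s w = JT w) & continuous_on {0..} (%s. JU s w)"
 by (rule ito_remainderE[OF R V _ \<tau>]) auto
show thesis
proof (rule that[OF JU], use paths ae R' in eventually_elim, intro conjI allI impI)
 fix w assume p: "strategy_path th ze t i w" and ae: "?ae R w"
  and R: "(ALL s>=0. R s w = JT w - JU s w) & ((%s. JU s w) ---> JT w) at_top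
  & (ALL s>=0. \<tau> w <= ennreal s --> JU s w = JT w) & continuous_on {0..} (%s. JU s w)"
 show hi: "integrable lborel (h w)" using ae by (simp add: set_integrable_def h_def)
 show h0: "h w r = 0" if "r \<notin> {t..} \<inter> hor w" for r using that by (simp add: h_def)
 fix m assume m: "sld th ze w m"
 show "path_eq U V JU JT h m w" unfolding path_eq_def
 proof (intro conjI allI impI)
  show "h w r = f r w (X (lm m (ennreal r) w) r w) (U r w) (V r w) (lm m (ennreal r) w)" if "t < r" "ennreal r < \<tau> w" for r
   unfolding h_def mode_at_lmode[OF p m that t0] using that t0 by (simp add: hor_iff)
  fix s assume s: "t <= s"
  have "{s..} \<inter> hor w = {s..} \<inter> ({t..} \<inter> hor w)" using s by auto
  hence "(LINT r:({s..} \<inter> hor w)|lborel. ?F w r) =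
   (LINT r:{s..}|lborel. h w r)" unfolding h_def by (simp only: set_lebesgue_integral_indicator)
  also have "... = integral\<^sup>L lborel (h w) - prim (h w) s"
   using s t0 by (intro prim_tail hi h0) auto
  finally show "U s w = g (XT (rm m top w) w) - (pay m top w - pay m (ennreal s) w)
     + (integral\<^sup>L lborel (h w) - prim (h w) s) - (JT w - JU s w)"
   using ae R s t0 by (simp add: mode_at_end[OF p m] cost_eq_paid(2)[where th=th and ze=ze, OF m] rmode_end(2)[OF p m order_refl])
 qed
qed auto
qed

text \<open>\<open>Yalong\<close> and \<open>U\<close> jump by the same costs and have the same
  final value, so their difference contains neither. What is left is an integral against
  \<open>along Z - V\<close> and a drift controlled by the Lipschitz bound, as
  \<open>comparison\<close> demands.\<close>

theorem compare:
assumes ep: "abs ep = 1" and ineq: "AE w in P. path_ineq ep w"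
 and U: "switching_bsde_solution P F W \<tau> X XT g f C t th ze U V"
shows "AE w in P. 0 <= ep * (Yalong t w - U t w)"
proof -
obtain JU JT h where JU: "ito_L2 P F W (stop_integrand \<tau> V) JU" and ae:
 "AE w in P. continuous_on {0..} (%s. JU s w) & ((%s. JU s w) ---> JT w) at_top &
  (ALL s>=0. \<tau> w <= ennreal s --> JU s w = JT w) & integrable lborel (h w) & (ALL r. r \<notin> {t..} \<inter> hor w --> h w r = 0) &
  (ALL m. sld th ze w m --> path_eq U V JU JT h m w)"
 by (rule bsde_path[OF U])
have US: "U \<in> S2 P F \<tau>" and VM: "V \<in> M2 P F \<tau>" using U by (auto simp: switching_bsde_solution_def)
obtain S1 where S1: "S1 \<in> borel_measurable P" "ALL w. 0 <= S1 w" "integrable P (%w. (S1 w)^2)"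
 "AE w in P. ALL s. 0 <= s & ennreal s < \<tau> w --> norm (Y s w) <= S1 w" by (rule S2_bound[OF YS \<tau>]) (rule that, assumption, blast)
obtain S2' where S2: "S2' \<in> borel_measurable P" "ALL w. 0 <= S2' w" "integrable P (%w. (S2' w)^2)"
 "AE w in P. ALL s. 0 <= s & ennreal s < \<tau> w --> norm (U s w) <= S2' w" by (rule S2_bound[OF US \<tau>]) (rule that, assumption, blast)
note [measurable] = S1(1) S2(1)
let ?H = "%s w. stop_integrand \<tau> (along Z) s w - stop_integrand \<tau> V s w"
let ?x = "%s w. ep * (Yalong s w - U s w)" and ?I = "%s w. ep * (along_int J s w - JU s w)"
have ep_le: "ep * a <= abs a" for a using abs_ge_self[of "ep * a"] ep by (simp add: abs_mult)
have I: "ito_L2 P F W (%s w. ep *\<^sub>R ?H s w) ?I"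
 by (intro ito_L2_cmult ito_L2_diff along_ito ZM J JU)
\<comment> \<open>All pathwise facts hold on one almost sure event, with a common index
  \<open>m\<close> for the two processes that are compared.\<close>
let ?good = "%w. strategy_path th ze t i w & (EX m. sld th ze w m &
  path_eq U V JU JT h m w &
  ((%s. ?x s w) ---> 0) at_top & (ALL s>=t. \<tau> w <= ennreal s --> ?x s w = 0)) &
  integrable lborel (h w) & (ALL r. r \<notin> {t..} \<inter> hor w --> h w r = 0) &
  continuous_on {0..} (%s. JU s w) & solves Y Z K J w & path_ineq ep w & w \<in> space P"
have good: "AE w in P. ?good w"
 using paths settles ae sol ineq AE_space
proof eventually_elim
 case (elim w)
 then obtain m where m: "sld th ze w m" by blast
 have Ue: "!!s. s>=t ==> U s w = g (XT (rm m top w) w) - (pay m top w - pay m (ennreal s) w)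
    + (integral\<^sup>L lborel (h w) - prim (h w) s) - (JT w - JU s w)"
  and hi: "integrable lborel (h w)" and h0: "!!r. r \<notin> {t..} \<inter> hor w ==> h w r = 0" using elim m unfolding path_eq_def by blast+
 have JJ: "((%s. JU s w) ---> JT w) at_top" "!!s. 0 <= s ==> \<tau> w <= ennreal s ==> JU s w = JT w" using elim by blast+
 have "((%s. g (XT (rm m top w) w) + (integral\<^sup>L lborel (h w) - prim (h w) s) - (JT w - JU s w)) --->
   g (XT (rm m top w) w) + (integral\<^sup>L lborel (h w) - integral\<^sup>L lborel (h w)) - (JT w - JT w)) at_top"
  by (intro tendsto_intros prim_tendsto hi JJ) (use h0 in \<open>simp add: hor_iff\<close>)
 moreover have "eventually (%s. g (XT (rm m top w) w) + (integral\<^sup>L lborel (h w) - prim (h w) s) - (JT w - JU s w) = U s w) at_top"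
  using mode_eventually_final[of "rho th w" "%k. ze k w" m C] eventually_ge_at_top[of t]
  by eventually_elim (simp add: Ue)
 ultimately have "((%s. U s w) ---> g (XT (rm m top w) w)) at_top" by (auto intro: Lim_transform_eventually)
 from tendsto_mult_left[OF tendsto_diff[OF Yalong_final(1)[OF elim(1) m elim(4)] this], of ep]
 have lim: "((%s. ?x s w) ---> 0) at_top" by simp
 have "?x s w = 0" if "t <= s" "\<tau> w <= ennreal s" for s
  using that t0 Yalong_final(2)[OF elim(1) m elim(4), of s] prim_after[OF hi _ _ that(2)] h0 JJ(2)[of s]
  by (simp add: Ue rmode_end(2)[OF elim(1) m that(2), of m])
 thus ?case using elim m lim by blast
qed
\<comment> \<open>The energy bound holds for all horizons at once: it is twice the sum of the total
  energies of \<open>Z\<close> and \<open>V\<close> on the stochastic interval.\<close>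
interpret comparison P W F "%s w. ep *\<^sub>R ?H s w" ?I ?x "%w. S1 w + S2' w" "%r. ubar r" t "SUP r\<in>{0..}. u r"
 "2 * sq_total \<tau> Z + 2 * sq_total \<tau> V"
proof
 show "ito_L2 P F W (%s w. ep *\<^sub>R ?H s w) ?I" by (rule I)
 show "0 <= 2 * sq_total \<tau> Z + 2 * sq_total \<tau> V" by (simp add: sq_total_def)
 fix T :: real assume "0 <= T"
 have j: "joint P (stop_integrand \<tau> (along Z))" "joint P (stop_integrand \<tau> V)"
  by (rule ito_L2_joint[OF along_ito[OF ZM J]], rule ito_L2_joint[OF JU])
 have "ep^2 = 1" using ep by (metis power2_abs one_power2)
 hence "time_L2 P T (%s w. ep *\<^sub>R ?H s w) = time_L2 P T ?H" by (simp add: time_L2_cmult joint_diff j)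
 also have "... <= 2 * time_L2 P T (stop_integrand \<tau> (along Z)) + 2 * time_L2 P T (stop_integrand \<tau> V)"
  by (rule time_L2_diff_le2[OF j])
 also have "... <= 2 * ennreal (sq_total \<tau> Z) + 2 * ennreal (sq_total \<tau> V)"
  by (intro add_mono mult_left_mono time_L2_stop_integrand ZM VM along_norm) auto
 also have "... = ennreal (2 * sq_total \<tau> Z + 2 * sq_total \<tau> V)"
  by (simp add: ennreal_mult' sq_total_def)
 finally show "time_L2 P T (%s w. ep *\<^sub>R ?H s w) <= ennreal (2 * sq_total \<tau> Z + 2 * sq_total \<tau> V)" .
next
 fix s assume "t <= s"
 hence s: "0 <= s" using t0 by simp
 have "U s \<in> Fmeas s" using US s by (simp add: S2_def adapted_def)
 thus "?x s \<in> Fmeas s" using Yalong_measurable[OF s] by simp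
next
 show "(%w. S1 w + S2' w) \<in> borel_measurable P" "!!w. 0 <= S1 w + S2' w" using S1(2) S2(2) by auto
 show "integrable P (%w. (S1 w + S2' w)^2)" by (rule integrable_square_add[OF S1(1) S2(1) S1(3) S2(3)])
 show "AE w in P. ALL s>=t. abs (?x s w) <= S1 w + S2' w"
  using good S1(4) S2(4)
 proof (eventually_elim, intro allI impI)
  fix w s assume g: "?good w"
   and b: "ALL s. 0 <= s & ennreal s < \<tau> w --> norm (Y s w) <= S1 w"
   "ALL s. 0 <= s & ennreal s < \<tau> w --> norm (U s w) <= S2' w" and s: "t <= s"
  obtain m where m: "sld th ze w m" "ALL s>=t. \<tau> w <= ennreal s --> ?x s w = 0" using g by blast
  show "abs (?x s w) <= S1 w + S2' w"
  proof (cases "ennreal s < \<tau> w")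
   case True
   have "abs (Yalong s w) <= norm (Y s w)"
    using g component_le_norm_cart[of "Y s w"] by (simp add: Yalong_settled(2)[OF _ m(1)])
   moreover have "norm (Y s w) <= S1 w" "abs (U s w) <= S2' w" using b True s t0 by auto
   ultimately show ?thesis using ep by (simp add: abs_mult)
  next
   case False
   hence "?x s w = 0" using m(2) s not_less by blast
   thus ?thesis using S1(2)[rule_format, of w] S2(2)[rule_format, of w] by (simp only: abs_zero)
  qed
 qed
next
 show "AE w in P. ((%s. ?x s w) ---> 0) at_top" using good by (rule eventually_mono) blast
 show "AE w in P. AE r in lborel. t < r --> isCont (%r. ?x r w) r"
  using good
 proof (rule eventually_mono, elim conjE exE)
  fix w m assume p: "strategy_path th ze t i w" and m: "sld th ze w m"
   and Ue: "path_eq U V JU JT h m w"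
   and hi: "integrable lborel (h w)" and cJ: "continuous_on {0..} (%s. JU s w)" and sol: "solves Y Z K J w"
  \<comment> \<open>Outside the finitely many switching times the mode and the cost are locally
    constant, so \<open>?x\<close> agrees near such a time with the continuous path
    \<open>?y\<close>.\<close>
  let ?N = "(%k. enn2real (rho th w (Suc k))) ` {..<m}"
  have "AE r in lborel. r \<notin> ?N" by (intro AE_not_in) (auto intro: finite_imp_null_set_lborel)
  thus "AE r in lborel. t < r --> isCont (%r. ?x r w) r"
  proof (rule eventually_mono, intro impI)
   fix r assume r: "r \<notin> ?N" "t < r"
   let ?y = "%s. ep * (Y s w $ rm m (ennreal r) w - (g (XT (rm m top w) w) - (pay m top w - pay m (ennreal r) w)
    + (integral\<^sup>L lborel (h w) - prim (h w) s) - (JT w - JU s w)))"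
   have cY: "continuous_on {0..} (%s. Y s w)" using sol by (simp add: solves_def)
   have "continuous_on {0<..} ?y"
    by (intro continuous_intros continuous_on_subset[OF cY] continuous_on_subset[OF cJ] continuous_on_subset[OF prim_continuous[OF hi]]) auto
   hence ic: "isCont ?y r" using r t0 by (simp add: continuous_on_eq_continuous_at)
   have ev: "eventually (%s. ?x s w = ?y s) (nhds r)"
   proof -
    have 1: "eventually (%s. rm m (ennreal s) w = rm m (ennreal r) w & pay m (ennreal s) w = pay m (ennreal r) w) (at r)"
     using r t0 by (intro rmode_eventually(3)) auto
    have 2: "eventually (%s. t < s) (at r)" using r(2) by (intro order_tendstoD(1)[OF tendsto_ident_at])
    have eq: "?x s w = ?y s" if "t < s" "rm m (ennreal s) w = rm m (ennreal r) w" "pay m (ennreal s) w = pay m (ennreal r) w" for s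
     using Ue that by (simp add: path_eq_def Yalong_settled(2)[OF p m])
    from 2 1 have "eventually (%s. ?x s w = ?y s) (at r)" by eventually_elim (rule eq, auto)
    moreover have "?x r w = ?y r" using r(2) by (intro eq) auto
    ultimately show ?thesis unfolding eventually_nhds_conv_at by blast
   qed
   show "isCont (%r. ?x r w) r" by (rule iffD2[OF isCont_cong[OF ev] ic])
  qed
 qed
 show "AE w in P. ALL s s'. t <= s & s <= s' --> ennreal (?x s' w - ?x s w - (?I s' w - ?I s w)) <=
   (NN r:{s..s'}. ennreal (ubar r * (abs (?x r w) + norm (ep *\<^sub>R ?H r w))))"
  using good
 proof (rule eventually_mono, elim conjE exE, intro allI impI)
  fix w m s s' assume p: "strategy_path th ze t i w" and m: "sld th ze w m"
   and Ue: "path_eq U V JU JT h m w"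
   and hi: "integrable lborel (h w)" and h0: "ALL r. r \<notin> {t..} \<inter> hor w --> h w r = 0"
   and sol: "solves Y Z K J w" and ineq: "path_ineq ep w" and w: "w \<in> space P" and s: "t <= s & s <= s'"
  let ?d = "%r. driver Y Z (lm m (ennreal r) w) w r"
  have s0: "0 <= s" "0 <= s'" "s <= s'" "t <= s'" using s t0 by auto
  note sf = spl_free[OF sol s0(1), of m] spl_free(2)[OF sol s0(2), of m]
  have ai: "along_int J r w = spl m (%j s. J j s w) w r" if "0 <= r" for r by (rule along_settled(4)[OF p m that])
  have "ep * (Yalong s' w - Yalong s w - (pay m (ennreal s') w - pay m (ennreal s) w)
   - (spl m (free w) w s' - spl m (free w) w s)) <= 0" using ineq m s by (simp add: path_ineq_def)
  \<comment> \<open>\<open>U\<close> pays the same \<open>pay m\<close> as \<open>Yalong\<close>, so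
    the costs cancel in the difference.\<close>
  moreover have Ud: "U s' w = U s w + (pay m (ennreal s') w - pay m (ennreal s) w) - (prim (h w) s' - prim (h w) s) + (JU s' w - JU s w)"
   using Ue s s0 by (simp add: path_eq_def)
  ultimately have "?x s' w - ?x s w - (?I s' w - ?I s w) <= ep * ((prim (h w) s' - prim (h w) s) - (prim ?d s' - prim ?d s))"
   unfolding Ud ai[OF s0(1)] ai[OF s0(2)] sf by (simp add: algebra_simps)
  also have "... <= abs ((prim (h w) s' - prim (h w) s) - (prim ?d s' - prim ?d s))"
   by (rule ep_le)
  also have "... = abs (LINT r:{s..s'}|lborel. h w r - ?d r)"
   unfolding prim_diff[OF hi s0(1,3)] prim_diff[OF sf(1) s0(1,3)]
   by (subst set_integral_diff) (unfold set_integrable_def, (intro integrable_mult_indicator hi sf(1), simp)+, simp)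
  finally have "ennreal (?x s' w - ?x s w - (?I s' w - ?I s w)) <= ennreal (norm (LINT r|lborel. indicator {s..s'} r *\<^sub>R (h w r - ?d r)))"
   by (intro ennreal_leI) (simp add: set_lebesgue_integral_def)
  also have "... <= (\<integral>\<^sup>+r. norm (indicator {s..s'} r *\<^sub>R (h w r - ?d r)) \<partial>lborel)"
   by (intro integral_norm_bound_ennreal integrable_mult_indicator Bochner_Integration.integrable_diff hi sf(1)) auto
  also have "... <= (NN r:{s..s'}. ennreal (ubar r * (abs (?x r w) + norm (ep *\<^sub>R ?H r w))))"
  proof (rule nn_integral_mono_AE)
   let ?le = "%r. ennreal (norm (indicator {s..s'} r *\<^sub>R (h w r - ?d r))) <=
     ennreal (ubar r * (abs (?x r w) + norm (ep *\<^sub>R ?H r w))) * indicator {s..s'} r"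
   \<comment> \<open>The excluded times are negligible: the initial time, \<tau>, and the switching
     times, at which the right mode of \<open>Yalong\<close> differs from the left mode in the
     driver.\<close>
   let ?N = "insert t (insert (enn2real (\<tau> w)) ((%k. enn2real (rho th w (Suc k))) ` {..<m}))"
   have "AE r in lborel. r \<notin> ?N" by (intro AE_not_in) (auto intro: finite_imp_null_set_lborel)
   thus "AE r in lborel. ?le r"
   proof (rule eventually_mono)
    fix r assume r: "r \<notin> ?N"
    show "?le r"
    proof (cases "r \<in> {s..s'} & ennreal r < \<tau> w")
     case True
     hence tr: "t < r" "0 <= r" using s t0 r by auto
     let ?l = "lm m (ennreal r) w"
     have "rm m (ennreal r) w = ?l"
     proof (rule rmode_eq_lmode)
      fix k assume "k < m"
      hence "rho th w (Suc k) ~= ennreal r" using r tr(2) by force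
      thus "(rho th w (Suc k) <= ennreal r & rho th w (Suc k) < top) = (rho th w (Suc k) < ennreal r)"
       by (auto simp: less_le top_unique)
     qed
     hence Yr: "Yalong r w = Y r w $ ?l" by (simp add: Yalong_settled(2)[OF p m])
     have hr: "r \<in> hor w" using True tr by (simp add: hor_iff less_imp_le)
     have "abs (h w r - ?d r) = abs (f r w (X ?l r w) (U r w) (V r w) ?l - f r w (X ?l r w) (Y r w $ ?l) (Z r w $ ?l) ?l)"
      using Ue tr True hr by (simp add: path_eq_def driver_def)
     also have "... <= u r * (abs (X ?l r w - X ?l r w) + abs (U r w - Y r w $ ?l) + norm (V r w - Z r w $ ?l))"
      by (rule Lip_f[OF tr(2) w])
     also have "... = u r * (abs (?x r w) + norm (ep *\<^sub>R ?H r w))"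
      using ep hr by (simp add: Yr abs_mult along_settled(2)[OF p m] stop_integrand_def abs_minus_commute norm_minus_commute)
     finally show ?thesis using True tr by (auto intro: ennreal_leI)
    next
     case False
     have "h w r - ?d r = 0" if "r \<in> {s..s'}"
     proof -
      have "0 <= r" using that s0 by simp
      have "ennreal r ~= \<tau> w"
      proof
       assume eq: "ennreal r = \<tau> w"
       have "enn2real (\<tau> w) = r" unfolding eq[symmetric] using \<open>0 <= r\<close> by simp
       thus False using r by simp
      qed
      hence "r \<notin> hor w" using False that by (auto simp: hor_iff)
      thus ?thesis using h0 by (simp add: driver_def)
     qed
     thus ?thesis by (auto simp: indicator_def)
    qed
   qed
  qed
  finally show "ennreal (?x s' w - ?x s w - (?I s' w - ?I s w)) <=
   (NN r:{s..s'}. ennreal (ubar r * (abs (?x r w) + norm (ep *\<^sub>R ?H r w))))" .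
 qed
qed (use t0 in \<open>auto intro: u_bar\<close>)
show ?thesis by (rule nonneg)
qed

end

section \<open>The value of a strategy\<close>

context strategy_solution
begin

definition jumps :: "real => 'w => bool" where
"jumps ep w \<longleftrightarrow> (ALL k s. t <= s --> rho th w (Suc k) = ennreal s -->
  ep * (Y s w $ ze (Suc k) w - Y s w $ ze k w - C (ze k w) (ze (Suc k) w)) <= 0)"

lemma solves_obstacle: "solves Y Z K J w ==> 0 <= s ==> Y s w $ j - C l j <= Y s w $ l"
unfolding solves_def by blast

lemma jumps_1: "solves Y Z K J w ==> jumps 1 w"
unfolding jumps_def
proof (intro allI impI)
fix k s assume "solves Y Z K J w" "t <= s"
from solves_obstacle[OF this(1), of s "ze (Suc k) w" "ze k w"] this(2) t0
show "1 * (Y s w $ ze (Suc k) w - Y s w $ ze k w - C (ze k w) (ze (Suc k) w)) <= 0" by simp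
qed

text \<open>While a mode is kept, \<open>Y\<close> deviates from its free part only by the
  reflection. Monotonicity of \<open>K\<close> settles the sign 1; the opposite sign asks that
  \<open>K\<close> be flat while its mode is active.\<close>

lemma path_ineqI:
assumes p: "strategy_path th ze t i w" and sol: "solves Y Z K J w" and jump: "jumps ep w"
 and stay: "!!m k a b. sld th ze w m ==> k <= m ==> t <= a ==> a <= b ==>
  rho th w k <= ennreal a | k = 0 ==> ennreal b <= (if k < m then rho th w (Suc k) else top) ==>
  0 <= ep * (stopped K w b $ ze k w - stopped K w a $ ze k w)"
shows "path_ineq ep w"
unfolding path_ineq_def
proof (intro allI impI)
fix m s s' assume m: "sld th ze w m" and s: "t <= s" "s <= s'"
show "ep * (Yalong s' w - Yalong s w - (pay m (ennreal s') w - pay m (ennreal s) w)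
 - (spl m (free w) w s' - spl m (free w) w s)) <= 0"
 unfolding Yalong_settled(2)[OF p m]
proof (rule splice_inequality[where y="%j s. Y s w $ j" and G="free w" and T=top])
 fix k a b assume k: "k <= m" "t <= a" "a <= b" "rho th w k <= ennreal a | k = 0"
  "ennreal b <= (if k < m then rho th w (Suc k) else top)"
 have "Y b w $ ze k w - Y a w $ ze k w - (free w (ze k w) b - free w (ze k w) a) =
  - (stopped K w b $ ze k w - stopped K w a $ ze k w)"
  using sol k t0 by (simp add: solves_def)
 thus "ep * (Y b w $ ze k w - Y a w $ ze k w - (free w (ze k w) b - free w (ze k w) a)) <= 0"
  using stay[OF m k] by (simp only: mult_minus_right)
qed (use jump s t0 rho_mono[OF p] rho_ge[OF p] in \<open>auto simp: jumps_def\<close>)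
qed

lemma path_ineq_1:
assumes "strategy_path th ze t i w" "solves Y Z K J w"
shows "path_ineq 1 w"
by (rule path_ineqI[OF assms jumps_1]) (use assms t0 in \<open>auto simp: solves_def mono_on_def\<close>)

text \<open>The switches made at the initial time lead from \<open>Y i\<close> to \<open>Yalong\<close>.\<close>

lemma initial_switches:
assumes p: "strategy_path th ze t i w" and m: "sld th ze w m" and jump: "jumps ep w"
shows "ep * (Yalong t w - cost C \<tau> th ze (ennreal t) w - Y t w $ i) <= 0"
proof -
have "ep * (Y t w $ rm n (ennreal t) w - pay n (ennreal t) w - Y t w $ i) <= 0" for n
proof (induction n)
 case 0
 thus ?case using p by (simp add: strategy_path_def paid_def)
next
 case (Suc n)
 show ?case
 proof (cases "rho th w (Suc n) <= ennreal t & rho th w (Suc n) < top")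
  case True
  hence r: "rho th w (Suc n) = ennreal t" using rho_ge[OF p, of n] by (intro antisym) auto
  have "rm n (ennreal t) w = ze n w"
   using rho_mono[OF p, of n] True by (intro rmode_last) (auto intro: order_trans le_less_trans)
  moreover have "ep * (Y t w $ ze (Suc n) w - Y t w $ ze n w - C (ze n w) (ze (Suc n) w)) <= 0"
   using jump r by (simp add: jumps_def)
  ultimately show ?thesis using Suc True by (simp add: paid_def algebra_simps)
 next
  case False
  hence "rm (Suc n) (ennreal t) w = rm n (ennreal t) w" "pay (Suc n) (ennreal t) w = pay n (ennreal t) w"
   by (auto simp: paid_def)
  thus ?thesis using Suc by simp
 qed
qed
thus ?thesis by (simp only: Yalong_settled(2)[OF p m] cost_eq_paid(2)[where th=th and ze=ze, OF m])
qed

text \<open>Comparison bounds \<open>U\<close> at time \<open>t\<close> by \<open>Yalong\<close>,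
  the value after the initial switches; these switches gain no more than they cost, by the
  constraint.\<close>

theorem value_le:
assumes U: "switching_bsde_solution P F W \<tau> X XT g f C t th ze U V"
shows "AE w in P. U t w - cost C \<tau> th ze (ennreal t) w <= Y t w $ i"
proof -
have "AE w in P. path_ineq 1 w" using paths sol by eventually_elim (rule path_ineq_1)
from compare[OF _ this U] have "AE w in P. 0 <= Yalong t w - U t w" by simp
with paths settles sol show ?thesis
proof eventually_elim
 case (elim w)
 then obtain m where "sld th ze w m" by blast
 from initial_switches[OF elim(1) this jumps_1[OF elim(3)]] elim(4) show ?case by simp
qed
qed

theorem value_eq:
assumes ineq: "AE w in P. path_ineq (- 1) w & jumps (- 1) w"
 and U: "switching_bsde_solution P F W \<tau> X XT g f C t th ze U V"
shows "AE w in P. Y t w $ i = U t w - cost C \<tau> th ze (ennreal t) w"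
proof -
have "AE w in P. path_ineq (- 1) w" using ineq by (rule eventually_mono) simp
from compare[OF _ this U] have "AE w in P. 0 <= - 1 * (Yalong t w - U t w)" by simp
with paths settles sol value_le[OF U] ineq show ?thesis
proof eventually_elim
 case (elim w)
 then obtain m where "sld th ze w m" by blast
 from initial_switches[OF elim(1) this, of "- 1"] elim show ?case by simp
qed
qed

text \<open>The equation starts at \<open>t\<close>, but the space asks for an adapted cadlag
  process on the whole half line. Before \<open>t\<close> the component \<open>Y i\<close> is a
  convenient filling.\<close>

definition Uval :: "real => 'w => real" where
"Uval s w = (if s < t then Y s w $ i else Yalong s w)"

lemma Uval_S2: "Uval \<in> S2 P F \<tau>"
proof -
have "adapted F Uval"
 unfolding adapted_def
proof (intro allI impI)
 fix s :: real assume s: "0 <= s"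
 have "Uval s = (if s < t then (%w. Y s w $ i) else Yalong s)" by (auto simp: Uval_def)
 thus "Uval s \<in> Fmeas s"
  using Yalong_measurable[OF s] borel_measurable_vec_nth[OF Y_measurable[OF s]] by auto
qed
moreover have "AE w in P. cadlag (%s. Uval s w)"
 using paths settles sol
proof eventually_elim
 case (elim w)
 then obtain m where m: "sld th ze w m" by blast
 have "continuous_on {0<..} (%s. Y s w)" using elim(3) by (auto simp: solves_def intro: continuous_on_subset)
 hence isC: "isCont (%s. Y s w) s" if "0 < s" for s using that by (simp add: continuous_on_eq_continuous_at)
 have right: "((%s. Y s w $ j) ---> Y s w $ j) (at_right s)" if "0 <= s" for s j
 proof -
  have "continuous_on {s..} (%s. Y s w)" using elim(3) that by (auto simp: solves_def intro: continuous_on_subset)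
  thus ?thesis by (intro tendsto_vec_nth) (simp add: continuous_on_def flip: at_within_Ici_at_right)
 qed
 have left: "((%s. Y s w $ j) ---> Y s w $ j) (at_left s)" if "0 < s" for s j
  using isC[OF that] by (intro tendsto_vec_nth) (simp add: isCont_def filterlim_at_split)
 note Ys = Yalong_settled(2)[OF elim(1) m]
 show ?case
  unfolding cadlag_def
 proof (intro conjI allI impI)
  fix s :: real assume s: "0 <= s"
  define j where "j = (if s < t then i else rm m (ennreal s) w)"
  have "eventually (%r. Y r w $ j = Uval r w) (at_right s)"
  proof (cases "s < t")
   case True
   thus ?thesis by (auto simp: eventually_at_right_field Uval_def j_def intro!: exI[of _ t])
  next
   case False
   from rmode_eventually(1)[OF s, of "rho th w" "%k. ze k w" m] eventually_at_right_less[of s]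
   show ?thesis by eventually_elim (use False in \<open>simp add: j_def Uval_def Ys\<close>)
  qed
  moreover have "Y s w $ j = Uval s w" by (simp add: j_def Uval_def Ys)
  ultimately show "((%r. Uval r w) ---> Uval s w) (at_right s)" using right[OF s, of j] by (auto intro: Lim_transform_eventually)
 next
  fix s :: real assume s: "0 < s"
  define j where "j = (if s <= t then i else lm m (ennreal s) w)"
  have "eventually (%r. Y r w $ j = Uval r w) (at_left s)"
  proof (cases "s <= t")
   case True
   thus ?thesis by (auto simp: eventually_at_left_field Uval_def j_def intro!: exI[of _ "s - 1"])
  next
   case False
   hence "eventually (%r. t < r) (at_left s)" by (intro order_tendstoD(1)[OF tendsto_ident_at]) simp
   with rmode_eventually(2)[OF s, of "rho th w" "%k. ze k w" m] show ?thesis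
    by eventually_elim (use False in \<open>simp add: j_def Uval_def Ys\<close>)
  qed
  thus "EX l. ((%r. Uval r w) ---> l) (at_left s)" by (intro exI) (rule Lim_transform_eventually[OF left[OF s, of j]])
 qed
qed
moreover have "(EE w. (SUP s\<in>hor w. nsq (Uval s w))) <= (EE w. (SUP s\<in>hor w. nsq (Y s w)))"
proof (rule nn_integral_mono_AE, use paths settles in eventually_elim)
 case (elim w)
 then obtain m where m: "sld th ze w m" by blast
 have "norm (Uval s w) <= norm (Y s w)" for s
  using component_le_norm_cart[of "Y s w"] by (simp add: Uval_def Yalong_settled(2)[OF elim(1) m])
 hence "nsq (Uval s w) <= nsq (Y s w)" for s by (intro ennreal_leI power_mono) auto
 thus ?case by (intro SUP_subset_mono order_refl)
qed
moreover have "(EE w. (SUP s\<in>hor w. nsq (Y s w))) < \<infinity>" using YS by (simp add: S2_def)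
ultimately show ?thesis unfolding S2_def using le_less_trans by blast
qed

text \<open>With both signs of the path inequality the increments of \<open>along_int J\<close> are
  expressed through \<open>Yalong\<close>, the cost and the driver. All three have limits, so the
  integral has one, and letting the right end tend to infinity gives the backward equation.\<close>

theorem Uval_solution:
assumes ineq: "AE w in P. path_ineq (- 1) w"
shows "switching_bsde_solution P F W \<tau> X XT g f C t th ze Uval (along Z)"
unfolding switching_bsde_solution_def
proof (intro conjI Uval_S2 along_M2 ZM exI)
define JT where "JT w = Lim at_top (%s. along_int J s w)" for w
have key: "AE w in P. ((%s. along_int J s w) ---> JT w) at_top & (EX m. sld th ze w m &
  integrable lborel (%r. driver Y Z (lm m (ennreal r) w) w r) &
  (ALL s>=t. Yalong s w = g (XT (rm m top w) w) - (pay m top w - pay m (ennreal s) w) +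
   (LINT r:{s..}|lborel. driver Y Z (lm m (ennreal r) w) w r) - (JT w - along_int J s w)))"
 using paths settles sol ineq
proof eventually_elim
 case (elim w)
 then obtain m where m: "sld th ze w m" by blast
 let ?d = "%r. driver Y Z (lm m (ennreal r) w) w r" and ?G = "g (XT (rm m top w) w)"
 have di: "integrable lborel ?d" by (rule spl_free(1)[OF elim(3) t0])
 have d0: "?d r = 0" if "r < 0" for r using that by (simp add: driver_def hor_iff)
 have inc: "along_int J s' w = along_int J s w + (Yalong s' w - Yalong s w) - (pay m (ennreal s') w - pay m (ennreal s) w) + (prim ?d s' - prim ?d s)"
  if "t <= s" "s <= s'" for s s'
 proof -
  have s0: "0 <= s" "0 <= s'" using that t0 by auto
  have "Yalong s' w - Yalong s w - (pay m (ennreal s') w - pay m (ennreal s) w) - (spl m (free w) w s' - spl m (free w) w s) = 0"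
   using path_ineq_1[OF elim(1,3)] elim(4) m that unfolding path_ineq_def by (intro antisym) auto
  thus ?thesis unfolding spl_free(2)[OF elim(3) s0(1)] spl_free(2)[OF elim(3) s0(2)]
   along_settled(4)[OF elim(1) m s0(1)] along_settled(4)[OF elim(1) m s0(2)] by simp
 qed
 have lim: "((%r. along_int J r w) ---> along_int J s w + (?G - Yalong s w) - (pay m top w - pay m (ennreal s) w) + (integral\<^sup>L lborel ?d - prim ?d s)) at_top"
  if s: "t <= s" for s
 proof (rule Lim_transform_eventually)
  show "((%r. along_int J s w + (Yalong r w - Yalong s w) - (pay m top w - pay m (ennreal s) w) + (prim ?d r - prim ?d s)) --->
   along_int J s w + (?G - Yalong s w) - (pay m top w - pay m (ennreal s) w) + (integral\<^sup>L lborel ?d - prim ?d s)) at_top"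
   by (intro tendsto_intros Yalong_final(1)[OF elim(1) m elim(3)] prim_tendsto di d0)
  show "eventually (%r. along_int J s w + (Yalong r w - Yalong s w) - (pay m top w - pay m (ennreal s) w) + (prim ?d r - prim ?d s)
   = along_int J r w) at_top"
   using mode_eventually_final[of "rho th w" "%k. ze k w" m C] eventually_ge_at_top[of s]
  proof eventually_elim
   case (elim r)
   thus ?case using inc[OF s, of r] by simp
  qed
 qed
 have Jt: "JT w = along_int J s w + (?G - Yalong s w) - (pay m top w - pay m (ennreal s) w) + (integral\<^sup>L lborel ?d - prim ?d s)" if "t <= s" for s
  unfolding JT_def by (rule tendsto_Lim[OF trivial_limit_at_top_linorder lim[OF that]])
 have "((%s. along_int J s w) ---> JT w) at_top" unfolding Jt[OF order_refl] by (rule lim) simp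
 moreover have "Yalong s w = ?G - (pay m top w - pay m (ennreal s) w) + (LINT r:{s..}|lborel. ?d r) - (JT w - along_int J s w)" if "t <= s" for s
 proof -
  have "(LINT r:{s..}|lborel. ?d r) = integral\<^sup>L lborel ?d - prim ?d s"
   by (rule prim_tail[OF di d0]) (use that t0 in auto)
  thus ?thesis using Jt[OF that] by simp
 qed
 ultimately show ?case using m di by blast
qed
show "ito_remainder P F W \<tau> (along Z) (%s w. JT w - along_int J s w)"
 unfolding ito_remainder_def
 using ito_integral_of_ito_L2[OF along_ito[OF ZM J]] key
 by (intro exI[of _ "along_int J"] exI[of _ JT] conjI) (auto elim: eventually_mono)
show "AE w in P. let \<alpha> = (%s. mode_at th ze s w); A = (%s. cost C \<tau> th ze s w);
  F\<^sub>\<alpha> = (%r. f r w (X (\<alpha> (ennreal r)) r w) (Uval r w) (along Z r w) (\<alpha> (ennreal r))) in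
  summable (switch_cost C \<tau> th ze (\<tau> w) w) & set_integrable lborel ({t..} \<inter> hor w) F\<^sub>\<alpha> &
  (ALL s>=t. Uval s w = g (XT (\<alpha> (\<tau> w)) w) - (A (\<tau> w) - A (ennreal s))
   + (LINT r:({s..} \<inter> hor w)|lborel. F\<^sub>\<alpha> r) - (JT w - along_int J s w))"
 using paths key
proof (eventually_elim)
 case (elim w)
 obtain m where m: "sld th ze w m" and
  di: "integrable lborel (%r. driver Y Z (lm m (ennreal r) w) w r)" and
  eq: "!!s. s >= t ==> Yalong s w = g (XT (rm m top w) w) - (pay m top w - pay m (ennreal s) w) +
   (LINT r:{s..}|lborel. driver Y Z (lm m (ennreal r) w) w r) - (JT w - along_int J s w)"
  using elim(2) by blast
 let ?d = "%r. driver Y Z (lm m (ennreal r) w) w r"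
 let ?F = "%r. f r w (X (mode_at th ze (ennreal r) w) r w) (Uval r w) (along Z r w) (mode_at th ze (ennreal r) w)"
 \<comment> \<open>Away from these finitely many times the left-continuous mode in the equation and
   the right-continuous mode in \<open>Uval\<close> coincide, so the drivers agree almost
   everywhere.\<close>
 let ?N = "insert t (insert (enn2real (\<tau> w)) ((%k. enn2real (rho th w (Suc k))) ` {..<m}))"
 have N: "countable ?N" by (simp add: countable_finite)
 have same: "indicator ({s..} \<inter> hor w) r *\<^sub>R ?d r = indicator ({s..} \<inter> hor w) r *\<^sub>R ?F r" if "t <= s" "r \<notin> ?N" for s r
 proof (cases "r \<in> {s..} \<inter> hor w")
  case True
  hence r: "t < r" "0 <= r" "ennreal r <= \<tau> w" using that t0 by (auto simp: hor_iff)
  have "ennreal r ~= \<tau> w"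
  proof
   assume eq: "ennreal r = \<tau> w"
   have "enn2real (\<tau> w) = r" unfolding eq[symmetric] using r by simp
   thus False using that by simp
  qed
  hence lt: "ennreal r < \<tau> w" using r by simp
  have "rm m (ennreal r) w = lm m (ennreal r) w"
  proof (rule rmode_eq_lmode)
   fix k assume "k < m"
   hence "rho th w (Suc k) ~= ennreal r" using that(2) r(2) by force
   thus "(rho th w (Suc k) <= ennreal r & rho th w (Suc k) < top) = (rho th w (Suc k) < ennreal r)"
    by (auto simp: less_le top_unique)
  qed
  thus ?thesis using True r(1)
   by (simp add: mode_at_lmode[OF elim(1) m r(1) lt t0] driver_def Uval_def Yalong_settled(2)[OF elim(1) m] along_settled(2)[OF elim(1) m])
 qed simp
 have ii: "integrable lborel (%r. indicator ({s..} \<inter> hor w) r *\<^sub>R ?d r)" for s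
 proof -
  have eq: "(%r. indicator ({s..} \<inter> hor w) r *\<^sub>R ?d r) = (%r. indicator {s..} r *\<^sub>R ?d r)"
   by (auto simp: fun_eq_iff driver_def indicator_def)
  show ?thesis unfolding eq by (rule integrable_mult_indicator[OF _ di]) simp
 qed
 have "integrable lborel (%r. indicator ({t..} \<inter> hor w) r *\<^sub>R ?F r)"
  by (rule iffD1[OF integrable_discrete_difference[OF N _ _ same] ii]) auto
 moreover have "(LINT r:({s..} \<inter> hor w)|lborel. ?F r) = (LINT r:{s..}|lborel. ?d r)" if "t <= s" for s
 proof -
  have "(LINT r:({s..} \<inter> hor w)|lborel. ?F r) = (LINT r|lborel. indicator ({s..} \<inter> hor w) r *\<^sub>R ?d r)"
   unfolding set_lebesgue_integral_def
   by (rule integral_discrete_difference[OF N, symmetric]) (use same[OF that] in auto)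
  also have "... = (LINT r:{s..}|lborel. ?d r)"
   unfolding set_lebesgue_integral_def by (intro Bochner_Integration.integral_cong) (auto simp: driver_def indicator_def)
  finally show ?thesis .
 qed
 ultimately show ?case
  unfolding Let_def using eq cost_eq_paid[where th=th and ze=ze, OF m]
  by (simp add: set_integrable_def Uval_def mode_at_end[OF elim(1) m] rmode_end(2)[OF elim(1) m order_refl])
qed
qed

end

section \<open>The candidate strategy\<close>

lemma increasing_tendsto_cases:
fixes s :: "nat => real"
assumes "incseq s"
shows "(EX l. s ----> l) | filterlim s at_top sequentially"
proof (cases "EX B. ALL k. s k <= B")
case True
then obtain B where "ALL k. s k <= B" by blast
from incseq_convergent[OF assms this] show ?thesis by blast
next
case False
have "eventually (%k. B <= s k) sequentially" for B
proof -
 obtain n where "B < s n" using False not_le by blast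
 thus ?thesis using assms unfolding eventually_sequentially incseq_def by (meson less_imp_le order_trans)
qed
thus ?thesis by (auto simp: filterlim_at_top)
qed

locale solution = switching P W F \<tau> X XT g f C u
for P :: "'w measure" and W :: "real => 'w => real^'p::finite" and F :: "ennreal => 'w measure"
 and \<tau> and X :: "'d::finite => real => 'w => real" and XT g f C u +
fixes Y :: "real => 'w => real^'d" and Z :: "real => 'w => real^'p^'d" and K :: "real => 'w => real^'d"
 and J :: "'d => real => 'w => real"
assumes YS: "Y \<in> S2 P F \<tau>" and ZM: "Z \<in> M2 P F \<tau>"
 and J: "!!j. ito_L2 P F W (stop_integrand \<tau> (%s w. Z s w $ j)) (J j)"
 and sol: "AE w in P. solves Y Z K J w"
begin

definition meets :: "'d => real^'d => bool" where
"meets a y \<longleftrightarrow> (EX l. l ~= a & y $ a = y $ l - C a l)"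

definition candidate_path :: "(nat => 'w => ennreal) => (nat => 'w => 'd) => real => 'd => 'w => bool" where
"candidate_path th ze t i w \<longleftrightarrow> th 0 w = min (ennreal t) (\<tau> w) & ze 0 w = i &
  (ALL j. th (Suc j) w = min (INF s\<in>{s. 0 <= s & th j w <= ennreal s & meets (ze j w) (Y s w)}. ennreal s) (\<tau> w) &
   (th (Suc j) w < \<tau> w --> ze (Suc j) w ~= ze j w & (let y = Y (enn2real (th (Suc j) w)) w in
    y $ ze j w = y $ ze (Suc j) w - C (ze j w) (ze (Suc j) w))))"

text \<open>A supremum over finitely many modes is attained unless the set is empty, and then it is
  minus infinity, which the real value on the left excludes. Conversely the constraint keeps the
  barrier below \<open>y a\<close>.\<close>

lemma barrier_iff:
assumes "!!j. y $ j - C a j <= y $ a"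
shows "ereal (y $ a) = barrier C a y \<longleftrightarrow> meets a y"
proof
assume eq: "ereal (y $ a) = barrier C a y"
let ?B = "(%j. ereal (y $ j - C a j)) ` (- {a})"
have "?B ~= {}" using eq by (auto simp: barrier_def bot_ereal_def)
hence "Sup ?B \<in> ?B" using Max_in[of ?B] by (simp add: cSup_eq_Max)
thus "meets a y" using eq by (auto simp: barrier_def meets_def)
next
assume "meets a y"
then obtain l where l: "l ~= a" "y $ a = y $ l - C a l" by (auto simp: meets_def)
show "ereal (y $ a) = barrier C a y"
 unfolding barrier_def
 by (rule antisym) (use l assms in \<open>auto intro: SUP_upper2 SUP_least\<close>)
qed

lemma solves_cont:
assumes "solves Y Z K J w"
shows "continuous_on {0..} (%s. Y s w)" "continuous_on {0..} (%s. Y s w $ j)" "continuous_on {0..} (stopped K w)"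
using assms by (auto simp: solves_def intro: continuous_intros)

lemma obstacle: "solves Y Z K J w ==> 0 <= s ==> Y s w $ j - C l j <= Y s w $ l"
unfolding solves_def by blast

text \<open>Off the barrier the gap is positive; on compact subintervals it has a positive minimum,
  which is the uniform gap needed to keep \<open>K\<close> constant. The right end is reached by
  continuity.\<close>

lemma flat:
assumes sol: "solves Y Z K J w" and ab: "0 <= a" "a <= b"
 and off: "!!r. a <= r ==> r < b ==> ennreal r < \<tau> w ==> ~ meets j (Y r w)"
shows "stopped K w b $ j = stopped K w a $ j"
proof -
\<comment> \<open>The right end is cut at \<tau>, after which the stopped \<open>K\<close> is
  constant anyway.\<close>
define c where "c = stop_time \<tau> b w"
have c: "ennreal c <= \<tau> w" "0 <= c" "c <= b" using ab by (auto simp: c_def ennreal_stop_time stop_time_nonneg stop_time_le)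
hence cK: "stopped K w c = stopped K w b" using stopped_horizon[of c w K] by (simp add: c_def stopped_def)
show ?thesis
proof (cases "a < c")
 case False
 have "stop_time \<tau> a w = stop_time \<tau> b w"
 proof (cases "\<tau> w <= ennreal a")
  case True
  thus ?thesis using ab order_trans[OF True ennreal_leI[OF ab(2)]] by (simp add: stop_after)
 next
  case lt: False
  have "a = b"
  proof (rule ccontr)
   assume "a ~= b"
   hence "ennreal a < ennreal c" using lt ab by (simp add: c_def ennreal_stop_time ennreal_less_iff)
   thus False using False ab by (simp add: ennreal_less_iff)
  qed
  thus ?thesis by simp
 qed
 thus ?thesis by (simp add: stopped_def)
next
 case True
 have const: "stopped K w d $ j = stopped K w a $ j" if d: "a < d" "d < c" for d
 proof -
  have d\<tau>: "ennreal d < \<tau> w" using less_le_trans[OF ennreal_lessI c(1)] ab d by auto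
  have "EX e>0. ALL r:{a..d}. l ~= j --> e <= Y r w $ j - Y r w $ l + C j l" for l
  proof (cases "l = j")
   case False
   have "continuous_on {a..d} (%r. Y r w $ j - Y r w $ l + C j l)"
    by (intro continuous_intros continuous_on_subset[OF solves_cont(2)[OF sol]]) (use ab in auto)
   from continuous_attains_inf[OF compact_Icc _ this] d
   obtain r where r: "r \<in> {a..d}" "ALL r':{a..d}. Y r w $ j - Y r w $ l + C j l <= Y r' w $ j - Y r' w $ l + C j l" by auto
   have "ennreal r < \<tau> w" using r(1) ennreal_leI[of r d] d\<tau> by (auto intro: le_less_trans)
   hence "~ meets j (Y r w)" using r(1) d c by (intro off) auto
   hence "0 < Y r w $ j - Y r w $ l + C j l"
    using obstacle[OF sol, of r l j] False r(1) ab by (force simp: meets_def)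
   thus ?thesis using r(2) by blast
  qed (auto intro: exI[of _ 1])
  hence "ALL l. EX e>0. ALL r:{a..d}. l ~= j --> e <= Y r w $ j - Y r w $ l + C j l" by blast
  from choice[OF this] obtain e where e: "ALL l. 0 < e l & (ALL r:{a..d}. l ~= j --> e l <= Y r w $ j - Y r w $ l + C j l)" by blast
  have "0 < Min (range e)" using e by simp
  moreover have "ALL r l. a < r --> r < d --> l ~= j --> Min (range e) <= Y r w $ j - Y r w $ l + C j l"
  proof (intro allI impI)
   fix r l assume "a < r" "r < d" "l ~= j"
   hence "e l <= Y r w $ j - Y r w $ l + C j l" using e by auto
   thus "Min (range e) <= Y r w $ j - Y r w $ l + C j l" by (intro order_trans[OF Min_le]) auto
  qed
  ultimately show ?thesis using sol ab d less_imp_le[OF d\<tau>] unfolding solves_def by blast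
 qed
 have "continuous_on {0<..} (stopped K w)" using solves_cont(3)[OF sol] by (rule continuous_on_subset) auto
 hence "isCont (stopped K w) c" using True ab by (simp add: continuous_on_eq_continuous_at)
 hence "((%s. stopped K w s $ j) ---> stopped K w c $ j) (at_left c)"
  by (intro tendsto_vec_nth) (simp add: isCont_def filterlim_at_split)
 moreover have "eventually (%s. stopped K w s $ j = stopped K w a $ j) (at_left c)"
  unfolding eventually_at_left[OF True] using const True by blast
 ultimately show ?thesis unfolding cK[symmetric]
  using tendsto_unique[OF trivial_limit_at_left_real _ tendsto_eventually] by blast
qed
qed

section \<open>Paths of the candidate strategy\<close>

context
fixes th :: "nat => 'w => ennreal" and ze :: "nat => 'w => 'd" and t :: real and i :: 'd and w :: 'w
assumes cand: "candidate_path th ze t i w" and solw: "solves Y Z K J w" and t0: "0 <= t"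
begin

lemma candidate_step: "th j w <= th (Suc j) w" "th j w <= \<tau> w"
proof -
show *: "th j w <= \<tau> w" for j using cand by (cases j) (auto simp: candidate_path_def)
have "th j w <= (INF s\<in>{s. 0 <= s & th j w <= ennreal s & meets (ze j w) (Y s w)}. ennreal s)"
 by (rule INF_greatest) simp
thus "th j w <= th (Suc j) w" using cand * by (simp add: candidate_path_def)
qed

lemma candidate_jump:
assumes "th (Suc k) w = ennreal s" "0 <= s" "ennreal s < \<tau> w"
shows "Y s w $ ze k w = Y s w $ ze (Suc k) w - C (ze k w) (ze (Suc k) w)" (is ?Q1) "ze (Suc k) w ~= ze k w"
proof -
have "th (Suc k) w < \<tau> w --> ze (Suc k) w ~= ze k w & (let y = Y (enn2real (th (Suc k) w)) w in
  y $ ze k w = y $ ze (Suc k) w - C (ze k w) (ze (Suc k) w))" using cand unfolding candidate_path_def by blast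
thus ?Q1 "ze (Suc k) w ~= ze k w"
 using assms by (simp_all add: Let_def)
qed

text \<open>Infinitely many switches before \<open>\<tau>\<close> would accumulate at a point where the values of \<open>Y\<close> allow
a cycle of switches without cost.\<close>

lemma candidate_finite: "EX n. th n w = \<tau> w"
proof (rule ccontr)
assume "\<nexists>n. th n w = \<tau> w"
hence lt: "th n w < \<tau> w" for n using candidate_step(2)[of n] by (simp add: less_le)
define s where "s n = enn2real (th n w)" for n
have s: "th n w = ennreal (s n)" "0 <= s n" for n using less_le_trans[OF lt[of n] top_greatest] by (auto simp: s_def)
have "incseq s" using candidate_step(1) unfolding s(1) by (intro incseq_SucI) (simp add: s(2) ennreal_le_iff)
\<comment> \<open>The switching times accumulate at a finite time or at infinity. In both cases
  \<open>Y\<close> converges along them, in the second case to its final values.\<close>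
from increasing_tendsto_cases[OF this] have "EX y. ALL j. (%n. Y (s n) w $ j) ----> y j"
proof
 assume "EX l. s ----> l"
 then obtain l where l: "s ----> l" by blast
 hence "0 <= l" using s(2) by (intro LIMSEQ_le_const) auto
 hence "(%n. Y (s n) w $ j) ----> Y l w $ j" for j
  using s(2) by (intro continuous_on_tendsto_compose[OF solves_cont(2)[OF solw] l]) auto
 thus ?thesis by (intro exI[of _ "%j. Y l w $ j"]) simp
next
 assume top: "filterlim s at_top sequentially"
 have "(%n. Y (s n) w $ j) ----> g (XT j w)" for j
  using solw by (intro filterlim_compose[OF _ top]) (simp add: solves_def)
 thus ?thesis by (intro exI[of _ "%j. g (XT j w)"]) simp
qed
then obtain y where y: "!!j. (%n. Y (s n) w $ j) ----> y j" by blast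
have step: "Y (s (Suc k)) w $ ze k w = Y (s (Suc k)) w $ ze (Suc k) w - C (ze k w) (ze (Suc k) w)" "ze (Suc k) w ~= ze k w" for k
 using candidate_jump[of k "s (Suc k)"] s[of "Suc k"] lt[of "Suc k"] by simp_all
\<comment> \<open>There are finitely many pairs of modes, so beyond some index only pairs that
  satisfy the switching inequality in the limit are ever used.\<close>
have "eventually (%k. ~ y a <= y b - C a b --> Y (s (Suc k)) w $ a ~= Y (s (Suc k)) w $ b - C a b) sequentially" for a b
proof (cases "y a <= y b - C a b")
 case False
 have "(%k. Y (s (Suc k)) w $ a - (Y (s (Suc k)) w $ b - C a b)) ----> y a - (y b - C a b)"
  by (intro tendsto_intros filterlim_compose[OF y filterlim_Suc])
 from order_tendstoD(1)[OF this, of 0] False show ?thesis by (auto elim: eventually_mono)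
qed simp
hence "eventually (%k. ALL a b. ~ y a <= y b - C a b --> Y (s (Suc k)) w $ a ~= Y (s (Suc k)) w $ b - C a b) sequentially"
 by (intro eventually_all_finite)
then obtain N where N: "!!k a b. N <= k ==> ~ y a <= y b - C a b ==> Y (s (Suc k)) w $ a ~= Y (s (Suc k)) w $ b - C a b"
 unfolding eventually_sequentially by blast
have "(%k. ze k w) ` {N..} = {}"
proof (rule no_free_cycle[OF C0 C3])
 fix a assume "a \<in> (%k. ze k w) ` {N..}"
 then obtain k where k: "N <= k" "a = ze k w" by auto
 hence "y a <= y (ze (Suc k) w) - C a (ze (Suc k) w)" using N[OF k(1)] step(1) by blast
 thus "EX b:(%k. ze k w) ` {N..}. b ~= a & y a <= y b - C a b"
  using k step(2)[of k] by (intro bexI[of _ "ze (Suc k) w"]) auto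
qed
thus False by auto
qed

lemma candidate_strategy_path: "strategy_path th ze t i w"
proof -
obtain n where n: "th n w = \<tau> w" using candidate_finite by blast
have "th k w = \<tau> w" if "n <= k" for k
 using lift_Suc_mono_le[of "%k. th k w", OF candidate_step(1) that] candidate_step(2)[of k] n by simp
hence "eventually (%k. th k w = \<tau> w) sequentially" unfolding eventually_sequentially by blast
thus ?thesis using cand candidate_step tendsto_eventually by (auto simp: strategy_path_def candidate_path_def)
qed

lemma candidate_settled: "EX m. sld th ze w m"
proof -
obtain n where n: "th n w = \<tau> w" using candidate_finite by blast
have "~ rho th w (Suc k) < top" if "n <= k" for k
 unfolding rho_less_top using lift_Suc_mono_le[of "%k. th k w" n "Suc k", OF candidate_step(1)] that n by (simp add: not_less)
thus ?thesis unfolding settled_def by blast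
qed

lemma candidate_stay:
assumes m: "sld th ze w m" and k: "k <= m" "t <= a" "a <= b"
 "rho th w k <= ennreal a | k = 0" "ennreal b <= (if k < m then rho th w (Suc k) else top)"
shows "stopped K w b $ ze k w = stopped K w a $ ze k w"
proof (rule flat[OF solw])
fix r assume r: "a <= r" "r < b" "ennreal r < \<tau> w"
have "ennreal b <= rho th w (Suc k)"
proof (cases "k < m")
 case False
 hence [simp]: "k = m" using k by simp
 \<comment> \<open>A switch after \<open>m\<close> would keep the mode because the strategy is
   settled, whereas the candidate changes its mode at every switch.\<close>
 have "~ rho th w (Suc m) < top"
 proof
  assume "rho th w (Suc m) < top"
  moreover from this have "th (Suc m) w < \<tau> w" unfolding rho_less_top .
  ultimately show False using m cand unfolding settled_def candidate_path_def by blast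
 qed
 thus ?thesis by (simp add: not_less top_unique)
qed (use k in simp)
hence "ennreal r < rho th w (Suc k)" using less_le_trans[OF ennreal_lessI[of b r]] r k(2) t0 by auto
hence lt: "ennreal r < th (Suc k) w" using r(3) candidate_step(2)[of "Suc k"] by (auto simp: rho_def split: if_splits)
have "th k w <= ennreal a"
proof (cases "k = 0")
 case True
 thus ?thesis using cand k(2) by (simp add: candidate_path_def min.coboundedI1 ennreal_leI)
next
 case False
 moreover have "th k w <= rho th w k" by (simp add: rho_def)
 ultimately show ?thesis using k(4) by (auto intro: order_trans)
qed
hence ge: "th k w <= ennreal r" using ennreal_leI[OF r(1)] by (rule order_trans)
show "~ meets (ze k w) (Y r w)"
proof
 assume "meets (ze k w) (Y r w)"
 hence "(INF s\<in>{s. 0 <= s & th k w <= ennreal s & meets (ze k w) (Y s w)}. ennreal s) <= ennreal r"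
  using ge r k(2) t0 by (intro INF_lower) auto
 hence "th (Suc k) w <= ennreal r" using cand by (simp add: candidate_path_def min.coboundedI1)
 thus False using lt by simp
qed
qed (use k t0 in auto)

end

end

lemma closed_hit:
fixes H :: "real set"
assumes "closed H" "H \<subseteq> {0..}"
shows "(INF r\<in>H. ennreal r) < top ==> EX r:H. (INF r\<in>H. ennreal r) = ennreal r"
 and "0 <= s ==> (INF r\<in>H. ennreal r) <= ennreal s \<longleftrightarrow> (EX r:H. r <= s)"
proof -
have *: "EX r:H. (INF r\<in>H. ennreal r) = ennreal r" if "(INF r\<in>H. ennreal r) < top"
proof
 have "H ~= {}" using that by auto
 moreover have bdd: "bdd_below H" using assms(2) by (auto intro: bdd_belowI[of _ 0])
 ultimately show i: "Inf H \<in> H" using assms(1) closed_contains_Inf by blast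
 show "(INF r\<in>H. ennreal r) = ennreal (Inf H)"
  by (rule antisym[OF INF_lower[OF i]]) (auto intro!: INF_greatest ennreal_leI cInf_lower bdd)
qed
thus "(INF r\<in>H. ennreal r) < top ==> EX r:H. (INF r\<in>H. ennreal r) = ennreal r" .
show "(INF r\<in>H. ennreal r) <= ennreal s \<longleftrightarrow> (EX r:H. r <= s)" if "0 <= s"
proof
 assume le: "(INF r\<in>H. ennreal r) <= ennreal s"
 then obtain r where r: "r \<in> H" "(INF r\<in>H. ennreal r) = ennreal r" using * le_less_trans[OF le ennreal_less_top] by blast
 hence "r <= s" using le that by (simp add: ennreal_le_iff)
 thus "EX r:H. r <= s" using r(1) by blast
qed (auto intro: INF_lower2 ennreal_leI)
qed

section \<open>Contact times as stopping times, and existence of a candidate\<close>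

context solution
begin

text \<open>Contact is recorded for each pair of modes: the sets are closed, their union gives the
  time of the next switch, and the individual ones tell which mode may be chosen.\<close>

definition hits :: "'d => 'd => 'w => ennreal => real set" where
"hits a b w h = {r. 0 <= r & h <= ennreal r & Y r w $ a = Y r w $ b - C a b}"

lemma hits_closed:
assumes "solves Y Z K J w"
shows "closed (hits a b w h)"
proof (cases h)
case (real c)
have "closed {r \<in> {c..}. Y r w $ a - (Y r w $ b - C a b) = 0}"
 by (intro continuous_closed_preimage_constant continuous_intros continuous_on_subset[OF solves_cont(2)[OF assms]]) (use real in auto)
also have "{r \<in> {c..}. Y r w $ a - (Y r w $ b - C a b) = 0} = hits a b w h"
 using real by (auto simp: hits_def ennreal_le_iff)
finally show ?thesis .
qed (auto simp: hits_def top_unique)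

lemma meets_hits: "{s. 0 <= s & h <= ennreal s & meets a (Y s w)} = (\<Union>b\<in>- {a}. hits a b w h)"
by (auto simp: meets_def hits_def)

text \<open>Contact up to \<open>s\<close> is expressed by countably many times: for each
  \<open>n\<close> there is near-contact up to \<open>1 / (n + 1)\<close> at a rational time or at
  \<open>s\<close>, and compactness recovers a true contact. The minimum with \<open>s\<close> keeps
  all events in \<open>F s\<close>.\<close>

lemma hits_event:
assumes sol: "solves Y Z K J w" and s: "0 <= s"
shows "(EX r:hits a b w h. r <= s) \<longleftrightarrow> (ALL n::nat. EX q:insert s ({0..s} \<inter> \<rat>).
 h <= ennreal (min s (q + inverse (real (Suc n)))) & Y q w $ a - Y q w $ b + C a b < inverse (real (Suc n)))"
 (is "?L \<longleftrightarrow> (ALL n. EX q:?Q. ?E n q)")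
proof
let ?D = "%q. Y q w $ a - Y q w $ b + C a b"
have D: "continuous_on {0..} ?D" by (intro continuous_intros solves_cont(2)[OF sol])
show "ALL n. EX q:?Q. ?E n q" if L: ?L
proof
 fix n :: nat
 let ?e = "inverse (real (Suc n))"
 obtain r where r: "0 <= r" "r <= s" "h <= ennreal r" "?D r = 0" using L by (auto simp: hits_def)
 have hr: "h <= ennreal (min s (q + ?e))" if "r <= q" for q
  using r that by (intro order_trans[OF r(3)] ennreal_leI) (auto intro: add_increasing2)
 show "EX q:?Q. ?E n q"
 proof (cases "r = s")
  case True
  thus ?thesis using r hr[of s] by (intro bexI[of _ s]) auto
 next
  case False
  have "(?D ---> ?D r) (at_right r)"
   using continuous_on_subset[OF D, of "{r..}"] r(1) by (auto simp: continuous_on_def simp flip: at_within_Ici_at_right)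
  hence "eventually (%q. ?D q < ?e) (at_right r)" unfolding r(4) by (intro order_tendstoD) auto
  then obtain c where c: "r < c" "!!q. r < q ==> q < c ==> ?D q < ?e" unfolding eventually_at_right_field by blast
  obtain q where "q \<in> \<rat>" "r < q" "q < min c s" using Rats_dense_in_real[of r "min c s"] False r(2) c(1) by auto
  thus ?thesis using c(2)[of q] hr[of q] r(1) by (intro bexI[of _ q]) auto
 qed
qed
assume "ALL n. EX q:?Q. ?E n q"
hence "ALL n. EX q. q \<in> ?Q & ?E n q" by blast
from choice[OF this] obtain q where q: "!!n. q n \<in> ?Q" "!!n. ?E n (q n)" by blast
have "q n \<in> {0..s}" for n using q(1)[of n] s by auto
hence qs: "ALL n. q n \<in> {0..s}" by blast
from seq_compactE[OF compact_imp_seq_compact[OF compact_Icc] qs]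
obtain r \<phi> where r: "r \<in> {0..s}" "strict_mono \<phi>" "(q \<circ> \<phi>) ----> r" by blast
have e: "(%n. inverse (real (Suc (\<phi> n)))) ----> 0"
 using LIMSEQ_subseq_LIMSEQ[OF LIMSEQ_inverse_real_of_nat r(2)] by (simp add: o_def)
have "(%n. ennreal (q (\<phi> n) + inverse (real (Suc (\<phi> n))))) ----> ennreal (r + 0)"
 using r(3) e by (intro tendsto_ennrealI tendsto_add) (auto simp: o_def)
moreover have "h <= ennreal (q (\<phi> n) + inverse (real (Suc (\<phi> n))))" for n
 by (rule order_trans[OF conjunct1[OF q(2)[of "\<phi> n"]] ennreal_leI]) simp
ultimately have h: "h <= ennreal r" by (intro LIMSEQ_le_const[of _ "ennreal r"]) auto
have "(%n. ?D (q (\<phi> n)) - inverse (real (Suc (\<phi> n)))) ----> ?D r - 0"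
 using r(1,3) q(1) qs by (intro tendsto_diff e continuous_on_tendsto_compose[OF D]) (auto simp: o_def)
hence "?D r <= 0" using q(2) by (intro LIMSEQ_le_const2[of _ "?D r"]) (auto intro!: exI[of _ 0] less_imp_le simp: less_diff_eq)
hence "?D r = 0" using obstacle[OF sol, of r b a] r(1) by auto
thus ?L using h r(1) by (auto simp: hits_def)
qed

lemma hits_measurable:
assumes th: "stopping_time F th" and ze: "ze \<in> pre_sigma th \<rightarrow>\<^sub>M count_space UNIV" and s: "0 <= s"
shows "Measurable.pred (F (ennreal s)) (%w. EX r:hits (ze w) b w (th w). r <= s)"
proof (rule pred_F_AE)
let ?Q = "insert s ({0..s} \<inter> \<rat>)"
have Q: "countable ?Q" by (intro countable_insert countable_Int2 countable_rat)
have [measurable]: "Measurable.pred (F (ennreal s)) (%w. ze w = a & th w <= ennreal s)" for a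
proof -
 have "{w \<in> space P. ze w = a} \<in> sets (pre_sigma th)"
  using measurable_sets[OF ze, of "{a}"] by (simp add: space_pre_sigma vimage_def Int_def conj_commute)
 from sets_pre_sigmaD[OF th this, of "ennreal s"] show ?thesis by (simp add: pred_def conj_ac)
qed
have [measurable]: "Measurable.pred (F (ennreal s)) (%w. th w <= ennreal (min s c))" for c
 by (rule stopping_time_le_const[OF th]) (simp add: ennreal_leI)
have Ym: "(%w. Y q w $ a) \<in> Fmeas s" if "q \<in> ?Q" for q a
proof -
 have "0 <= q" "q <= s" using that s by auto
 hence "Y q \<in> Fmeas q" "ennreal q <= ennreal s" using YS by (auto simp: S2_def adapted_def intro: ennreal_leI)
 thus ?thesis by (intro borel_measurable_vec_nth) (rule measurable_F_mono)
qed
have "Measurable.pred (F (ennreal s)) (%w. th w <= ennreal (min s (q + inverse (real (Suc n)))) &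
  Y q w $ a - Y q w $ b + C a b < inverse (real (Suc n)))" if "q \<in> ?Q" for q a and n :: nat
 using Ym[OF that, measurable] by measurable
hence [measurable]: "Measurable.pred (F (ennreal s)) (%w. EX q:?Q. th w <= ennreal (min s (q + inverse (real (Suc n)))) &
  Y q w $ a - Y q w $ b + C a b < inverse (real (Suc n)))" for a and n :: nat
 unfolding pred_def by (intro sets.sets_Collect_countable_Ex'[OF _ Q])
show "Measurable.pred (F (ennreal s)) (%w. EX a:UNIV. (ze w = a & th w <= ennreal s) & (ALL n::nat. EX q:?Q.
 th w <= ennreal (min s (q + inverse (real (Suc n)))) & Y q w $ a - Y q w $ b + C a b < inverse (real (Suc n))))"
 by measurable
show "AE w in P. (EX a:UNIV. (ze w = a & th w <= ennreal s) & (ALL n::nat. EX q:?Q.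
  th w <= ennreal (min s (q + inverse (real (Suc n)))) & Y q w $ a - Y q w $ b + C a b < inverse (real (Suc n)))) =
 (EX r:hits (ze w) b w (th w). r <= s)"
 using sol
proof eventually_elim
 case (elim w)
 have "th w <= ennreal s" if "r \<in> hits (ze w) b w (th w)" "r <= s" for r
  using that by (auto simp: hits_def intro: order_trans ennreal_leI)
 thus ?case unfolding hits_event[OF elim s, symmetric] by blast
qed
qed

definition next_time :: "('w => ennreal) => ('w => 'd) => 'w => ennreal" where
"next_time th ze w = min (INF s\<in>{s. 0 <= s & th w <= ennreal s &
  ereal (Y s w $ ze w) = barrier C (ze w) (Y s w)}. ennreal s) (\<tau> w)"

lemma next_time_solves:
assumes "solves Y Z K J w"
shows "{s. 0 <= s & th w <= ennreal s & ereal (Y s w $ ze w) = barrier C (ze w) (Y s w)} =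
  {s. 0 <= s & th w <= ennreal s & meets (ze w) (Y s w)}" (is ?Q1)
 "next_time th ze w = min (INF s\<in>(\<Union>b\<in>- {ze w}. hits (ze w) b w (th w)). ennreal s) (\<tau> w)" (is ?Q2)
 "closed (\<Union>b\<in>- {ze w}. hits (ze w) b w (th w))" (is ?Q3) "(\<Union>b\<in>- {ze w}. hits (ze w) b w (th w)) \<subseteq> {0..}" (is ?Q4)
proof -
show 1: ?Q1
 using barrier_iff[OF obstacle[OF assms]] by auto
show ?Q2
 unfolding next_time_def 1 meets_hits ..
show ?Q3 by (intro closed_UN ballI hits_closed[OF assms]) auto
show ?Q4 by (auto simp: hits_def)
qed

lemma next_time_stopping:
assumes th: "stopping_time F th" and ze: "ze \<in> pre_sigma th \<rightarrow>\<^sub>M count_space UNIV"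
 and T: "!!w. w \<in> space P ==> T w = next_time th ze w"
shows "stopping_time F T"
proof
fix s :: ennreal
show "Measurable.pred (F s) (%w. T w <= s)"
proof (cases s)
 case (real c)
 have [measurable]: "Measurable.pred (F (ennreal c)) (%w. EX r:hits (ze w) b w (th w). r <= c)" for b
  using hits_measurable[OF th ze] real by blast
 have [measurable]: "Measurable.pred (F (ennreal c)) (%w. \<tau> w <= ennreal c)" by (rule stopping_timeD[OF \<tau>])
 have [measurable]: "Measurable.pred (F (ennreal c)) (%w. ze w = b & th w <= ennreal c)" for b
 proof -
  have "{w \<in> space P. ze w = b} \<in> sets (pre_sigma th)"
   using measurable_sets[OF ze, of "{b}"] by (simp add: space_pre_sigma vimage_def Int_def conj_commute)
  from sets_pre_sigmaD[OF th this, of "ennreal c"] show ?thesis by (simp add: pred_def conj_ac)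
 qed
 \<comment> \<open>The condition that \<open>b\<close> differs from the current mode is not decided
   at time \<open>c\<close> in general. Conjoined with \<open>th w <= ennreal c\<close> it is, and a
   contact before \<open>c\<close> implies this inequality.\<close>
 have "Measurable.pred (F (ennreal c)) (%w. \<tau> w <= ennreal c |
   (EX b:UNIV. ~ (ze w = b & th w <= ennreal c) & (EX r:hits (ze w) b w (th w). r <= c)))"
  by measurable
 hence "Measurable.pred (F (ennreal c)) (%w. T w <= ennreal c)"
 proof (rule pred_F_AE, use sol AE_space in eventually_elim)
  case (elim w)
  have A: "th w <= ennreal c" if r: "r \<in> hits (ze w) b w (th w)" "r <= c" for r b
  proof (rule order_trans)
   show "th w <= ennreal r" using r(1) by (simp add: hits_def)
  qed (rule ennreal_leI[OF r(2)])
  have "(EX b:UNIV. ~ (ze w = b & th w <= ennreal c) & (EX r:hits (ze w) b w (th w). r <= c)) \<longleftrightarrow>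
   (EX r:(\<Union>b\<in>- {ze w}. hits (ze w) b w (th w)). r <= c)" (is "?L \<longleftrightarrow> ?R")
  proof
   assume ?L
   then obtain b r where b: "~ (ze w = b & th w <= ennreal c)" "r \<in> hits (ze w) b w (th w)" "r <= c" by blast
   hence "b \<in> - {ze w}" using A[OF b(2,3)] by simp
   thus ?R using b(2,3) by blast
  next
   assume ?R
   then obtain b r where b: "b \<in> - {ze w}" "r \<in> hits (ze w) b w (th w)" "r <= c" by blast
   hence "~ (ze w = b & th w <= ennreal c)" by simp
   thus ?L using b(2,3) by (intro bexI conjI) auto
  qed
  also have "... \<longleftrightarrow> (INF s\<in>(\<Union>b\<in>- {ze w}. hits (ze w) b w (th w)). ennreal s) <= ennreal c"
   by (rule closed_hit(2)[OF next_time_solves(3,4)[OF elim(1)] real(1), symmetric])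
  finally show ?case unfolding T[OF elim(2)] next_time_solves(2)[OF elim(1)] min_le_iff_disj by argo
 qed
 thus ?thesis by (simp add: real)
qed simp
qed

lemma candidateD:
assumes c: "candidate_strategy P F \<tau> C Y t i th ze"
shows "stopping_time F (th k)" "ze k \<in> pre_sigma (th k) \<rightarrow>\<^sub>M count_space UNIV"
 "AE w in P. candidate_path th ze t i w" (is ?Q1)
proof -
have c0: "!!w. w \<in> space P ==> th 0 w = min (ennreal t) (\<tau> w) & ze 0 w = i"
 and c1: "!!j w. w \<in> space P ==> th (Suc j) w = next_time (th j) (ze j) w"
 and c2: "!!j. ze (Suc j) \<in> pre_sigma (th (Suc j)) \<rightarrow>\<^sub>M count_space UNIV"
 and c3: "AE w in P. ALL j. th (Suc j) w < \<tau> w --> ze (Suc j) w ~= ze j w & (let y = Y (enn2real (th (Suc j) w)) w in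
       y $ ze j w = y $ ze (Suc j) w - C (ze j w) (ze (Suc j) w))"
 using c unfolding candidate_strategy_def next_time_def AE_all_countable by blast+
show m: "ze k \<in> pre_sigma (th k) \<rightarrow>\<^sub>M count_space UNIV" for k
proof (cases k)
 case 0
 thus ?thesis using c0 by (subst measurable_cong[where g="%_. i"]) (auto simp: space_pre_sigma)
qed (use c2 in simp)
show "stopping_time F (th k)"
proof (induction k)
 case 0
 have "stopping_time F (%w. min (ennreal t) (\<tau> w))" by (intro stopping_time_min stopping_time_const \<tau>)
 thus ?case using c0 by (subst stopping_time_cong) auto
qed (rule next_time_stopping[OF _ m c1])
show ?Q1
 using c3 sol AE_space
proof eventually_elim
 case (elim w)
 thus ?case using c0[OF elim(3)] c1[OF elim(3)] next_time_solves(1)[OF elim(2)]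
  by (simp add: candidate_path_def next_time_def)
qed
qed

lemma strategy_solutionI:
assumes "0 <= t" "!!k. stopping_time F (th k)" "!!k. ze k \<in> pre_sigma (th k) \<rightarrow>\<^sub>M count_space UNIV"
 "!!w. w \<in> space P ==> ze 0 w = i" "AE w in P. strategy_path th ze t i w"
 "AE w in P. EX m. sld th ze w m"
shows "strategy_solution P W F \<tau> X XT g f C u th ze t i Y Z K J"
by unfold_locales (use assms YS ZM J sol in auto)

theorem candidate_optimal:
assumes c: "candidate_strategy P F \<tau> C Y t i th ze" and t: "0 <= t"
shows "admissible P F \<tau> t i th ze" (is ?Q1) "EX U V. switching_bsde_solution P F W \<tau> X XT g f C t th ze U V" (is ?Q2)
 "switching_bsde_solution P F W \<tau> X XT g f C t th ze U V ==>
  AE w in P. Y t w $ i = U t w - cost C \<tau> th ze (ennreal t) w"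
proof -
have path: "AE w in P. strategy_path th ze t i w"
 using candidateD(3)[OF c] sol by eventually_elim (rule candidate_strategy_path[OF _ _ t])
have st: "AE w in P. EX m. sld th ze w m"
 using candidateD(3)[OF c] sol by eventually_elim (rule candidate_settled[OF _ _ t])
show ?Q1 unfolding admissible_def using candidateD[OF c] path by (auto simp: strategy_path_def)
interpret strategy_solution P W F \<tau> X XT g f C u th ze t i Y Z K J
 by (rule strategy_solutionI) (use t candidateD[OF c] path st c in \<open>auto simp: candidate_strategy_def\<close>)
have ineq: "AE w in P. path_ineq (- 1) w & jumps (- 1) w"
 using candidateD(3)[OF c] sol path
proof eventually_elim
 case (elim w)
 have "jumps (- 1) w"
  unfolding jumps_def
 proof (intro allI impI)
  fix k s assume s: "t <= s" "rho th w (Suc k) = ennreal s"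
  hence "th (Suc k) w = ennreal s" "ennreal s < \<tau> w" by (auto simp: rho_def split: if_splits)
  from candidate_jump(1)[OF elim(1,2) t this(1) _ this(2)] s t
  show "- 1 * (Y s w $ ze (Suc k) w - Y s w $ ze k w - C (ze k w) (ze (Suc k) w)) <= 0" by simp
 qed
 moreover from this have "path_ineq (- 1) w"
  by (rule path_ineqI[OF elim(3,2)]) (simp add: candidate_stay[OF elim(1,2) t])
 ultimately show ?case by simp
qed
hence "AE w in P. path_ineq (- 1) w" by (rule eventually_mono) simp
from Uval_solution[OF this] show ?Q2 by blast
show "AE w in P. Y t w $ i = U t w - cost C \<tau> th ze (ennreal t) w"
 if "switching_bsde_solution P F W \<tau> X XT g f C t th ze U V" using value_eq[OF ineq that] .
qed

text \<open>Finite cost makes the strategy settled, so the comparison applies to it.\<close>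

theorem admissible_value_le:
assumes a: "admissible P F \<tau> t i th ze" and U: "switching_bsde_solution P F W \<tau> X XT g f C t th ze U V" and t: "0 <= t"
shows "AE w in P. U t w - cost C \<tau> th ze (ennreal t) w <= Y t w $ i"
proof -
\<comment> \<open>Admissibility fixes the initial mode almost surely, while the locale wants it at
  every point; redefining it on a null set changes no cost and no mode on the others.\<close>
define eta where "eta = ze(0 := %_. i)"
have ae: "AE w in P. th 0 w = min (ennreal t) (\<tau> w) & ze 0 w = i &
   (ALL k. th k w <= th (Suc k) w & th k w <= \<tau> w) & (%k. th k w) ----> \<tau> w" using a by (simp add: admissible_def)
hence path: "AE w in P. strategy_path th eta t i w" by (rule eventually_mono) (simp add: strategy_path_def eta_def)
have eqs: "switch_cost C \<tau> th ze s w = switch_cost C \<tau> th eta s w" "cost C \<tau> th ze s w = cost C \<tau> th eta s w"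
 "mode_at th ze s w = mode_at th eta s w" if "ze 0 w = i" for s w
proof -
 have k: "ze k w = eta k w" for k using that by (simp add: eta_def)
 show 1: "switch_cost C \<tau> th ze s w = switch_cost C \<tau> th eta s w" by (simp add: switch_cost_def k fun_eq_iff)
 show "cost C \<tau> th ze s w = cost C \<tau> th eta s w" unfolding cost_def 1 ..
 show "mode_at th ze s w = mode_at th eta s w" unfolding mode_at_def k ..
qed
have U': "switching_bsde_solution P F W \<tau> X XT g f C t th eta U V"
proof -
 obtain R where R: "ito_remainder P F W \<tau> V R" and e: "AE w in P. let \<alpha> = (%s. mode_at th ze s w); A = (%s. cost C \<tau> th ze s w);
      F\<^sub>\<alpha> = (%r. f r w (X (\<alpha> (ennreal r)) r w) (U r w) (V r w) (\<alpha> (ennreal r))) in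
     summable (switch_cost C \<tau> th ze (\<tau> w) w) & set_integrable lborel ({t..} \<inter> hor w) F\<^sub>\<alpha> &
     (ALL s>=t. U s w = g (XT (\<alpha> (\<tau> w)) w) - (A (\<tau> w) - A (ennreal s))
      + (LINT r:({s..} \<inter> hor w)|lborel. F\<^sub>\<alpha> r) - R s w)"
  using U unfolding switching_bsde_solution_def by blast
 have "AE w in P. let \<alpha> = (%s. mode_at th eta s w); A = (%s. cost C \<tau> th eta s w);
      F\<^sub>\<alpha> = (%r. f r w (X (\<alpha> (ennreal r)) r w) (U r w) (V r w) (\<alpha> (ennreal r))) in
     summable (switch_cost C \<tau> th eta (\<tau> w) w) & set_integrable lborel ({t..} \<inter> hor w) F\<^sub>\<alpha> &
     (ALL s>=t. U s w = g (XT (\<alpha> (\<tau> w)) w) - (A (\<tau> w) - A (ennreal s))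
      + (LINT r:({s..} \<inter> hor w)|lborel. F\<^sub>\<alpha> r) - R s w)"
  using e ae
 proof eventually_elim
  case (elim w)
  hence z: "ze 0 w = i" by simp
  show ?case using elim(1) unfolding eqs[OF z] .
 qed
 thus ?thesis using U R unfolding switching_bsde_solution_def by blast
qed
have st: "AE w in P. EX m. settled C (rho th w) (%k. eta k w) m"
proof -
 have "AE w in P. summable (switch_cost C \<tau> th eta (\<tau> w) w)"
  using U' unfolding switching_bsde_solution_def Let_def by (auto elim: eventually_mono)
 with path show ?thesis by eventually_elim (rule settled_of_summable, auto)
qed
interpret strategy_solution P W F \<tau> X XT g f C u th eta t i Y Z K J
proof (rule strategy_solutionI[OF t _ _ _ path st])
 show "stopping_time F (th k)" for k using a by (simp add: admissible_def)
 show "eta k \<in> pre_sigma (th k) \<rightarrow>\<^sub>M count_space UNIV" for k using a by (cases k) (auto simp: admissible_def eta_def)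
qed (simp add: eta_def)
from value_le[OF U'] ae show ?thesis by eventually_elim (simp add: eqs)
qed

text \<open>A mode may be chosen if its own contact time \<open>h b\<close> is no later than
  \<open>T\<close>. Both are stopping times, so the set of eligible modes is known at
  \<open>T\<close>, and choosing from it is a function on finitely many sets.\<close>

lemma next_mode:
assumes th: "stopping_time F th" and ze: "ze \<in> pre_sigma th \<rightarrow>\<^sub>M count_space UNIV"
 and le: "!!w. w \<in> space P ==> th w <= \<tau> w"
defines "T \<equiv> next_time th ze"
obtains xi where "xi \<in> pre_sigma T \<rightarrow>\<^sub>M count_space UNIV"
 "AE w in P. T w < \<tau> w --> xi w ~= ze w & (let y = Y (enn2real (T w)) w in y $ ze w = y $ xi w - C (ze w) (xi w))"
proof -
have T: "stopping_time F T" unfolding T_def by (rule next_time_stopping[OF th ze]) simp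
define h where "h b w = (INF r\<in>hits (ze w) b w (th w). ennreal r)" for b w
define xi where "xi w = (SOME b. b \<in> {b. b ~= ze w & ~ T w < h b w})" for w
have h: "stopping_time F (h b)" for b
proof
 fix s :: ennreal
 show "Measurable.pred (F s) (%w. h b w <= s)"
 proof (cases s)
  case (real c)
  have "Measurable.pred (F (ennreal c)) (%w. h b w <= ennreal c)"
  proof (rule pred_F_AE[OF hits_measurable[OF th ze real(1)]])
   show "AE w in P. (EX r:hits (ze w) b w (th w). r <= c) = (h b w <= ennreal c)"
    using sol
   proof eventually_elim
    case (elim w)
    have "hits (ze w) b w (th w) \<subseteq> {0..}" by (auto simp: hits_def)
    from closed_hit(2)[OF hits_closed[OF elim] this real(1)] show ?case unfolding h_def by simp
   qed
  qed
  thus ?thesis by (simp add: real)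
 qed simp
qed
have lt [measurable]: "Measurable.pred (pre_sigma T) (%w. T w < h b w)" for b by (rule stopping_time_less[OF T h])
have thT: "th w <= T w" if "w \<in> space P" for w
 using le[OF that] by (auto simp: T_def next_time_def intro!: INF_greatest)
have "sets (pre_sigma th) \<subseteq> sets (pre_sigma T)" by (rule mono_pre_sigma[OF th T thT])
hence [measurable]: "ze \<in> pre_sigma T \<rightarrow>\<^sub>M count_space UNIV"
 using ze by (auto simp: measurable_def space_pre_sigma)
have "xi -` {c} \<inter> space (pre_sigma T) \<in> sets (pre_sigma T)" for c
proof -
 \<comment> \<open>The preimage is split according to the finitely many possible sets
   \<open>S\<close> of eligible modes, on each of which the choice is constant.\<close>
 have "xi -` {c} \<inter> space (pre_sigma T) = {w \<in> space (pre_sigma T). EX S:UNIV. (ALL b:UNIV. b \<in> S \<longleftrightarrow> b ~= ze w & ~ T w < h b w) & (SOME b. b \<in> S) = c}"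
  (is "_ = ?R")
 proof (intro equalityI subsetI)
  fix w assume "w \<in> ?R"
  then obtain S where S: "w \<in> space (pre_sigma T)" "ALL b. b \<in> S \<longleftrightarrow> b ~= ze w & ~ T w < h b w" "(SOME b. b \<in> S) = c" by blast
  hence "S = {b. b ~= ze w & ~ T w < h b w}" by blast
  thus "w \<in> xi -` {c} \<inter> space (pre_sigma T)" using S by (simp add: xi_def)
 next
  fix w assume "w \<in> xi -` {c} \<inter> space (pre_sigma T)"
  hence "w \<in> space (pre_sigma T)" "(SOME b. b \<in> {b. b ~= ze w & ~ T w < h b w}) = c" by (simp_all add: xi_def)
  thus "w \<in> ?R" by (intro CollectI conjI bexI[of _ "{b. b ~= ze w & ~ T w < h b w}"] ballI) simp_all
 qed
 also have "... \<in> sets (pre_sigma T)" by measurable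
 finally show ?thesis .
qed
hence xi: "xi \<in> pre_sigma T \<rightarrow>\<^sub>M count_space UNIV" by (simp add: measurable_count_space_eq2)
have "AE w in P. T w < \<tau> w --> xi w ~= ze w & (let y = Y (enn2real (T w)) w in y $ ze w = y $ xi w - C (ze w) (xi w))"
 using sol
proof (eventually_elim, intro impI)
 fix w assume s: "solves Y Z K J w" and lt: "T w < \<tau> w"
 let ?H = "\<Union>b\<in>- {ze w}. hits (ze w) b w (th w)"
 have T_eq: "T w = (INF r\<in>?H. ennreal r)" using lt by (auto simp: T_def next_time_solves(2)[OF s] min_def split: if_splits)
 hence "(INF r\<in>?H. ennreal r) < top" using lt less_le_trans[OF lt top_greatest] by simp
 from closed_hit(1)[OF next_time_solves(3)[of w ze th, OF s] next_time_solves(4)[of w ze th, OF s] this] obtain r where r: "r \<in> ?H" "T w = ennreal r" using T_eq by auto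
 then obtain b where b: "b ~= ze w" "r \<in> hits (ze w) b w (th w)" by blast
 have "h b w <= T w" unfolding h_def r(2) using b(2) by (rule INF_lower)
 hence "b \<in> {b. b ~= ze w & ~ T w < h b w}" using b(1) by (simp add: not_less)
 hence x: "xi w \<in> {b. b ~= ze w & ~ T w < h b w}" unfolding xi_def by (rule someI)
 hence hx: "h (xi w) w <= T w" by (simp add: not_less)
 have "h (xi w) w < top" using hx r(2) by (auto intro: le_less_trans)
 then obtain q where q: "q \<in> hits (ze w) (xi w) w (th w)" "h (xi w) w = ennreal q"
  unfolding h_def using closed_hit(1)[OF hits_closed[OF s, of "ze w" "xi w" "th w"]] by (auto simp: hits_def)
 have "T w <= ennreal q" unfolding T_eq using q(1) x by (intro INF_lower) auto
 hence "T w = ennreal q" using hx q(2) by (intro antisym) auto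
 hence "enn2real (T w) = q" using q(1) by (simp add: hits_def)
 thus "xi w ~= ze w & (let y = Y (enn2real (T w)) w in y $ ze w = y $ xi w - C (ze w) (xi w))"
  using q(1) x by (simp add: hits_def Let_def)
qed
with xi show thesis by (rule that)
qed

lemma candidate_exists:
assumes t: "0 <= t"
obtains th ze where "candidate_strategy P F \<tau> C Y t i th ze"
proof -
let ?init = "(%w. min (ennreal t) (\<tau> w), %_. i) :: ('w => ennreal) \<times> ('w => 'd)"
let ?P = "%n x. (n = (0::nat) --> x = ?init) & stopping_time F (fst x) &
 snd x \<in> pre_sigma (fst x) \<rightarrow>\<^sub>M count_space UNIV & (ALL w:space P. fst x w <= \<tau> w)"
let ?Q = "%n x x'. fst x' = next_time (fst x) (snd x) & (AE w in P. fst x' w < \<tau> w -->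
 snd x' w ~= snd x w & (let y = Y (enn2real (fst x' w)) w in y $ snd x w = y $ snd x' w - C (snd x w) (snd x' w)))"
have "EX s. ALL n. ?P n (s n) & ?Q n (s n) (s (Suc n))"
proof (rule dependent_nat_choice)
 show "EX x. ?P 0 x" by (rule exI[of _ ?init]) (auto intro!: stopping_time_min stopping_time_const \<tau>)
 fix x n assume x: "?P n x"
 obtain xi where xi: "xi \<in> pre_sigma (next_time (fst x) (snd x)) \<rightarrow>\<^sub>M count_space UNIV"
  "AE w in P. next_time (fst x) (snd x) w < \<tau> w --> xi w ~= snd x w &
   (let y = Y (enn2real (next_time (fst x) (snd x) w)) w in y $ snd x w = y $ xi w - C (snd x w) (xi w))"
  by (rule next_mode[of "fst x" "snd x"]) (use x in auto)
 have "stopping_time F (next_time (fst x) (snd x))" by (rule next_time_stopping[of "fst x" "snd x"]) (use x in auto)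
 thus "EX x'. ?P (Suc n) x' & ?Q n x x'"
  using xi by (intro exI[of _ "(next_time (fst x) (snd x), xi)"]) (auto simp: next_time_def)
qed
then obtain s where s: "!!n. ?P n (s n)" "!!n. ?Q n (s n) (s (Suc n))" by blast
have "candidate_strategy P F \<tau> C Y t i (%n. fst (s n)) (%n. snd (s n))"
 unfolding candidate_strategy_def
proof (intro conjI ballI allI)
 show "fst (s (Suc j)) w = min (INF r\<in>{r. 0 <= r & fst (s j) w <= ennreal r &
   ereal (Y r w $ snd (s j) w) = barrier C (snd (s j) w) (Y r w)}. ennreal r) (\<tau> w)" for j w
  using s(2)[of j] by (simp add: next_time_def)
 show "snd (s (Suc j)) \<in> pre_sigma (fst (s (Suc j))) \<rightarrow>\<^sub>M count_space UNIV" for j using s(1) by blast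
 show "AE w in P. fst (s (Suc j)) w < \<tau> w --> snd (s (Suc j)) w ~= snd (s j) w &
  (let y = Y (enn2real (fst (s (Suc j)) w)) w in
    y $ snd (s j) w = y $ snd (s (Suc j)) w - C (snd (s j) w) (snd (s (Suc j)) w))" for j using s(2) by blast
qed (use s(1)[of 0] in auto)
thus thesis by (rule that)
qed

text \<open>The bound is attained by a candidate strategy, so every other upper bound of the family
  lies above \<open>Y t i\<close>.\<close>

theorem value_ess_sup:
assumes t: "0 <= t"
shows "is_ess_sup P {(%w. U t w - cost C \<tau> th ze (ennreal t) w) | th ze U V.
  admissible P F \<tau> t i th ze & switching_bsde_solution P F W \<tau> X XT g f C t th ze U V} (%w. Y t w $ i)"
unfolding is_ess_sup_def
proof (intro conjI ballI impI)
have "Y t \<in> Fmeas t" using YS t by (simp add: S2_def adapted_def)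
thus "(%w. Y t w $ i) \<in> borel_measurable P" by (intro borel_measurable_vec_nth measurable_F_P)
show "AE w in P. v w <= Y t w $ i" if "v \<in> {(%w. U t w - cost C \<tau> th ze (ennreal t) w) | th ze U V.
  admissible P F \<tau> t i th ze & switching_bsde_solution P F W \<tau> X XT g f C t th ze U V}" for v
 using that admissible_value_le[OF _ _ t] by blast
fix y' assume y': "ALL v:{(%w. U t w - cost C \<tau> th ze (ennreal t) w) | th ze U V.
  admissible P F \<tau> t i th ze & switching_bsde_solution P F W \<tau> X XT g f C t th ze U V}. AE w in P. v w <= y' w"
obtain th ze where c: "candidate_strategy P F \<tau> C Y t i th ze" by (rule candidate_exists[OF t])
obtain U V where U: "switching_bsde_solution P F W \<tau> X XT g f C t th ze U V" using candidate_optimal(2)[OF c t] by blast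
have "(%w. U t w - cost C \<tau> th ze (ennreal t) w) \<in> {(%w. U t w - cost C \<tau> th ze (ennreal t) w) | th ze U V.
  admissible P F \<tau> t i th ze & switching_bsde_solution P F W \<tau> X XT g f C t th ze U V}"
 using candidate_optimal(1)[OF c t] U by blast
from bspec[OF y' this] have "AE w in P. U t w - cost C \<tau> th ze (ennreal t) w <= y' w" .
with candidate_optimal(3)[OF c t U] show "AE w in P. Y t w $ i <= y' w" by eventually_elim simp
qed

end

section \<open>Uniqueness\<close>

text \<open>A sum of squared increments is at most the largest increment times the variation, and
  the largest increment tends to 0 by uniform continuity.\<close>

lemma quadratic_variation_zero:
fixes N v :: "real => real"
assumes N: "continuous_on {0..T} N" and v: "!!s s'. 0 <= s ==> s <= s' ==> s' <= T ==> abs (N s' - N s) <= v s' - v s"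
 and T: "0 <= T"
defines "Q \<equiv> %n. \<Sum>k<Suc n. (N (T * real (Suc k) / real (Suc n)) - N (T * real k / real (Suc n)))^2"
shows "Q n <= (v T - v 0)^2" "Q ----> 0"
proof -
let ?p = "%n k. T * real k / real (Suc n)"
have p: "0 <= ?p n k" "?p n k <= ?p n (Suc k)" "?p n (Suc k) <= T" if "k < Suc n" for n k
proof -
 have "T * real (Suc k) <= T * real (Suc n)" using that T by (intro mult_left_mono) auto
 thus "0 <= ?p n k" "?p n k <= ?p n (Suc k)" "?p n (Suc k) <= T"
  using T by (auto simp: field_simps simp del: of_nat_Suc intro!: mult_left_mono)
qed
have bound: "Q n <= c * (v T - v 0)" if c: "!!k. k < Suc n ==> abs (N (?p n (Suc k)) - N (?p n k)) <= c" for n c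
proof -
 have c0: "0 <= c" using c[of 0] by linarith
 have "Q n <= (\<Sum>k<Suc n. c * (v (?p n (Suc k)) - v (?p n k)))"
  unfolding Q_def
 proof (rule sum_mono)
  fix k assume "k \<in> {..<Suc n}"
  hence k: "k < Suc n" by simp
  have "abs (N (?p n (Suc k)) - N (?p n k)) * abs (N (?p n (Suc k)) - N (?p n k)) <= c * (v (?p n (Suc k)) - v (?p n k))"
   using c[OF k] v[OF p[OF k]] c0 by (intro mult_mono) auto
  thus "(N (?p n (Suc k)) - N (?p n k))^2 <= c * (v (?p n (Suc k)) - v (?p n k))"
   by (simp only: power2_eq_square abs_mult_self_eq)
 qed
 also have "... = c * (\<Sum>k<Suc n. v (?p n (Suc k)) - v (?p n k))" by (simp only: sum_distrib_left)
 also have "(\<Sum>k<Suc n. v (?p n (Suc k)) - v (?p n k)) = v (?p n (Suc n)) - v (?p n 0)"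
  by (rule sum_lessThan_telescope)
 also have "?p n (Suc n) = T" by (simp del: of_nat_Suc)
 finally show ?thesis by simp
qed
have vm: "v s <= v s'" if "0 <= s" "s <= s'" "s' <= T" for s s' using v[OF that] by linarith
show "Q n <= (v T - v 0)^2"
 unfolding power2_eq_square
proof (rule bound)
 fix k assume k: "k < Suc n"
 show "abs (N (?p n (Suc k)) - N (?p n k)) <= v T - v 0"
  using v[OF p[OF k]] vm[of 0 "?p n k"] vm[of "?p n (Suc k)" T] p[OF k] by linarith
qed
show "Q ----> 0"
proof (rule LIMSEQ_I)
 fix e :: real assume e: "0 < e"
 \<comment> \<open>The added 1 keeps the denominator positive for a path without variation.\<close>
 have V: "0 < v T - v 0 + 1" using vm[of 0 T] T by simp
 have "uniformly_continuous_on {0..T} N" using N by (rule compact_uniformly_continuous) simp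
 then obtain d where d: "0 < d" "!!x y. x \<in> {0..T} ==> y \<in> {0..T} ==> dist y x < d ==> dist (N y) (N x) < e / (v T - v 0 + 1)"
  unfolding uniformly_continuous_on_def using e V by (metis divide_pos_pos)
 have "(%n. T * inverse (real (Suc n))) ----> T * 0" by (intro tendsto_intros LIMSEQ_inverse_real_of_nat)
 hence "eventually (%n. T * inverse (real (Suc n)) < d) sequentially" using d(1) by (intro order_tendstoD(2)) auto
 then obtain n0 where n0: "!!n. n0 <= n ==> T * inverse (real (Suc n)) < d" unfolding eventually_sequentially by blast
 have "norm (Q n - 0) < e" if "n0 <= n" for n
 proof -
  have "Q n <= e / (v T - v 0 + 1) * (v T - v 0)"
  proof (rule bound)
   fix k assume k: "k < Suc n"
   have "?p n (Suc k) - ?p n k = T * inverse (real (Suc n))" by (simp add: divide_inverse algebra_simps)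
   hence "dist (?p n (Suc k)) (?p n k) < d" using n0[OF that] p[OF k] by (simp add: dist_real_def)
   hence "dist (N (?p n (Suc k))) (N (?p n k)) < e / (v T - v 0 + 1)" using p[OF k] by (intro d(2)) auto
   thus "abs (N (?p n (Suc k)) - N (?p n k)) <= e / (v T - v 0 + 1)" by (simp only: dist_real_def less_imp_le)
  qed
  also have "... < e" using e V by (simp add: field_simps)
  finally show ?thesis unfolding Q_def by (simp add: sum_nonneg del: sum.lessThan_Suc of_nat_Suc)
 qed
 thus "EX n0. ALL n>=n0. norm (Q n - 0) < e" by blast
qed
qed

text \<open>A continuous square integrable martingale of bounded variation vanishes: its second
  moment equals the expected sum of squared increments on every grid. No measurability of
  \<open>v\<close> is assumed, so a measurable bound \<open>V\<close> on its total serves as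
  majorant.\<close>

lemma (in brownian_basis) ito_L2_finite_variation:
assumes I: "ito_L2 P F W H N" and T: "0 <= T"
 and v: "AE w in P. ALL s s'. 0 <= s --> s <= s' --> s' <= T --> abs (N s' w - N s w) <= v s' w - v s w"
 and V: "V \<in> borel_measurable P" "integrable P (%w. (V w)^2)" "AE w in P. v T w - v 0 w <= V w"
shows "time_L2 P T H = 0" "AE w in P. N T w = 0"
proof -
let ?p = "%n k. T * real k / real (Suc n)"
let ?D = "%n k w. N (?p n (Suc k)) w - N (?p n k) w"
have p: "0 <= ?p n k" "?p n k <= ?p n (Suc k)" for n k
 using T by (auto simp: divide_right_mono mult_left_mono simp del: of_nat_Suc)
note [measurable] = ito_L2_measurable_P[OF I p(1)] ito_L2_measurable_P[OF I T]
have Ds: "integrable P (%w. (?D n k w)^2)" for n k by (rule ito_L2_increment_square(1)[OF I p])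
have Ns: "integrable P (%w. (N r w)^2)" if "0 <= r" for r by (rule ito_L2_square_integrable(1)[OF I that])
have sum: "expectation (%w. (N (?p n k) w)^2) = (\<Sum>j<k. expectation (%w. (?D n j w)^2))" for n k
proof (induction k)
 case 0
 have "expectation (%w. (N (?p n 0) w)^2) = expectation (%_. 0)"
  using ito_L2_zero_time[OF I] borel_measurable_integrable[OF Ns[of 0]] by (intro Bochner_Integration.integral_cong_AE) auto
 thus ?case by simp
next
 case (Suc k)
 note o = ito_L2_increment_orthogonal[OF I p[of k n] ito_L2_measurable[OF I p(1)[of k n]] Ns[OF p(1)[of k n]]]
 have "expectation (%w. (N (?p n (Suc k)) w)^2) = expectation (%w. (N (?p n k) w)^2 + ((?D n k w)^2 + 2 * (N (?p n k) w * ?D n k w)))"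
  by (intro Bochner_Integration.integral_cong) (auto simp: power2_eq_square algebra_simps)
 also have "... = expectation (%w. (N (?p n k) w)^2) + expectation (%w. (?D n k w)^2)"
  using o Ds[of k n] Ns[OF p(1)[of k n]] by simp
 finally show ?case using Suc by simp
qed
have eq: "expectation (%w. (N T w)^2) = expectation (%w. \<Sum>k<Suc n. (?D n k w)^2)" for n
proof -
 have "?p n (Suc n) = T" by (simp del: of_nat_Suc)
 thus ?thesis using sum[of "Suc n" n] by (simp only: Bochner_Integration.integral_sum[OF Ds])
qed
have "(%n. expectation (%w. \<Sum>k<Suc n. (?D n k w)^2)) ----> expectation (%_. 0)"
proof (rule integral_dominated_convergence[where w="%w. (V w)^2"])
 have cont: "AE w in P. continuous_on {0..} (%s. N s w)" by (rule ito_L2D(3)[OF I])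
 show "AE w in P. (%n. \<Sum>k<Suc n. (?D n k w)^2) ----> 0"
  using cont v
 proof eventually_elim
  case (elim w)
  thus ?case by (intro quadratic_variation_zero(2)[OF _ _ T, where v="%s. v s w"]) (auto intro: continuous_on_subset)
 qed
 show "AE w in P. norm (\<Sum>k<Suc n. (?D n k w)^2) <= (V w)^2" for n
  using cont v V(3)
 proof eventually_elim
  case (elim w)
  have "(\<Sum>k<Suc n. (?D n k w)^2) <= (v T w - v 0 w)^2"
   using elim by (intro quadratic_variation_zero(1)[OF _ _ T, where v="%s. v s w"]) (auto intro: continuous_on_subset)
  also have "... <= (V w)^2"
  proof (rule power_mono[OF elim(3)])
   have "abs (N T w - N 0 w) <= v T w - v 0 w" using elim(2) T by blast
   thus "0 <= v T w - v 0 w" by linarith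
  qed
  finally show ?case by (simp add: sum_nonneg del: sum.lessThan_Suc of_nat_Suc)
 qed
 show "(%w. \<Sum>k<Suc n. (?D n k w)^2) \<in> borel_measurable P" for n
  by (intro borel_measurable_sum borel_measurable_integrable Ds)
qed (use V(2) in auto)
hence "(%n. expectation (%w. (N T w)^2)) ----> 0" unfolding eq[symmetric] by simp
hence 0: "expectation (%w. (N T w)^2) = 0" by (simp add: LIMSEQ_const_iff)
thus "AE w in P. N T w = 0" using integral_nonneg_eq_0_iff_AE[OF Ns[OF T]] by simp
have "(\<integral>\<^sup>+w. ennreal ((N T w)^2) \<partial>P) = 0" using 0 by (simp add: nn_integral_eq_integral[OF Ns[OF T]])
thus "time_L2 P T H = 0" using ito_L2_isometry[OF I T] by simp
qed

lemma is_ess_sup_unique: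
assumes "is_ess_sup P U y" "is_ess_sup P U y'"
shows "AE w in P. y w = y' w"
proof -
have le: "AE w in P. y w <= y' w" if "is_ess_sup P U y" "is_ess_sup P U y'" for y y'
 using that by (simp add: is_ess_sup_def)
from le[OF assms] le[OF assms(2,1)] show ?thesis by eventually_elim simp
qed

lemma continuous_eq_of_rat:
fixes f :: "real => 'b::real_normed_vector"
assumes "continuous_on {0..} f" "continuous_on {0..} h" "!!q. q \<in> {0..} \<inter> \<rat> ==> f q = h q" "0 <= s"
shows "f s = h s"
proof (rule ccontr)
assume "f s ~= h s"
have "continuous_on {s..} (%r. f r - h r)"
 by (rule continuous_on_subset[OF continuous_on_diff[OF assms(1,2)]]) (use assms(4) in auto)
hence "((%r. f r - h r) ---> f s - h s) (at_right s)" by (simp add: continuous_on_def flip: at_within_Ici_at_right)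
hence "eventually (%r. f r - h r ~= 0) (at_right s)" using \<open>f s ~= h s\<close> by (intro tendsto_imp_eventually_ne) auto
then obtain c where c: "s < c" "!!r. s < r ==> r < c ==> f r ~= h r" unfolding eventually_at_right_field by auto
obtain q where "q \<in> \<rat>" "s < q" "q < c" using Rats_dense_in_real[OF c(1)] by blast
thus False using c(2)[of q] assms(3)[of q] assms(4) by auto
qed

section \<open>Identification of the three components\<close>

context switching
begin

lemma solves_increment:
"solves Y Z K J w ==> 0 <= s ==> s <= s' ==> Y s' w $ j - Y s w $ j =
 J j s' w - J j s w - (prim (driver Y Z j w) s' - prim (driver Y Z j w) s) - (stopped K w s' $ j - stopped K w s $ j)"
unfolding solves_def by blast

lemma solvesD:
assumes "solves Y Z K J w"
shows "integrable lborel (driver Y Z j w)" "continuous_on {0..} (%s. J j s w)"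
 "mono_on {0..} (%s. stopped K w s $ j)" "K 0 w = 0"
using assms unfolding solves_def by blast+

lemma stopped_bound:
assumes sol: "solves Y Z K J w" and S: "!!s. 0 <= s ==> ennreal s < \<tau> w ==> norm (K s w) <= S" "0 <= S" and s: "0 <= s"
shows "stopped K w s $ j <= S"
proof -
let ?k = "%s. stopped K w s $ j"
have lt: "?k r <= S" if "0 <= r" "ennreal r < \<tau> w" for r
 using component_le_norm_cart[of "K r w" j] S(1)[OF that] that by (simp add: stopped_horizon less_imp_le)
define c where "c = stop_time \<tau> s w"
have c: "0 <= c" "ennreal c <= \<tau> w" using s by (auto simp: c_def stop_time_nonneg ennreal_stop_time)
hence eq: "?k s = ?k c" using stopped_horizon[of c w K] by (simp add: c_def stopped_def)
show ?thesis
proof (cases "c = 0")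
 case True
 thus ?thesis unfolding eq using sol S(2) by (simp add: solves_def stopped_horizon)
next
 case False
 have "continuous_on {0<..} (stopped K w)" using sol by (auto simp: solves_def intro: continuous_on_subset)
 hence "isCont (stopped K w) c" using False c by (simp add: continuous_on_eq_continuous_at)
 hence lim: "(?k ---> ?k c) (at_left c)" by (intro tendsto_vec_nth) (simp add: isCont_def filterlim_at_split)
 have "eventually (%r. ?k r <= S) (at_left c)"
  unfolding eventually_at_left_field
 proof (intro exI[of _ 0] conjI allI impI)
  fix r :: real assume "0 < r" "r < c"
  thus "?k r <= S" using less_le_trans[OF ennreal_lessI c(2)] by (intro lt) auto
 qed (use False c in simp)
 from tendsto_upperbound[OF lim this] show ?thesis unfolding eq by simp
qed
qed

theorem unique:
assumes s1: "rbsde_solution P F W \<tau> X XT g f C Y Z K" and s2: "rbsde_solution P F W \<tau> X XT g f C Y' Z' K'"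
shows "AE w in P. ALL s>=0. Y' s w = Y s w" (is ?Q1) "AE w in P. AE s in lborel. s \<in> hor w --> Z' s w = Z s w" (is ?Q2)
 "AE w in P. ALL s:hor w. K' s w = K s w" (is ?Q3)
proof -
obtain J where J: "!!i. ito_L2 P F W (stop_integrand \<tau> (%s w. Z s w $ i)) (J i)" and sol: "AE w in P. solves Y Z K J w"
 using rbsde_solves[OF s1] by blast
obtain J' where J': "!!i. ito_L2 P F W (stop_integrand \<tau> (%s w. Z' s w $ i)) (J' i)" and sol': "AE w in P. solves Y' Z' K' J' w"
 using rbsde_solves[OF s2] by blast
have m: "Y \<in> S2 P F \<tau>" "Z \<in> M2 P F \<tau>" "K \<in> S2 P F \<tau>" "Y' \<in> S2 P F \<tau>" "Z' \<in> M2 P F \<tau>" "K' \<in> S2 P F \<tau>"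
 using s1 s2 by (auto simp: rbsde_solution_def A2_def)
interpret A: solution P W F \<tau> X XT g f C u Y Z K J by unfold_locales (use m J sol in auto)
interpret B: solution P W F \<tau> X XT g f C u Y' Z' K' J' by unfold_locales (use m J' sol' in auto)
\<comment> \<open>The family of strategy values does not mention the solution, so both components
  are essential suprema of the same family.\<close>
have "AE w in P. Y' q w $ j = Y q w $ j" if "0 <= q" for q j
 by (rule is_ess_sup_unique[OF B.value_ess_sup[OF that] A.value_ess_sup[OF that]])
hence "AE w in P. ALL j:UNIV. Y' q w $ j = Y q w $ j" if "0 <= q" for q using that by (intro AE_finite_allI) auto
moreover have "countable ({0..} \<inter> \<rat> :: real set)" by (intro countable_Int2 countable_rat)
ultimately have "AE w in P. ALL q:{0..} \<inter> \<rat>. ALL j:UNIV. Y' q w $ j = Y q w $ j" by (simp add: AE_ball_countable)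
with sol sol' show YY: ?Q1
proof (eventually_elim, intro allI impI)
 fix w and s :: real assume w: "solves Y Z K J w" "solves Y' Z' K' J' w" "ALL q:{0..} \<inter> \<rat>. ALL j:UNIV. Y' q w $ j = Y q w $ j" "0 <= s"
 show "Y' s w = Y s w"
  by (rule continuous_eq_of_rat[OF B.solves_cont(1)[OF w(2)] A.solves_cont(1)[OF w(1)] _ w(4)]) (use w(3) in \<open>simp add: vec_eq_iff\<close>)
qed
let ?H = "%j s w. stop_integrand \<tau> (%s w. Z s w $ j) s w - stop_integrand \<tau> (%s w. Z' s w $ j) s w"
let ?N = "%j s w. J j s w - J' j s w"
have I: "ito_L2 P F W (?H j) (?N j)" for j by (rule ito_L2_diff[OF J J'])
obtain S where S: "S \<in> borel_measurable P" "ALL w. 0 <= S w" "integrable P (%w. (S w)^2)"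
 "AE w in P. ALL s. 0 <= s & ennreal s < \<tau> w --> norm (K s w) <= S w" by (rule S2_bound[OF m(3) \<tau>]) (rule that, assumption, blast)
obtain S' where S': "S' \<in> borel_measurable P" "ALL w. 0 <= S' w" "integrable P (%w. (S' w)^2)"
 "AE w in P. ALL s. 0 <= s & ennreal s < \<tau> w --> norm (K' s w) <= S' w" by (rule S2_bound[OF m(6) \<tau>]) (rule that, assumption, blast)
note [measurable] = S(1) S'(1)
define U where "U = (\<integral>r. (ubar r)^2 \<partial>lborel)"
have zero: "time_L2 P T (?H j) = 0 & (AE w in P. ?N j T w = 0)" if T: "0 <= T" for T j
proof -
 let ?h = "%w r. abs (driver Y Z j w r - driver Y' Z' j w r)"
 \<comment> \<open>Once \<open>Y' = Y\<close>, the increments of \<open>?N j\<close> are those of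
   the integrated difference of the drivers plus those of \<open>K\<close> minus those of
   \<open>K'\<close>, whence this bound on the variation.\<close>
 let ?v = "%s w. prim (?h w) s + stopped K w s $ j + stopped K' w s $ j"
 let ?E = "%w. (NN r:{0..T}. nsq (?H j r w))"
 \<comment> \<open>The difference of the drivers is at most \<open>u\<close> times that of the
   integrands; the Cauchy-Schwarz inequality bounds its integral by the root of \<open>U\<close>
   times the energy, which is square integrable.\<close>
 let ?V = "%w. sqrt (U * enn2real (?E w)) + (S w + S' w)"
 have Em [measurable]: "?E \<in> borel_measurable P" by (rule joint_inner_measurable[OF ito_L2_joint[OF I]])
 have Efin: "(EE w. ?E w) < \<infinity>" using ito_L2D(4)[OF I T] by (simp add: time_L2_def)
 have Eae: "AE w in P. ?E w ~= \<infinity>" using Efin by (intro nn_integral_PInf_AE) auto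
 have "(EE w. ennreal (enn2real (?E w))) = (EE w. ?E w)"
  using Eae by (intro nn_integral_cong_AE) (auto simp: less_top)
 hence Ei: "integrable P (%w. enn2real (?E w))" using Efin by (intro integrableI_nonneg) auto
 have U0: "0 <= U" unfolding U_def by (intro Bochner_Integration.integral_nonneg) simp
 have "AE w in P. (ALL s s'. 0 <= s --> s <= s' --> s' <= T --> abs (?N j s' w - ?N j s w) <= ?v s' w - ?v s w) & ?v T w - ?v 0 w <= ?V w"
  using sol sol' YY S(4) S'(4) Eae AE_space
 proof eventually_elim
  case (elim w)
  have di: "integrable lborel (driver Y Z j w)" "integrable lborel (driver Y' Z' j w)" by (rule solvesD(1)[OF elim(1)], rule solvesD(1)[OF elim(2)])
  hence hi: "integrable lborel (?h w)" by simp
  have mono: "stopped K w s $ j <= stopped K w s' $ j" "stopped K' w s $ j <= stopped K' w s' $ j" if "0 <= s" "s <= s'" for s s'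
   using solvesD(3)[OF elim(1), of j] solvesD(3)[OF elim(2), of j] that by (auto simp: mono_on_def)
  have "abs (?N j s' w - ?N j s w) <= ?v s' w - ?v s w" if s: "0 <= s" "s <= s'" for s s'
  proof -
   have "abs ((prim (driver Y Z j w) s' - prim (driver Y Z j w) s) - (prim (driver Y' Z' j w) s' - prim (driver Y' Z' j w) s)) =
     abs (LINT r:{s..s'}|lborel. driver Y Z j w r - driver Y' Z' j w r)"
    unfolding prim_diff[OF di(1) s] prim_diff[OF di(2) s]
    by (subst set_integral_diff) (unfold set_integrable_def, (intro integrable_mult_indicator di, simp)+, simp)
   also have "... <= (LINT r|lborel. norm (indicator {s..s'} r *\<^sub>R (driver Y Z j w r - driver Y' Z' j w r)))"
    unfolding set_lebesgue_integral_def using integral_norm_bound by simp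
   also have "... = prim (?h w) s' - prim (?h w) s"
    unfolding prim_diff[OF hi s] set_lebesgue_integral_def by (simp add: abs_mult)
   finally have "abs ((prim (driver Y Z j w) s' - prim (driver Y Z j w) s) - (prim (driver Y' Z' j w) s' - prim (driver Y' Z' j w) s))
    <= prim (?h w) s' - prim (?h w) s" .
   moreover have "Y s' w $ j - Y s w $ j = Y' s' w $ j - Y' s w $ j" using elim(3) s by simp
   ultimately show ?thesis
    using solves_increment[OF elim(1) s, of j] solves_increment[OF elim(2) s, of j] mono[OF s] by linarith
  qed
  moreover have "?v T w - ?v 0 w <= ?V w"
  proof -
   have "prim (?h w) T - prim (?h w) 0 = (LINT r:{0..T}|lborel. ?h w r)" by (rule prim_diff[OF hi order_refl T])
   moreover have "(LINT r:{0..T}|lborel. ?h w r) <= sqrt (U * enn2real (?E w))"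
   proof (rule real_le_rsqrt)
    let ?z = "%r. norm (indicator {0..} r *\<^sub>R ?H j r w)"
    have zm: "?z \<in> borel_measurable borel" using joint_section[OF ito_L2_joint[OF I] elim(7)] by measurable
    have L0: "0 <= (LINT r:{0..T}|lborel. ?h w r)" unfolding set_lebesgue_integral_def by (intro Bochner_Integration.integral_nonneg) simp
    have "ennreal (LINT r:{0..T}|lborel. ?h w r) = (\<integral>\<^sup>+r. ennreal (indicator {0..T} r *\<^sub>R ?h w r) \<partial>lborel)"
     unfolding set_lebesgue_integral_def
     by (rule nn_integral_eq_integral[symmetric]) (auto intro!: integrable_mult_indicator[OF _ hi, simplified])
    also have "... <= (NN r:{0..T}. ennreal (ubar r * ?z r))"
    proof (intro nn_integral_mono)
     fix r
     have "?h w r <= u r * norm (?H j r w)" if "0 <= r"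
     proof (cases "r \<in> hor w")
      case True
      hence "?h w r <= u r * (abs (X j r w - X j r w) + abs (Y r w $ j - Y' r w $ j) + norm (Z r w $ j - Z' r w $ j))"
       using Lip_f[OF that elim(7), of "X j r w" "Y r w $ j" "Z r w $ j" j "X j r w" "Y' r w $ j" "Z' r w $ j"]
       by (simp add: driver_def)
      thus ?thesis using True elim(3) that by (simp add: stop_integrand_def)
     qed (use u_pos[OF that] in \<open>simp add: driver_def stop_integrand_def\<close>)
     thus "ennreal (indicator {0..T} r *\<^sub>R ?h w r) <= ennreal (ubar r * ?z r) * indicator {0..T} r"
      by (cases "r \<in> {0..T}") (auto intro!: ennreal_leI)
    qed
    finally have "(ennreal (LINT r:{0..T}|lborel. ?h w r))^2 <= (NN r:{0..T}. ennreal (ubar r * ?z r))^2"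
     by (rule power_mono) simp
    also have "... <= (NN r:{0..T}. ennreal ((ubar r)^2)) * (NN r:{0..T}. ennreal ((?z r)^2))"
     by (rule Cauchy_Schwarz_NN[OF u_bar(1) zm]) (rule u_bar(2) norm_ge_zero | simp)+
    also have "... <= ennreal U * ?E w"
     unfolding U_def nn_integral_eq_integral[OF u_bar(5) AE_I2[OF zero_le_power2], symmetric]
     by (intro mult_mono nn_integral_mono) (auto simp: indicator_def)
    also have "... = ennreal (U * enn2real (?E w))"
     using elim(6) U0 by (simp add: ennreal_mult' less_top)
    finally show "(LINT r:{0..T}|lborel. ?h w r)^2 <= U * enn2real (?E w)"
     using U0 by (simp add: ennreal_power L0 ennreal_le_iff)
   qed
   moreover have "stopped K w T $ j <= S w" "stopped K' w T $ j <= S' w"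
    using stopped_bound[OF elim(1) _ _ T, of "S w"] stopped_bound[OF elim(2) _ _ T, of "S' w"] elim S(2) S'(2) by auto
   moreover have "stopped K w 0 $ j = 0" "stopped K' w 0 $ j = 0"
    using solvesD(4)[OF elim(1)] solvesD(4)[OF elim(2)] by (simp_all add: stopped_horizon)
   ultimately show ?thesis by linarith
  qed
  ultimately show ?case by blast
 qed
 hence v: "AE w in P. ALL s s'. 0 <= s --> s <= s' --> s' <= T --> abs (?N j s' w - ?N j s w) <= ?v s' w - ?v s w"
  and v': "AE w in P. ?v T w - ?v 0 w <= ?V w" by (auto elim: eventually_mono)
 have Vi: "integrable P (%w. (?V w)^2)"
  by (intro integrable_square_add S(1,3) S'(1,3)) (use Ei U0 in auto)
 show ?thesis using ito_L2_finite_variation[OF I T v _ Vi v'] by simp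
qed
{
 fix j :: 'd and n :: nat
 have Em: "(%w. (NN r:{0..real n}. nsq (?H j r w))) \<in> borel_measurable P"
  by (rule joint_inner_measurable[OF ito_L2_joint[OF I]])
 have "AE w in P. (NN r:{0..real n}. nsq (?H j r w)) = 0"
  using zero[of "real n" j] unfolding time_L2_def by (simp add: nn_integral_0_iff_AE[OF Em])
 with AE_space have "AE w in P. AE r in lborel. r \<in> {0..real n} --> ?H j r w = 0"
 proof eventually_elim
  case (elim w)
  have "(%r. nsq (?H j r w) * indicator {0..real n} r) \<in> borel_measurable lborel"
   using joint_section_nn[OF ito_L2_joint[OF I] elim(1)] by simp
  from nn_integral_0_iff_AE[OF this] elim(2) have "AE r in lborel. nsq (?H j r w) * indicator {0..real n} r = 0" by simp
  thus ?case by (rule eventually_mono) (auto simp: indicator_def)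
 qed
 moreover have "AE w in P. ALL q:{0..} \<inter> \<rat>. ?N j q w = 0"
  using zero by (simp add: AE_ball_countable countable_Int2 countable_rat)
 ultimately have "AE w in P. ALL q:{0..} \<inter> \<rat>. ?N j q w = 0 & (AE r in lborel. r \<in> {0..real n} --> ?H j r w = 0)"
  by eventually_elim blast
} note Hz = this
let ?Z = "%w. ALL j:UNIV. ALL n::nat. ALL q:{0..} \<inter> \<rat>. ?N j q w = 0 & (AE r in lborel. r \<in> {0..real n} --> ?H j r w = 0)"
have Hz: "AE w in P. ?Z w"
proof (rule AE_finite_allI)
 show "AE w in P. ALL n::nat. ALL q:{0..} \<inter> \<rat>. ?N j q w = 0 & (AE r in lborel. r \<in> {0..real n} --> ?H j r w = 0)" for j
  unfolding AE_all_countable using Hz by blast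
qed simp
have Hr: "AE r in lborel. 0 <= r --> (ALL j. ?H j r w = 0)"
 if "?Z w" for w
proof -
 have "0 \<in> {0..} \<inter> (\<rat> :: real set)" by simp
 hence "AE r in lborel. r \<in> {0..real n} --> ?H j r w = 0" for j n using that by blast
 hence "AE r in lborel. ALL j:UNIV. ALL n::nat. r \<in> {0..real n} --> ?H j r w = 0"
  by (intro AE_finite_allI AE_all_countable[THEN iffD2] allI) auto
 thus ?thesis
 proof (rule eventually_mono, intro impI allI)
  fix r j assume "ALL j:UNIV. ALL n::nat. r \<in> {0..real n} --> ?H j r w = 0" "0 <= r"
  moreover obtain n where "r <= real n" using real_arch_simple by blast
  ultimately show "?H j r w = 0" by auto
 qed
qed
show ?Q2
 using Hz
proof (rule eventually_mono)
 fix w assume "?Z w"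
 from Hr[OF this] show "AE s in lborel. s \<in> hor w --> Z' s w = Z s w"
  by (rule eventually_mono) (auto simp: stop_integrand_def hor_iff vec_eq_iff)
qed
show ?Q3
 using Hz sol sol' YY
proof (eventually_elim, intro ballI)
 fix w s assume z: "?Z w"
  and s1: "solves Y Z K J w" and s2: "solves Y' Z' K' J' w" and y: "ALL s>=0. Y' s w = Y s w" and s: "s \<in> hor w"
 hence s0: "0 <= s" "ennreal s <= \<tau> w" by (auto simp: hor_iff)
 have "stopped K' w s $ j = stopped K w s $ j" for j
 \<comment> \<open>With equal \<open>Y\<close>, equal martingale parts and almost everywhere equal
   drivers, the increments from 0 in the two equations leave only the reflections, which therefore
   agree.\<close>
 proof -
  have JJ: "J j r w = J' j r w" if "0 <= r" for r
   by (rule continuous_eq_of_rat[of "%r. J j r w" "%r. J' j r w", OF solvesD(2)[OF s1] solvesD(2)[OF s2] _ that]) (use z in auto)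
  have "prim (driver Y Z j w) r = prim (driver Y' Z' j w) r" for r
   unfolding prim_def
  proof (rule set_lebesgue_integral_cong_AE)
   show "AE x\<in>{0..r} in lborel. driver Y Z j w x = driver Y' Z' j w x"
    using Hr[OF z] by (rule eventually_mono) (use y in \<open>auto simp: driver_def stop_integrand_def indicator_def\<close>)
   show "driver Y Z j w \<in> borel_measurable lborel" "driver Y' Z' j w \<in> borel_measurable lborel"
    using solvesD(1)[OF s1, of j] solvesD(1)[OF s2, of j] by auto
  qed simp
  thus ?thesis
   using solves_increment[OF s1 order_refl s0(1), of j] solves_increment[OF s2 order_refl s0(1), of j] JJ s0 y solvesD(4)[OF s1] solvesD(4)[OF s2]
   by (simp add: stopped_horizon)
 qed
 thus "K' s w = K s w" using s0 by (simp add: stopped_horizon vec_eq_iff)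
qed
qed

end

theorem theorem4p1:
  fixes M P :: "'w measure"
    and W :: "real \<Rightarrow> 'w \<Rightarrow> real^'p::finite"
    and F :: "ennreal \<Rightarrow> 'w measure"
    and \<tau> :: "'w \<Rightarrow> ennreal"
    and b :: "real \<Rightarrow> 'w \<Rightarrow> real \<Rightarrow> 'd::finite \<Rightarrow> real"
    and \<sigma> :: "real \<Rightarrow> 'w \<Rightarrow> real \<Rightarrow> 'd \<Rightarrow> real^'p"
    and g :: "real \<Rightarrow> real"
    and f :: "real \<Rightarrow> 'w \<Rightarrow> real \<Rightarrow> real \<Rightarrow> real^'p \<Rightarrow> 'd \<Rightarrow> real"
    and C :: "'d \<Rightarrow> 'd \<Rightarrow> real"
    and u :: "real \<Rightarrow> real"
    and x\<^sub>0 :: real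
    and X :: "'d \<Rightarrow> real \<Rightarrow> 'w \<Rightarrow> real"
    and X\<^sub>\<tau> :: "'d \<Rightarrow> 'w \<Rightarrow> real"
    and Y K :: "real \<Rightarrow> 'w \<Rightarrow> real^'d"
    and Z :: "real \<Rightarrow> 'w \<Rightarrow> real^'p^'d"
    and t :: real and i :: 'd
  assumes prob: "prob_space M" and P: "P = completion M"
    and BM: "brownian_motion P W" and F: "F = augmented_filtration P W"
    and \<tau>: "stopping_time F \<tau>"
    and prog_b: "\<And>x i. progressive F (\<lambda>s \<omega>. b s \<omega> x i)"
    and prog_\<sigma>: "\<And>x i. progressive F (\<lambda>s \<omega>. \<sigma> s \<omega> x i)"
    and prog_f: "\<And>x y z i. progressive F (\<lambda>s \<omega>. f s \<omega> x y z i)"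
    and X: "\<And>i. sde_solution P F W \<tau> x\<^sub>0 (\<lambda>s \<omega> x. b s \<omega> x i) (\<lambda>s \<omega> x. \<sigma> s \<omega> x i) (X i)"
    and X\<^sub>\<tau>: "\<And>i. value_at_tau P \<tau> (X i) (X\<^sub>\<tau> i)"
    and f0: "sq_integrable_process P \<tau> (\<lambda>s \<omega>. \<chi> i. f s \<omega> 0 0 0 i)"
    and u_pos: "\<And>s. s \<ge> 0 \<Longrightarrow> 0 < u s"
    and u_bdd: "bounded (u ` {0..})"
    and u_int: "set_integrable lborel {0..} u"
    and u2_int: "set_integrable lborel {0..} (\<lambda>s. (u s)\<^sup>2)"
    and Lip_b\<sigma>: "\<And>s \<omega> x x' i. s \<ge> 0 \<Longrightarrow> \<omega> \<in> space P \<Longrightarrow>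
      \<bar>b s \<omega> x i - b s \<omega> x' i\<bar> + norm (\<sigma> s \<omega> x i - \<sigma> s \<omega> x' i) \<le> u s * \<bar>x - x'\<bar>"
    and Lip_f: "\<And>s \<omega> x x' y y' z z' i. s \<ge> 0 \<Longrightarrow> \<omega> \<in> space P \<Longrightarrow>
      \<bar>f s \<omega> x y z i - f s \<omega> x' y' z' i\<bar> \<le> u s * (\<bar>x - x'\<bar> + \<bar>y - y'\<bar> + norm (z - z'))"
    and C_nonneg: "\<And>i j. 0 \<le> C i j"
    and C_triangle: "\<And>i j l. i \<noteq> j \<Longrightarrow> j \<noteq> l \<Longrightarrow> C i l < C i j + C j l"
    and g_meas: "(\<lambda>\<omega>. (\<chi> i. g (X\<^sub>\<tau> i \<omega>)) :: real^'d)
      \<in> borel_measurable (filtration.pre_sigma (space P) F \<tau>)"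
    and g_L2: "integrable P (\<lambda>\<omega>. (norm ((\<chi> i. g (X\<^sub>\<tau> i \<omega>)) :: real^'d))\<^sup>2)"
    and g_Q: "AE \<omega> in P. (\<chi> i. g (X\<^sub>\<tau> i \<omega>)) \<in> closure (Q_set C)"
    and sol: "rbsde_solution P F W \<tau> X X\<^sub>\<tau> g f C Y Z K"
    and t: "t \<ge> 0"
  shows
    "(\<forall>\<theta> \<zeta> U V. admissible P F \<tau> t i \<theta> \<zeta> \<and> switching_bsde_solution P F W \<tau> X X\<^sub>\<tau> g f C t \<theta> \<zeta> U V \<longrightarrow>
        (AE \<omega> in P. Y t \<omega> $ i \<ge> U t \<omega> - cost C \<tau> \<theta> \<zeta> (ennreal t) \<omega>))
     \<and> (\<forall>\<theta> \<zeta>. candidate_strategy P F \<tau> C Y t i \<theta> \<zeta> \<longrightarrow>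
        admissible P F \<tau> t i \<theta> \<zeta> \<and>
        (\<exists>U V. switching_bsde_solution P F W \<tau> X X\<^sub>\<tau> g f C t \<theta> \<zeta> U V) \<and>
        (\<forall>U V. switching_bsde_solution P F W \<tau> X X\<^sub>\<tau> g f C t \<theta> \<zeta> U V \<longrightarrow>
           (AE \<omega> in P. Y t \<omega> $ i = U t \<omega> - cost C \<tau> \<theta> \<zeta> (ennreal t) \<omega>)))
     \<and> is_ess_sup P
        {(\<lambda>\<omega>. U t \<omega> - cost C \<tau> \<theta> \<zeta> (ennreal t) \<omega>) | \<theta> \<zeta> U V.
           admissible P F \<tau> t i \<theta> \<zeta> \<and> switching_bsde_solution P F W \<tau> X X\<^sub>\<tau> g f C t \<theta> \<zeta> U V}
        (\<lambda>\<omega>. Y t \<omega> $ i)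
     \<and> (\<forall>Y' Z' K'. rbsde_solution P F W \<tau> X X\<^sub>\<tau> g f C Y' Z' K' \<longrightarrow>
        (AE \<omega> in P. \<forall>s\<ge>0. Y' s \<omega> = Y s \<omega>) \<and>
        (AE \<omega> in P. AE s in lborel. s \<in> horizon \<tau> \<omega> \<longrightarrow> Z' s \<omega> = Z s \<omega>) \<and>
        (AE \<omega> in P. \<forall>s\<in>horizon \<tau> \<omega>. K' s \<omega> = K s \<omega>))"
proof -
 have "prob_space P" unfolding P
  using prob_space.emeasure_space_1[OF prob] by (intro prob_spaceI) (simp add: emeasure_completion main_part_sets)
 moreover have "complete_measure P" unfolding P by (rule completion.complete_measure_axioms)
 ultimately interpret switching P W F \<tau> X X\<^sub>\<tau> g f C u
  by (intro switching.intro brownian_basis.intro switching_axioms.intro BM F \<tau> u_pos u_bdd u_int u2_int Lip_f C_nonneg C_triangle)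
 note rbsde = sol
 obtain J where J: "\<And>i. ito_L2 P F W (stop_integrand \<tau> (\<lambda>s \<omega>. Z s \<omega> $ i)) (J i)" and J_sol: "AE \<omega> in P. solves Y Z K J \<omega>"
  using rbsde_solves[OF sol] by blast
 interpret solution P W F \<tau> X X\<^sub>\<tau> g f C u Y Z K J
  by unfold_locales (use sol in \<open>simp add: rbsde_solution_def\<close>, use sol in \<open>simp add: rbsde_solution_def\<close>, rule J, rule J_sol)
 show ?thesis
 proof (intro conjI allI impI)
  fix \<theta> \<zeta> U V
  assume "admissible P F \<tau> t i \<theta> \<zeta> \<and> switching_bsde_solution P F W \<tau> X X\<^sub>\<tau> g f C t \<theta> \<zeta> U V"
  then show "AE \<omega> in P. U t \<omega> - cost C \<tau> \<theta> \<zeta> (ennreal t) \<omega> \<le> Y t \<omega> $ i"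
   using admissible_value_le[OF _ _ t] by blast
 qed ((rule candidate_optimal[OF _ t] value_ess_sup[OF t] unique[OF rbsde], assumption+) | rule value_ess_sup[OF t])+
qed

end
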